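(* Let $\alpha$, $\delta$, $\psi$, $\omega$ denote the Niemeier lattices with root systems $D_{24}$, $A_{24}$, $A_1^{24}$, and the Leech lattice, respectively. (1) $\varTheta(\vartheta_\alpha^{(2)})\equiv\varTheta(\vartheta_\delta^{(2)})\equiv\varTheta(\vartheta_\psi^{(2)})\equiv\varTheta(\vartheta_\omega^{(2)})\equiv0\pmod{23}$. (2) Each of $\vartheta_\alpha^{(3)}$, $\vartheta_\delta^{(3)}$, $\vartheta_\psi^{(3)}$, $\vartheta_\omega^{(3)}$ is a mod 23 singular modular form with nontrivial maximal 23-rank 2.
   Context: For a lattice with Gram matrix $S$ of rank 24, $\vartheta^{(n)}(Z)=\sum_{X\in M_{24,n}(\mathbb{Z})}\exp(\pi\sqrt{-1}\,\mathrm{tr}({}^tXSXZ))=\sum_T a(\vartheta^{(n)};T)\exp(2\pi\sqrt{-1}\mathrm{tr}(TZ))$, $T$ over positive semidefinite $T\in\mathrm{Sym}_n^*(\mathbb{Z})=\{T\in\mathrm{Sym}_n(\mathbb{Q}):t_{ii},2t_{ij}\in\mathbb{Z}\}$; these are Siegel modular forms of weight 12 for $Sp_n(\mathbb{Z})$ with integral coefficients. A Niemeier lattice is a positive definite even unimodular lattice of rank 24. The theta operator is defined on formal Fourier expansions by $\varTheta(\sum a(F;T)q^T)=\sum a(F;T)\det(T)q^T$; a congruence $G\equiv0\pmod p$ of formal expansions means all coefficients are divisible by $p$. For a prime $p$, a modular form $F\in M_k(Sp_n(\mathbb{Z}))$ with $p$-integral coefficients is a mod $p$ singular modular form with (nontrivial)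 maximal $p$-rank $r<n$ if $a(F;T)\equiv0\pmod p$ for all $T$ with $r+1\le\mathrm{rank}(T)\le n$, and $a(F;T)\not\equiv0\pmod p$ for some $T$ with $\mathrm{rank}(T)=r$. *)

theory Defs
  imports "HOL-Analysis.Analysis" "HOL-Computational_Algebra.Primes"
begin

definition bilin :: "'a::comm_ring_1^'n^'n \<Rightarrow> 'a^'n \<Rightarrow> 'a^'n \<Rightarrow> 'a" where
  "bilin S x y = (\<Sum>i\<in>UNIV. \<Sum>j\<in>UNIV. x $ i * S $ i $ j * y $ j)"

definition pos_definite :: "real^'n^'n \<Rightarrow> bool" where
  "pos_definite A \<longleftrightarrow> transpose A = A \<and> (\<forall>x. x \<noteq> 0 \<longrightarrow> bilin A x x > 0)"

definition pos_semidefinite :: "real^'n^'n \<Rightarrow> bool" where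
  "pos_semidefinite A \<longleftrightarrow> transpose A = A \<and> (\<forall>x. bilin A x x \<ge> 0)"

definition niemeier :: "int^24^24 \<Rightarrow> bool" where
  "niemeier S \<longleftrightarrow>
     pos_definite (map_matrix real_of_int S) \<and> (\<forall>x. even (bilin S x x)) \<and> det S = 1"

definition lattice_roots :: "int^'m^'m \<Rightarrow> (int^'m) set" where
  "lattice_roots S = {x. bilin S x x = 2}"

text \<open>All roots have norm 2, so inner products of roots are Cartan integers.  A bijection of root
  systems preserving them extends to a linear isometry of the spans, i.e. it is an isomorphism of
  root systems.\<close>

definition has_root_system :: "int^'m^'m \<Rightarrow> (real^'k) set \<Rightarrow> bool" where
  "has_root_system S R \<longleftrightarrow>
     (\<exists>f. bij_betw f (lattice_roots S) R \<and>
          (\<forall>x\<in>lattice_roots S. \<forall>y\<in>lattice_roots S. f x \<bullet> f y = of_int (bilin S x y)))"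

text \<open>For \<open>k = CARD('k)\<close> these are the root systems of type \<open>D\<close> of rank \<open>k\<close>,
  of type \<open>A\<close> of rank \<open>k - 1\<close> (in the hyperplane of coordinate sum 0), and
  the orthogonal sum of \<open>k\<close> copies of \<open>A\<close> of rank 1, all with roots of norm 2.\<close>

definition root_system_D :: "(real^'k) set" where
  "root_system_D = {axis i s + axis j t | i j s t. i \<noteq> j \<and> s \<in> {1, -1} \<and> t \<in> {1, -1}}"

definition root_system_A :: "(real^'k) set" where
  "root_system_A = {axis i 1 - axis j 1 | i j. i \<noteq> j}"

definition root_system_A1_power :: "(real^'k) set" where
  "root_system_A1_power = {axis i s | i s. s \<in> {sqrt 2, - sqrt 2}}"

text \<open>The type \<open>23 option\<close> is the projective line over the field with 23 elements
  (arithmetic in the type \<open>23\<close> is modulo 23), with \<open>None\<close> as the point at infinity.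
  The binary Golay code is spanned, under symmetric difference, by the whole line and the translates
  of the set consisting of 0 and the quadratic nonresidues.\<close>

definition golay_generator :: "23 \<Rightarrow> 23 option set" where
  "golay_generator i = Some ` {n - i | n. n = 0 \<or> (\<nexists>m. n = m ^ 2)}"

inductive_set golay_code :: "23 option set set" where
  empty: "{} \<in> golay_code"
| whole: "C \<in> golay_code \<Longrightarrow> sym_diff C UNIV \<in> golay_code"
| generator: "C \<in> golay_code \<Longrightarrow> sym_diff C (golay_generator i) \<in> golay_code"

text \<open>Conway's description of the Leech lattice, with all vectors multiplied by \<open>sqrt 8\<close>.\<close>

definition scaled_leech :: "(int^(23 option)) set" where
  "scaled_leech =
     {x. \<exists>m\<in>{0, 1}. (\<forall>i. x $ i mod 2 = m) \<and>
                     {i. x $ i mod 4 = m + 2} \<in> golay_code \<and>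
                     (\<Sum>i\<in>UNIV. x $ i) mod 8 = 4 * m}"

text \<open>\<open>S\<close> is the Gram matrix of some basis (the columns of \<open>B\<close>, divided by \<open>sqrt 8\<close>)
  of the Leech lattice.\<close>

definition leech_gram :: "int^24^24 \<Rightarrow> bool" where
  "leech_gram S \<longleftrightarrow>
     (\<exists>B :: int^24^(23 option).
        range (\<lambda>x. B *v x) = scaled_leech \<and> transpose B ** B = map_matrix (\<lambda>s. 8 * s) S)"

definition siegel_space :: "(complex^'n^'n) set" where
  "siegel_space = {Z. transpose Z = Z \<and> pos_definite (map_matrix Im Z)}"

definition symplectic :: "int^'n^'n \<Rightarrow> int^'n^'n \<Rightarrow> int^'n^'n \<Rightarrow> int^'n^'n \<Rightarrow> bool" where
  "symplectic A B C D \<longleftrightarrow>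
     transpose A ** C = transpose C ** A \<and> transpose B ** D = transpose D ** B \<and>
     transpose A ** D - transpose C ** B = mat 1"

text \<open>The index set of Fourier expansions: positive semidefinite half-integral matrices.
  Their entries are automatically rational.\<close>

definition half_integral_psd :: "(real^'n^'n) set" where
  "half_integral_psd =
     {T. pos_semidefinite T \<and> (\<forall>i. T $ i $ i \<in> \<int>) \<and> (\<forall>i j. 2 * T $ i $ j \<in> \<int>)}"

text \<open>A formal Fourier expansion is a family of coefficients indexed by the above matrices,
  extended by 0 to all matrices.\<close>

type_synonym 'n fourier_exp = "real^'n^'n \<Rightarrow> complex"

definition has_fourier_expansion ::
    "(complex^'n^'n \<Rightarrow> complex) \<Rightarrow> 'n::finite fourier_exp \<Rightarrow> bool" where
  "has_fourier_expansion F a \<longleftrightarrow>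
     (\<forall>T. T \<notin> half_integral_psd \<longrightarrow> a T = 0) \<and>
     (\<forall>Z\<in>siegel_space.
        ((\<lambda>T. a T * exp (2 * complex_of_real pi * \<i> * trace (map_matrix complex_of_real T ** Z)))
          has_sum F Z) half_integral_psd)"

definition fourier_coeff :: "(complex^'n^'n \<Rightarrow> complex) \<Rightarrow> 'n::finite fourier_exp" where
  "fourier_coeff F = (THE a. has_fourier_expansion F a)"

text \<open>Holomorphy in the entries of a symmetric matrix: the real derivative along the space of
  symmetric matrices is complex linear.\<close>

definition holomorphic_siegel :: "(complex^'n^'n \<Rightarrow> complex) \<Rightarrow> bool" where
  "holomorphic_siegel F \<longleftrightarrow>
     (\<forall>Z\<in>siegel_space. \<exists>F'. (F has_derivative F') (at Z within siegel_space) \<and>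
        (\<forall>c W. F' (map_matrix (\<lambda>w. c * w) W) = c * F' W))"

text \<open>The existence of a Fourier expansion over positive semidefinite matrices is automatic in
  degree at least 2 (Koecher); in degree 1 it is the condition at the cusp.\<close>

definition siegel_modular_form :: "nat \<Rightarrow> (complex^'n^'n \<Rightarrow> complex) \<Rightarrow> bool" where
  "siegel_modular_form k F \<longleftrightarrow>
     holomorphic_siegel F \<and>
     (\<forall>A B C D. symplectic A B C D \<longrightarrow> (\<forall>Z\<in>siegel_space.
        let A' = map_matrix of_int A; B' = map_matrix of_int B;
            C' = map_matrix of_int C; D' = map_matrix of_int D
        in F ((A' ** Z + B') ** matrix_inv (C' ** Z + D')) = det (C' ** Z + D') ^ k * F Z)) \<and>
     (\<exists>a. has_fourier_expansion F a)"

definition theta_series :: "int^'m^'m \<Rightarrow> complex^'n^'n \<Rightarrow> complex" where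
  "theta_series S Z =
     (\<Sum>\<^sub>\<infinity>X::int^'n^'m. exp (complex_of_real pi * \<i> *
        trace (map_matrix of_int (transpose X ** S ** X) ** Z)))"

definition theta_op :: "'n::finite fourier_exp \<Rightarrow> 'n fourier_exp" where
  "theta_op a = (\<lambda>T. a T * complex_of_real (det T))"

definition p_integral :: "nat \<Rightarrow> complex \<Rightarrow> bool" where
  "p_integral p x \<longleftrightarrow> (\<exists>u v :: int. \<not> int p dvd v \<and> x = of_int u / of_int v)"

text \<open>Divisibility by \<open>p\<close> in the ring of \<open>p\<close>-integral rational numbers.\<close>

definition cong_zero :: "nat \<Rightarrow> complex \<Rightarrow> bool" where
  "cong_zero p x \<longleftrightarrow> (\<exists>y. p_integral p y \<and> x = of_nat p * y)"

definition expansion_cong_zero :: "nat \<Rightarrow> 'n::finite fourier_exp \<Rightarrow> bool" where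
  "expansion_cong_zero p a \<longleftrightarrow> (\<forall>T\<in>half_integral_psd. cong_zero p (a T))"

definition mod_p_singular ::
    "nat \<Rightarrow> nat \<Rightarrow> nat \<Rightarrow> (complex^'n^'n \<Rightarrow> complex) \<Rightarrow> bool" where
  "mod_p_singular p k r F \<longleftrightarrow>
     prime p \<and> siegel_modular_form k F \<and>
     (\<forall>T\<in>half_integral_psd. p_integral p (fourier_coeff F T)) \<and>
     r < CARD('n) \<and>
     (\<forall>T\<in>half_integral_psd. r + 1 \<le> rank T \<and> rank T \<le> CARD('n) \<longrightarrow>
        cong_zero p (fourier_coeff F T)) \<and>
     (\<exists>T\<in>half_integral_psd. rank T = r \<and> \<not> cong_zero p (fourier_coeff F T))"

end

theory Submission
  imports Defs "HOL-Complex_Analysis.Complex_Analysis"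
begin

text \<open>Each of the four lattices has an isometry \<open>g\<close> of order 23 whose fixed lattice has rank 2 and
  discriminant divisible by 23. Since \<open>g\<close> acts on the representations of \<open>T\<close>, the coefficient \<open>a(T)\<close>
  is congruent modulo 23 to the number of representations of \<open>T\<close> by fixed vectors. For \<open>T\<close> of degree 3
  and rank 3 there are none; for \<open>T\<close> of degree 2 they exist only if 23 divides \<open>4 det T\<close>; and the Gram matrix
  of a suitable pair of fixed vectors has at least one but fewer than 23 such representations.

  For the root systems \<open>D\<close> and \<open>A\<close>, \<open>g\<close> permutes 23 coordinates cyclically; for the Leech lattice it is a
  translation of the projective line over the field with 23 elements. For the root system \<open>A\<^sub>1\<^sup>24\<close>
  the glue code is a self-dual code of minimum weight 8, and such a code is shown to be equivalent to
  the quadratic residue code of length 23 with a parity bit, which is cyclic.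

  The theta series is a modular form because it transforms correctly under unimodular substitutions,
  translations, and the inversion in one variable (Poisson summation over one column), and these
  generate the symplectic group over the integers.\<close>

text \<open>The number 23 enters twice: a vector fixed by \<open>g\<close> has coordinates
  \<open>(a, ..., a, b)\<close> with 23 equal entries, which puts the factor 23 into the
  discriminant of the fixed lattice; and 23 is prime, so all other orbits of \<open>g\<close> have
  23 elements. Both congruences follow from this count. The cost lies elsewhere: a singular form has
  to be a modular form, and \<open>fourier_coeff\<close> is a definite description, so the
  transformation law and the uniqueness of Fourier expansions come before any coefficient is a
  representation number. The obstacle in the Poisson summation is that the form is diagonal only in
  real coordinates while the sum runs over integers. In unitriangular coordinates each new integer
  variable merely shifts the arguments of the others, and induction needs the one-dimensional
  formula alone. Its constant comes from a scaling relation at squares of rationals and the identity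
  theorem, without a Gaussian integral. Each lattice is known only through its roots or up to a
  change of basis, so coordinates on which \<open>g\<close> can act have to be constructed.\<close>

no_notation fps_nth (infixl "$" 75)

section \<open>Fourier coefficients of periodic holomorphic functions\<close>

definition fourier_char :: "int \<Rightarrow> complex \<Rightarrow> complex" where
  "fourier_char k z = exp (2 * of_real pi * \<i> * of_int k * z)"

lemma fourier_char_add: "fourier_char (j + k) z = fourier_char j z * fourier_char k z"
  by (simp add: fourier_char_def ring_distribs exp_add)

lemma fourier_char_shift_int: "fourier_char k (z + of_int n) = fourier_char k z"
proof -
  have "fourier_char k (z + of_int n) = fourier_char k z * exp (2 * of_real pi * \<i> * of_int (k * n))"
    by (simp add: fourier_char_def ring_distribs exp_add mult_ac)
  also have "exp (2 * of_real pi * \<i> * of_int (k * n)) = 1"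
    using exp_integer_2pi[of "of_int (k * n)"] by (simp add: mult_ac)
  finally show ?thesis by simp
qed

lemma fourier_char_eq_1_iff: "fourier_char 1 z = 1 \<longleftrightarrow> z \<in> \<int>"
proof
  assume "fourier_char 1 z = 1"
  then obtain n :: int where "Im z = 0" "Re z = of_int n"
    by (auto simp: fourier_char_def exp_eq_1)
  then have "z = of_int n" by (simp add: complex_eq_iff)
  then show "z \<in> \<int>" by simp
next
  assume "z \<in> \<int>"
  then obtain n where "z = of_int n" by (auto elim: Ints_cases)
  then show "fourier_char 1 z = 1"
    using fourier_char_shift_int[of 1 0 n] by (simp add: fourier_char_def)
qed

lemma fourier_char_holomorphic: "fourier_char k holomorphic_on A"
  unfolding fourier_char_def[abs_def] by (intro holomorphic_intros)

lemma norm_fourier_char: "norm (fourier_char k z) = exp (- 2 * pi * of_int k * Im z)"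
  by (simp add: fourier_char_def norm_exp_eq_Re) 

text \<open>The base point \<open>z\<close> is kept as a parameter: for a periodic entire function
  the integral does not depend on it, and moving it off the real axis gives the decay in
  \<open>k\<close>.\<close>

definition fourier_coef :: "(complex \<Rightarrow> complex) \<Rightarrow> int \<Rightarrow> complex \<Rightarrow> complex" where
  "fourier_coef f k z = contour_integral (linepath z (z + 1)) (\<lambda>t. f t * fourier_char (- k) t)"

text \<open>A primitive \<open>G\<close> of the integrand exists on the whole plane. By periodicity
  of the integrand, \<open>G (z + 1) - G z\<close> has derivative zero, and this difference is the
  integral in question.\<close>

lemma fourier_coef_indep:
  assumes f: "f holomorphic_on UNIV" and per: "\<And>z. f (z + 1) = f z"
  shows "fourier_coef f k z = fourier_coef f k w"
proof -
  define g where "g = (\<lambda>t. f t * fourier_char (- k) t)"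
  have g: "g holomorphic_on UNIV"
    unfolding g_def by (intro holomorphic_intros f fourier_char_holomorphic)
  obtain G where G: "\<And>z. (G has_field_derivative g z) (at z)"
    using holomorphic_convex_primitive'[of UNIV g] g by (auto)
  have gper: "g (z + 1) = g z" for z
    using per fourier_char_shift_int[of "-k" z 1] by (simp add: g_def)
  have "((\<lambda>z. G (z + 1) - G z) has_field_derivative 0) (at z)" for z
    using DERIV_diff[OF DERIV_shift[THEN iffD1, OF G[of "z+1"]] G[of z]] gper[of z] by simp
  then have "\<exists>c. \<forall>z\<in>UNIV. G (z + 1) - G z = c"
    by (intro has_field_derivative_zero_constant) (auto intro: has_field_derivative_at_within)
  then obtain c where c: "\<And>z. G (z + 1) - G z = c" by blast
  have "fourier_coef f k z = G (z + 1) - G z" for z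
  proof -
    have "(g has_contour_integral (G (z + 1) - G z)) (linepath z (z + 1))"
      using contour_integral_primitive[of UNIV G g "linepath z (z+1)"] G by (simp add: has_field_derivative_at_within)
    then show ?thesis
      unfolding fourier_coef_def g_def by (rule contour_integral_unique)
  qed
  then show ?thesis using c by simp
qed

lemma fourier_coef_bound:
  assumes f: "continuous_on UNIV f"
  shows "\<exists>B. \<forall>k. norm (fourier_coef f k z) \<le> B * exp (2 * pi * of_int k * Im z)"
proof -
  have "compact (f ` closed_segment z (z + 1))"
    by (intro compact_continuous_image continuous_on_subset[OF f]) auto
  then obtain B where B: "\<And>t. t \<in> closed_segment z (z + 1) \<Longrightarrow> norm (f t) \<le> B" "B > 0"
    using bounded_pos[of "f ` closed_segment z (z + 1)"] compact_imp_bounded by blast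
  have "norm (fourier_coef f k z) \<le> (B * exp (2 * pi * of_int k * Im z)) * norm (z + 1 - z)" for k
    unfolding fourier_coef_def
  proof (rule contour_integral_bound_linepath)
    have "continuous_on (closed_segment z (z + 1)) (\<lambda>t. f t * fourier_char (- k) t)"
      by (intro continuous_intros continuous_on_subset[OF f] holomorphic_on_imp_continuous_on
            fourier_char_holomorphic) auto
    then show "(\<lambda>t. f t * fourier_char (- k) t) contour_integrable_on linepath z (z + 1)"
      by (rule contour_integrable_continuous_linepath)
    show "0 \<le> B * exp (2 * pi * of_int k * Im z)" using B by simp
    fix t assume t: "t \<in> closed_segment z (z + 1)"
    then have "Im t = Im z"
      by (auto simp: closed_segment_def algebra_simps)
    then show "norm (f t * fourier_char (- k) t) \<le> B * exp (2 * pi * of_int k * Im z)"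
      using B(1)[OF t] by (simp add: norm_mult norm_fourier_char mult_right_mono)
  qed
  then show ?thesis by auto
qed

text \<open>The segment is moved to height -1 for positive and to height 1 for negative indices,
  where the bound decays like \<open>exp (- 2 * pi * n)\<close>.\<close>

lemma fourier_coef_tendsto_0:
  assumes f: "f holomorphic_on UNIV" and per: "\<And>z. f (z + 1) = f z"
  shows "(\<lambda>n. fourier_coef f (int n) 0) \<longlonglongrightarrow> 0" "(\<lambda>n. fourier_coef f (- int n) 0) \<longlonglongrightarrow> 0"
proof -
  have c: "continuous_on UNIV f" using f by (rule holomorphic_on_imp_continuous_on)
  obtain B where "\<And>k. norm (fourier_coef f k (-\<i>)) \<le> B * exp (2 * pi * of_int k * Im (-\<i>))"
    using fourier_coef_bound[OF c] by blast
  then have B: "norm (fourier_coef f (int n) 0) \<le> B * exp (-2 * pi * real n)" for n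
    using fourier_coef_indep[OF f per, of "int n" 0 "-\<i>"]
    by (metis (no_types, lifting) imaginary_unit.simps(2) mult.right_neutral mult_minus_left
        mult_minus_right of_int_of_nat_eq uminus_complex.sel(2))
  obtain B' where "\<And>k. norm (fourier_coef f k \<i>) \<le> B' * exp (2 * pi * of_int k * Im \<i>)"
    using fourier_coef_bound[OF c] by blast
  then have B': "norm (fourier_coef f (-int n) 0) \<le> B' * exp (-2 * pi * real n)" for n
    using fourier_coef_indep[OF f per, of "-int n" 0 "\<i>"]
    by (metis (no_types, lifting) imaginary_unit.simps(2) mult.right_neutral mult_minus_left mult_minus_right of_int_minus of_int_of_nat_eq)
  have lim: "(\<lambda>n. C * exp (-2 * pi * real n)) \<longlonglongrightarrow> 0" for C
  proof -
    have "(\<lambda>n. exp (-2 * pi) ^ n) \<longlonglongrightarrow> 0" by (rule LIMSEQ_realpow_zero) auto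
    from tendsto_mult_left[OF this, of C] show ?thesis
      by (simp add: exp_of_nat_mult[symmetric] mult_ac)
  qed
  show "(\<lambda>n. fourier_coef f (int n) 0) \<longlonglongrightarrow> 0"
    by (rule Lim_null_comparison[OF _ lim[of B]]) (use B in auto)
  show "(\<lambda>n. fourier_coef f (-int n) 0) \<longlonglongrightarrow> 0"
    by (rule Lim_null_comparison[OF _ lim[of B']]) (use B' in auto)
qed

lemma fourier_coef_integral:
  "fourier_coef f k z = integral {0..1} (\<lambda>x. f (z + of_real x) * fourier_char (- k) (z + of_real x))"
proof -
  have "linepath z (z + 1) x = z + of_real x" for x
    by (simp add: linepath_def scaleR_conv_of_real algebra_simps)
  then show ?thesis
    unfolding fourier_coef_def contour_integral_integral by simp
qed

lemma fourier_coef_translate: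
  assumes f: "f holomorphic_on UNIV" and per: "\<And>z. f (z + 1) = f z"
  shows "fourier_coef (\<lambda>t. f (b + t)) k 0 = fourier_coef f k 0 * fourier_char k b"
proof -
  have "fourier_char (- k) t = fourier_char k b * fourier_char (- k) (b + t)" for t
    by (simp add: fourier_char_def exp_add[symmetric] ring_distribs)
  then have "f (b + t) * fourier_char (- k) t = fourier_char k b * (f (b + t) * fourier_char (- k) (b + t))" for t
    by (metis mult.left_commute)
  then have "fourier_coef (\<lambda>t. f (b + t)) k 0 = fourier_char k b * fourier_coef f k b"
    unfolding fourier_coef_integral
    by (simp only: add_0 integral_mult_right)
  then show ?thesis
    using fourier_coef_indep[OF f per, of k b 0] by (simp add: mult_ac)
qed

lemma fourier_coef_const: "fourier_coef (\<lambda>t. c) k 0 = (if k = 0 then c else 0)"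
proof (cases "k = 0")
  case True
  then show ?thesis by (simp add: fourier_coef_integral fourier_char_def)
next
  case False
  define u where "u = 2 * of_real pi * \<i> * of_int (- k)"
  have u: "u \<noteq> 0" using False by (simp add: u_def)
  have "((\<lambda>t. c * exp (u * t)) has_contour_integral (c * exp (u * 1) / u - c * exp (u * 0) / u)) (linepath 0 1)"
  proof -
    have "((\<lambda>t. c * exp (u * t) / u) has_field_derivative c * exp (u * x)) (at x within UNIV)" for x
      using u by (auto intro!: derivative_eq_intros)
    from contour_integral_primitive[OF this, of "linepath 0 1"] show ?thesis by simp
  qed
  moreover have "exp u = 1"
    using exp_integer_2pi[of "of_int (- k)"] by (simp add: mult_ac u_def)
  ultimately have "((\<lambda>t. c * exp (u * t)) has_contour_integral 0) (linepath 0 1)" by simp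
  then show ?thesis using False
    unfolding fourier_coef_def fourier_char_def u_def[symmetric] by (simp add: contour_integral_unique)
qed

lemma fourier_coef_diff:
  assumes "f holomorphic_on UNIV" "g holomorphic_on UNIV"
  shows "fourier_coef (\<lambda>t. f t - g t) k z = fourier_coef f k z - fourier_coef g k z"
proof -
  have "(\<lambda>t. h t * fourier_char (- k) t) contour_integrable_on linepath z (z + 1)"
    if "h holomorphic_on UNIV" for h
    by (intro contour_integrable_continuous_linepath continuous_intros
        holomorphic_on_imp_continuous_on fourier_char_holomorphic holomorphic_on_subset[OF that]) auto
  from contour_integral_diff[OF this[OF assms(1)] this[OF assms(2)]] show ?thesis
    unfolding fourier_coef_def by (simp add: algebra_simps)
qed

text \<open>Chernoff's argument: dividing by \<open>exp (2\<pi>iz) - 1\<close> makes the partial sums telescope.\<close>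

lemma fourier_sum_at_zero:
  assumes f: "f holomorphic_on UNIV" and per: "\<And>z. f (z + 1) = f z" and f0: "f 0 = 0"
  shows "(\<lambda>N. \<Sum>k=-int N..int N. fourier_coef f k 0) \<longlonglongrightarrow> 0"
proof -
  let ?E = "fourier_char 1"
  have perz: "f (z + of_int n) = f z" for z n
  proof (induction n arbitrary: z rule: int_induct[of _ 0])
    case (step1 i) then show ?case using per[of "z + of_int i"] by (simp add: add_ac)
  next
    case (step2 i) then show ?case using per[of "z + of_int (i - 1)"] by (simp add: add_ac)
  qed auto
  define F1 where "F1 = (\<lambda>z. if z = 0 then deriv f 0 else (f z - f 0) / (z - 0))"
  define F2 where "F2 = (\<lambda>z. if z = 0 then deriv ?E 0 else (?E z - ?E 0) / (z - 0))"
  have F1: "F1 holomorphic_on UNIV" unfolding F1_def by (rule pole_lemma) (use f in auto)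
  have F2: "F2 holomorphic_on UNIV"
    unfolding F2_def by (rule pole_lemma) (auto simp: fourier_char_holomorphic)
  have E0: "?E 0 = 1" by (simp add: fourier_char_def)
  have dE: "deriv ?E 0 = 2 * of_real pi * \<i>"
    unfolding fourier_char_def by (rule DERIV_imp_deriv) (auto intro!: derivative_eq_intros)
  have F2nz: "F2 z \<noteq> 0" if "z \<in> ball 0 1" for z
  proof (cases "z = 0")
    case False
    have "z \<notin> \<int>"
    proof
      assume "z \<in> \<int>"
      then obtain n where n: "z = of_int n" by (auto elim: Ints_cases)
      then show False using that False by (simp add: norm_of_int)
    qed
    then show ?thesis using False fourier_char_eq_1_iff[of z] by (simp add: F2_def E0)
  qed (simp add: F2_def dE)
  \<comment> \<open>The quotient is entire: \<open>f\<close> vanishes at all integers by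
    periodicity, and the zeros of the denominator there are simple. The value at integers is the
    limit, a quotient of derivatives.\<close>
  define g where "g = (\<lambda>z. if z \<in> \<int> then deriv f 0 / deriv ?E 0 else f z / (?E z - 1))"
  have gper: "g (z + of_int n) = g z" for z n
    by (simp add: g_def perz fourier_char_shift_int)
  have fg: "f z = g z * ?E z - g z" for z
  proof (cases "z \<in> \<int>")
    case True
    then obtain n where n: "z = of_int n" by (auto elim: Ints_cases)
    have "f z = 0" using perz[of 0 n] f0 n by simp
    then show ?thesis using True fourier_char_eq_1_iff[of z] by simp
  next
    case False
    then have "g z * (?E z - 1) = f z" using fourier_char_eq_1_iff[of z] by (simp add: g_def)
    then show ?thesis by (simp add: algebra_simps)
  qed
  \<comment> \<open>Near 0 the quotient is one of two difference quotients with removable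
    singularities, the lower one without zeros in the unit disc; periodicity carries this to the
    other integers.\<close>
  have gball: "g z = F1 z / F2 z" if "z \<in> ball 0 1" for z
  proof (cases "z = 0")
    case True then show ?thesis by (simp add: g_def F1_def F2_def)
  next
    case False
    have "z \<notin> \<int>"
    proof
      assume "z \<in> \<int>"
      then obtain n where n: "z = of_int n" by (auto elim: Ints_cases)
      then show False using that False by (simp add: norm_of_int)
    qed
    then show ?thesis using False by (simp add: g_def F1_def F2_def E0 f0)
  qed
  have g0: "g holomorphic_on ball 0 1"
    by (rule holomorphic_transform[OF holomorphic_on_divide])
       (use F1 F2 F2nz gball in \<open>auto intro: holomorphic_on_subset\<close>)
  have "g field_differentiable (at z)" for z
  proof (cases "z \<in> \<int>")
    case True
    then obtain n where n: "z = of_int n" by (auto elim: Ints_cases)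
    have "g field_differentiable (at 0)"
      using g0 by (rule holomorphic_on_imp_differentiable_at) auto
    then obtain D where "(g has_field_derivative D) (at 0)" by (auto simp: field_differentiable_def)
    then have "((\<lambda>w. g (w + of_int (-n))) has_field_derivative D) (at (of_int n))"
      using DERIV_shift[of g D "of_int n" "of_int (-n)"] by simp
    then show ?thesis unfolding gper n by (auto simp: field_differentiable_def)
  next
    case False
    have "(\<lambda>z. f z / (?E z - 1)) holomorphic_on (- \<int>)"
      by (intro holomorphic_intros holomorphic_on_subset[OF f] fourier_char_holomorphic)
         (auto simp: fourier_char_eq_1_iff)
    then have "g holomorphic_on (- \<int>)" by (rule holomorphic_transform) (auto simp: g_def)
    then show ?thesis
      using False by (auto intro!: holomorphic_on_imp_differentiable_at[of g "- \<int>"] simp: open_Compl)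
  qed
  then have g: "g holomorphic_on UNIV" by (simp add: holomorphic_on_def field_differentiable_at_within)
  have coef: "fourier_coef f k 0 = fourier_coef g (k - 1) 0 - fourier_coef g k 0" for k
  proof -
    have "fourier_coef f k 0 = fourier_coef (\<lambda>z. g z * ?E z) k 0 - fourier_coef g k 0"
      by (subst fourier_coef_diff[symmetric]) 
         (auto simp: fg[symmetric] intro!: holomorphic_intros g fourier_char_holomorphic)
    also have "fourier_coef (\<lambda>z. g z * ?E z) k 0 = fourier_coef g (k - 1) 0"
      unfolding fourier_coef_def using fourier_char_add[of 1 "- k"] by (simp add: mult.assoc)
    finally show ?thesis .
  qed
  have tele: "(\<Sum>k=-int N..int N. fourier_coef f k 0) = fourier_coef g (- int (Suc N)) 0 - fourier_coef g (int N) 0" for N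
  proof (induction N)
    case 0 then show ?case by (simp add: coef)
  next
    case (Suc N)
    have "{-int (Suc N)..int (Suc N)} = insert (- int (Suc N)) (insert (int (Suc N)) {-int N..int N})"
      by auto
    then show ?case using Suc by (simp add: coef algebra_simps)
  qed
  have per1: "g (z + 1) = g z" for z using gper[of z 1] by simp
  have "(\<lambda>N. fourier_coef g (- int (Suc N)) 0 - fourier_coef g (int N) 0) \<longlonglongrightarrow> 0 - 0"
    by (intro tendsto_diff LIMSEQ_Suc[OF fourier_coef_tendsto_0(2)[OF g per1]] fourier_coef_tendsto_0(1)[OF g per1])
  then show ?thesis unfolding tele by simp
qed

text \<open>Translating by \<open>b\<close> and subtracting the constant \<open>f b\<close> reduces
  to a function that vanishes at 0; the constant affects the coefficient of index 0 only.\<close>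

lemma fourier_sum:
  assumes f: "f holomorphic_on UNIV" and per: "\<And>z. f (z + 1) = f z"
  shows "(\<lambda>N. \<Sum>k=-int N..int N. fourier_coef f k 0 * fourier_char k b) \<longlonglongrightarrow> f b"
proof -
  define h where "h = (\<lambda>t. f (b + t) - f b)"
  have fb: "(\<lambda>t. f (b + t)) holomorphic_on UNIV"
    by (rule holomorphic_on_compose_gen[OF _ f, of "\<lambda>t. b + t", unfolded o_def]) (auto intro!: holomorphic_intros)
  have h: "h holomorphic_on UNIV" unfolding h_def by (intro holomorphic_intros fb)
  have coef: "fourier_coef h k 0 = fourier_coef f k 0 * fourier_char k b - (if k = 0 then f b else 0)" for k
    unfolding h_def by (subst fourier_coef_diff) (auto simp: fourier_coef_translate[OF f per] fourier_coef_const fb)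
  have "(\<lambda>N. \<Sum>k=-int N..int N. fourier_coef h k 0) \<longlonglongrightarrow> 0"
    by (rule fourier_sum_at_zero) (use h per in \<open>auto simp: h_def add.assoc[symmetric]\<close>)
  moreover have "(\<Sum>k=-int N..int N. fourier_coef h k 0) = (\<Sum>k=-int N..int N. fourier_coef f k 0 * fourier_char k b) - f b" for N
    unfolding coef sum_subtractf by (simp add: sum.delta)
  ultimately show ?thesis by (simp add: LIM_zero_iff)
qed

section \<open>The one-dimensional theta inversion formula\<close>

lemma summable_exp_abs_int:
  assumes "s > 0"
  shows "(\<lambda>n::int. exp (- s * real_of_int \<bar>n\<bar>)) summable_on UNIV"
proof -
  have geo: "(\<lambda>n::nat. exp (- s) ^ n) summable_on UNIV"
    using assms by (intro summable_nonneg_imp_summable_on summable_geometric) auto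
  have eq: "exp (- s * real n) = exp (- s) ^ n" for n
    by (simp add: exp_of_nat_mult[symmetric] mult_ac)
  have 1: "(\<lambda>n::int. exp (- s * real_of_int \<bar>n\<bar>)) summable_on (range int)"
    by (subst summable_on_reindex) (use geo eq in \<open>auto simp: o_def\<close>)
  have 2: "(\<lambda>n::int. exp (- s * real_of_int \<bar>n\<bar>)) summable_on (range (\<lambda>n. - int n))"
    by (subst summable_on_reindex) (use geo eq in \<open>auto simp: o_def inj_def\<close>)
  have "n \<in> range int \<union> range (\<lambda>n. - int n)" for n
    by (cases n rule: int_cases2) auto
  then have "(UNIV :: int set) = range int \<union> range (\<lambda>n. - int n)" by blast
  then show ?thesis using summable_on_union[OF 1 2] by simp
qed

text \<open>Completing the square in the absolute value of \<open>x\<close>. Gaussian decay is given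
  up for exponential decay, whose sums over the integers are geometric, and the bound is uniform for
  \<open>\<beta>\<close> of bounded size.\<close>

lemma quadratic_le_minus_abs:
  fixes x :: real
  assumes "\<alpha> > 0" "\<bar>\<beta>\<bar> \<le> B"
  shows "- \<alpha> * x\<^sup>2 + \<beta> * x \<le> (B + 1)\<^sup>2 / (4 * \<alpha>) - \<bar>x\<bar>"
proof -
  have "0 \<le> (2 * \<alpha> * \<bar>x\<bar> - (B + 1))\<^sup>2 / (4 * \<alpha>)" using assms by simp
  also have "\<dots> = \<alpha> * x\<^sup>2 - (B + 1) * \<bar>x\<bar> + (B + 1)\<^sup>2 / (4 * \<alpha>)"
    using assms by (simp add: field_simps power2_eq_square)
  finally have "- \<alpha> * x\<^sup>2 + B * \<bar>x\<bar> \<le> (B + 1)\<^sup>2 / (4 * \<alpha>) - \<bar>x\<bar>" by (simp add: algebra_simps)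
  moreover have "\<beta> * x \<le> B * \<bar>x\<bar>"
    by (rule order.trans[OF _ mult_right_mono[OF assms(2)]]) (auto simp flip: abs_mult)
  ultimately show ?thesis by linarith
qed

lemma norm_exp_quadratic_le:
  assumes "\<rho> > 0" "Re p \<ge> \<rho>" "norm q \<le> Q" "norm r \<le> R"
  shows "norm (exp (- (p * of_real x ^ 2 + q * of_real x + r))) \<le>
         exp ((Q + 1)\<^sup>2 / (4 * \<rho>) + R) * exp (- \<bar>x\<bar>)"
proof -
  have "norm (exp (- (p * of_real x ^ 2 + q * of_real x + r))) =
        exp (- Re p * x\<^sup>2 + (- Re q) * x - Re r)"
    by (simp add: power2_eq_square)
  also have "\<dots> \<le> exp ((Q + 1)\<^sup>2 / (4 * \<rho>) + R - \<bar>x\<bar>)"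
  proof (subst exp_le_cancel_iff)
    have "- Re p * x\<^sup>2 \<le> - \<rho> * x\<^sup>2"
      using assms by (intro mult_right_mono) auto
    moreover have "- \<rho> * x\<^sup>2 + (- Re q) * x \<le> (Q + 1)\<^sup>2 / (4 * \<rho>) - \<bar>x\<bar>"
      by (rule quadratic_le_minus_abs) (use assms abs_Re_le_cmod[of q] in auto)
    moreover have "- Re r \<le> R" using assms abs_Re_le_cmod[of r] by linarith
    ultimately show "- Re p * x\<^sup>2 + (- Re q) * x - Re r \<le> (Q + 1)\<^sup>2 / (4 * \<rho>) + R - \<bar>x\<bar>"
      by simp
  qed
  finally show ?thesis by (simp only: exp_diff exp_minus divide_inverse)
qed

lemma summable_exp_neg_abs_int: "(\<lambda>n::int. C * exp (- real_of_int \<bar>n\<bar>)) summable_on UNIV"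
  using summable_exp_abs_int[of 1] by (intro summable_on_cmult_right) simp

lemma abs_summable_exp_quadratic:
  assumes "Re p > 0"
  shows "(\<lambda>n::int. norm (exp (- (p * of_int n ^ 2 + q * of_int n + r)))) summable_on UNIV"
proof (rule summable_on_comparison_test[OF summable_exp_neg_abs_int
        [of "exp ((norm q + 1)\<^sup>2 / (4 * Re p) + norm r)"]])
  show "norm (exp (- (p * of_int n ^ 2 + q * of_int n + r)))
      \<le> exp ((norm q + 1)\<^sup>2 / (4 * Re p) + norm r) * exp (- real_of_int \<bar>n\<bar>)" for n :: int
    using norm_exp_quadratic_le[where \<rho> = "Re p" and p = p and q = q and r = r and x = "of_int n"] assms by simp
qed auto

text \<open>On a closed disc inside \<open>S\<close> the real part of \<open>p\<close> attains a
  positive minimum while \<open>q\<close> and \<open>r\<close> are bounded, so one geometric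
  majorant serves the whole disc and the partial sums converge uniformly.\<close>

lemma holomorphic_exp_quadratic_series:
  assumes S: "open S" and hol: "p holomorphic_on S" "q holomorphic_on S" "r holomorphic_on S"
    and pos: "\<And>z. z \<in> S \<Longrightarrow> Re (p z) > 0"
  shows "(\<lambda>z. \<Sum>\<^sub>\<infinity>n::int. exp (- (p z * of_int n ^ 2 + q z * of_int n + r z))) holomorphic_on S"
proof -
  let ?f = "\<lambda>n z. exp (- (p z * of_int n ^ 2 + q z * of_int n + r z))"
  have "(\<lambda>z. \<Sum>\<^sub>\<infinity>n::int. ?f n z) field_differentiable (at z)" if z: "z \<in> S" for z
  proof -
    obtain e where e: "e > 0" "cball z e \<subseteq> S" using S z by (meson open_contains_cball)
    have cont: "continuous_on (cball z e) p" "continuous_on (cball z e) q" "continuous_on (cball z e) r"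
      using hol e by (meson continuous_on_subset holomorphic_on_imp_continuous_on)+
    have "continuous_on (cball z e) (\<lambda>w. Re (p w))" by (intro continuous_intros cont)
    then obtain w where w: "w \<in> cball z e" "\<And>x. x \<in> cball z e \<Longrightarrow> Re (p w) \<le> Re (p x)"
      using continuous_attains_inf[of "cball z e" "\<lambda>w. Re (p w)"] e by auto
    obtain Q where Q: "\<And>x. x \<in> cball z e \<Longrightarrow> norm (q x) \<le> Q"
      using compact_imp_bounded[OF compact_continuous_image[OF cont(2) compact_cball]]
      unfolding bounded_iff by blast
    obtain R where R: "\<And>x. x \<in> cball z e \<Longrightarrow> norm (r x) \<le> R"
      using compact_imp_bounded[OF compact_continuous_image[OF cont(3) compact_cball]]
      unfolding bounded_iff by blast
    have "uniform_limit (cball z e) (\<lambda>X z. \<Sum>n\<in>X. ?f n z) (\<lambda>z. \<Sum>\<^sub>\<infinity>n. ?f n z)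
            (finite_subsets_at_top UNIV)"
    proof (rule Weierstrass_m_test_general)
      show "norm (?f n x) \<le> exp ((Q + 1)\<^sup>2 / (4 * Re (p w)) + R) * exp (- real_of_int \<bar>n\<bar>)"
        if "x \<in> cball z e" for n x
        using norm_exp_quadratic_le[of "Re (p w)" "p x" "q x" Q "r x" R "of_int n"] w Q R pos e that by auto
    qed (rule summable_exp_neg_abs_int)
    moreover have "continuous_on (cball z e) (\<lambda>z. \<Sum>n\<in>X. ?f n z) \<and> (\<lambda>z. \<Sum>n\<in>X. ?f n z) holomorphic_on ball z e" for X
      by (intro conjI continuous_intros holomorphic_intros cont)
         (use hol e ball_subset_cball in \<open>blast intro: holomorphic_on_subset\<close>)+
    ultimately have "(\<lambda>z. \<Sum>\<^sub>\<infinity>n::int. ?f n z) holomorphic_on ball z e"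
      using holomorphic_uniform_limit[of z e "\<lambda>X z. \<Sum>n\<in>X. ?f n z" "finite_subsets_at_top UNIV"] by auto
    then show ?thesis by (rule holomorphic_on_imp_differentiable_at) (use e in auto)
  qed
  then show ?thesis by (simp add: holomorphic_on_def field_differentiable_at_within)
qed

text \<open>A Jacobi theta series in Gaussian normalisation. The shift \<open>b\<close> is complex
  because it will come from a combination of lattice vectors with coefficients built from the
  complex entries of \<open>Z\<close>.\<close>

definition gauss_sum :: "complex \<Rightarrow> complex \<Rightarrow> complex" where
  "gauss_sum a b = (\<Sum>\<^sub>\<infinity>n::int. exp (- of_real pi * a * (of_int n + b)\<^sup>2))"

definition gauss_dual :: "complex \<Rightarrow> complex \<Rightarrow> complex" where
  "gauss_dual a b = (\<Sum>\<^sub>\<infinity>n::int. exp (- of_real pi * of_int n ^ 2 / a + 2 * of_real pi * \<i> * of_int n * b))"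

lemma gauss_term_quadratic:
  "exp (- of_real pi * a * (of_int n + b)\<^sup>2) =
   exp (- ((of_real pi * a) * of_int n ^ 2 + (2 * of_real pi * a * b) * of_int n + of_real pi * a * b\<^sup>2) :: complex)"
  by (simp add: power2_eq_square algebra_simps)

lemma dual_term_quadratic:
  "exp (- of_real pi * of_int n ^ 2 / a + 2 * of_real pi * \<i> * of_int n * b) =
   exp (- ((of_real pi / a) * of_int n ^ 2 + (- 2 * of_real pi * \<i> * b) * of_int n + 0) :: complex)"
  by (simp add: power2_eq_square algebra_simps)

lemma Re_pi_divide_pos: "Re a > 0 \<Longrightarrow> Re (of_real pi / a) > 0"
  by (simp add: Re_divide divide_simps sum_power2_gt_zero_iff)

lemma abs_summable_gauss:
  "Re a > 0 \<Longrightarrow> (\<lambda>n::int. norm (exp (- of_real pi * a * (of_int n + b)\<^sup>2))) summable_on UNIV"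
  unfolding gauss_term_quadratic by (rule abs_summable_exp_quadratic) simp

lemma abs_summable_dual:
  "Re a > 0 \<Longrightarrow>
    (\<lambda>n::int. norm (exp (- of_real pi * of_int n ^ 2 / a + 2 * of_real pi * \<i> * of_int n * b))) summable_on UNIV"
  unfolding dual_term_quadratic by (rule abs_summable_exp_quadratic) (rule Re_pi_divide_pos)

lemma gauss_sum_holomorphic_shift: "Re a > 0 \<Longrightarrow> gauss_sum a holomorphic_on UNIV"
  unfolding gauss_sum_def[abs_def] gauss_term_quadratic
  by (rule holomorphic_exp_quadratic_series) (auto intro!: holomorphic_intros)

lemma gauss_sum_holomorphic: "(\<lambda>a. gauss_sum a b) holomorphic_on {a. Re a > 0}"
  unfolding gauss_sum_def[abs_def] gauss_term_quadratic
  by (rule holomorphic_exp_quadratic_series) (auto intro!: holomorphic_intros simp: open_halfspace_Re_gt)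

lemma gauss_dual_holomorphic: "(\<lambda>a. gauss_dual a b) holomorphic_on {a. Re a > 0}"
  unfolding gauss_dual_def[abs_def] dual_term_quadratic
  by (rule holomorphic_exp_quadratic_series)
     (auto intro!: holomorphic_intros Re_pi_divide_pos simp: open_halfspace_Re_gt)

lemma gauss_sum_periodic: "gauss_sum a (b + 1) = gauss_sum a b"
  unfolding gauss_sum_def
  by (rule infsum_reindex_bij_witness[of _ "\<lambda>n. n - 1" "\<lambda>n. n + 1"]) (auto simp: add_ac)

text \<open>The second quasi-period of the theta function: expanding the square leaves a cross term
  that is an integer multiple of 2 pi i and disappears under the exponential.\<close>

lemma gauss_sum_quasiperiodic:
  assumes "Re a > 0"
  shows "gauss_sum a (b + \<i> / a) = exp (of_real pi / a) * fourier_char (- 1) b * gauss_sum a b"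
proof -
  have "a \<noteq> 0" using assms by auto
  have "exp (- of_real pi * a * (of_int n + (b + \<i> / a))\<^sup>2) =
        exp (of_real pi / a) * fourier_char (- 1) b * exp (- of_real pi * a * (of_int n + b)\<^sup>2)" for n
  proof -
    have "- of_real pi * a * (of_int n + (b + \<i> / a))\<^sup>2 =
      of_real pi / a + 2 * of_real pi * \<i> * of_int (-1) * b + - of_real pi * a * (of_int n + b)\<^sup>2
      + of_int (2 * - n) * of_real pi * \<i>"
      using \<open>a \<noteq> 0\<close> by (simp add: field_simps power2_eq_square)
    then have "exp (- of_real pi * a * (of_int n + (b + \<i> / a))\<^sup>2) =
      exp (of_real pi / a) * exp (2 * of_real pi * \<i> * of_int (-1) * b) * exp (- of_real pi * a * (of_int n + b)\<^sup>2)
      * exp (of_int (2 * - n) * of_real pi * \<i>)" by (simp only: exp_add)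
    moreover have "exp (of_int (2 * - n) * of_real pi * \<i>) = 1"
      by (subst exp_eq_1) (auto intro!: exI[of _ "- n"])
    ultimately show ?thesis unfolding fourier_char_def by (simp only: mult_1_right)
  qed
  then show ?thesis
    unfolding gauss_sum_def by (simp add: infsum_cmult_right')
qed

text \<open>Translation by \<open>\<i> / a\<close> multiplies the \<open>k\<close>-th coefficient by
  a character value, and quasi-periodicity turns this into a recursion between neighbouring
  coefficients. All of them follow from the one of index 0.\<close>

lemma gauss_sum_fourier_coef:
  assumes a: "Re a > 0"
  shows "fourier_coef (gauss_sum a) k 0 = fourier_coef (gauss_sum a) 0 0 * exp (- of_real pi * of_int k ^ 2 / a)"
proof -
  let ?C = "\<lambda>k. fourier_coef (gauss_sum a) k 0"
  have a0: "a \<noteq> 0" using a by auto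
  have hol: "gauss_sum a holomorphic_on UNIV" using a by (rule gauss_sum_holomorphic_shift)
  have step: "?C (k + 1) = ?C k * exp (- of_real pi * (2 * of_int k + 1) / a)" for k
  proof -
    have "?C k * fourier_char k (\<i> / a) = fourier_coef (\<lambda>t. gauss_sum a (\<i> / a + t)) k 0"
      by (rule fourier_coef_translate[symmetric, OF hol gauss_sum_periodic])
    also have "\<dots> = exp (of_real pi / a) * ?C (k + 1)"
    proof -
      have "gauss_sum a (\<i> / a + t) * fourier_char (- k) t =
            exp (of_real pi / a) * (gauss_sum a t * fourier_char (- (k + 1)) t)" for t
        using gauss_sum_quasiperiodic[OF a, of t] fourier_char_add[of "-1" "-k" t]
        by (simp add: add.commute mult_ac)
      then show ?thesis unfolding fourier_coef_integral by (simp only: integral_mult_right)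
    qed
    finally have *: "exp (of_real pi / a) * ?C (k + 1) = ?C k * fourier_char k (\<i> / a)" by simp
    have "?C (k + 1) = exp (- (of_real pi / a)) * (exp (of_real pi / a) * ?C (k + 1))"
      by (simp add: exp_minus)
    also have "\<dots> = ?C k * (exp (- (of_real pi / a)) * fourier_char k (\<i> / a))"
      unfolding * by (simp add: mult_ac)
    also have "exp (- (of_real pi / a)) * fourier_char k (\<i> / a) = exp (- of_real pi * (2 * of_int k + 1) / a)"
      unfolding fourier_char_def exp_add[symmetric] using a0 by (simp add: field_simps)
    finally show ?thesis .
  qed
  show ?thesis
  proof (induction k rule: int_induct[of _ 0])
    case base then show ?case by simp
  next
    case (step1 k)
    have "?C (k + 1) = ?C 0 * (exp (- of_real pi * of_int k ^ 2 / a) * exp (- of_real pi * (2 * of_int k + 1) / a))"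
      unfolding step step1 by (simp add: mult_ac)
    also have "exp (- of_real pi * of_int k ^ 2 / a) * exp (- of_real pi * (2 * of_int k + 1) / a) =
      exp (- of_real pi * of_int (k + 1) ^ 2 / a)"
      unfolding exp_add[symmetric] using a0 by (simp add: add_divide_distrib diff_divide_distrib power2_eq_square algebra_simps)
    finally show ?case .
  next
    case (step2 k)
    have "?C (k - 1) * exp (- of_real pi * (2 * of_int (k - 1) + 1) / a) = ?C 0 * exp (- of_real pi * of_int k ^ 2 / a)"
      using step[of "k - 1"] step2 by simp
    also have "- of_real pi * of_int k ^ 2 / a = - of_real pi * of_int (k - 1) ^ 2 / a + - of_real pi * (2 * of_int (k - 1) + 1) / a"
      using a0 by (simp add: field_simps power2_eq_square)
    also have "?C 0 * exp \<dots> = ?C 0 * exp (- of_real pi * of_int (k - 1) ^ 2 / a) * exp (- of_real pi * (2 * of_int (k - 1) + 1) / a)"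
      by (simp only: exp_add mult.assoc)
    finally show ?case by (simp only: mult_right_cancel exp_not_eq_zero not_False_eq_True)
  qed
qed

text \<open>Links the symmetric partial sums, for which the convergence of Fourier series is known,
  with unordered sums.\<close>

lemma filterlim_symmetric_intervals:
  "filterlim (\<lambda>N. {- int N..int N}) (finite_subsets_at_top UNIV) sequentially"
  unfolding filterlim_finite_subsets_at_top
proof (intro allI impI)
  fix X :: "int set" assume X: "finite X \<and> X \<subseteq> UNIV"
  then obtain B where B: "\<And>x. x \<in> X \<Longrightarrow> \<bar>x\<bar> \<le> B"
    by (metis (no_types, lifting) Max_ge finite_imageI image_eqI)
  show "\<forall>\<^sub>F N in sequentially. finite {- int N..int N} \<and> X \<subseteq> {- int N..int N} \<and> {- int N..int N} \<subseteq> UNIV"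
    using eventually_ge_at_top[of "nat B"]
  proof eventually_elim
    case (elim N)
    have "x \<in> {- int N..int N}" if "x \<in> X" for x using B[OF that] elim by auto
    then show ?case by auto
  qed
qed

text \<open>Inserts the coefficients just found into the Fourier series of
  \<open>gauss_sum a\<close>. What remains open is the constant
  \<open>fourier_coef (gauss_sum a) 0 0\<close>, which will turn out to be the inverse of
  \<open>csqrt a\<close>.\<close>

lemma gauss_sum_eq_dual:
  assumes a: "Re a > 0"
  shows "gauss_sum a b = fourier_coef (gauss_sum a) 0 0 * gauss_dual a b"
proof -
  let ?c = "fourier_coef (gauss_sum a) 0 0"
  have "((\<lambda>n::int. exp (- of_real pi * of_int n ^ 2 / a + 2 * of_real pi * \<i> * of_int n * b)) has_sum gauss_dual a b) UNIV"
    unfolding gauss_dual_def by (rule has_sum_infsum[OF abs_summable_summable[OF abs_summable_dual[OF a]]])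
  then have "((\<lambda>n::int. exp (- of_real pi * of_int n ^ 2 / a) * fourier_char n b) has_sum gauss_dual a b) UNIV"
    by (simp only: exp_add fourier_char_def)
  then have "(\<lambda>N. \<Sum>n=-int N..int N. exp (- of_real pi * of_int n ^ 2 / a) * fourier_char n b) \<longlonglongrightarrow> gauss_dual a b"
    unfolding has_sum_def using filterlim_compose[OF _ filterlim_symmetric_intervals] by blast
  then have "(\<lambda>N. ?c * (\<Sum>n=-int N..int N. exp (- of_real pi * of_int n ^ 2 / a) * fourier_char n b)) \<longlonglongrightarrow> ?c * gauss_dual a b"
    by (rule tendsto_mult_left)
  moreover have "?c * (\<Sum>n=-int N..int N. exp (- of_real pi * of_int n ^ 2 / a) * fourier_char n b) =
      (\<Sum>n=-int N..int N. fourier_coef (gauss_sum a) n 0 * fourier_char n b)" for N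
    unfolding sum_distrib_left
    by (rule sum.cong[OF refl], subst (2) gauss_sum_fourier_coef[OF a]) (simp add: mult.assoc)
  ultimately show ?thesis
    using fourier_sum[OF gauss_sum_holomorphic_shift[OF a] gauss_sum_periodic, of b] LIMSEQ_unique by auto
qed

lemma sum_fourier_char:
  assumes "N > 0"
  shows "(\<Sum>j<N. fourier_char n (of_nat j / of_nat N)) = (if int N dvd n then of_nat N else 0)"
proof -
  define w where "w = fourier_char n (1 / of_nat N)"
  have pow: "fourier_char n (of_nat j / of_nat N) = w ^ j" for j
    by (simp add: w_def fourier_char_def exp_of_nat_mult[symmetric] mult_ac)
  have wN: "w ^ N = 1"
  proof -
    have "w ^ N = fourier_char n (0 + of_int 1)" using pow[of N] assms by simp
    also have "\<dots> = 1" unfolding fourier_char_shift_int by (simp add: fourier_char_def)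
    finally show ?thesis .
  qed
  have w1: "w = 1 \<longleftrightarrow> int N dvd n"
  proof -
    have "w = fourier_char 1 (of_int n / of_nat N)" by (simp add: w_def fourier_char_def)
    then have "w = 1 \<longleftrightarrow> (of_int n / of_nat N :: complex) \<in> \<int>" by (simp add: fourier_char_eq_1_iff)
    also have "\<dots> \<longleftrightarrow> (of_int n / of_int (int N) :: complex) \<in> \<int>" by simp
    also have "\<dots> \<longleftrightarrow> int N dvd n" using assms
      by (subst of_int_div_of_int_in_Ints_iff) auto
    finally show ?thesis .
  qed
  show ?thesis
  proof (cases "w = 1")
    case True then show ?thesis using w1 by (simp add: pow)
  next
    case False
    have "(\<Sum>j<N. w ^ j) = 0" using geometric_sum[OF False, of N] wN by simp
    then show ?thesis using w1 False by (simp add: pow)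
  qed
qed

lemma has_sum_finite_sum:
  fixes f :: "'i \<Rightarrow> 'a \<Rightarrow> 'b::topological_comm_monoid_add"
  assumes "\<And>j. j \<in> J \<Longrightarrow> (f j has_sum s j) A"
  shows "((\<lambda>x. \<Sum>j\<in>J. f j x) has_sum (\<Sum>j\<in>J. s j)) A"
  using assms by (induction J rule: infinite_finite_induct) (auto intro!: has_sum_add)

text \<open>Summing over the \<open>N\<close>-division points keeps the indices divisible by
  \<open>N\<close>, by orthogonality of characters; the factor \<open>N^2\<close> in the parameter
  then cancels against the square of such an index.\<close>

lemma gauss_dual_dissection:
  assumes a: "Re a > 0" and N: "N > 0"
  shows "(\<Sum>j<N. gauss_dual (of_nat N ^ 2 * a) (of_nat j / of_nat N)) = of_nat N * gauss_dual a 0"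
proof -
  have a': "Re (of_nat N ^ 2 * a) > 0"
  proof -
    have "of_nat N ^ 2 * a = of_real (real N ^ 2) * a" by simp
    moreover have "Re (of_real (real N ^ 2) * a) = real N ^ 2 * Re a" by (simp del: of_real_power)
    ultimately show ?thesis using a N by (metis mult_pos_pos of_nat_0_less_iff zero_less_power)
  qed
  let ?t = "\<lambda>n::int. exp (- of_real pi * of_int n ^ 2 / (of_nat N ^ 2 * a)) :: complex"
  let ?u = "\<lambda>n::int. ?t n * (if int N dvd n then of_nat N else 0)"
  have s: "((\<lambda>n. ?t n * fourier_char n b) has_sum gauss_dual (of_nat N ^ 2 * a) b) UNIV" for b
    using has_sum_infsum[OF abs_summable_summable[OF abs_summable_dual[OF a', of b]]]
    unfolding gauss_dual_def by (simp only: exp_add fourier_char_def)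
  have "((\<lambda>n. \<Sum>j<N. ?t n * fourier_char n (of_nat j / of_nat N)) has_sum
      (\<Sum>j<N. gauss_dual (of_nat N ^ 2 * a) (of_nat j / of_nat N))) UNIV"
    by (intro has_sum_finite_sum s)
  then have 1: "(?u has_sum
      (\<Sum>j<N. gauss_dual (of_nat N ^ 2 * a) (of_nat j / of_nat N))) UNIV"
    by (simp only: sum_distrib_left[symmetric] sum_fourier_char[OF N])
  have s2: "((\<lambda>n::int. exp (- of_real pi * of_int n ^ 2 / a)) has_sum gauss_dual a 0) UNIV"
    using has_sum_infsum[OF abs_summable_summable[OF abs_summable_dual[OF a, of 0]]]
    unfolding gauss_dual_def by simp
  have eq: "of_nat N * exp (- of_real pi * of_int n ^ 2 / a) = ?u (int N * n)" for n
    using N by (simp add: power_mult_distrib)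
  have 2: "((\<lambda>n. ?u (int N * n)) has_sum of_nat N * gauss_dual a 0) UNIV"
    unfolding eq[symmetric] by (rule has_sum_cmult_right[OF s2])
  have inj: "inj (\<lambda>n. int N * n)" using N by (auto simp: inj_def)
  have "(?u has_sum of_nat N * gauss_dual a 0) (range (\<lambda>n. int N * n))"
    using 2 unfolding has_sum_reindex[OF inj] o_def .
  then have "(?u has_sum of_nat N * gauss_dual a 0) UNIV"
    by (rule has_sum_cong_neutral[THEN iffD1, rotated -1]) auto
  from has_sum_unique[OF 1 this] show ?thesis .
qed

text \<open>The counterpart on the other side: the terms for the shift \<open>j / N\<close> are
  those of \<open>gauss_sum a 0\<close> at the indices congruent to \<open>j\<close> modulo
  \<open>N\<close>.\<close>

lemma gauss_sum_dissection:
  assumes a: "Re a > 0" and N: "N > 0"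
  shows "(\<Sum>j<N. gauss_sum (of_nat N ^ 2 * a) (of_nat j / of_nat N)) = gauss_sum a 0"
proof -
  let ?t = "\<lambda>n::int. exp (- of_real pi * a * (of_int n)\<^sup>2) :: complex"
  let ?h = "\<lambda>(j, m). int N * m + int j"
  have bij: "bij_betw ?h ({..<N} \<times> UNIV) UNIV"
  proof (rule bij_betw_byWitness[of _ "\<lambda>n. (nat (n mod int N), n div int N)"])
    show "\<forall>x\<in>{..<N} \<times> UNIV. (nat (?h x mod int N), ?h x div int N) = x"
      using N by auto
    show "\<forall>n\<in>UNIV. ?h (nat (n mod int N), n div int N) = n"
      using N by auto
    show "(\<lambda>n. (nat (n mod int N), n div int N)) ` UNIV \<subseteq> {..<N} \<times> UNIV"
      using N by (auto simp: nat_less_iff)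
  qed auto
  have "?t summable_on UNIV"
    using abs_summable_summable[OF abs_summable_gauss[OF a, of 0]] by simp
  then have "(?t \<circ> ?h) summable_on {..<N} \<times> UNIV"
    using summable_on_reindex_bij_betw[OF bij, of ?t] by (simp only: o_def)
  then have *: "infsum (?t \<circ> ?h) ({..<N} \<times> UNIV) = (\<Sum>\<^sub>\<infinity>j\<in>{..<N}. \<Sum>\<^sub>\<infinity>m. (?t \<circ> ?h) (j, m))"
    by (rule infsum_Sigma_banach[symmetric])
  have "gauss_sum a 0 = infsum ?t UNIV" by (simp add: gauss_sum_def)
  also have "\<dots> = infsum (?t \<circ> ?h) ({..<N} \<times> UNIV)"
    using infsum_reindex_bij_betw[OF bij, of ?t] by (simp add: o_def)
  also have "\<dots> = (\<Sum>j<N. \<Sum>\<^sub>\<infinity>m. (?t \<circ> ?h) (j, m))" unfolding * by simp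
  also have "\<dots> = (\<Sum>j<N. gauss_sum (of_nat N ^ 2 * a) (of_nat j / of_nat N))"
  proof (rule sum.cong)
    fix j
    have "of_nat N * (of_int m + of_nat j / of_nat N) = (of_nat N * of_int m + of_nat j :: complex)" for m
      using N by (simp add: distrib_left)
    then have "(of_nat N)\<^sup>2 * (of_int m + of_nat j / of_nat N)\<^sup>2 = (of_nat N * of_int m + of_nat j :: complex)\<^sup>2" for m
      unfolding power_mult_distrib[symmetric] by simp
    then have "- of_real pi * a * (of_int (int N * m + int j))\<^sup>2 =
       - of_real pi * (of_nat N ^ 2 * a) * (of_int m + of_nat j / of_nat N :: complex)\<^sup>2" for m
      by (simp add: mult_ac)
    then show "(\<Sum>\<^sub>\<infinity>m. (?t \<circ> ?h) (j, m)) = gauss_sum (of_nat N ^ 2 * a) (of_nat j / of_nat N)"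
      unfolding gauss_sum_def o_def by (simp only: prod.case)
  qed simp
  finally show ?thesis by simp
qed

lemma gauss_dual_pos:
  assumes "t > 0"
  shows "gauss_dual (of_real t) 0 \<noteq> 0"
proof -
  let ?f = "\<lambda>n::int. exp (- pi * of_int n ^ 2 / t)"
  have "(\<lambda>n::int. norm (exp (- of_real pi * of_int n ^ 2 / of_real t + 2 * of_real pi * \<i> * of_int n * 0) :: complex)) summable_on UNIV"
    by (rule abs_summable_dual) (use assms in simp)
  moreover have "norm (exp (- of_real pi * of_int n ^ 2 / of_real t + 2 * of_real pi * \<i> * of_int n * 0) :: complex) = ?f n" for n
    using assms by (simp add: Re_divide power2_eq_square)
  ultimately have s: "?f summable_on UNIV" by simp
  have "gauss_dual (of_real t) 0 = (\<Sum>\<^sub>\<infinity>n. of_real (?f n))"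
    unfolding gauss_dual_def by (simp add: exp_of_real[symmetric])
  also have "\<dots> = of_real (infsum ?f UNIV)" by (rule infsumI[OF has_sum_of_real[OF has_sum_infsum[OF s]]])
  also have "infsum ?f UNIV > 0"
  proof -
    have "0 < (\<Sum>n\<in>{0::int}. ?f n)" by simp
    also have "\<dots> \<le> infsum ?f UNIV" by (rule finite_sum_le_infsum[OF s]) auto
    finally show ?thesis .
  qed
  then have "of_real (infsum ?f UNIV) \<noteq> (0::complex)" by simp
  finally show ?thesis .
qed

text \<open>Comparing the two dissections shows how the unknown constant scales when the parameter
  is multiplied by a square. This replaces the evaluation of a Gaussian integral; cancelling needs
  that the dual series does not vanish.\<close>

lemma fourier_coef_gauss_scale:
  assumes t: "t > 0" and N: "N > 0"
  shows "fourier_coef (gauss_sum (of_real t)) 0 0 = of_nat N * fourier_coef (gauss_sum (of_nat N ^ 2 * of_real t)) 0 0"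
proof -
  have a: "Re (complex_of_real t) > 0" using t by simp
  have "of_nat N ^ 2 * of_real t = (of_real (real N ^ 2 * t) :: complex)" by simp
  then have a': "Re (of_nat N ^ 2 * complex_of_real t) > 0"
    using t N by (metis Re_complex_of_real mult_pos_pos of_nat_0_less_iff zero_less_power)
  have "fourier_coef (gauss_sum (of_real t)) 0 0 * gauss_dual (of_real t) 0 = gauss_sum (of_real t) 0"
    using gauss_sum_eq_dual[OF a, of 0] by simp
  also have "\<dots> = (\<Sum>j<N. gauss_sum (of_nat N ^ 2 * of_real t) (of_nat j / of_nat N))"
    by (rule gauss_sum_dissection[OF a N, symmetric])
  also have "\<dots> = fourier_coef (gauss_sum (of_nat N ^ 2 * of_real t)) 0 0 *
       (\<Sum>j<N. gauss_dual (of_nat N ^ 2 * of_real t) (of_nat j / of_nat N))"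
    unfolding sum_distrib_left by (intro sum.cong refl gauss_sum_eq_dual a')
  also have "\<dots> = (of_nat N * fourier_coef (gauss_sum (of_nat N ^ 2 * of_real t)) 0 0) * gauss_dual (of_real t) 0"
    unfolding gauss_dual_dissection[OF a N] by (simp add: mult_ac)
  finally show ?thesis using gauss_dual_pos[OF t] by simp
qed

lemma fourier_coef_gauss_one: "fourier_coef (gauss_sum 1) 0 0 = 1"
proof -
  have "gauss_sum 1 0 = gauss_dual 1 0" by (simp add: gauss_sum_def gauss_dual_def)
  then show ?thesis using gauss_sum_eq_dual[of 1 0] gauss_dual_pos[of 1] by simp
qed

text \<open>The scaling relation and the self-dual value at 1 determine the constant at squares of
  rational numbers. These accumulate at 1, and both sides are holomorphic in the right half-plane,
  so the identity theorem gives the rest.\<close>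

theorem theta_inversion:
  assumes a: "Re a > 0"
  shows "csqrt a * gauss_sum a b = gauss_dual a b"
proof -
  let ?S = "{a::complex. Re a > 0}"
  let ?h = "\<lambda>a. csqrt a * gauss_sum a b - gauss_dual a b"
  \<comment> \<open>Squares of rationals \<open>p / q\<close> with \<open>p = q + 1\<close>: never
    equal to 1, convergent to 1, and linked with the parameter 1 by scaling, since
    \<open>q^2\<close> times such a square is \<open>p^2\<close>.\<close>
  define \<xi> where "\<xi> n = complex_of_real ((real (Suc (Suc n)) / real (Suc n))\<^sup>2)" for n
  have zero: "?h (\<xi> n) = 0" for n
  proof -
    let ?p = "Suc (Suc n)" and ?q = "Suc n"
    let ?t = "(real ?p / real ?q)\<^sup>2"
    have t: "?t > 0" by simp
    have "fourier_coef (gauss_sum 1) 0 0 = of_nat ?p * fourier_coef (gauss_sum (of_nat ?p ^ 2)) 0 0"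
      using fourier_coef_gauss_scale[of 1 ?p] by simp
    then have p: "of_nat ?p * fourier_coef (gauss_sum (of_nat ?p ^ 2)) 0 0 = 1"
      by (simp only: fourier_coef_gauss_one)
    have "of_nat ?q ^ 2 * complex_of_real ?t = of_nat ?p ^ 2"
      by (simp add: power_divide del: of_nat_Suc)
    then have q: "fourier_coef (gauss_sum (\<xi> n)) 0 0 = of_nat ?q * fourier_coef (gauss_sum (of_nat ?p ^ 2)) 0 0"
      using fourier_coef_gauss_scale[OF t, of ?q] unfolding \<xi>_def by simp
    have "csqrt (\<xi> n) = of_real (sqrt ?t)"
      unfolding \<xi>_def by (rule of_real_sqrt[symmetric]) (rule zero_le_power2)
    also have "\<dots> = of_nat ?p / of_nat ?q" by (simp add: real_sqrt_divide del: of_nat_Suc)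
    finally have "csqrt (\<xi> n) * fourier_coef (gauss_sum (\<xi> n)) 0 0 = of_nat ?p * fourier_coef (gauss_sum (of_nat ?p ^ 2)) 0 0"
      unfolding q by (simp del: of_nat_Suc)
    then have "csqrt (\<xi> n) * fourier_coef (gauss_sum (\<xi> n)) 0 0 = 1" using p by simp
    moreover have "gauss_sum (\<xi> n) b = fourier_coef (gauss_sum (\<xi> n)) 0 0 * gauss_dual (\<xi> n) b"
      by (rule gauss_sum_eq_dual) (simp add: \<xi>_def flip: of_real_power)
    ultimately show ?thesis by (simp flip: mult.assoc)
  qed
  have lim: "\<xi> \<longlonglongrightarrow> 1"
  proof -
    have "(\<lambda>n. real (Suc (Suc n)) / real (Suc n)) \<longlonglongrightarrow> 1"
      using LIMSEQ_Suc_n_over_n LIMSEQ_Suc by blast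
    then have "(\<lambda>n. complex_of_real ((real (Suc (Suc n)) / real (Suc n))\<^sup>2)) \<longlonglongrightarrow> of_real (1\<^sup>2)"
      by (intro tendsto_intros)
    then show ?thesis unfolding \<xi>_def by simp
  qed
  have ne: "\<xi> n \<noteq> 1" for n
  proof -
    have "(real (Suc (Suc n)) / real (Suc n))\<^sup>2 > 1" by (simp add: one_less_power)
    then show ?thesis unfolding \<xi>_def by (metis less_irrefl of_real_eq_1_iff)
  qed
  have islim: "1 islimpt range \<xi>"
    unfolding islimpt_sequential using lim ne by (intro exI[of _ \<xi>]) auto
  have "?h a = 0"
  proof (rule analytic_continuation[of ?h ?S "range \<xi>" 1])
    show "?h holomorphic_on ?S"
      by (intro holomorphic_intros gauss_sum_holomorphic gauss_dual_holomorphic)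
         (auto simp: complex_nonpos_Reals_iff)
    show "connected ?S" by (intro convex_connected convex_halfspace_Re_gt)
    show "range \<xi> \<subseteq> ?S" unfolding \<xi>_def by (auto simp flip: of_real_power)
  qed (use a zero islim in \<open>auto simp: open_halfspace_Re_gt\<close>)
  then show ?thesis by simp
qed

section \<open>Poisson summation over lattices\<close>

text \<open>A character in the summation variable is absorbed into the shift: \<open>b\<close>
  becomes \<open>b - \<i> * c / a\<close>. On the dual side the same change moves the summation
  points from \<open>s\<close> to \<open>s - c\<close>.\<close>

lemma gauss_sum_character:
  fixes c :: real
  assumes a: "Re a > 0"
  shows "csqrt a * (\<Sum>\<^sub>\<infinity>t::int. exp (- of_real pi * a * (of_int t + b)\<^sup>2 + 2 * of_real pi * \<i> * of_real c * of_int t)) =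
         (\<Sum>\<^sub>\<infinity>s::int. exp (- of_real pi * (of_real (of_int s - c))\<^sup>2 / a + 2 * of_real pi * \<i> * of_real (of_int s - c) * b))"
proof -
  have a0: "a \<noteq> 0" using a by auto
  define b' where "b' = b - \<i> * of_real c / a"
  define e where "e = exp (- of_real pi * of_real c ^ 2 / a - 2 * of_real pi * \<i> * of_real c * b)"
  have 1: "exp (- of_real pi * a * (of_int t + b)\<^sup>2 + 2 * of_real pi * \<i> * of_real c * of_int t) =
        e * exp (- of_real pi * a * (of_int t + b')\<^sup>2)" for t :: int
  proof -
    have "a * (of_int t + b')\<^sup>2 = a * (of_int t + b)\<^sup>2 - 2 * \<i> * of_real c * (of_int t + b) - of_real c ^ 2 / a"
      unfolding b'_def using a0 by (simp add: field_simps power2_eq_square)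
    then have "- of_real pi * a * (of_int t + b)\<^sup>2 + 2 * of_real pi * \<i> * of_real c * of_int t =
      (- of_real pi * of_real c ^ 2 / a - 2 * of_real pi * \<i> * of_real c * b) + - of_real pi * a * (of_int t + b')\<^sup>2"
      by (simp add: mult.assoc) (simp add: algebra_simps)
    then show ?thesis unfolding e_def by (simp only: exp_add)
  qed
  have 2: "exp (- of_real pi * (of_real (of_int s - c))\<^sup>2 / a + 2 * of_real pi * \<i> * of_real (of_int s - c) * b) =
        e * exp (- of_real pi * of_int s ^ 2 / a + 2 * of_real pi * \<i> * of_int s * b')" for s :: int
  proof -
    have "- of_real pi * (of_real (of_int s - c))\<^sup>2 / a + 2 * of_real pi * \<i> * of_real (of_int s - c) * b =
      (- of_real pi * of_real c ^ 2 / a - 2 * of_real pi * \<i> * of_real c * b)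
      + (- of_real pi * of_int s ^ 2 / a + 2 * of_real pi * \<i> * of_int s * b')"
      unfolding b'_def using a0 by (simp add: field_simps power2_eq_square)
    then show ?thesis unfolding e_def by (simp only: exp_add)
  qed
  have "csqrt a * (e * gauss_sum a b') = e * gauss_dual a b'"
    using theta_inversion[OF a, of b'] by (metis mult.left_commute)
  then show ?thesis
    unfolding 1 2 gauss_sum_def gauss_dual_def by (simp only: infsum_cmult_right')
qed

text \<open>Vectors on a varying index set are functions that vanish outside it, since an induction
  on the set of coordinates cannot change the type.\<close>

definition supp_vecs :: "'m set \<Rightarrow> ('m \<Rightarrow> int) set" where
  "supp_vecs I = {x. \<forall>k. k \<notin> I \<longrightarrow> x k = 0}"

definition lin_form :: "'m set \<Rightarrow> ('m \<Rightarrow> 'm \<Rightarrow> real) \<Rightarrow> 'm \<Rightarrow> ('m \<Rightarrow> int) \<Rightarrow> real" where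
  "lin_form I L k x = (\<Sum>j\<in>I. L k j * of_int (x j))"

lemma bij_betw_supp_vecs_insert:
  assumes "m \<notin> I"
  shows "bij_betw (\<lambda>(x, t). x(m := t)) (supp_vecs I \<times> UNIV) (supp_vecs (insert m I))"
  by (rule bij_betw_byWitness[of _ "\<lambda>x. (x(m := 0), x m)"])
     (use assms in \<open>auto simp: supp_vecs_def fun_eq_iff\<close>)

text \<open>\<open>frame I d L V\<close>: the matrix \<open>L\<close> on \<open>I\<close> is unitriangular with respect to some ordering
  of \<open>I\<close>, \<open>V\<close> is its inverse transpose, and \<open>d\<close> is positive.\<close>

inductive frame :: "'m set \<Rightarrow> ('m \<Rightarrow> real) \<Rightarrow> ('m \<Rightarrow> 'm \<Rightarrow> real) \<Rightarrow> ('m \<Rightarrow> 'm \<Rightarrow> real) \<Rightarrow> bool" where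
  empty: "frame {} d L V"
| insert: "frame I d L V \<Longrightarrow> m \<notin> I \<Longrightarrow> finite I \<Longrightarrow> D > 0 \<Longrightarrow>
    frame (insert m I) (d(m := D))
      (\<lambda>k j. if k = m then of_bool (j = m) else if j = m then u k else L k j)
      (\<lambda>k j. if k = m then (if j = m then 1 else - (\<Sum>l\<in>I. u l * V l j)) else if j = m then 0 else V k j)"

lemma frame_pos: "frame I d L V \<Longrightarrow> k \<in> I \<Longrightarrow> d k > 0"
  by (induction rule: frame.induct) auto

text \<open>The new variable \<open>t\<close> shifts the old forms of \<open>L\<close>, whereas for
  \<open>V\<close> the old variables shift the new form. This opposite triangularity matches the
  duality between shifts and characters in one variable.\<close>

lemma lin_form_insert:
  fixes L V :: "'m \<Rightarrow> 'm \<Rightarrow> real" and u :: "'m \<Rightarrow> real"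
  assumes "m \<notin> I" "finite I" "x \<in> supp_vecs I"
  defines "L' \<equiv> \<lambda>k j. if k = m then of_bool (j = m) else if j = m then u k else L k j"
    and "V' \<equiv> \<lambda>k j. if k = m then (if j = m then 1 else - (\<Sum>l\<in>I. u l * V l j)) else if j = m then 0 else V k j"
  shows "lin_form (insert m I) L' m (x(m := t)) = of_int t"
    and "k \<in> I \<Longrightarrow> lin_form (insert m I) L' k (x(m := t)) = lin_form I L k x + u k * of_int t"
    and "lin_form (insert m I) V' m (x(m := t)) = of_int t - (\<Sum>l\<in>I. u l * lin_form I V l x)"
    and "k \<in> I \<Longrightarrow> lin_form (insert m I) V' k (x(m := t)) = lin_form I V k x"
proof -
  have ne: "j \<noteq> m" if "j \<in> I" for j using assms(1) that by auto
  have s: "(\<Sum>j\<in>I. M k j * of_int ((x(m := t)) j)) = (\<Sum>j\<in>I. M k j * of_int (x j))" for M :: "'m \<Rightarrow> 'm \<Rightarrow> real" and k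
    using ne by (intro sum.cong) auto
  show "lin_form (insert m I) L' m (x(m := t)) = of_int t"
    unfolding lin_form_def using assms(1,2) by (simp add: s) (simp add: L'_def ne)
  show "lin_form (insert m I) L' k (x(m := t)) = lin_form I L k x + u k * of_int t" if "k \<in> I"
    unfolding lin_form_def using assms(1,2) that ne by (simp add: s) (simp add: L'_def cong: sum.cong)
  show "lin_form (insert m I) V' k (x(m := t)) = lin_form I V k x" if "k \<in> I"
    unfolding lin_form_def using assms(1,2) that ne by (simp add: s) (simp add: V'_def cong: sum.cong)
  have "(\<Sum>j\<in>I. V' m j * of_int (x j)) = (\<Sum>j\<in>I. \<Sum>l\<in>I. - (u l * (V l j * of_int (x j))))"
    by (intro sum.cong refl) (auto simp: V'_def ne sum_distrib_right sum_negf mult.assoc)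
  also have "\<dots> = (\<Sum>l\<in>I. \<Sum>j\<in>I. - (u l * (V l j * of_int (x j))))"
    by (rule sum.swap)
  also have "\<dots> = - (\<Sum>l\<in>I. u l * lin_form I V l x)"
    by (simp add: sum_negf sum_distrib_left lin_form_def)
  finally show "lin_form (insert m I) V' m (x(m := t)) = of_int t - (\<Sum>l\<in>I. u l * lin_form I V l x)"
    unfolding lin_form_def[of _ V'] by (simp only: sum.insert[OF assms(2,1)] s) (simp add: V'_def)
qed

text \<open>The shift is replaced by its floor, at the cost of a factor \<open>exp 1\<close>, and an
  integer shift only permutes the terms. Uniformity in \<open>s\<close> is what the induction on
  coordinates requires.\<close>

lemma sum_exp_shift_bound:
  shows "\<exists>C\<ge>0. \<forall>s F. finite F \<longrightarrow> (\<Sum>n\<in>F. exp (- \<bar>real_of_int n + s\<bar>)) \<le> C"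
proof -
  let ?C = "exp 1 * (\<Sum>\<^sub>\<infinity>n::int. exp (- real_of_int \<bar>n\<bar>))"
  have sm: "(\<lambda>n::int. exp (- real_of_int \<bar>n\<bar>)) summable_on UNIV" using summable_exp_abs_int[of 1] by simp
  have "(\<Sum>n\<in>F. exp (- \<bar>real_of_int n + s\<bar>)) \<le> ?C" if F: "finite F" for s F
  proof -
    have "(\<Sum>n\<in>F. exp (- \<bar>real_of_int n + s\<bar>)) \<le> (\<Sum>n\<in>F. exp 1 * exp (- real_of_int \<bar>n + \<lfloor>s\<rfloor>\<bar>))"
    proof (rule sum_mono)
      fix n
      have "- \<bar>real_of_int n + s\<bar> \<le> 1 + - real_of_int \<bar>n + \<lfloor>s\<rfloor>\<bar>" by linarith
      then show "exp (- \<bar>real_of_int n + s\<bar>) \<le> exp 1 * exp (- real_of_int \<bar>n + \<lfloor>s\<rfloor>\<bar>)"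
        unfolding exp_add[symmetric] by (simp only: exp_le_cancel_iff)
    qed
    also have "\<dots> = exp 1 * (\<Sum>n\<in>(\<lambda>n. n + \<lfloor>s\<rfloor>) ` F. exp (- real_of_int \<bar>n\<bar>))"
      by (subst sum.reindex) (auto simp: sum_distrib_left)
    also have "\<dots> \<le> ?C"
      by (intro mult_left_mono finite_sum_le_infsum[OF sm]) (use F in auto)
    finally show ?thesis .
  qed
  moreover have "?C \<ge> 0" by (intro mult_nonneg_nonneg infsum_nonneg) auto
  ultimately show ?thesis by blast
qed

text \<open>A finite set of pairs is enclosed in the product of its two projections, which bounds an
  arbitrary partial sum by an iterated one.\<close>

lemma sum_le_sum_product:
  fixes h :: "'a \<times> 'b \<Rightarrow> real"
  assumes "bij_betw \<phi> (A \<times> B) T" "finite F" "F \<subseteq> T" "\<And>z. z \<in> T \<Longrightarrow> f z \<ge> 0"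
  shows "\<exists>F1 F2. finite F1 \<and> finite F2 \<and> F1 \<subseteq> A \<and> F2 \<subseteq> B \<and> sum f F \<le> (\<Sum>x\<in>F1. \<Sum>y\<in>F2. f (\<phi> (x, y)) :: real)"
proof -
  define \<psi> where "\<psi> = inv_into (A \<times> B) \<phi>"
  define G where "G = \<psi> ` F"
  have G: "G \<subseteq> A \<times> B" "finite G" "\<phi> ` G = F"
    unfolding G_def \<psi>_def using assms(1-3)
    by (auto simp: bij_betw_def image_iff inv_into_into f_inv_into_f subset_iff)
  let ?F1 = "fst ` G" and ?F2 = "snd ` G"
  have sub: "G \<subseteq> ?F1 \<times> ?F2" "?F1 \<times> ?F2 \<subseteq> A \<times> B" using G by (auto simp: image_iff) force+
  have "inj_on \<phi> (A \<times> B)" using assms(1) by (simp add: bij_betw_def)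
  then have "sum f F = (\<Sum>z\<in>G. f (\<phi> z))"
    using G by (metis (no_types, lifting) inj_on_subset sum.reindex_cong)
  also have "\<dots> \<le> (\<Sum>z\<in>?F1 \<times> ?F2. f (\<phi> z))"
  proof (rule sum_mono2)
    show "0 \<le> f (\<phi> z)" if "z \<in> ?F1 \<times> ?F2 - G" for z
      using that sub assms(1,4) by (meson DiffD1 bij_betwE subsetD)
  qed (use G sub in auto)
  also have "\<dots> = (\<Sum>x\<in>?F1. \<Sum>y\<in>?F2. f (\<phi> (x, y)))" by (simp add: sum.cartesian_product)
  finally show ?thesis using G sub by (intro exI[of _ ?F1] exI[of _ ?F2]) auto
qed

text \<open>The bound has to be uniform in the shifts \<open>s\<close>: in the induction step the
  shifts of the old coordinates depend on the new variable for \<open>L\<close>, and the shift of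
  the new coordinate depends on the old variables for \<open>V\<close>.\<close>

lemma frame_sum_bound:
  assumes "frame I d L V"
  shows "(\<exists>C\<ge>0. \<forall>s F. finite F \<longrightarrow> F \<subseteq> supp_vecs I \<longrightarrow> (\<Sum>x\<in>F. \<Prod>k\<in>I. exp (- \<bar>lin_form I L k x + s k\<bar>)) \<le> C) \<and>
         (\<exists>C\<ge>0. \<forall>s F. finite F \<longrightarrow> F \<subseteq> supp_vecs I \<longrightarrow> (\<Sum>x\<in>F. \<Prod>k\<in>I. exp (- \<bar>lin_form I V k x + s k\<bar>)) \<le> C)"
  using assms
proof (induction rule: frame.induct)
  case (empty d L V)
  have "supp_vecs {} = {\<lambda>_::'a. 0}" by (auto simp: supp_vecs_def)
  then have "real (card F) \<le> 1" if "F \<subseteq> supp_vecs ({} :: 'a set)" for F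
    using card_mono[of "supp_vecs ({} :: 'a set)" F] that by auto
  then show ?case by (auto intro!: exI[of _ 1])
next
  case (insert I d L V m D u)
  let ?L = "\<lambda>k j. if k = m then of_bool (j = m) else if j = m then u k else L k j"
  let ?V = "\<lambda>k j. if k = m then (if j = m then 1 else - (\<Sum>l\<in>I. u l * V l j)) else if j = m then 0 else V k j"
  let ?I = "insert m I"
  let ?\<phi> = "\<lambda>(x, t). x(m := t)"
  note bij = bij_betw_supp_vecs_insert[OF insert.hyps(2)]
  obtain C1 where C1: "C1 \<ge> 0" "\<And>s F. finite F \<Longrightarrow> (\<Sum>n\<in>F. exp (- \<bar>real_of_int n + s\<bar>)) \<le> C1"
    using sum_exp_shift_bound by blast
  from insert.IH obtain C2 where C2: "C2 \<ge> 0"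
    "\<And>s F. finite F \<Longrightarrow> F \<subseteq> supp_vecs I \<Longrightarrow> (\<Sum>x\<in>F. \<Prod>k\<in>I. exp (- \<bar>lin_form I L k x + s k\<bar>)) \<le> C2"
    by blast
  from insert.IH obtain C3 where C3: "C3 \<ge> 0"
    "\<And>s F. finite F \<Longrightarrow> F \<subseteq> supp_vecs I \<Longrightarrow> (\<Sum>x\<in>F. \<Prod>k\<in>I. exp (- \<bar>lin_form I V k x + s k\<bar>)) \<le> C3"
    by blast
  have "(\<Sum>x\<in>F. \<Prod>k\<in>?I. exp (- \<bar>lin_form ?I ?L k x + s k\<bar>)) \<le> C1 * C2"
    if F: "finite F" "F \<subseteq> supp_vecs ?I" for s F
  proof -
    obtain F1 F2 where F12: "finite F1" "finite F2" "F1 \<subseteq> supp_vecs I"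
      and le: "(\<Sum>x\<in>F. \<Prod>k\<in>?I. exp (- \<bar>lin_form ?I ?L k x + s k\<bar>)) \<le>
          (\<Sum>x\<in>F1. \<Sum>t\<in>F2. \<Prod>k\<in>?I. exp (- \<bar>lin_form ?I ?L k (?\<phi> (x, t)) + s k\<bar>))"
      using sum_le_sum_product[OF bij F, of "\<lambda>x. \<Prod>k\<in>?I. exp (- \<bar>lin_form ?I ?L k x + s k\<bar>)"] by (auto simp: prod_nonneg)
    have "(\<Sum>x\<in>F1. \<Sum>t\<in>F2. \<Prod>k\<in>?I. exp (- \<bar>lin_form ?I ?L k (?\<phi> (x, t)) + s k\<bar>)) =
      (\<Sum>x\<in>F1. \<Sum>t\<in>F2. exp (- \<bar>real_of_int t + s m\<bar>) * (\<Prod>k\<in>I. exp (- \<bar>lin_form I L k x + (s k + u k * of_int t)\<bar>)))"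
    proof (intro sum.cong refl)
      fix x t assume x: "x \<in> F1"
      then have x: "x \<in> supp_vecs I" using F12 by auto
      show "(\<Prod>k\<in>?I. exp (- \<bar>lin_form ?I ?L k (?\<phi> (x, t)) + s k\<bar>)) =
        exp (- \<bar>real_of_int t + s m\<bar>) * (\<Prod>k\<in>I. exp (- \<bar>lin_form I L k x + (s k + u k * of_int t)\<bar>))"
        using insert.hyps lin_form_insert(1,2)[OF insert.hyps(2,3) x, where u = u and L = L]
        by (simp add: add_ac cong: prod.cong)
    qed
    also have "\<dots> = (\<Sum>t\<in>F2. exp (- \<bar>real_of_int t + s m\<bar>) * (\<Sum>x\<in>F1. \<Prod>k\<in>I. exp (- \<bar>lin_form I L k x + (s k + u k * of_int t)\<bar>)))"
      by (subst sum.swap) (simp add: sum_distrib_left)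
    also have "\<dots> \<le> (\<Sum>t\<in>F2. exp (- \<bar>real_of_int t + s m\<bar>) * C2)"
      by (intro sum_mono mult_left_mono C2 F12) auto
    also have "\<dots> = (\<Sum>t\<in>F2. exp (- \<bar>real_of_int t + s m\<bar>)) * C2" by (simp add: sum_distrib_right)
    also have "\<dots> \<le> C1 * C2" by (intro mult_right_mono C1 C2 F12)
    finally show ?thesis using le by linarith
  qed
  moreover have "(\<Sum>x\<in>F. \<Prod>k\<in>?I. exp (- \<bar>lin_form ?I ?V k x + s k\<bar>)) \<le> C3 * C1"
    if F: "finite F" "F \<subseteq> supp_vecs ?I" for s F
  proof -
    obtain F1 F2 where F12: "finite F1" "finite F2" "F1 \<subseteq> supp_vecs I"
      and le: "(\<Sum>x\<in>F. \<Prod>k\<in>?I. exp (- \<bar>lin_form ?I ?V k x + s k\<bar>)) \<le>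
          (\<Sum>x\<in>F1. \<Sum>t\<in>F2. \<Prod>k\<in>?I. exp (- \<bar>lin_form ?I ?V k (?\<phi> (x, t)) + s k\<bar>))"
      using sum_le_sum_product[OF bij F, of "\<lambda>x. \<Prod>k\<in>?I. exp (- \<bar>lin_form ?I ?V k x + s k\<bar>)"] by (auto simp: prod_nonneg)
    have "(\<Sum>x\<in>F1. \<Sum>t\<in>F2. \<Prod>k\<in>?I. exp (- \<bar>lin_form ?I ?V k (?\<phi> (x, t)) + s k\<bar>)) =
      (\<Sum>x\<in>F1. (\<Prod>k\<in>I. exp (- \<bar>lin_form I V k x + s k\<bar>)) * (\<Sum>t\<in>F2. exp (- \<bar>real_of_int t + (s m - (\<Sum>l\<in>I. u l * lin_form I V l x))\<bar>)))"
      unfolding sum_distrib_left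
    proof (intro sum.cong refl)
      fix x t assume x: "x \<in> F1"
      then have x: "x \<in> supp_vecs I" using F12 by auto
      show "(\<Prod>k\<in>?I. exp (- \<bar>lin_form ?I ?V k (?\<phi> (x, t)) + s k\<bar>)) =
        (\<Prod>k\<in>I. exp (- \<bar>lin_form I V k x + s k\<bar>)) * exp (- \<bar>real_of_int t + (s m - (\<Sum>l\<in>I. u l * lin_form I V l x))\<bar>)"
        using insert.hyps lin_form_insert(3,4)[OF insert.hyps(2,3) x, where u = u and V = V]
        by (simp add: mult.commute diff_add_eq add_diff_eq cong: prod.cong)
    qed
    also have "\<dots> \<le> (\<Sum>x\<in>F1. (\<Prod>k\<in>I. exp (- \<bar>lin_form I V k x + s k\<bar>)) * C1)"
      by (intro sum_mono mult_left_mono C1 F12 prod_nonneg) auto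
    also have "\<dots> = (\<Sum>x\<in>F1. \<Prod>k\<in>I. exp (- \<bar>lin_form I V k x + s k\<bar>)) * C1" by (simp add: sum_distrib_right)
    also have "\<dots> \<le> C3 * C1" by (intro mult_right_mono C1 C3 F12)
    finally show ?thesis using le by linarith
  qed
  ultimately show ?case using C1(1) C2(1) C3(1) by (meson mult_nonneg_nonneg)
qed

definition frame_term :: "'m set \<Rightarrow> ('m \<Rightarrow> real) \<Rightarrow> ('m \<Rightarrow> 'm \<Rightarrow> real) \<Rightarrow> complex \<Rightarrow> ('m \<Rightarrow> complex) \<Rightarrow> ('m \<Rightarrow> int) \<Rightarrow> complex" where
  "frame_term I d L a w x = (\<Prod>k\<in>I. exp (- of_real pi * (a * of_real (d k)) * (of_real (lin_form I L k x) + w k)\<^sup>2))"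

definition frame_dual_term :: "'m set \<Rightarrow> ('m \<Rightarrow> real) \<Rightarrow> ('m \<Rightarrow> 'm \<Rightarrow> real) \<Rightarrow> complex \<Rightarrow> ('m \<Rightarrow> complex) \<Rightarrow> ('m \<Rightarrow> int) \<Rightarrow> complex" where
  "frame_dual_term I d V a w y = (\<Prod>k\<in>I. exp (- of_real pi * (of_real (lin_form I V k y))\<^sup>2 / (a * of_real (d k))
      + 2 * of_real pi * \<i> * of_real (lin_form I V k y) * w k))"

lemma summable_prod_exp_bound:
  assumes B: "\<exists>C\<ge>0. \<forall>s F. finite F \<longrightarrow> F \<subseteq> A \<longrightarrow> (\<Sum>x\<in>F. \<Prod>k\<in>I. exp (- \<bar>l k x + s k\<bar>)) \<le> C"
    and le: "\<And>k x. k \<in> I \<Longrightarrow> norm (f k x) \<le> K k * exp (- \<bar>l k x\<bar>)"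
  shows "(\<lambda>x. norm (\<Prod>k\<in>I. f k x :: complex)) summable_on A"
proof -
  obtain C where C: "\<And>s F. finite F \<Longrightarrow> F \<subseteq> A \<Longrightarrow> (\<Sum>x\<in>F. \<Prod>k\<in>I. exp (- \<bar>l k x + s k\<bar>)) \<le> C"
    using B by blast
  have "(\<lambda>x. \<Prod>k\<in>I. exp (- \<bar>l k x + 0\<bar>)) summable_on A"
    by (rule nonneg_bounded_partial_sums_imp_summable_on[of _ _ C])
       (use C[of _ "\<lambda>_. 0"] in \<open>auto intro!: prod_nonneg eventually_finite_subsets_at_top_weakI\<close>)
  then have "(\<lambda>x. (\<Prod>k\<in>I. K k) * (\<Prod>k\<in>I. exp (- \<bar>l k x\<bar>))) summable_on A"
    by (intro summable_on_cmult_right) simp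
  then show ?thesis
  proof (rule summable_on_comparison_test)
    show "norm (\<Prod>k\<in>I. f k x) \<le> (\<Prod>k\<in>I. K k) * (\<Prod>k\<in>I. exp (- \<bar>l k x\<bar>))" for x
      unfolding prod_norm[symmetric] prod.distrib[symmetric] by (rule prod_mono) (use le in auto)
  qed auto
qed

lemma frame_term_summable:
  assumes fr: "frame I d L V" and a: "Re a > 0"
  shows "(\<lambda>x. norm (frame_term I d L a w x)) summable_on supp_vecs I"
    and "(\<lambda>y. norm (frame_dual_term I d V a w y)) summable_on supp_vecs I"
proof -
  have pos: "Re (a * of_real (d k)) > 0" if "k \<in> I" for k
    using frame_pos[OF fr that] a by simp
  let ?p = "\<lambda>k. of_real pi * (a * of_real (d k))"
  let ?q = "\<lambda>k. 2 * of_real pi * (a * of_real (d k)) * w k"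
  let ?r = "\<lambda>k. of_real pi * (a * of_real (d k)) * (w k)\<^sup>2"
  show "(\<lambda>x. norm (frame_term I d L a w x)) summable_on supp_vecs I"
    unfolding frame_term_def
  proof (rule summable_prod_exp_bound[OF conjunct1[OF frame_sum_bound[OF fr]]])
    fix k x assume k: "k \<in> I"
    have "- of_real pi * (a * of_real (d k)) * (of_real t + w k)\<^sup>2 = - (?p k * of_real t ^ 2 + ?q k * of_real t + ?r k)" for t :: real
      by (simp add: power2_eq_square algebra_simps)
    then show "norm (exp (- of_real pi * (a * of_real (d k)) * (of_real (lin_form I L k x) + w k)\<^sup>2)) \<le>
      exp ((norm (?q k) + 1)\<^sup>2 / (4 * Re (?p k)) + norm (?r k)) * exp (- \<bar>lin_form I L k x\<bar>)"
      using norm_exp_quadratic_le[where \<rho> = "Re (?p k)" and p = "?p k" and q = "?q k" and r = "?r k" and x = "lin_form I L k x",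
          OF _ order.refl order.refl order.refl] pos[OF k] by (simp only:) (simp add: mult_pos_pos)
  qed
  let ?p = "\<lambda>k. of_real pi / (a * of_real (d k))"
  let ?q = "\<lambda>k. - 2 * of_real pi * \<i> * w k"
  show "(\<lambda>y. norm (frame_dual_term I d V a w y)) summable_on supp_vecs I"
    unfolding frame_dual_term_def
  proof (rule summable_prod_exp_bound[OF conjunct2[OF frame_sum_bound[OF fr]]])
    fix k x assume k: "k \<in> I"
    have "- of_real pi * (of_real t)\<^sup>2 / (a * of_real (d k)) + 2 * of_real pi * \<i> * of_real t * w k
       = - (?p k * of_real t ^ 2 + ?q k * of_real t + 0)" for t :: real
      by (simp add: power2_eq_square algebra_simps)
    then show "norm (exp (- of_real pi * (of_real (lin_form I V k x))\<^sup>2 / (a * of_real (d k))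
      + 2 * of_real pi * \<i> * of_real (lin_form I V k x) * w k)) \<le>
      exp ((norm (?q k) + 1)\<^sup>2 / (4 * Re (?p k)) + norm (0::complex)) * exp (- \<bar>lin_form I V k x\<bar>)"
      using norm_exp_quadratic_le[where \<rho> = "Re (?p k)" and p = "?p k" and q = "?q k" and r = 0 and x = "lin_form I V k x",
          OF Re_pi_divide_pos[OF pos[OF k]] order.refl order.refl order.refl] by (simp only:)
  qed
qed

text \<open>Induction on the coordinates. With the new variable \<open>t\<close> fixed, the inner
  sum is dualised by the induction hypothesis with shifted \<open>w\<close>. On the dual side that
  shift is a character in \<open>t\<close>, so the outer sum is a one-dimensional theta series with
  character and can be dualised in turn.\<close>

theorem frame_poisson:
  assumes "frame I d L V" and a: "Re a > 0"
  shows "(\<Prod>k\<in>I. csqrt (a * of_real (d k))) * (\<Sum>\<^sub>\<infinity>x\<in>supp_vecs I. frame_term I d L a w x) =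
         (\<Sum>\<^sub>\<infinity>y\<in>supp_vecs I. frame_dual_term I d V a w y)"
  using assms(1)
proof (induction arbitrary: w rule: frame.induct)
  case (empty d L V)
  have "supp_vecs {} = {\<lambda>_::'a. 0}" by (auto simp: supp_vecs_def)
  then show ?case by (simp add: frame_term_def frame_dual_term_def)
next
  case (insert I d L V m D u)
  let ?L = "\<lambda>k j. if k = m then of_bool (j = m) else if j = m then u k else L k j"
  let ?V = "\<lambda>k j. if k = m then (if j = m then 1 else - (\<Sum>l\<in>I. u l * V l j)) else if j = m then 0 else V k j"
  let ?d = "d(m := D)"
  let ?I = "insert m I"
  let ?\<phi> = "\<lambda>(x, t). x(m := t)"
  let ?T = "supp_vecs I"
  have fr': "frame ?I ?d ?L ?V" by (rule frame.insert) (use insert.hyps in auto)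
  have aD: "Re (a * of_real D) > 0" using a insert.hyps by simp
  define P where "P = (\<Prod>k\<in>I. csqrt (a * of_real (d k)))"
  define c where "c y = (\<Sum>l\<in>I. u l * lin_form I V l y)" for y
  define E where "E t = exp (- of_real pi * (a * of_real D) * (of_int t + w m)\<^sup>2)" for t :: int
  define X where "X y t = exp (2 * of_real pi * \<i> * of_real (c y) * of_int t)" for y and t :: int
  have ne: "k \<noteq> m" if "k \<in> I" for k using insert.hyps that by auto
  note bij = bij_betw_supp_vecs_insert[OF insert.hyps(2)]
  have trm: "frame_term ?I ?d ?L a w (?\<phi> (x, t)) = E t * frame_term I d L a (\<lambda>k. w k + of_real (u k) * of_int t) x"
    if "x \<in> ?T" for x t
    unfolding frame_term_def E_def using insert.hyps ne
      lin_form_insert(1,2)[OF insert.hyps(2,3) that, where u = u and L = L]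
    by (simp add: add_ac cong: prod.cong)
  have dual_shift: "frame_dual_term I d V a (\<lambda>k. w k + of_real (u k) * of_int t) y = frame_dual_term I d V a w y * X y t" for y t
  proof -
    have "X y t = (\<Prod>k\<in>I. exp (2 * of_real pi * \<i> * of_real (lin_form I V k y) * (of_real (u k) * of_int t)))"
      unfolding X_def c_def exp_sum[OF insert.hyps(3), symmetric]
      by (simp add: sum_distrib_left sum_distrib_right mult_ac)
    then show ?thesis
      unfolding frame_dual_term_def by (simp only: prod.distrib[symmetric] exp_add[symmetric] distrib_left add.assoc)
  qed
  have dual: "frame_dual_term ?I ?d ?V a w (?\<phi> (y, s)) = frame_dual_term I d V a w y *
      exp (- of_real pi * (of_real (of_int s - c y))\<^sup>2 / (a * of_real D) + 2 * of_real pi * \<i> * of_real (of_int s - c y) * w m)"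
    if "y \<in> ?T" for y s
    unfolding frame_dual_term_def c_def using insert.hyps ne
      lin_form_insert(3,4)[OF insert.hyps(2,3) that, where u = u and V = V]
    by (simp add: mult.commute cong: prod.cong)
  have "(\<lambda>x. norm (frame_term ?I ?d ?L a w x)) summable_on supp_vecs ?I"
    by (rule frame_term_summable(1)[OF fr' a])
  then have "frame_term ?I ?d ?L a w summable_on supp_vecs ?I" by (rule abs_summable_summable)
  then have "(\<lambda>z. frame_term ?I ?d ?L a w (?\<phi> z)) summable_on (?T \<times> UNIV)"
    using summable_on_reindex_bij_betw[OF bij] by blast
  then have sm1: "(\<lambda>(x, t). E t * frame_term I d L a (\<lambda>k. w k + of_real (u k) * of_int t) x) summable_on (?T \<times> UNIV)"
    by (rule summable_on_cong[THEN iffD1, rotated]) (auto simp: trm[unfolded prod.case] simp del: fun_upd_apply)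
  have "(\<lambda>x. norm (frame_dual_term ?I ?d ?V a w x)) summable_on supp_vecs ?I"
    by (rule frame_term_summable(2)[OF fr' a])
  then have "frame_dual_term ?I ?d ?V a w summable_on supp_vecs ?I" by (rule abs_summable_summable)
  then have sm3: "(\<lambda>z. frame_dual_term ?I ?d ?V a w (?\<phi> z)) summable_on (?T \<times> UNIV)"
    using summable_on_reindex_bij_betw[OF bij] by blast
  have Eabs: "(\<lambda>t. norm (E t)) summable_on UNIV"
    unfolding E_def by (rule abs_summable_gauss[OF aD])
  have normX: "norm (X y t) = 1" for y t by (simp add: X_def)
  \<comment> \<open>Absolute convergence of the mixed sum, already dual in the old variables but not
    in \<open>t\<close>, permits the second exchange of summations; the character \<open>X\<close>
    has modulus 1.\<close>
  have sm2: "(\<lambda>(y, t). frame_dual_term I d V a w y * (E t * X y t)) summable_on (?T \<times> UNIV)"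
  proof (rule abs_summable_summable)
    have "(\<lambda>(y, t). norm (frame_dual_term I d V a w y) * norm (E t)) summable_on (?T \<times> UNIV)"
    proof (rule summable_on_SigmaI[where g = "\<lambda>y. norm (frame_dual_term I d V a w y) * (\<Sum>\<^sub>\<infinity>t. norm (E t))"])
      show "(\<lambda>y. norm (frame_dual_term I d V a w y) * (\<Sum>\<^sub>\<infinity>t. norm (E t))) summable_on ?T"
        by (intro summable_on_cmult_left frame_term_summable(2)[OF insert.hyps(1) a])
      show "((\<lambda>t. case (y, t) of (y, t) \<Rightarrow> norm (frame_dual_term I d V a w y) * norm (E t)) has_sum
          norm (frame_dual_term I d V a w y) * (\<Sum>\<^sub>\<infinity>t. norm (E t))) UNIV" for y
        by (simp add: has_sum_cmult_right has_sum_infsum[OF Eabs])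
    qed auto
    then show "(\<lambda>z. norm (case z of (y, t) \<Rightarrow> frame_dual_term I d V a w y * (E t * X y t))) summable_on (?T \<times> UNIV)"
      by (rule summable_on_cong[THEN iffD1, rotated]) (auto simp: norm_mult normX)
  qed
  have "(\<Prod>k\<in>?I. csqrt (a * of_real (?d k))) = csqrt (a * of_real D) * P"
    unfolding P_def using insert.hyps ne by (simp cong: prod.cong)
  moreover have "(\<Sum>\<^sub>\<infinity>x\<in>supp_vecs ?I. frame_term ?I ?d ?L a w x) =
      (\<Sum>\<^sub>\<infinity>z\<in>?T \<times> UNIV. frame_term ?I ?d ?L a w (?\<phi> z))"
    by (rule infsum_reindex_bij_betw[OF bij, symmetric])
  moreover have "\<dots> = (\<Sum>\<^sub>\<infinity>(x, t)\<in>?T \<times> UNIV. E t * frame_term I d L a (\<lambda>k. w k + of_real (u k) * of_int t) x)"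
    by (rule infsum_cong) (auto simp: trm[unfolded prod.case] simp del: fun_upd_apply)
  moreover have "\<dots> = (\<Sum>\<^sub>\<infinity>x\<in>?T. \<Sum>\<^sub>\<infinity>t. E t * frame_term I d L a (\<lambda>k. w k + of_real (u k) * of_int t) x)"
    by (rule infsum_Sigma'_banach[symmetric]) (rule sm1)
  moreover have "\<dots> = (\<Sum>\<^sub>\<infinity>t. \<Sum>\<^sub>\<infinity>x\<in>?T. E t * frame_term I d L a (\<lambda>k. w k + of_real (u k) * of_int t) x)"
    by (rule infsum_swap_banach) (rule sm1)
  ultimately have 1: "(\<Prod>k\<in>?I. csqrt (a * of_real (?d k))) * (\<Sum>\<^sub>\<infinity>x\<in>supp_vecs ?I. frame_term ?I ?d ?L a w x) =
      csqrt (a * of_real D) * (P * (\<Sum>\<^sub>\<infinity>t. E t * (\<Sum>\<^sub>\<infinity>x\<in>?T. frame_term I d L a (\<lambda>k. w k + of_real (u k) * of_int t) x)))"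
    by (simp only: infsum_cmult_right' mult.assoc)
  have "P * (\<Sum>\<^sub>\<infinity>t. E t * (\<Sum>\<^sub>\<infinity>x\<in>?T. frame_term I d L a (\<lambda>k. w k + of_real (u k) * of_int t) x)) =
     (\<Sum>\<^sub>\<infinity>t. E t * (P * (\<Sum>\<^sub>\<infinity>x\<in>?T. frame_term I d L a (\<lambda>k. w k + of_real (u k) * of_int t) x)))"
    by (simp only: infsum_cmult_right'[symmetric] mult.left_commute)
  also have "\<dots> = (\<Sum>\<^sub>\<infinity>t. E t * (\<Sum>\<^sub>\<infinity>y\<in>?T. frame_dual_term I d V a w y * X y t))"
    unfolding P_def insert.IH dual_shift ..
  also have "\<dots> = (\<Sum>\<^sub>\<infinity>t. \<Sum>\<^sub>\<infinity>y\<in>?T. frame_dual_term I d V a w y * (E t * X y t))"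
    by (simp only: infsum_cmult_right'[symmetric] mult.left_commute)
  also have "\<dots> = (\<Sum>\<^sub>\<infinity>y\<in>?T. \<Sum>\<^sub>\<infinity>t. frame_dual_term I d V a w y * (E t * X y t))"
    by (rule infsum_swap_banach[symmetric]) (rule sm2)
  also have "\<dots> = (\<Sum>\<^sub>\<infinity>y\<in>?T. frame_dual_term I d V a w y * (\<Sum>\<^sub>\<infinity>t. E t * X y t))"
    by (simp only: infsum_cmult_right')
  finally have 2: "csqrt (a * of_real D) * (P * (\<Sum>\<^sub>\<infinity>t. E t * (\<Sum>\<^sub>\<infinity>x\<in>?T. frame_term I d L a (\<lambda>k. w k + of_real (u k) * of_int t) x))) =
     (\<Sum>\<^sub>\<infinity>y\<in>?T. frame_dual_term I d V a w y * (csqrt (a * of_real D) * (\<Sum>\<^sub>\<infinity>t. E t * X y t)))"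
    by (simp only: infsum_cmult_right'[symmetric] mult.left_commute)
  have 3: "csqrt (a * of_real D) * (\<Sum>\<^sub>\<infinity>t. E t * X y t) =
      (\<Sum>\<^sub>\<infinity>s::int. exp (- of_real pi * (of_real (of_int s - c y))\<^sup>2 / (a * of_real D) + 2 * of_real pi * \<i> * of_real (of_int s - c y) * w m))" for y
    using gauss_sum_character[OF aD, of "w m" "c y"] unfolding E_def X_def by (simp only: exp_add)
  have "(\<Sum>\<^sub>\<infinity>y\<in>?T. frame_dual_term I d V a w y * (csqrt (a * of_real D) * (\<Sum>\<^sub>\<infinity>t. E t * X y t))) =
     (\<Sum>\<^sub>\<infinity>y\<in>?T. \<Sum>\<^sub>\<infinity>s. frame_dual_term ?I ?d ?V a w (?\<phi> (y, s)))"
    by (rule infsum_cong, subst 3) (simp only: dual infsum_cmult_right')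
  also have "\<dots> = (\<Sum>\<^sub>\<infinity>z\<in>?T \<times> UNIV. frame_dual_term ?I ?d ?V a w (?\<phi> z))"
    by (rule infsum_Sigma_banach) (rule sm3)
  also have "\<dots> = (\<Sum>\<^sub>\<infinity>y\<in>supp_vecs ?I. frame_dual_term ?I ?d ?V a w y)"
    by (rule infsum_reindex_bij_betw[OF bij])
  finally show ?case unfolding 1 2 .
qed

lemma frame_inverse:
  assumes "frame I d L V"
  shows "\<forall>i\<in>I. \<forall>j\<in>I. (\<Sum>k\<in>I. L k i * V k j) = of_bool (i = j)"
    and "\<forall>k\<in>I. \<forall>l\<in>I. (\<Sum>i\<in>I. L k i * V l i) = of_bool (k = l)"
  using assms
proof (induction rule: frame.induct)
  case (insert I d L V m D u)
  have ne: "k \<noteq> m" if "k \<in> I" for k using insert.hyps that by auto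
  let ?L = "\<lambda>k j. if k = m then of_bool (j = m) else if j = m then u k else L k j"
  let ?V = "\<lambda>k j. if k = m then (if j = m then 1 else - (\<Sum>l\<in>I. u l * V l j)) else if j = m then 0 else V k j"
  {
    case 1
    have *: "(\<Sum>k\<in>I. L k i * V k j) = of_bool (i = j)" if "i \<in> I" "j \<in> I" for i j
      using insert.IH(1) that by blast
    show ?case
    proof (intro ballI)
      fix i j assume ij: "i \<in> insert m I" "j \<in> insert m I"
      consider "i = m" "j = m" | "i = m" "j \<in> I" | "i \<in> I" "j = m" | "i \<in> I" "j \<in> I" using ij by auto
      then show "(\<Sum>k\<in>insert m I. ?L k i * ?V k j) = of_bool (i = j)"
      proof cases
        case 1 then show ?thesis using insert.hyps ne by (simp add: sum.neutral)
      next
        case 2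
        then show ?thesis using insert.hyps ne by (auto cong: sum.cong)
      next
        case 3 then show ?thesis using insert.hyps ne by (simp add: sum.neutral)
      next
        case 4 then show ?thesis using insert.hyps ne * by (simp cong: sum.cong)
      qed
    qed
  next
    case 2
    have *: "(\<Sum>i\<in>I. L k i * V l i) = of_bool (k = l)" if "k \<in> I" "l \<in> I" for k l
      using insert.IH(2) that by blast
    show ?case
    proof (intro ballI)
      fix k l assume kl: "k \<in> insert m I" "l \<in> insert m I"
      consider "k = m" "l = m" | "k = m" "l \<in> I" | "k \<in> I" "l = m" | "k \<in> I" "l \<in> I" using kl by auto
      then show "(\<Sum>i\<in>insert m I. ?L k i * ?V l i) = of_bool (k = l)"
      proof cases
        case 1 then show ?thesis using insert.hyps ne by (simp add: sum.neutral)
      next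
        case 2 then show ?thesis using insert.hyps ne by (auto cong: sum.cong)
      next
        case 3
        have "(\<Sum>i\<in>I. L k i * - (\<Sum>l\<in>I. u l * V l i)) = - (\<Sum>l\<in>I. u l * (\<Sum>i\<in>I. L k i * V l i))"
          unfolding sum_distrib_left sum_negf[symmetric] mult_minus_right
          by (subst sum.swap) (simp add: mult_ac)
        also have "(\<Sum>l\<in>I. u l * (\<Sum>i\<in>I. L k i * V l i)) = (\<Sum>l\<in>I. u l * of_bool (k = l))"
          using 3 * by (intro sum.cong) auto
        also have "\<dots> = u k" using 3 insert.hyps by (simp add: of_bool_def sum.delta' if_distrib cong: if_cong)
        finally show ?thesis using 3 insert.hyps ne by (simp cong: sum.cong)
      next
        case 4 then show ?thesis using insert.hyps ne * by (simp cong: sum.cong)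
      qed
    qed
  }
qed auto

text \<open>Completing the square one variable at a time, that is, a triangular decomposition of the
  Gram matrix. The new pivot \<open>D\<close> is positive because it is a value of the form.\<close>

lemma frame_exists:
  fixes s :: "'m \<Rightarrow> 'm \<Rightarrow> real"
  assumes "finite I" "\<And>i j. i \<in> I \<Longrightarrow> j \<in> I \<Longrightarrow> s i j = s j i"
    and "\<And>x. (\<exists>i\<in>I. x i \<noteq> 0) \<Longrightarrow> (\<Sum>i\<in>I. \<Sum>j\<in>I. x i * s i j * x j) > 0"
  shows "\<exists>d L V. frame I d L V \<and> (\<forall>i\<in>I. \<forall>j\<in>I. s i j = (\<Sum>k\<in>I. d k * L k i * L k j))"
  using assms
proof (induction I rule: finite_induct)
  case empty
  then show ?case using frame.empty by fastforce
next
  case (insert m I)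
  have ne: "k \<noteq> m" if "k \<in> I" for k using insert.hyps that by auto
  have pos: "(\<Sum>i\<in>I. \<Sum>j\<in>I. x i * s i j * x j) > 0" if x: "\<exists>i\<in>I. x i \<noteq> 0" for x
  proof -
    have "(\<Sum>i\<in>insert m I. \<Sum>j\<in>insert m I. (x(m := 0)) i * s i j * (x(m := 0)) j) > 0"
      by (rule insert.prems(2)) (use x ne in auto)
    then show ?thesis using insert.hyps ne by (simp cong: sum.cong)
  qed
  obtain d L V where fr: "frame I d L V" and s: "\<And>i j. i \<in> I \<Longrightarrow> j \<in> I \<Longrightarrow> s i j = (\<Sum>k\<in>I. d k * L k i * L k j)"
    using insert.IH[OF insert.prems(1) pos] by auto
  note inv = frame_inverse[OF fr, rule_format]
  \<comment> \<open>The mixed entries of the new column, transported by the inverse transpose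
    \<open>V\<close> and divided by the pivots: the solution of the triangular system verified
    below.\<close>
  define u where "u k = (\<Sum>i\<in>I. V k i * s i m) / d k" for k
  have dpos: "d k > 0" if "k \<in> I" for k using frame_pos[OF fr that] .
  have u: "(\<Sum>k\<in>I. d k * L k i * u k) = s i m" if i: "i \<in> I" for i
  proof -
    have "(\<Sum>k\<in>I. d k * L k i * u k) = (\<Sum>k\<in>I. \<Sum>j\<in>I. L k i * V k j * s j m)"
      unfolding u_def
    proof (intro sum.cong refl)
      fix k assume "k \<in> I"
      then have "d k \<noteq> 0" using dpos[of k] by simp
      then have "d k * L k i * ((\<Sum>i\<in>I. V k i * s i m) / d k) = L k i * (\<Sum>i\<in>I. V k i * s i m)"
        by simp
      then show "d k * L k i * ((\<Sum>i\<in>I. V k i * s i m) / d k) = (\<Sum>j\<in>I. L k i * V k j * s j m)"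
        by (simp only: sum_distrib_left mult.assoc)
    qed
    also have "\<dots> = (\<Sum>j\<in>I. (\<Sum>k\<in>I. L k i * V k j) * s j m)"
      by (subst sum.swap) (simp add: sum_distrib_right)
    also have "\<dots> = (\<Sum>j\<in>I. of_bool (i = j) * s j m)" using i inv(1) by (intro sum.cong) auto
    also have "\<dots> = s i m" using i insert.hyps by (simp add: of_bool_def if_distrib[of "\<lambda>x. x * _"] cong: if_cong)
    finally show ?thesis .
  qed
  define D where "D = s m m - (\<Sum>k\<in>I. d k * u k * u k)"
  have "D > 0"
  proof -
    \<comment> \<open>The vector with entry 1 at \<open>m\<close> at which the form is smallest: its
      old part solves \<open>L x = - u\<close>. The value of the form there is the pivot
      \<open>D\<close>.\<close>
    define x where "x i = (if i = m then 1 else - (\<Sum>l\<in>I. V l i * u l))" for i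
    have Lx: "(\<Sum>i\<in>I. L k i * x i) = - u k" if k: "k \<in> I" for k
    proof -
      have "(\<Sum>i\<in>I. L k i * x i) = (\<Sum>i\<in>I. \<Sum>l\<in>I. - (L k i * V l i * u l))"
        by (intro sum.cong refl) (auto simp: x_def ne sum_distrib_left sum_negf mult_ac)
      also have "\<dots> = (\<Sum>l\<in>I. - ((\<Sum>i\<in>I. L k i * V l i) * u l))"
        by (subst sum.swap) (simp add: sum_distrib_right sum_negf)
      also have "\<dots> = (\<Sum>l\<in>I. - (of_bool (k = l) * u l))" using k inv(2) by (intro sum.cong) auto
      also have "\<dots> = - u k" using k insert.hyps by (simp add: of_bool_def if_distrib[of "\<lambda>x. x * _"] sum_negf cong: if_cong)
      finally show ?thesis .
    qed
    have cross: "(\<Sum>i\<in>I. x i * s i m) = - (\<Sum>k\<in>I. d k * u k * u k)"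
    proof -
      have "(\<Sum>i\<in>I. x i * s i m) = (\<Sum>i\<in>I. x i * (\<Sum>k\<in>I. d k * L k i * u k))"
        by (intro sum.cong) (simp_all add: u)
      also have "\<dots> = (\<Sum>k\<in>I. d k * u k * (\<Sum>i\<in>I. L k i * x i))"
        unfolding sum_distrib_left by (subst sum.swap) (simp add: mult_ac)
      also have "\<dots> = (\<Sum>k\<in>I. d k * u k * (- u k))" by (intro sum.cong) (simp_all add: Lx)
      finally show ?thesis by (simp add: sum_negf)
    qed
    have quad: "(\<Sum>i\<in>I. \<Sum>j\<in>I. x i * s i j * x j) = (\<Sum>k\<in>I. d k * u k * u k)"
    proof -
      have "(\<Sum>i\<in>I. \<Sum>j\<in>I. x i * s i j * x j) = (\<Sum>i\<in>I. \<Sum>j\<in>I. \<Sum>k\<in>I. d k * (L k i * x i) * (L k j * x j))"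
        by (intro sum.cong refl) (simp add: s sum_distrib_left sum_distrib_right mult_ac)
      also have "\<dots> = (\<Sum>k\<in>I. \<Sum>i\<in>I. \<Sum>j\<in>I. d k * (L k i * x i) * (L k j * x j))"
        by (subst (2) sum.swap, subst sum.swap) simp
      also have "\<dots> = (\<Sum>k\<in>I. d k * (\<Sum>i\<in>I. L k i * x i) * (\<Sum>j\<in>I. L k j * x j))"
        by (simp add: sum_distrib_left sum_distrib_right mult_ac)
      also have "\<dots> = (\<Sum>k\<in>I. d k * u k * u k)" by (intro sum.cong) (simp_all add: Lx)
      finally show ?thesis .
    qed
    have "0 < (\<Sum>i\<in>insert m I. \<Sum>j\<in>insert m I. x i * s i j * x j)"
      by (rule insert.prems(2)) (auto simp: x_def)
    also have "\<dots> = s m m + (\<Sum>j\<in>I. x j * s m j) + ((\<Sum>i\<in>I. x i * s i m) + (\<Sum>i\<in>I. \<Sum>j\<in>I. x i * s i j * x j))"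
    proof -
      have "x m = 1" by (simp add: x_def)
      then show ?thesis using insert.hyps by (simp add: sum.distrib mult_ac)
    qed
    also have "(\<Sum>j\<in>I. x j * s m j) = (\<Sum>j\<in>I. x j * s j m)"
      by (intro sum.cong) (auto simp: insert.prems(1)[of m])
    finally show ?thesis unfolding cross quad D_def by simp
  qed
  let ?L = "\<lambda>k j. if k = m then of_bool (j = m) else if j = m then u k else L k j"
  let ?V = "\<lambda>k j. if k = m then (if j = m then 1 else - (\<Sum>l\<in>I. u l * V l j)) else if j = m then 0 else V k j"
  have "frame (insert m I) (d(m := D)) ?L ?V"
    by (rule frame.insert) (use fr insert.hyps \<open>D > 0\<close> in auto)
  moreover have "s i j = (\<Sum>k\<in>insert m I. (d(m := D)) k * ?L k i * ?L k j)" if ij: "i \<in> insert m I" "j \<in> insert m I" for i j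
  proof -
    consider "i = m" "j = m" | "i = m" "j \<in> I" | "i \<in> I" "j = m" | "i \<in> I" "j \<in> I" using ij by auto
    then show ?thesis
    proof cases
      case 1 then show ?thesis using insert.hyps ne by (simp add: D_def cong: sum.cong)
    next
      case 2 then show ?thesis using insert.hyps ne insert.prems(1)[of m j] u[of j] by (simp add: mult_ac cong: sum.cong)
    next
      case 3 then show ?thesis using insert.hyps ne u[of i] by (simp cong: sum.cong)
    next
      case 4 then show ?thesis using insert.hyps ne s by (simp cong: sum.cong)
    qed
  qed
  ultimately show ?case by blast
qed

section \<open>Integral bilinear forms and Poisson summation over unimodular lattices\<close>

lemma bilin_of_int:
  "bilin (map_matrix of_int S) (\<chi> i. of_int (x $ i)) (\<chi> i. of_int (y $ i)) = (of_int (bilin S x y) :: 'a::comm_ring_1)"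
  by (simp add: bilin_def map_matrix_def)

lemma bilin_add_left: "bilin S (x + y) z = bilin S x z + bilin S y z"
  by (simp add: bilin_def ring_distribs sum.distrib)

lemma bilin_add_right: "bilin S z (x + y) = bilin S z x + bilin S z y"
  by (simp add: bilin_def ring_distribs sum.distrib)

lemma bilin_scale_left: "bilin S (c *s x) y = c * bilin S x y"
  by (simp add: bilin_def sum_distrib_left mult_ac)

lemma bilin_scale_right: "bilin S x (c *s y) = c * bilin S x y"
  by (simp add: bilin_def sum_distrib_left mult_ac)

lemma bilin_commute:
  assumes "transpose S = S"
  shows "bilin S x y = bilin S y x"
proof -
  have "S $ i $ j = S $ j $ i" for i j using assms by (metis transpose_def vec_lambda_beta)
  then show ?thesis unfolding bilin_def by (subst sum.swap) (simp add: mult_ac)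
qed

lemma bilin_matrix_vector: "bilin S x y = (\<Sum>i\<in>UNIV. x $ i * (S *v y) $ i)"
  by (simp add: bilin_def matrix_vector_mult_def sum_distrib_left mult_ac)

lemma bilin_zero [simp]: "bilin S 0 y = 0" "bilin S x 0 = 0"
  by (simp_all add: bilin_def)

lemma pos_definite_frame:
  fixes A :: "real^'m^'m"
  assumes "pos_definite A"
  obtains d L V where "frame UNIV d L V" "\<And>i j. A $ i $ j = (\<Sum>k\<in>UNIV. d k * L k i * L k j)"
proof -
  have sym: "A $ i $ j = A $ j $ i" for i j
    using assms unfolding pos_definite_def by (metis transpose_def vec_lambda_beta)
  have pos: "(\<Sum>i\<in>UNIV. \<Sum>j\<in>UNIV. x i * A $ i $ j * x j) > 0" if x: "\<exists>i\<in>UNIV. x i \<noteq> 0" for x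
  proof -
    have "(\<chi> i. x i) \<noteq> 0" using x by (auto simp: vec_eq_iff)
    then have "bilin A (\<chi> i. x i) (\<chi> i. x i) > 0" using assms unfolding pos_definite_def by blast
    then show ?thesis by (simp add: bilin_def)
  qed
  show ?thesis using frame_exists[of UNIV "\<lambda>i j. A $ i $ j"] sym pos that by auto
qed

definition of_int_vec :: "int^'m \<Rightarrow> 'a::ring_1^'m" where
  "of_int_vec x = (\<chi> i. of_int (x $ i))"

lemma bilin_of_int_vec:
  "bilin (map_matrix of_int S) (of_int_vec x) (of_int_vec y) = (of_int (bilin S x y) :: 'a::comm_ring_1)"
  unfolding of_int_vec_def by (rule bilin_of_int)

lemma of_int_vec_eq_0_iff: "of_int_vec x = (0 :: 'a::ring_char_0^'m) \<longleftrightarrow> x = 0"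
  by (simp add: of_int_vec_def vec_eq_iff)

text \<open>Surjectivity over the integers takes the place of determinant 1: it serves to reindex
  the dual sum and to construct lattice vectors from their inner products, and it can be verified
  without a determinant for a lattice given as a set of vectors.\<close>

definition unimodular :: "int^'m^'m \<Rightarrow> bool" where
  "unimodular S \<longleftrightarrow> pos_definite (map_matrix real_of_int S) \<and> (\<forall>b. \<exists>x. S *v x = b)"

lemma unimodular_pos:
  assumes "unimodular S" "x \<noteq> 0"
  shows "bilin S x x > 0"
proof -
  have "(of_int_vec x :: real^'a) \<noteq> 0" using assms(2) by (simp add: of_int_vec_eq_0_iff)
  then have "bilin (map_matrix real_of_int S) (of_int_vec x) (of_int_vec x) > 0"
    using assms(1) unfolding unimodular_def pos_definite_def by blast
  then show ?thesis by (simp add: bilin_of_int_vec)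
qed

lemma unimodular_sym:
  assumes "unimodular S"
  shows "transpose S = S"
proof -
  have "transpose (map_matrix real_of_int S) = map_matrix real_of_int S"
    using assms unfolding unimodular_def pos_definite_def by blast
  then show ?thesis by (simp add: transpose_def map_matrix_def vec_eq_iff)
qed

lemma unimodular_bij:
  assumes "unimodular S"
  shows "bij ((*v) S)"
proof (rule bijI)
  show "surj ((*v) S)" using assms unfolding unimodular_def by (metis surjI)
  show "inj ((*v) S)"
  proof (rule injI)
    fix x y assume "S *v x = S *v y"
    then have 0: "S *v (x - y) = 0" by (simp add: matrix_vector_mult_diff_distrib)
    then have "bilin S (x - y) (x - y) = 0" by (simp add: bilin_matrix_vector)
    then show "x = y" using unimodular_pos[OF assms, of "x - y"] by fastforce
  qed
qed

lemma bij_betw_vec_nth_supp_vecs: "bij_betw (\<lambda>x::int^'m. vec_nth x) UNIV (supp_vecs UNIV)"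
  by (rule bij_betw_byWitness[of _ vec_lambda]) (auto simp: supp_vecs_def vec_lambda_beta)

lemma csqrt_mult_of_real:
  assumes "r > 0"
  shows "csqrt (a * of_real r) = csqrt a * of_real (sqrt r)"
  by (rule csqrt_unique)
     (use assms csqrt_principal[of a] in \<open>auto simp: power_mult_distrib of_real_power[symmetric] simp del: of_real_power\<close>)

text \<open>The frame formula yields a dual sum with the inverse form; substituting
  \<open>S *v x\<close> turns it into a sum with \<open>S\<close> itself. The square roots of the
  pivots multiply to 1, which is seen by comparing both sides at parameter 1 and shift 0.\<close>

theorem lattice_poisson:
  fixes S :: "int^'m^'m"
  assumes S: "unimodular S" and a: "Re a > 0"
  defines "q \<equiv> bilin (map_matrix of_int S :: complex^'m^'m)"
  shows "(\<lambda>x. norm (exp (- of_real pi * a * q (of_int_vec x + w) (of_int_vec x + w)))) summable_on UNIV"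
    and "csqrt a ^ CARD('m) * (\<Sum>\<^sub>\<infinity>x. exp (- of_real pi * a * q (of_int_vec x + w) (of_int_vec x + w))) =
         (\<Sum>\<^sub>\<infinity>x. exp (- of_real pi / a * q (of_int_vec x) (of_int_vec x) + 2 * of_real pi * \<i> * q (of_int_vec x) w))"
proof -
  obtain d L V where fr: "frame UNIV d L V"
    and A: "\<And>i j. map_matrix real_of_int S $ i $ j = (\<Sum>k\<in>UNIV. d k * L k i * L k j)"
    using pos_definite_frame S unfolding unimodular_def by blast
  note inv = frame_inverse[OF fr, rule_format, OF UNIV_I UNIV_I]
  have dpos: "d k > 0" for k using frame_pos[OF fr, of k] by simp
  define M where "M z k = (\<Sum>j\<in>UNIV. of_real (L k j) * z $ j)" for z :: "complex^'m" and k
  have M_add: "M (x + y) k = M x k + M y k" for x y k by (simp add: M_def distrib_left sum.distrib)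
  have q: "q x y = (\<Sum>k\<in>UNIV. of_real (d k) * M x k * M y k)" for x y
  proof -
    have "(of_int (S $ i $ j) :: complex) = of_real (\<Sum>k\<in>UNIV. d k * L k i * L k j)" for i j
      unfolding A[symmetric] by (simp add: map_matrix_def)
    then have "q x y = (\<Sum>i\<in>UNIV. \<Sum>j\<in>UNIV. \<Sum>k\<in>UNIV. of_real (d k) * (of_real (L k i) * x $ i) * (of_real (L k j) * y $ j))"
      unfolding q_def bilin_def map_matrix_def by (simp add: sum_distrib_left sum_distrib_right mult_ac)
    also have "\<dots> = (\<Sum>k\<in>UNIV. \<Sum>i\<in>UNIV. \<Sum>j\<in>UNIV. of_real (d k) * (of_real (L k i) * x $ i) * (of_real (L k j) * y $ j))"
      by (subst (2) sum.swap, subst sum.swap) simp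
    also have "\<dots> = (\<Sum>k\<in>UNIV. of_real (d k) * M x k * M y k)"
      unfolding M_def by (simp add: sum_distrib_left sum_distrib_right mult_ac)
    finally show ?thesis .
  qed
  have M_int: "M (of_int_vec x) k = of_real (lin_form UNIV L k (vec_nth x))" for x k
    by (simp add: M_def lin_form_def of_int_vec_def)
  have trm: "exp (- of_real pi * b * q (of_int_vec x + w) (of_int_vec x + w)) = frame_term UNIV d L b (M w) (vec_nth x)" for b w x
    unfolding frame_term_def q exp_sum[OF finite, symmetric]
    by (simp add: sum_distrib_left M_add M_int power2_eq_square mult_ac)
  \<comment> \<open>\<open>V\<close> is the inverse transpose of \<open>L\<close>, and
    \<open>S\<close> is the product of the transpose of \<open>L\<close>, the pivots and
    \<open>L\<close>. Hence in the variable \<open>S *v x\<close> the dual forms become the original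
    ones times the pivots.\<close>
  have VS: "lin_form UNIV V k (vec_nth (S *v x)) = d k * lin_form UNIV L k (vec_nth x)" for k x
  proof -
    have "lin_form UNIV V k (vec_nth (S *v x)) = (\<Sum>j\<in>UNIV. \<Sum>i\<in>UNIV. \<Sum>l\<in>UNIV. (L l j * V k j) * (d l * L l i * of_int (x $ i)))"
    proof -
      have "real_of_int (S $ j $ i) = (\<Sum>l\<in>UNIV. d l * L l j * L l i)" for i j
        using A[of j i] by (simp add: map_matrix_def)
      then show ?thesis
        unfolding lin_form_def matrix_vector_mult_def by (simp add: sum_distrib_left sum_distrib_right mult_ac)
    qed
    also have "\<dots> = (\<Sum>i\<in>UNIV. \<Sum>l\<in>UNIV. (\<Sum>j\<in>UNIV. L l j * V k j) * (d l * L l i * of_int (x $ i)))"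
      unfolding sum_distrib_right by (subst sum.swap, rule sum.cong[OF refl], rule sum.swap)
    also have "\<dots> = d k * lin_form UNIV L k (vec_nth x)"
    proof -
      have "(\<Sum>l\<in>UNIV. of_bool (l = k) * f l) = f k" for f :: "'m \<Rightarrow> real"
        by (simp add: of_bool_def if_distrib[of "\<lambda>x. x * _"] cong: if_cong)
      then show ?thesis unfolding inv(2) lin_form_def by (simp add: sum_distrib_left mult.assoc)
    qed
    finally show ?thesis .
  qed
  have dual: "exp (- of_real pi / b * q (of_int_vec x) (of_int_vec x) + 2 * of_real pi * \<i> * q (of_int_vec x) w) =
      frame_dual_term UNIV d V b (M w) (vec_nth (S *v x))" if "b \<noteq> 0" for b w x
  proof -
    have "of_real (d k) \<noteq> (0::complex)" for k using dpos[of k] by simp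
    then have "- of_real pi * (of_real (d k * lin_form UNIV L k (vec_nth x)))\<^sup>2 / (b * of_real (d k)) =
       - of_real pi / b * (of_real (d k) * M (of_int_vec x) k * M (of_int_vec x) k)" for k
      using that by (simp add: M_int power2_eq_square)
    then show ?thesis
      unfolding frame_dual_term_def VS q exp_sum[OF finite, symmetric]
      by (simp add: sum_distrib_left sum_subtractf sum_negf M_int mult_ac)
  qed
  have s: "(\<lambda>x. norm (exp (- of_real pi * b * q (of_int_vec x + w) (of_int_vec x + w)))) summable_on UNIV" if "Re b > 0" for b w
    unfolding trm using frame_term_summable(1)[OF fr that, of "M w"]
    by (subst summable_on_reindex_bij_betw[OF bij_betw_vec_nth_supp_vecs])
  show "(\<lambda>x. norm (exp (- of_real pi * a * q (of_int_vec x + w) (of_int_vec x + w)))) summable_on UNIV"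
    by (rule s[OF a])
  have main: "(\<Prod>k\<in>UNIV. csqrt (b * of_real (d k))) * (\<Sum>\<^sub>\<infinity>x. exp (- of_real pi * b * q (of_int_vec x + w) (of_int_vec x + w))) =
         (\<Sum>\<^sub>\<infinity>x. exp (- of_real pi / b * q (of_int_vec x) (of_int_vec x) + 2 * of_real pi * \<i> * q (of_int_vec x) w))"
    if b: "Re b > 0" for b w
  proof -
    have b0: "b \<noteq> 0" using b by auto
    have bS: "bij_betw (\<lambda>x. vec_nth (S *v x)) UNIV (supp_vecs UNIV)"
      using bij_betw_trans[OF unimodular_bij[OF S] bij_betw_vec_nth_supp_vecs] by (simp add: o_def)
    show ?thesis
      unfolding trm dual[OF b0] using frame_poisson[OF fr b, of "M w"]
      by (simp only: infsum_reindex_bij_betw[OF bS] infsum_reindex_bij_betw[OF bij_betw_vec_nth_supp_vecs])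
  qed
  have root: "(\<Prod>k\<in>UNIV. csqrt (b * of_real (d k))) = csqrt b ^ CARD('m) * of_real (\<Prod>k\<in>UNIV. sqrt (d k))" for b
    by (simp add: csqrt_mult_of_real[OF dpos] prod.distrib)
  \<comment> \<open>At parameter 1 and shift 0 both sides of \<open>main\<close> contain the same
    positive real sum, which can be cancelled.\<close>
  have "(\<Prod>k\<in>UNIV. sqrt (d k)) = 1"
  proof -
    let ?f = "\<lambda>x. exp (- pi * of_int (bilin S x x))"
    let ?g = "\<lambda>x. exp (- of_real pi * 1 * q (of_int_vec x + 0) (of_int_vec x + 0))"
    have g: "?g x = of_real (?f x)" for x
      unfolding q_def by (simp add: bilin_of_int_vec exp_of_real[symmetric])
    have sf: "?f summable_on UNIV"
      using s[of 1 0] unfolding g by simp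
    have "infsum ?f UNIV > 0"
    proof -
      have "0 < (\<Sum>x\<in>{0}. ?f x)" by simp
      also have "\<dots> \<le> infsum ?f UNIV" by (rule finite_sum_le_infsum[OF sf]) auto
      finally show ?thesis .
    qed
    moreover have "infsum ?g UNIV = of_real (infsum ?f UNIV)"
      unfolding g by (rule infsumI[OF has_sum_of_real[OF has_sum_infsum[OF sf]]])
    ultimately have ne: "infsum ?g UNIV \<noteq> 0" by simp
    have "of_real (\<Prod>k\<in>UNIV. sqrt (d k)) * infsum ?g UNIV = infsum ?g UNIV"
      using main[of 1 0] unfolding root by (simp add: q_def)
    then have "complex_of_real (\<Prod>k\<in>UNIV. sqrt (d k)) = 1" using ne by simp
    then show ?thesis by (simp only: of_real_eq_1_iff)
  qed
  then show "csqrt a ^ CARD('m) * (\<Sum>\<^sub>\<infinity>x. exp (- of_real pi * a * q (of_int_vec x + w) (of_int_vec x + w))) =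
         (\<Sum>\<^sub>\<infinity>x. exp (- of_real pi / a * q (of_int_vec x) (of_int_vec x) + 2 * of_real pi * \<i> * q (of_int_vec x) w))"
    using main[OF a, of w] unfolding root by simp
qed

section \<open>Siegel theta series and partial inversions\<close>

lemma symmetric_entry:
  assumes "transpose A = A"
  shows "A $ i $ j = A $ j $ i"
  using arg_cong[OF assms, of "\<lambda>M. M $ i $ j"] by (simp add: transpose_def)

lemma sum_rotate: "(\<Sum>k\<in>A. \<Sum>i\<in>B. \<Sum>j\<in>C. f k i j) = (\<Sum>i\<in>B. \<Sum>j\<in>C. \<Sum>k\<in>A. f k i j)"
  by (subst sum.swap, rule sum.cong[OF refl], rule sum.swap)

lemma pos_definite_lower_bound:
  fixes A :: "real^'m^'m"
  assumes A: "pos_definite A"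
  obtains \<mu> where "\<mu> > 0" "\<And>x. \<mu> * (\<Sum>i\<in>UNIV. (x $ i)\<^sup>2) \<le> bilin A x x"
proof -
  let ?S = "sphere 0 1 :: (real^'m) set"
  have ne: "?S \<noteq> {}" using vector_choose_size[of 1] by (auto simp: sphere_def dist_norm)
  have "continuous_on ?S (\<lambda>x. bilin A x x)"
    unfolding bilin_def by (intro continuous_intros)
  then obtain z where z: "z \<in> ?S" "\<And>x. x \<in> ?S \<Longrightarrow> bilin A z z \<le> bilin A x x"
    using continuous_attains_inf[of ?S "\<lambda>x. bilin A x x"] ne by auto
  define \<mu> where "\<mu> = bilin A z z"
  have "z \<noteq> 0" using z(1) by auto
  then have pos: "\<mu> > 0" using A unfolding \<mu>_def pos_definite_def by blast
  have "\<mu> * (\<Sum>i\<in>UNIV. (x $ i)\<^sup>2) \<le> bilin A x x" for x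
  proof (cases "x = 0")
    case False
    have n: "(\<Sum>i\<in>UNIV. (x $ i)\<^sup>2) = (norm x)\<^sup>2"
      unfolding power2_norm_eq_inner inner_vec_def by (simp add: power2_eq_square)
    have "\<mu> \<le> bilin A ((1 / norm x) *s x) ((1 / norm x) *s x)"
      unfolding \<mu>_def by (rule z(2)) (use False in \<open>simp add: scalar_mult_eq_scaleR\<close>)
    also have "\<dots> = bilin A x x / (norm x)\<^sup>2"
      by (simp add: bilin_scale_left bilin_scale_right power2_eq_square)
    finally show ?thesis unfolding n using False by (simp add: pos_le_divide_eq)
  qed simp
  then show ?thesis using that pos by blast
qed

definition gram_trace :: "int^'m^'m \<Rightarrow> int^'n^'m \<Rightarrow> complex^'n^'n \<Rightarrow> complex" where
  "gram_trace S X Z = (\<Sum>i\<in>UNIV. \<Sum>j\<in>UNIV. of_int (bilin S (column i X) (column j X)) * Z $ j $ i)"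

definition gram_size :: "int^'m^'m \<Rightarrow> int^'n^'m \<Rightarrow> real" where
  "gram_size S X = (\<Sum>i\<in>UNIV. of_int (bilin S (column i X) (column i X)))"

lemma gram_entry: "(transpose X ** S ** X) $ i $ j = bilin S (column i X) (column j X)"
  unfolding bilin_def matrix_matrix_mult_def transpose_def column_def
  by (simp add: sum_distrib_right) (rule sum.swap)

lemma trace_gram: "trace (map_matrix of_int (transpose X ** S ** X) ** Z) = gram_trace S X Z"
  unfolding trace_def gram_trace_def
  by (subst matrix_matrix_mult_def) (simp add: map_matrix_def gram_entry)

lemma theta_series_gram: "theta_series S Z = (\<Sum>\<^sub>\<infinity>X. exp (of_real pi * \<i> * gram_trace S X Z))"
  unfolding theta_series_def trace_gram ..

lemma gram_trace_add: "gram_trace S X (Z + W) = gram_trace S X Z + gram_trace S X W"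
  by (simp add: gram_trace_def ring_distribs sum.distrib)

text \<open>Diagonalising \<open>S\<close> splits the trace into values of the form with matrix
  \<open>Im Z\<close> at real vectors, one for each diagonal coordinate. The lower bound of that
  form applies to each of them, with a constant independent of \<open>X\<close>.\<close>

lemma Im_gram_trace_ge:
  fixes S :: "int^'m^'m"
  assumes S: "pos_definite (map_matrix real_of_int S)" and Z: "Z \<in> siegel_space"
  obtains \<mu> where "\<mu> > 0" "\<And>X. \<mu> * gram_size S X \<le> Im (gram_trace S X Z)"
proof -
  obtain d L V where fr: "frame UNIV d L V"
    and A: "\<And>i j. map_matrix real_of_int S $ i $ j = (\<Sum>k\<in>UNIV. d k * L k i * L k j)"
    using pos_definite_frame S by blast
  have dpos: "d k > 0" for k using frame_pos[OF fr, of k] by simp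
  define M where "M k x = (\<Sum>j\<in>UNIV. L k j * of_int (x $ j))" for k and x :: "int^'m"
  have b: "of_int (bilin S x y) = (\<Sum>k\<in>UNIV. d k * M k x * M k y)" for x y
  proof -
    have "real_of_int (S $ i $ j) = (\<Sum>k\<in>UNIV. d k * L k i * L k j)" for i j
      using A[of i j] by (simp add: map_matrix_def)
    then have "of_int (bilin S x y) = (\<Sum>i\<in>UNIV. \<Sum>j\<in>UNIV. \<Sum>k\<in>UNIV. d k * (L k i * of_int (x $ i)) * (L k j * of_int (y $ j)))"
      unfolding bilin_def by (simp add: sum_distrib_left sum_distrib_right mult_ac)
    also have "\<dots> = (\<Sum>k\<in>UNIV. \<Sum>i\<in>UNIV. \<Sum>j\<in>UNIV. d k * (L k i * of_int (x $ i)) * (L k j * of_int (y $ j)))"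
      by (subst (2) sum.swap, subst sum.swap) simp
    also have "\<dots> = (\<Sum>k\<in>UNIV. d k * M k x * M k y)"
      unfolding M_def by (simp add: sum_distrib_left sum_distrib_right mult_ac)
    finally show ?thesis .
  qed
  let ?Y = "map_matrix Im Z"
  have Y: "pos_definite ?Y" using Z by (simp add: siegel_space_def)
  have Ysym: "?Y $ i $ j = ?Y $ j $ i" for i j
    using Y unfolding pos_definite_def by (intro symmetric_entry) blast
  obtain \<mu> where l: "\<mu> > 0" "\<And>x. \<mu> * (\<Sum>i\<in>UNIV. (x $ i)\<^sup>2) \<le> bilin ?Y x x"
    using pos_definite_lower_bound[OF Y] by blast
  have "\<mu> * gram_size S X \<le> Im (gram_trace S X Z)" for X
  proof -
    have "\<mu> * gram_size S X = (\<Sum>i\<in>UNIV. \<Sum>k\<in>UNIV. d k * (\<mu> * (M k (column i X))\<^sup>2))"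
      unfolding gram_size_def b by (simp add: sum_distrib_left power2_eq_square mult_ac)
    also have "\<dots> = (\<Sum>k\<in>UNIV. d k * (\<mu> * (\<Sum>i\<in>UNIV. ((\<chi> i. M k (column i X)) $ i)\<^sup>2)))"
      by (subst sum.swap) (simp add: sum_distrib_left)
    also have "\<dots> \<le> (\<Sum>k\<in>UNIV. d k * bilin ?Y (\<chi> i. M k (column i X)) (\<chi> i. M k (column i X)))"
      by (intro sum_mono mult_left_mono l(2)) (simp add: less_imp_le[OF dpos])
    also have "\<dots> = (\<Sum>k\<in>UNIV. \<Sum>i\<in>UNIV. \<Sum>j\<in>UNIV. d k * M k (column i X) * M k (column j X) * ?Y $ i $ j)"
      unfolding bilin_def by (simp add: sum_distrib_left mult_ac)
    also have "\<dots> = (\<Sum>i\<in>UNIV. \<Sum>j\<in>UNIV. of_int (bilin S (column i X) (column j X)) * ?Y $ i $ j)"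
      unfolding b sum_distrib_right by (rule sum_rotate)
    also have "\<dots> = Im (gram_trace S X Z)"
      unfolding gram_trace_def by (subst Ysym) (simp add: map_matrix_def)
    finally show ?thesis .
  qed
  then show ?thesis using that l(1) by blast
qed

lemma norm_exp_gram_trace: "norm (exp (of_real pi * \<i> * gram_trace S X Z)) = exp (- pi * Im (gram_trace S X Z))"
  by simp

lemma bilin_map_mat_1:
  assumes "f 0 = 0" "f 1 = (1 :: 'b::comm_ring_1)"
  shows "bilin (map_matrix f (mat 1 :: int^'k^'k)) x x = (\<Sum>i\<in>UNIV. (x $ i)\<^sup>2)"
proof -
  have "x $ i * f (if i = j then 1 else 0) * x $ j = (if j = i then x $ i * x $ j else 0)" for i j
    using assms by simp
  then show ?thesis unfolding bilin_def map_matrix_def mat_def by (simp add: power2_eq_square)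
qed

lemma pos_definite_mat_1: "pos_definite (map_matrix real_of_int (mat 1 :: int^'k^'k))"
  unfolding pos_definite_def
proof (intro conjI allI impI)
  show "transpose (map_matrix real_of_int (mat 1 :: int^'k^'k)) = map_matrix real_of_int (mat 1)"
    by (auto simp: transpose_def map_matrix_def mat_def vec_eq_iff)
  fix x :: "real^'k" assume "x \<noteq> 0"
  then obtain i where "x $ i \<noteq> 0" by (auto simp: vec_eq_iff)
  then show "bilin (map_matrix real_of_int (mat 1 :: int^'k^'k)) x x > 0"
    by (subst bilin_map_mat_1) (auto intro!: sum_pos2[of _ i])
qed

text \<open>The identity matrix is unimodular in the present sense, so this is the convergence half
  of the lattice Poisson formula.\<close>

lemma summable_exp_neg_squares:
  fixes c :: real
  assumes "c > 0"
  shows "(\<lambda>x::int^'k. exp (- c * (\<Sum>i\<in>UNIV. of_int (x $ i) ^ 2))) summable_on UNIV"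
proof -
  have "unimodular (mat 1 :: int^'k^'k)" using pos_definite_mat_1 by (auto simp: unimodular_def matrix_vector_mul_lid)
  from lattice_poisson(1)[OF this, of "of_real (c / pi)" 0] show ?thesis
    using assms by (simp add: bilin_map_mat_1) (simp add: of_int_vec_def)
qed

lemma bij_betw_matrix_vec:
  "bij_betw (\<lambda>x :: int^('m \<times> 'n). (\<chi> k i. x $ (k, i)) :: int^'n^'m) UNIV UNIV"
  by (rule bij_betw_byWitness[of _ "\<lambda>X. \<chi> p. X $ fst p $ snd p"]) (auto simp: vec_eq_iff)

lemma summable_exp_gram_size:
  fixes S :: "int^'m^'m"
  assumes S: "pos_definite (map_matrix real_of_int S)" and c: "c > 0"
  shows "(\<lambda>X :: int^'n^'m. exp (- c * gram_size S X)) summable_on UNIV"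
proof -
  obtain \<mu> where l: "\<mu> > 0" "\<And>x. \<mu> * (\<Sum>i\<in>UNIV. (x $ i)\<^sup>2) \<le> bilin (map_matrix real_of_int S) x x"
    using pos_definite_lower_bound[OF S] by blast
  let ?f = "\<lambda>X :: int^'n^'m. exp (- (c * \<mu>) * (\<Sum>i\<in>UNIV. \<Sum>k\<in>UNIV. of_int (X $ k $ i) ^ 2))"
  have "(\<lambda>x::int^('m \<times> 'n). exp (- (c * \<mu>) * (\<Sum>p\<in>UNIV. of_int (x $ p) ^ 2))) summable_on UNIV"
    by (rule summable_exp_neg_squares) (use c l in simp)
  moreover have "(\<Sum>p\<in>UNIV. real_of_int (x $ p) ^ 2) = (\<Sum>i\<in>UNIV. \<Sum>k\<in>UNIV. of_int (x $ (k, i)) ^ 2)" for x :: "int^('m \<times> 'n)"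
    by (subst sum.swap) (simp add: sum.cartesian_product UNIV_Times_UNIV[symmetric] del: UNIV_Times_UNIV)
  ultimately have "(\<lambda>x. ?f (\<chi> k i. x $ (k, i))) summable_on UNIV" by simp
  then have "?f summable_on UNIV"
    by (subst (asm) summable_on_reindex_bij_betw[OF bij_betw_matrix_vec, of ?f])
  then show ?thesis
  proof (rule summable_on_comparison_test)
    fix X :: "int^'n^'m"
    have "\<mu> * (\<Sum>i\<in>UNIV. \<Sum>k\<in>UNIV. of_int (X $ k $ i) ^ 2) \<le> gram_size S X"
      unfolding gram_size_def sum_distrib_left[of \<mu> "\<lambda>i. \<Sum>k\<in>UNIV. of_int (X $ k $ i) ^ 2"]
    proof (rule sum_mono)
      fix i
      show "\<mu> * (\<Sum>k\<in>UNIV. of_int (X $ k $ i) ^ 2) \<le> of_int (bilin S (column i X) (column i X))"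
        using l(2)[of "of_int_vec (column i X)"] unfolding bilin_of_int_vec by (simp add: of_int_vec_def column_def)
    qed
    then have "c * (\<mu> * (\<Sum>i\<in>UNIV. \<Sum>k\<in>UNIV. of_int (X $ k $ i) ^ 2)) \<le> c * gram_size S X"
      using c by simp
    then show "exp (- c * gram_size S X) \<le> ?f X" by (simp add: mult.assoc)
  qed auto
qed

lemma theta_abs_summable:
  fixes S :: "int^'m^'m" and Z :: "complex^'n^'n"
  assumes S: "pos_definite (map_matrix real_of_int S)" and Z: "Z \<in> siegel_space"
  shows "(\<lambda>X. norm (exp (of_real pi * \<i> * gram_trace S X Z))) summable_on UNIV"
proof -
  obtain \<mu> where l: "\<mu> > 0" "\<And>X. \<mu> * gram_size S X \<le> Im (gram_trace S X Z)"
    using Im_gram_trace_ge[OF S Z] by blast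
  have "(\<lambda>X :: int^'n^'m. exp (- (pi * \<mu>) * gram_size S X)) summable_on UNIV"
    by (rule summable_exp_gram_size[OF S]) (use l in simp)
  then show ?thesis
    by (rule summable_on_comparison_test) (use l in \<open>auto simp: norm_exp_gram_trace mult.assoc\<close>)
qed

text \<open>The action of the inversion of \<open>SL_2\<close> embedded at index \<open>p\<close>;
  away from \<open>p\<close> the entries form the Schur complement of
  \<open>Z $ p $ p\<close>.\<close>

definition partial_inversion :: "'n::finite \<Rightarrow> complex^'n^'n \<Rightarrow> complex^'n^'n" where
  "partial_inversion p Z = (\<chi> i j.
     if i = p then (if j = p then - 1 / Z $ p $ p else Z $ p $ j / Z $ p $ p)
     else if j = p then Z $ i $ p / Z $ p $ p
     else Z $ i $ j - Z $ i $ p * Z $ p $ j / Z $ p $ p)"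

lemma sum_split_index:
  fixes f :: "'n::finite \<Rightarrow> 'a::comm_monoid_add"
  shows "(\<Sum>i\<in>UNIV. f i) = f p + (\<Sum>i\<in>-{p}. f i)"
  using sum.remove[of UNIV p f] by (simp add: Compl_eq_Diff_UNIV)

lemma double_sum_split_index:
  fixes f :: "'n::finite \<Rightarrow> 'n \<Rightarrow> 'a::comm_monoid_add"
  shows "(\<Sum>i\<in>UNIV. \<Sum>j\<in>UNIV. f i j) =
    f p p + ((\<Sum>j\<in>-{p}. f p j) + (\<Sum>i\<in>-{p}. f i p)) + (\<Sum>i\<in>-{p}. \<Sum>j\<in>-{p}. f i j)"
  by (simp add: sum_split_index[of _ p] sum.distrib add_ac)

lemma siegel_diag_Im_pos:
  assumes "Z \<in> siegel_space"
  shows "Im (Z $ p $ p) > 0"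
proof -
  have eq: "bilin (map_matrix Im Z) (axis p 1) (axis p 1) = Im (Z $ p $ p)"
    by (simp add: bilin_def axis_def map_matrix_def if_distrib[of "\<lambda>x. x * _"] if_distrib[of "\<lambda>x. _ * x"] cong: if_cong)
  have "(axis p 1 :: real^'a) \<noteq> 0" by (simp add: axis_eq_0_iff)
  then show ?thesis using assms unfolding eq[symmetric] siegel_space_def pos_definite_def by blast
qed

text \<open>The imaginary part of the new form at \<open>v\<close> equals that of \<open>Z\<close>
  at a real vector \<open>r\<close> plus the square of \<open>Im \<eta>\<close> times
  \<open>Im (Z $ p $ p)\<close>, where \<open>r\<close> replaces \<open>v $ p\<close> by
  \<open>Re \<eta>\<close>. Both summands are non-negative and do not vanish together.\<close>

lemma partial_inversion_siegel:
  assumes Z: "Z \<in> siegel_space"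
  shows "partial_inversion p Z \<in> siegel_space"
proof -
  let ?\<tau> = "Z $ p $ p" and ?W = "partial_inversion p Z" and ?J = "- {p}"
  have Zs: "Z $ i $ j = Z $ j $ i" for i j
    using Z by (auto simp: siegel_space_def intro: symmetric_entry)
  have Y: "pos_definite (map_matrix Im Z)" using Z by (simp add: siegel_space_def)
  have \<tau>: "Im ?\<tau> > 0" using siegel_diag_Im_pos[OF Z] .
  then have \<tau>0: "?\<tau> \<noteq> 0" by auto
  have Ws: "?W $ i $ j = ?W $ j $ i" for i j
    by (simp add: partial_inversion_def Zs[of i j] Zs[of i p] Zs[of p j] mult.commute)
  then have sym: "transpose ?W = ?W" by (simp add: transpose_def vec_eq_iff)
  moreover have "pos_definite (map_matrix Im ?W)"
    unfolding pos_definite_def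
  proof (intro conjI allI impI)
    show "transpose (map_matrix Im ?W) = map_matrix Im ?W"
      using Ws by (auto simp: transpose_def map_matrix_def vec_eq_iff)
    fix v :: "real^'a" assume v: "v \<noteq> 0"
    define s where "s = (\<Sum>j\<in>?J. Z $ p $ j * of_real (v $ j))"
    \<comment> \<open>Chosen so that the form of \<open>?W\<close> at \<open>v\<close> becomes
      \<open>K - ?\<tau> * \<eta>\<^sup>2\<close>.\<close>
    define \<eta> where "\<eta> = (of_real (v $ p) - s) / ?\<tau>"
    define r where "r = (\<chi> j. if j = p then Re \<eta> else v $ j)"
    define K where "K = (\<Sum>i\<in>?J. \<Sum>j\<in>?J. Z $ i $ j * (of_real (v $ i) * of_real (v $ j)))"
    have s_eq: "s = of_real (v $ p) - ?\<tau> * \<eta>" unfolding \<eta>_def using \<tau>0 by simp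
    have s2: "(\<Sum>i\<in>?J. Z $ i $ p * of_real (v $ i)) = s" unfolding s_def by (simp add: Zs[of _ p])
    have ne: "j \<noteq> p" if "j \<in> ?J" for j using that by auto
    have "(\<Sum>i\<in>UNIV. \<Sum>j\<in>UNIV. ?W $ i $ j * (of_real (v $ i) * of_real (v $ j))) =
       - (of_real (v $ p))\<^sup>2 / ?\<tau> + 2 * of_real (v $ p) * s / ?\<tau> + (K - s * s / ?\<tau>)"
    proof -
      have a: "?W $ p $ p * (of_real (v $ p) * of_real (v $ p)) = - (of_real (v $ p))\<^sup>2 / ?\<tau>"
        by (simp add: partial_inversion_def power2_eq_square)
      have b: "(\<Sum>j\<in>?J. ?W $ p $ j * (of_real (v $ p) * of_real (v $ j))) = of_real (v $ p) * s / ?\<tau>"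
        unfolding s_def sum_distrib_left sum_divide_distrib
        by (intro sum.cong) (auto simp: partial_inversion_def)
      have c: "(\<Sum>i\<in>?J. ?W $ i $ p * (of_real (v $ i) * of_real (v $ p))) = of_real (v $ p) * s / ?\<tau>"
        unfolding s2[symmetric] sum_distrib_left sum_divide_distrib
        by (intro sum.cong) (auto simp: partial_inversion_def)
      have "(\<Sum>i\<in>?J. \<Sum>j\<in>?J. ?W $ i $ j * (of_real (v $ i) * of_real (v $ j))) =
        (\<Sum>i\<in>?J. \<Sum>j\<in>?J. Z $ i $ j * (of_real (v $ i) * of_real (v $ j))
          - (Z $ i $ p * of_real (v $ i)) * (Z $ p $ j * of_real (v $ j)) / ?\<tau>)"
        by (intro sum.cong refl) (auto simp: partial_inversion_def algebra_simps)
      also have "\<dots> = K - (\<Sum>i\<in>?J. \<Sum>j\<in>?J. (Z $ i $ p * of_real (v $ i)) * (Z $ p $ j * of_real (v $ j))) / ?\<tau>"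
        unfolding K_def by (simp only: sum_subtractf sum_divide_distrib)
      also have "(\<Sum>i\<in>?J. \<Sum>j\<in>?J. (Z $ i $ p * of_real (v $ i)) * (Z $ p $ j * of_real (v $ j))) = s * s"
        unfolding sum_product[symmetric] s2 s_def[symmetric] ..
      finally show ?thesis unfolding double_sum_split_index[of _ p] a b c by (simp add: field_simps)
    qed
    also have "\<dots> = K - ?\<tau> * \<eta>\<^sup>2"
      unfolding s_eq using \<tau>0 by (simp add: field_simps power2_eq_square)
    finally have W: "(\<Sum>i\<in>UNIV. \<Sum>j\<in>UNIV. ?W $ i $ j * (of_real (v $ i) * of_real (v $ j))) = K - ?\<tau> * \<eta>\<^sup>2" .
    have "bilin (map_matrix Im ?W) v v = Im (\<Sum>i\<in>UNIV. \<Sum>j\<in>UNIV. ?W $ i $ j * (of_real (v $ i) * of_real (v $ j)))"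
      by (simp add: bilin_def map_matrix_def mult_ac flip: of_real_mult)
    also have "\<dots> = Im (K - ?\<tau> * \<eta>\<^sup>2)" unfolding W ..
    finally have 1: "bilin (map_matrix Im ?W) v v = Im K - Im (?\<tau> * \<eta>\<^sup>2)" by simp
    have "(\<Sum>i\<in>UNIV. \<Sum>j\<in>UNIV. Z $ i $ j * (of_real (r $ i) * of_real (r $ j))) =
       ?\<tau> * (of_real (Re \<eta>))\<^sup>2 + 2 * of_real (Re \<eta>) * s + K"
    proof -
      have a: "Z $ p $ p * (of_real (r $ p) * of_real (r $ p)) = ?\<tau> * (of_real (Re \<eta>))\<^sup>2"
        by (simp add: r_def power2_eq_square)
      have b: "(\<Sum>j\<in>?J. Z $ p $ j * (of_real (r $ p) * of_real (r $ j))) = of_real (Re \<eta>) * s"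
        unfolding s_def sum_distrib_left by (intro sum.cong) (auto simp: r_def)
      have c: "(\<Sum>i\<in>?J. Z $ i $ p * (of_real (r $ i) * of_real (r $ p))) = of_real (Re \<eta>) * s"
        unfolding s2[symmetric] sum_distrib_left by (intro sum.cong) (auto simp: r_def)
      have "(\<Sum>i\<in>?J. \<Sum>j\<in>?J. Z $ i $ j * (of_real (r $ i) * of_real (r $ j))) = K"
        unfolding K_def by (intro sum.cong refl) (auto simp: r_def)
      then show ?thesis unfolding double_sum_split_index[of _ p] a b c by simp
    qed
    moreover have "bilin (map_matrix Im Z) r r = Im (\<Sum>i\<in>UNIV. \<Sum>j\<in>UNIV. Z $ i $ j * (of_real (r $ i) * of_real (r $ j)))"
      by (simp add: bilin_def map_matrix_def mult_ac flip: of_real_mult)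
    ultimately have 2: "bilin (map_matrix Im Z) r r = Im (?\<tau> * (of_real (Re \<eta>))\<^sup>2 + 2 * of_real (Re \<eta>) * s + K)" by simp
    have "bilin (map_matrix Im ?W) v v = bilin (map_matrix Im Z) r r + (Im \<eta>)\<^sup>2 * Im ?\<tau>"
      unfolding 1 2 s_eq by (simp add: power2_eq_square algebra_simps)
    moreover have "bilin (map_matrix Im Z) r r + (Im \<eta>)\<^sup>2 * Im ?\<tau> > 0"
    proof (cases "r = 0")
      case False
      then have "bilin (map_matrix Im Z) r r > 0" using Y unfolding pos_definite_def by blast
      then show ?thesis using \<tau> by (simp add: add_pos_nonneg)
    next
      case True
      then have r: "r $ j = 0" for j by simp
      have vj: "v $ j = 0" if "j \<noteq> p" for j using r[of j] that by (simp add: r_def)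
      then have "s = 0" by (simp add: s_def)
      moreover have "v $ p \<noteq> 0"
      proof
        assume "v $ p = 0"
        then have "v $ j = 0" for j using vj[of j] by (cases "j = p") auto
        then show False using v by (simp add: vec_eq_iff)
      qed
      ultimately have "\<eta> \<noteq> 0" using \<tau>0 by (simp add: \<eta>_def)
      moreover have "Re \<eta> = 0" using r[of p] by (simp add: r_def)
      ultimately have "Im \<eta> \<noteq> 0" by (simp add: complex_eq_iff)
      then show ?thesis using True \<tau> by simp
    qed
    ultimately show "0 < bilin (map_matrix Im ?W) v v" by simp
  qed
  ultimately show ?thesis by (simp add: siegel_space_def)
qed

lemma bilin_sum_left: "bilin S (\<Sum>i\<in>A. f i) y = (\<Sum>i\<in>A. bilin S (f i) y)"
  by (induction A rule: infinite_finite_induct) (auto simp: bilin_add_left)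

lemma bilin_sum_right: "bilin S y (\<Sum>i\<in>A. f i) = (\<Sum>i\<in>A. bilin S y (f i))"
  by (induction A rule: infinite_finite_induct) (auto simp: bilin_add_right)

definition set_column :: "'n \<Rightarrow> (int^'n^'m) \<times> (int^'m) \<Rightarrow> int^'n^'m" where
  "set_column p = (\<lambda>(X, x). \<chi> k i. if i = p then x $ k else X $ k $ i)"

lemma column_set_column: "column i (set_column p (X, x)) = (if i = p then x else column i X)"
  by (simp add: set_column_def column_def vec_eq_iff)

lemma bij_betw_set_column: "bij_betw (set_column p) ({X. column p X = 0} \<times> UNIV) UNIV"
  by (rule bij_betw_byWitness[of _ "\<lambda>X. (\<chi> k i. if i = p then 0 else X $ k $ i, column p X)"])
     (auto simp: set_column_def column_def vec_eq_iff)

text \<open>With the other columns fixed, the exponent is quadratic in column \<open>p\<close>. The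
  same complex shift and the same remainder occur for \<open>Z\<close> and, on the dual side, for
  the inverted matrix, so Poisson summation in that single column gives the formula.\<close>

theorem theta_partial_inversion:
  fixes S :: "int^24^24" and Z :: "complex^'n^'n"
  assumes S: "unimodular S" and Z: "Z \<in> siegel_space"
  shows "theta_series S (partial_inversion p Z) = (Z $ p $ p) ^ 12 * theta_series S Z"
proof -
  let ?\<tau> = "Z $ p $ p" and ?W = "partial_inversion p Z" and ?J = "- {p}"
  have pd: "pos_definite (map_matrix real_of_int S)" using S by (simp add: unimodular_def)
  define q where "q = bilin (map_matrix of_int S :: complex^24^24)"
  have Zs: "Z $ i $ j = Z $ j $ i" for i j
    using Z by (auto simp: siegel_space_def intro: symmetric_entry)
  have Zp: "Z $ p $ i = Z $ i $ p" if "i \<noteq> p" for i by (rule Zs)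
  have \<tau>: "Im ?\<tau> > 0" using siegel_diag_Im_pos[OF Z] .
  then have \<tau>0: "?\<tau> \<noteq> 0" by auto
  have Ssym: "bilin S x y = bilin S y x" for x y by (rule bilin_commute[OF unimodular_sym[OF S]])
  have qint: "q (of_int_vec x) (of_int_vec y) = of_int (bilin S x y)" for x y
    unfolding q_def by (rule bilin_of_int_vec)
  have "transpose (map_matrix of_int S :: complex^24^24) = map_matrix of_int S"
    using symmetric_entry[OF unimodular_sym[OF S]] by (auto simp: transpose_def map_matrix_def vec_eq_iff)
  then have qsym: "q x y = q y x" for x y unfolding q_def by (rule bilin_commute)
  \<comment> \<open>Completing the square in column \<open>p\<close>: \<open>w X\<close> is the
    shift, and the remainder \<open>R X\<close> is formed with \<open>?W\<close> because the Schur
    complement is what is left over.\<close>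
  define w where "w X = (\<Sum>j\<in>?J. (Z $ j $ p / ?\<tau>) *s of_int_vec (column j X))" for X :: "int^'n^24"
  define R where "R X = (\<Sum>i\<in>?J. \<Sum>j\<in>?J. of_int (bilin S (column i X) (column j X)) * ?W $ j $ i)" for X :: "int^'n^24"
  have qw: "q (of_int_vec x) (w X) = (\<Sum>j\<in>?J. of_int (bilin S x (column j X)) * Z $ j $ p) / ?\<tau>" for x X
    unfolding w_def q_def bilin_sum_right bilin_scale_right bilin_of_int_vec sum_divide_distrib
    by (simp add: mult.commute)
  have qww: "q (w X) (w X) = (\<Sum>i\<in>?J. \<Sum>j\<in>?J. of_int (bilin S (column i X) (column j X)) * (Z $ i $ p * Z $ j $ p)) / ?\<tau>\<^sup>2" for X
    unfolding w_def q_def bilin_sum_right bilin_sum_left bilin_scale_right bilin_scale_left bilin_of_int_vec sum_divide_distrib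
    by (subst sum.swap) (simp add: power2_eq_square sum_distrib_left mult_ac)
  have ne: "i \<noteq> p" if "i \<in> ?J" for i using that by auto
  have 1: "gram_trace S (set_column p (X, x)) Z = ?\<tau> * q (of_int_vec x + w X) (of_int_vec x + w X) + R X" for X x
  proof -
    have a: "(\<Sum>j\<in>?J. of_int (bilin S (column p (set_column p (X, x))) (column j (set_column p (X, x)))) * Z $ j $ p) = ?\<tau> * q (of_int_vec x) (w X)"
      unfolding qw using \<tau>0 by (auto simp: column_set_column intro!: sum.cong)
    have b: "(\<Sum>i\<in>?J. of_int (bilin S (column i (set_column p (X, x))) (column p (set_column p (X, x)))) * Z $ p $ i) = ?\<tau> * q (of_int_vec x) (w X)"
      unfolding qw using \<tau>0 by (auto simp: column_set_column Zp Ssym[of "column _ X" x] intro!: sum.cong)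
    have "(\<Sum>i\<in>?J. \<Sum>j\<in>?J. of_int (bilin S (column i (set_column p (X, x))) (column j (set_column p (X, x)))) * Z $ j $ i) =
       (\<Sum>i\<in>?J. \<Sum>j\<in>?J. of_int (bilin S (column i X) (column j X)) * ?W $ j $ i
         + of_int (bilin S (column i X) (column j X)) * (Z $ i $ p * Z $ j $ p) / ?\<tau>)"
      by (intro sum.cong refl) (auto simp: column_set_column partial_inversion_def Zp algebra_simps)
    also have "\<dots> = R X + ?\<tau> * q (w X) (w X)"
    proof -
      have "?\<tau> * (y / ?\<tau>\<^sup>2) = y / ?\<tau>" for y using \<tau>0 by (simp add: power2_eq_square)
      note * = this
      show ?thesis unfolding qww R_def * by (simp only: sum.distrib sum_divide_distrib)
    qed
    finally show ?thesis
      unfolding gram_trace_def double_sum_split_index[of _ p] a b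
      by (simp add: column_set_column q_def bilin_add_left bilin_add_right bilin_of_int_vec)
         (simp add: q_def[symmetric] qsym[of "w X" "of_int_vec x"] algebra_simps)
  qed
  have 2: "gram_trace S (set_column p (X, x)) ?W = - 1 / ?\<tau> * q (of_int_vec x) (of_int_vec x) + 2 * q (of_int_vec x) (w X) + R X" for X x
  proof -
    have a: "(\<Sum>j\<in>?J. of_int (bilin S (column p (set_column p (X, x))) (column j (set_column p (X, x)))) * ?W $ j $ p) = q (of_int_vec x) (w X)"
      unfolding qw sum_divide_distrib by (auto simp: column_set_column partial_inversion_def intro!: sum.cong)
    have b: "(\<Sum>i\<in>?J. of_int (bilin S (column i (set_column p (X, x))) (column p (set_column p (X, x)))) * ?W $ p $ i) = q (of_int_vec x) (w X)"
      unfolding qw sum_divide_distrib by (auto simp: column_set_column partial_inversion_def Zp Ssym[of "column _ X" x] intro!: sum.cong)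
    have "(\<Sum>i\<in>?J. \<Sum>j\<in>?J. of_int (bilin S (column i (set_column p (X, x))) (column j (set_column p (X, x)))) * ?W $ j $ i) = R X"
      unfolding R_def by (intro sum.cong refl) (auto simp: column_set_column)
    then show ?thesis
      unfolding gram_trace_def double_sum_split_index[of _ p] a b
      by (simp add: column_set_column qint partial_inversion_def)
  qed
  \<comment> \<open>Poisson summation needs a positive real part, hence the rotation of the upper
    half-plane. In rank 24 the twelfth power of \<open>- \<i>\<close> is 1, so no root of unity
    survives in the automorphy factor.\<close>
  define a where "a = - \<i> * ?\<tau>"
  have a: "Re a > 0" using \<tau> by (simp add: a_def)
  have a12: "csqrt a ^ CARD(24) = ?\<tau> ^ 12"
  proof -
    have "csqrt a ^ CARD(24) = (csqrt a ^ 2) ^ 12" by (simp only: power_mult[symmetric]) simp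
    also have "\<dots> = (- \<i>) ^ 12 * ?\<tau> ^ 12" by (simp add: a_def power_mult_distrib)
    also have "(- \<i>) ^ 12 = ((\<i>\<^sup>2) ^ 6 :: complex)" by (simp only: power_mult[symmetric]) simp
    finally show ?thesis by simp
  qed
  let ?T = "{X :: int^'n^24. column p X = 0}"
  have split: "theta_series S Z' = (\<Sum>\<^sub>\<infinity>X\<in>?T. \<Sum>\<^sub>\<infinity>x. exp (of_real pi * \<i> * gram_trace S (set_column p (X, x)) Z'))"
    if "Z' \<in> siegel_space" for Z'
  proof -
    let ?f = "\<lambda>X. exp (of_real pi * \<i> * gram_trace S X Z')"
    have "?f summable_on UNIV" by (rule abs_summable_summable[OF theta_abs_summable[OF pd that]])
    then have "(\<lambda>z. ?f (set_column p z)) summable_on (?T \<times> UNIV)"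
      by (subst summable_on_reindex_bij_betw[OF bij_betw_set_column])
    then have "(\<Sum>\<^sub>\<infinity>X\<in>?T. \<Sum>\<^sub>\<infinity>x. ?f (set_column p (X, x))) = (\<Sum>\<^sub>\<infinity>z\<in>?T \<times> UNIV. ?f (set_column p z))"
      by (rule infsum_Sigma_banach)
    also have "\<dots> = theta_series S Z'"
      unfolding theta_series_gram by (rule infsum_reindex_bij_betw[OF bij_betw_set_column])
    finally show ?thesis by simp
  qed
  have inner: "(\<Sum>\<^sub>\<infinity>x. exp (of_real pi * \<i> * gram_trace S (set_column p (X, x)) ?W)) =
     ?\<tau> ^ 12 * (\<Sum>\<^sub>\<infinity>x. exp (of_real pi * \<i> * gram_trace S (set_column p (X, x)) Z))" for X
  proof -
    have e1: "of_real pi * \<i> * gram_trace S (set_column p (X, x)) Z =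
      of_real pi * \<i> * R X + - of_real pi * a * q (of_int_vec x + w X) (of_int_vec x + w X)" for x
      unfolding 1 a_def by (simp add: algebra_simps)
    have e2: "of_real pi * \<i> * gram_trace S (set_column p (X, x)) ?W =
      of_real pi * \<i> * R X + (- of_real pi / a * q (of_int_vec x) (of_int_vec x) + 2 * of_real pi * \<i> * q (of_int_vec x) (w X))" for x
    proof -
      have "- of_real pi / a = of_real pi * \<i> * (- 1 / ?\<tau>)"
        using \<tau>0 by (simp add: a_def field_simps)
      then show ?thesis unfolding 2 by (simp add: algebra_simps)
    qed
    show ?thesis
      unfolding e1 e2 exp_add[of "of_real pi * \<i> * R X"] infsum_cmult_right' lattice_poisson(2)[OF S a, of "w X", folded q_def, symmetric] a12
      by (simp add: mult.left_commute)
  qed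
  show ?thesis
    unfolding split[OF Z] split[OF partial_inversion_siegel[OF Z]] inner by (rule infsum_cmult_right')
qed

section \<open>Generators of the symplectic group\<close>

lemma map_matrix_nth: "map_matrix f M $ i $ j = f (M $ i $ j)"
  by (simp add: map_matrix_def)

lemma transpose_map_matrix: "transpose (map_matrix f M) = map_matrix f (transpose M)"
  by (simp add: transpose_def map_matrix_def)

lemma matrix_diff_ldistrib: "A ** (B - C) = A ** B - A ** (C :: 'a::ring_1^'p^'n)"
  by (simp add: matrix_matrix_mult_def vec_eq_iff right_diff_distrib sum_subtractf)

lemma matrix_diff_rdistrib: "(A - B) ** C = A ** C - B ** (C :: 'a::ring_1^'p^'n)"
  by (simp add: matrix_matrix_mult_def vec_eq_iff left_diff_distrib sum_subtractf)

lemma matrix_add_rdistrib: "(A + B) ** C = A ** C + B ** (C :: 'a::semiring_1^'p^'n)"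
  by (simp add: matrix_matrix_mult_def vec_eq_iff distrib_right sum.distrib)

lemma matrix_zero_mult: "0 ** X = (0 :: 'a::semiring_1^'p^'n)" "Y ** 0 = (0 :: 'a^'p^'n)"
  by (simp_all add: matrix_matrix_mult_def vec_eq_iff)

lemma transpose_zero: "transpose 0 = 0"
  by (simp add: transpose_def vec_eq_iff)

lemma transpose_add: "transpose (A + B) = transpose A + transpose B"
  by (simp add: transpose_def vec_eq_iff)

text \<open>The defining relations say that the block matrix preserves the standard alternating
  form, here for pairs of column blocks. Closure under products is this identity applied to the
  blocks of the second factor.\<close>

lemma symplectic_pairing:
  fixes A B C D :: "int^'n^'n" and X1 X2 Y1 Y2 :: "int^'n^'n"
  assumes "symplectic A B C D"
  shows "transpose (A ** X1 + B ** X2) ** (C ** Y1 + D ** Y2) - transpose (C ** X1 + D ** X2) ** (A ** Y1 + B ** Y2) =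
         transpose X1 ** Y2 - transpose X2 ** Y1"
proof -
  have 1: "transpose A ** C = transpose C ** A" "transpose B ** D = transpose D ** B"
    and 2: "transpose A ** D = transpose C ** B + mat 1"
    using assms unfolding symplectic_def by (auto simp: algebra_simps)
  have 3: "transpose D ** A = transpose B ** C + mat 1"
    using arg_cong[OF 2, of transpose] by (simp add: matrix_transpose_mul transpose_add)
  have expand: "transpose (P ** X1 + Q ** X2) ** (R ** Y1 + T ** Y2) =
      transpose X1 ** (transpose P ** R) ** Y1 + transpose X1 ** (transpose P ** T) ** Y2 +
      (transpose X2 ** (transpose Q ** R) ** Y1 + transpose X2 ** (transpose Q ** T) ** Y2)" for P Q R T :: "int^'n^'n"
    by (simp add: transpose_add matrix_transpose_mul matrix_add_ldistrib matrix_add_rdistrib matrix_mul_assoc)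
  show ?thesis
    unfolding expand 1 2 3 by (simp add: matrix_add_ldistrib matrix_add_rdistrib)
qed

lemma symplectic_mult:
  assumes "symplectic A B C D" "symplectic A' B' C' D'"
  shows "symplectic (A ** A' + B ** C') (A ** B' + B ** D') (C ** A' + D ** C') (C ** B' + D ** D')"
  using symplectic_pairing[OF assms(1), of A' C' A' C'] symplectic_pairing[OF assms(1), of B' D' B' D']
    symplectic_pairing[OF assms(1), of A' C' B' D'] assms(2)
  unfolding symplectic_def by simp

text \<open>The transformed point is characterised by its product with the denominator instead of by
  an inverse matrix, and the non-vanishing of the denominator is part of the claim. Group elements
  can then be composed without inverting anything.\<close>

definition transforms :: "nat \<Rightarrow> (complex^'n^'n \<Rightarrow> complex) \<Rightarrow> int^'n^'n \<Rightarrow> int^'n^'n \<Rightarrow> int^'n^'n \<Rightarrow> int^'n^'n \<Rightarrow> bool" where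
  "transforms k F A B C D \<longleftrightarrow> (\<forall>Z\<in>siegel_space. \<exists>W\<in>siegel_space.
     map_matrix of_int A ** Z + map_matrix of_int B = W ** (map_matrix of_int C ** Z + map_matrix of_int D) \<and>
     det (map_matrix of_int C ** Z + map_matrix of_int D) \<noteq> 0 \<and>
     F W = det (map_matrix of_int C ** Z + map_matrix of_int D) ^ k * F Z)"

lemma map_matrix_of_int_mult:
  "(map_matrix of_int (A ** B) :: 'a::ring_1^'p^'n) = map_matrix of_int A ** map_matrix of_int B"
  by (simp add: map_matrix_def matrix_matrix_mult_def vec_eq_iff)

lemma map_matrix_of_int_add:
  "(map_matrix of_int (A + B) :: 'a::ring_1^'p^'n) = map_matrix of_int A + map_matrix of_int B"
  by (simp add: map_matrix_def vec_eq_iff)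

lemma map_matrix_of_int_mat_1: "(map_matrix of_int (mat 1) :: 'a::ring_1^'n^'n) = mat 1"
  by (simp add: map_matrix_def mat_def vec_eq_iff)

lemma map_matrix_of_int_transpose:
  "(map_matrix of_int (transpose A) :: 'a::ring_1^'p^'n) = transpose (map_matrix of_int A)"
  by (simp add: map_matrix_def transpose_def vec_eq_iff)

lemma transforms_mult:
  fixes A :: "int^'n^'n"
  assumes "transforms k F A B C D" "transforms k F A' B' C' D'"
  shows "transforms k F (A ** A' + B ** C') (A ** B' + B ** D') (C ** A' + D ** C') (C ** B' + D ** D')"
  unfolding transforms_def
proof
  fix Z :: "complex^'n^'n" assume Z: "Z \<in> siegel_space"
  let ?c = "map_matrix of_int :: int^'n^'n \<Rightarrow> complex^'n^'n"
  let ?Q = "?c C' ** Z + ?c D'"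
  obtain W where W: "W \<in> siegel_space" "?c A' ** Z + ?c B' = W ** ?Q" "det ?Q \<noteq> 0" "F W = det ?Q ^ k * F Z"
    using assms(2) Z unfolding transforms_def by blast
  let ?P = "?c C ** W + ?c D"
  obtain V where V: "V \<in> siegel_space" "?c A ** W + ?c B = V ** ?P" "det ?P \<noteq> 0" "F V = det ?P ^ k * F W"
    using assms(1) W(1) unfolding transforms_def by blast
  have *: "?c (P ** A' + R ** C') ** Z + ?c (P ** B' + R ** D') = (?c P ** W + ?c R) ** ?Q" for P R
  proof -
    have "?c (P ** A' + R ** C') ** Z + ?c (P ** B' + R ** D') = ?c P ** (?c A' ** Z + ?c B') + ?c R ** ?Q"
      by (simp add: map_matrix_of_int_add map_matrix_of_int_mult matrix_add_ldistrib matrix_add_rdistrib matrix_mul_assoc)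
    also have "\<dots> = (?c P ** W + ?c R) ** ?Q"
      unfolding W(2) by (simp add: matrix_add_rdistrib matrix_mul_assoc)
    finally show ?thesis .
  qed
  have "V ** (?P ** ?Q) = (?c A ** W + ?c B) ** ?Q" by (simp add: V(2) matrix_mul_assoc)
  then show "\<exists>V\<in>siegel_space. ?c (A ** A' + B ** C') ** Z + ?c (A ** B' + B ** D') =
       V ** (?c (C ** A' + D ** C') ** Z + ?c (C ** B' + D ** D')) \<and>
       det (?c (C ** A' + D ** C') ** Z + ?c (C ** B' + D ** D')) \<noteq> 0 \<and>
       F V = det (?c (C ** A' + D ** C') ** Z + ?c (C ** B' + D ** D')) ^ k * F Z"
    unfolding * using V W by (intro bexI[of _ V]) (auto simp: det_mul power_mult_distrib)
qed

definition unit_entry :: "'n \<Rightarrow> 'n \<Rightarrow> int \<Rightarrow> int^'n^'n" where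
  "unit_entry i j k = (\<chi> a b. if a = i \<and> b = j then k else 0)"

lemma unit_entry_mult: "(unit_entry i j k ** X) $ a $ b = (if a = i then k * X $ j $ b else 0)"
proof -
  have "(\<Sum>l\<in>UNIV. (if a = i \<and> l = j then k else 0) * X $ l $ b) = (\<Sum>l\<in>UNIV. if l = j then (if a = i then k * X $ l $ b else 0) else 0)"
    by (intro sum.cong) auto
  then show ?thesis by (simp add: matrix_matrix_mult_def unit_entry_def)
qed

lemma unit_entry_mult_unit_entry:
  "unit_entry i j k ** unit_entry p q l = (if j = p then unit_entry i q (k * l) else 0)"
  by (simp add: vec_eq_iff unit_entry_mult) (auto simp: unit_entry_def)

lemma transpose_unit_entry: "transpose (unit_entry i j k) = unit_entry j i k"
  by (auto simp: transpose_def unit_entry_def vec_eq_iff)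

lemma unit_entry_minus: "unit_entry i j (- k) = - unit_entry i j k"
  by (auto simp: unit_entry_def vec_eq_iff)

lemma matrix_minus_mult: "(- A) ** B = - (A ** (B :: 'a::ring_1^'p^'n))" "A ** (- B) = - (A ** B)"
  by (simp_all add: matrix_matrix_mult_def vec_eq_iff sum_negf)

text \<open>\<open>reaches\<close> collects what the reduction of symplectic matrices by elementary row operations
  has to preserve.\<close>

definition reaches :: "nat \<Rightarrow> (complex^'n^'n \<Rightarrow> complex) \<Rightarrow> (int^'n^'n) \<times> (int^'n^'n) \<times> (int^'n^'n) \<times> (int^'n^'n) \<Rightarrow>
    (int^'n^'n) \<times> (int^'n^'n) \<times> (int^'n^'n) \<times> (int^'n^'n) \<Rightarrow> bool" where
  "reaches k F = (\<lambda>(A, B, C, D) (A', B', C', D').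
     (symplectic A B C D \<longrightarrow> symplectic A' B' C' D') \<and> (transforms k F A' B' C' D' \<longrightarrow> transforms k F A B C D))"

lemma reaches_refl: "reaches k F M M" by (auto simp: reaches_def)

lemma reaches_trans: "reaches k F M N \<Longrightarrow> reaches k F N P \<Longrightarrow> reaches k F M P"
  by (auto simp: reaches_def)

text \<open>The blocks \<open>P'\<close>, \<open>Q'\<close>, \<open>R'\<close>, \<open>T'\<close>
  form the inverse of \<open>P\<close>, \<open>Q\<close>, \<open>R\<close>, \<open>T\<close>.
  Multiplying by the former keeps a matrix symplectic; multiplying back by the latter, for which the
  transformation law is known, returns the law to the original matrix.\<close>

lemma reaches_left_mult:
  assumes "symplectic P' Q' R' T'" "transforms k F P Q R T"
    and "P ** P' + Q ** R' = mat 1" "P ** Q' + Q ** T' = 0" "R ** P' + T ** R' = 0" "R ** Q' + T ** T' = mat 1"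
  shows "reaches k F (A, B, C, D) (P' ** A + Q' ** C, P' ** B + Q' ** D, R' ** A + T' ** C, R' ** B + T' ** D)"
proof -
  have 1: "P ** (P' ** X + Q' ** Y) + Q ** (R' ** X + T' ** Y) = X"
    "R ** (P' ** X + Q' ** Y) + T ** (R' ** X + T' ** Y) = Y" for X Y
  proof -
    have "P ** (P' ** X + Q' ** Y) + Q ** (R' ** X + T' ** Y) = (P ** P' + Q ** R') ** X + (P ** Q' + Q ** T') ** Y"
      by (simp add: matrix_add_ldistrib matrix_add_rdistrib matrix_mul_assoc add_ac)
    then show "P ** (P' ** X + Q' ** Y) + Q ** (R' ** X + T' ** Y) = X" by (simp add: assms)
    have "R ** (P' ** X + Q' ** Y) + T ** (R' ** X + T' ** Y) = (R ** P' + T ** R') ** X + (R ** Q' + T ** T') ** Y"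
      by (simp add: matrix_add_ldistrib matrix_add_rdistrib matrix_mul_assoc add_ac)
    then show "R ** (P' ** X + Q' ** Y) + T ** (R' ** X + T' ** Y) = Y" by (simp add: assms)
  qed
  show ?thesis
    using symplectic_mult[OF assms(1)] transforms_mult[OF assms(2), of "P' ** A + Q' ** C" "P' ** B + Q' ** D" "R' ** A + T' ** C" "R' ** B + T' ** D"]
    unfolding reaches_def 1 by auto
qed

lemma even_symmetric_sum:
  fixes f :: "'a \<Rightarrow> 'a \<Rightarrow> int"
  assumes "finite I" "\<And>i j. f i j = f j i" "\<And>i. even (f i i)"
  shows "even (\<Sum>i\<in>I. \<Sum>j\<in>I. f i j)"
  using assms(1)
proof (induction I rule: finite_induct)
  case (insert m I)
  have "(\<Sum>i\<in>insert m I. \<Sum>j\<in>insert m I. f i j) = f m m + 2 * (\<Sum>j\<in>I. f m j) + (\<Sum>i\<in>I. \<Sum>j\<in>I. f i j)"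
  proof -
    have "(\<Sum>i\<in>I. f i m) = (\<Sum>i\<in>I. f m i)" by (intro sum.cong refl assms(2))
    then show ?thesis using insert by (simp add: sum.distrib)
  qed
  then show ?case using insert assms(3) by simp
qed simp

lemma int_det_unit:
  fixes A B :: "int^'n^'n"
  assumes "A ** B = mat 1"
  shows "det A = 1 \<or> det A = -1"
proof -
  have "det A * det B = 1" using arg_cong[OF assms, of det] by (simp add: det_mul)
  then show ?thesis by (auto simp: zmult_eq_1_iff)
qed

lemma det_map_matrix_of_int: "det (map_matrix of_int A :: 'a::comm_ring_1^'n^'n) = of_int (det A)"
  by (simp add: det_def map_matrix_def)

lemma gram_trace_congruence:
  "gram_trace S X (map_matrix of_int A ** Z ** transpose (map_matrix of_int A)) = gram_trace S (X ** A) Z"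
proof -
  let ?c = "map_matrix of_int"
  have "gram_trace S X (?c A ** Z ** transpose (?c A)) = trace (?c (transpose X ** S ** X) ** (?c A ** Z ** transpose (?c A)))"
    by (simp add: trace_gram)
  also have "\<dots> = trace ((?c (transpose X ** S ** X) ** ?c A ** Z) ** transpose (?c A))"
    by (simp add: matrix_mul_assoc)
  also have "\<dots> = trace (transpose (?c A) ** (?c (transpose X ** S ** X) ** ?c A ** Z))"
    by (rule trace_mul_sym)
  also have "\<dots> = trace (?c (transpose (X ** A) ** S ** (X ** A)) ** Z)"
    by (simp add: map_matrix_of_int_mult map_matrix_of_int_transpose matrix_transpose_mul matrix_mul_assoc)
  finally show ?thesis by (simp add: trace_gram)
qed

lemma siegel_space_affine:
  fixes A N :: "int^'n^'n" and Z :: "complex^'n^'n"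
  assumes Z: "Z \<in> siegel_space" and A: "A ** A' = mat 1" and N: "transpose N = N"
  shows "map_matrix of_int A ** Z ** transpose (map_matrix of_int A) + map_matrix of_int N \<in> siegel_space"
proof -
  let ?A = "map_matrix of_int A :: complex^'n^'n" and ?R = "map_matrix of_int A :: real^'n^'n"
  let ?W = "?A ** Z ** transpose ?A + map_matrix of_int N"
  have Zt: "transpose Z = Z" and Y: "pos_definite (map_matrix Im Z)" using Z by (auto simp: siegel_space_def)
  have Wt: "transpose ?W = ?W"
    by (simp add: transpose_add matrix_transpose_mul Zt matrix_mul_assoc map_matrix_of_int_transpose[symmetric] N)
  have Im: "map_matrix Im ?W = ?R ** map_matrix Im Z ** transpose ?R"
  proof -
    have 1: "Im ((?A ** Z ** transpose ?A) $ i $ j) = (?R ** map_matrix Im Z ** transpose ?R) $ i $ j" for i j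
      unfolding matrix_matrix_mult_def transpose_def map_matrix_def
      by (simp add: sum_distrib_right)
    show ?thesis by (simp add: vec_eq_iff map_matrix_nth 1)
  qed
  have "pos_definite (map_matrix Im ?W)"
    unfolding pos_definite_def
  proof (intro conjI allI impI)
    show "transpose (map_matrix Im ?W) = map_matrix Im ?W"
      by (subst transpose_map_matrix) (simp only: Wt)
    fix x :: "real^'n" assume x: "x \<noteq> 0"
    have inv: "transpose (map_matrix of_int A') ** transpose ?R = (mat 1 :: real^'n^'n)"
      unfolding matrix_transpose_mul[symmetric] map_matrix_of_int_mult[symmetric] A by (simp add: map_matrix_of_int_mat_1)
    have "transpose ?R *v x \<noteq> 0"
    proof
      assume "transpose ?R *v x = 0"
      then have "(transpose (map_matrix of_int A') ** transpose ?R) *v x = 0"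
        by (metis matrix_vector_mul_assoc matrix_vector_mult_0_right)
      then show False using x unfolding inv by simp
    qed
    moreover have "bilin (map_matrix Im ?W) x x = bilin (map_matrix Im Z) (transpose ?R *v x) (transpose ?R *v x)"
    proof -
      have ip: "bilin M y z = y \<bullet> (M *v z)" for M and y z :: "real^'n"
        by (simp add: bilin_matrix_vector inner_vec_def)
      have "x \<bullet> (?R *v y) = (transpose ?R *v x) \<bullet> y" for y
        by (simp add: dot_lmul_matrix)
      then show ?thesis unfolding Im ip by (simp add: matrix_vector_mul_assoc[symmetric] del: transpose_matrix_vector)
    qed
    ultimately show "bilin (map_matrix Im ?W) x x > 0" using Y unfolding pos_definite_def by metis
  qed
  then show ?thesis using Wt by (simp add: siegel_space_def)
qed

text \<open>The linear part is absorbed by the substitution \<open>X ** A\<close>. The translation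
  changes the exponent by pi i times an even integer: off-diagonal terms occur twice, and diagonal
  terms are even because the lattice is.\<close>

lemma theta_affine:
  fixes S :: "int^'m^'m" and A N :: "int^'n^'n"
  assumes S: "transpose S = S" "\<And>x. even (bilin S x x)" and A: "A ** A' = mat 1" and N: "transpose N = N"
  shows "theta_series S (map_matrix of_int A ** Z ** transpose (map_matrix of_int A) + map_matrix of_int N) = theta_series S Z"
proof -
  have A': "A' ** A = mat 1" 
  proof -
    let ?c = "map_matrix of_int :: int^'n^'n \<Rightarrow> real^'n^'n"
    have "?c A ** ?c A' = mat 1" unfolding map_matrix_of_int_mult[symmetric] A by (rule map_matrix_of_int_mat_1)
    then have "?c A' ** ?c A = mat 1" using matrix_left_right_inverse by blast
    then have "?c (A' ** A) = ?c (mat 1)" unfolding map_matrix_of_int_mult map_matrix_of_int_mat_1 .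
    then show ?thesis by (simp add: map_matrix_def vec_eq_iff)
  qed
  have bij: "bij_betw (\<lambda>X :: int^'n^'m. X ** A) UNIV UNIV"
    by (rule bij_betw_byWitness[of _ "\<lambda>X. X ** A'"]) (auto simp: matrix_mul_assoc[symmetric] A A')
  have Ne: "exp (of_real pi * \<i> * gram_trace S X (map_matrix of_int N)) = 1" for X
  proof -
    have "even (\<Sum>i\<in>UNIV. \<Sum>j\<in>UNIV. bilin S (column i X) (column j X) * N $ j $ i)"
    proof (rule even_symmetric_sum)
      show "bilin S (column i X) (column j X) * N $ j $ i = bilin S (column j X) (column i X) * N $ i $ j" for i j
        by (simp only: bilin_commute[OF S(1), of "column i X" "column j X"] symmetric_entry[OF N, of j i])
    qed (use S(2) in auto)
    then obtain l where "(\<Sum>i\<in>UNIV. \<Sum>j\<in>UNIV. bilin S (column i X) (column j X) * N $ j $ i) = 2 * l" by (elim evenE)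
    moreover have "gram_trace S X (map_matrix of_int N) = of_int (\<Sum>i\<in>UNIV. \<Sum>j\<in>UNIV. bilin S (column i X) (column j X) * N $ j $ i)"
      by (simp add: gram_trace_def map_matrix_def)
    ultimately have "of_real pi * \<i> * gram_trace S X (map_matrix of_int N) = of_int (2 * l) * of_real pi * \<i>" by simp
    then show ?thesis by (simp only:) (subst exp_eq_1, auto intro!: exI[of _ l])
  qed
  have "theta_series S (map_matrix of_int A ** Z ** transpose (map_matrix of_int A) + map_matrix of_int N) =
     (\<Sum>\<^sub>\<infinity>X. exp (of_real pi * \<i> * gram_trace S (X ** A) Z))"
    unfolding theta_series_gram gram_trace_add distrib_left exp_add Ne gram_trace_congruence by simp
  also have "\<dots> = theta_series S Z"
    unfolding theta_series_gram by (rule infsum_reindex_bij_betw[OF bij])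
  finally show ?thesis .
qed

text \<open>With lower left block zero, \<open>D\<close> is the inverse transpose of
  \<open>A\<close>, so its determinant is 1 or -1 and disappears in an even power. The action is
  congruence by \<open>A\<close> followed by a symmetric translation.\<close>

lemma transforms_upper:
  fixes S :: "int^'m^'m" and A B D :: "int^'n^'n"
  assumes S: "transpose S = S" "\<And>x. even (bilin S x x)" and sp: "symplectic A B 0 D" and k: "even k"
  shows "transforms k (theta_series S) A B 0 D"
proof -
  have AD: "transpose A ** D = mat 1" and BD: "transpose B ** D = transpose D ** B"
    using sp by (simp_all add: symplectic_def transpose_def zero_vec_def[symmetric] matrix_matrix_mult_def)
  have DA: "D ** transpose A = mat 1"
  proof -
    let ?c = "map_matrix of_int :: int^'n^'n \<Rightarrow> real^'n^'n"
    have "?c (transpose A) ** ?c D = mat 1" unfolding map_matrix_of_int_mult[symmetric] AD by (rule map_matrix_of_int_mat_1)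
    then have "?c D ** ?c (transpose A) = mat 1" using matrix_left_right_inverse by blast
    then have "?c (D ** transpose A) = ?c (mat 1)" unfolding map_matrix_of_int_mult map_matrix_of_int_mat_1 .
    then show ?thesis by (simp add: map_matrix_def vec_eq_iff)
  qed
  have ADt: "A ** transpose D = mat 1" using arg_cong[OF DA, of transpose] by (simp add: matrix_transpose_mul)
  have N: "transpose (B ** transpose A) = B ** transpose A"
  proof -
    have "A ** transpose B = A ** (transpose B ** D) ** transpose A" by (simp add: DA matrix_mul_assoc[symmetric])
    also have "\<dots> = (A ** transpose D) ** B ** transpose A" unfolding BD by (simp add: matrix_mul_assoc)
    finally show ?thesis by (simp add: ADt matrix_transpose_mul)
  qed
  let ?c = "map_matrix of_int :: int^'n^'n \<Rightarrow> complex^'n^'n"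
  have det: "det (?c D) ^ k = 1" "det (?c D) \<noteq> 0"
    using int_det_unit[OF DA] k by (auto simp: det_map_matrix_of_int)
  show ?thesis
    unfolding transforms_def
  proof
    fix Z :: "complex^'n^'n" assume Z: "Z \<in> siegel_space"
    let ?W = "?c A ** Z ** transpose (?c A) + ?c (B ** transpose A)"
    have "transpose (?c A) ** ?c D = mat 1"
      unfolding map_matrix_of_int_transpose[symmetric] map_matrix_of_int_mult[symmetric] AD by (rule map_matrix_of_int_mat_1)
    then have W: "?c A ** Z + ?c B = ?W ** ?c D"
      by (simp add: matrix_add_rdistrib matrix_mul_assoc[symmetric] map_matrix_of_int_mult map_matrix_of_int_transpose)
    have "?c (0 :: int^'n^'n) ** Z = 0"
      by (simp add: map_matrix_def matrix_matrix_mult_def vec_eq_iff)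
    then show "\<exists>W\<in>siegel_space. ?c A ** Z + ?c B = W ** (?c 0 ** Z + ?c D) \<and> det (?c 0 ** Z + ?c D) \<noteq> 0 \<and>
        theta_series S W = det (?c 0 ** Z + ?c D) ^ k * theta_series S Z"
      using siegel_space_affine[OF Z ADt N] theta_affine[OF S ADt N, of Z] det W
      by (intro bexI[of _ ?W]) auto
  qed
qed

lemma transforms_partial_inversion:
  fixes S :: "int^24^24" and p :: "'n::finite"
  assumes S: "unimodular S"
  shows "transforms 12 (theta_series S :: complex^'n^'n \<Rightarrow> complex)
           (mat 1 - unit_entry p p 1) (- unit_entry p p 1) (unit_entry p p 1) (mat 1 - unit_entry p p 1)"
  unfolding transforms_def
proof
  fix Z :: "complex^'n^'n" assume Z: "Z \<in> siegel_space"
  let ?c = "map_matrix of_int :: int^'n^'n \<Rightarrow> complex^'n^'n"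
  let ?\<tau> = "Z $ p $ p" and ?W = "partial_inversion p Z"
  let ?Q = "?c (unit_entry p p 1) ** Z + ?c (mat 1 - unit_entry p p 1)"
  have \<tau>: "?\<tau> \<noteq> 0" using siegel_diag_Im_pos[OF Z, of p] by auto
  have e: "(?c (unit_entry p p 1) ** X) $ i $ j = (if i = p then X $ p $ j else 0)" for X i j
  proof -
    have "(\<Sum>l\<in>UNIV. of_int (if i = p \<and> l = p then 1 else 0) * X $ l $ j) = (\<Sum>l\<in>UNIV. if l = p then (if i = p then X $ p $ j else 0) else 0)"
      by (intro sum.cong) auto
    then show ?thesis by (simp add: matrix_matrix_mult_def unit_entry_def map_matrix_def)
  qed
  have f: "?c (mat 1 - unit_entry p p 1) $ i $ j = (if i = j \<and> i \<noteq> p then 1 else 0)" for i j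
    by (auto simp: map_matrix_def mat_def unit_entry_def)
  define Q0 where "Q0 = ?Q"
  \<comment> \<open>The denominator is the identity matrix with row \<open>p\<close> replaced by row
    \<open>p\<close> of \<open>Z\<close>; expanding that row gives the determinant
    \<open>?\<tau>\<close>.\<close>
  have Q: "Q0 $ i $ j = (if i = p then Z $ p $ j else if i = j then 1 else 0)" for i j
    unfolding Q0_def vector_add_component e f by auto
  have "?c (mat 1 - unit_entry p p 1) ** Z + ?c (- unit_entry p p 1) = ?W ** Q0"
  proof -
    have 1: "(?c (mat 1 - unit_entry p p 1) ** Z + ?c (- unit_entry p p 1)) $ i $ j =
        (if i = p then (if j = p then -1 else 0) else Z $ i $ j)" for i j
    proof -
      have "?c (mat 1 - unit_entry p p 1) = mat 1 - ?c (unit_entry p p 1)"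
        by (auto simp: map_matrix_def mat_def vec_eq_iff)
      then have "(?c (mat 1 - unit_entry p p 1) ** Z) $ i $ j = Z $ i $ j - (if i = p then Z $ p $ j else 0)"
        by (simp add: matrix_diff_rdistrib e)
      then show ?thesis by (simp add: map_matrix_def unit_entry_def)
    qed
    have 2: "(?W ** Q0) $ i $ j = ?W $ i $ p * Z $ p $ j + (if j = p then 0 else ?W $ i $ j)" for i j
    proof -
      have "(?W ** Q0) $ i $ j = (\<Sum>l\<in>UNIV. ?W $ i $ l * Q0 $ l $ j)" by (simp add: matrix_matrix_mult_def)
      also have "\<dots> = ?W $ i $ p * Z $ p $ j + (\<Sum>l\<in>-{p}. ?W $ i $ l * Q0 $ l $ j)"
        by (subst sum_split_index[of _ p]) (simp only: Q simp_thms if_True)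
      also have "(\<Sum>l\<in>-{p}. ?W $ i $ l * Q0 $ l $ j) = (\<Sum>l\<in>-{p}. if l = j then ?W $ i $ l else 0)"
        unfolding Q by (intro sum.cong) auto
      finally show ?thesis by simp
    qed
    show ?thesis unfolding vec_eq_iff 1 2 using \<tau> by (auto simp: partial_inversion_def)
  qed
  moreover have "det Q0 = ?\<tau>"
  proof -
    let ?R = "\<lambda>v. (\<chi> i. if i = p then v else row i Q0) :: complex^'n^'n"
    have "Q0 = ?R (row p Z)"
      by (simp add: vec_eq_iff row_def Q)
    moreover have "det (?R (row p Z)) = ?\<tau>"
    proof -
      have "row p Z = (\<Sum>j\<in>UNIV. (Z $ p $ j) *s axis j 1)"
        by (simp add: vec_eq_iff row_def axis_def if_distrib[of "\<lambda>x. _ * x"] cong: if_cong)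
      then have "det (?R (row p Z)) = (\<Sum>j\<in>UNIV. det (?R ((Z $ p $ j) *s axis j 1)))"
        by (simp only:) (rule det_linear_row_sum, simp)
      also have "\<dots> = (\<Sum>j\<in>UNIV. Z $ p $ j * det (?R (axis j 1)))"
        by (simp only: det_row_mul)
      also have "\<dots> = (\<Sum>j\<in>UNIV. if j = p then ?\<tau> else 0)"
      proof (rule sum.cong[OF refl])
        fix j
        show "Z $ p $ j * det (?R (axis j 1)) = (if j = p then ?\<tau> else 0)"
        proof (cases "j = p")
          case True
          have "?R (axis j 1) = mat 1"
            using True by (auto simp: vec_eq_iff row_def Q axis_def mat_def)
          then show ?thesis using True by simp
        next
          case False
          have "det (?R (axis j 1)) = 0"
            by (rule det_identical_rows[of p j]) (use False in \<open>auto simp: vec_eq_iff row_def Q axis_def\<close>)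
          then show ?thesis using False by simp
        qed
      qed
      finally show ?thesis by simp
    qed
    ultimately show ?thesis by simp
  qed
  ultimately show "\<exists>W\<in>siegel_space.
       ?c (mat 1 - unit_entry p p 1) ** Z + ?c (- unit_entry p p 1) = W ** ?Q \<and>
       det ?Q \<noteq> 0 \<and> theta_series S W = det ?Q ^ 12 * theta_series S Z"
    unfolding Q0_def[symmetric] using \<tau> partial_inversion_siegel[OF Z] theta_partial_inversion[OF S Z]
    by (intro bexI[of _ ?W]) auto
qed

lemma symplectic_inverse_inversion:
  "symplectic (mat 1 - unit_entry p p 1) (unit_entry p p 1) (- unit_entry p p 1) (mat 1 - unit_entry p p 1)"
proof -
  have t: "transpose (mat 1 - unit_entry p p 1) = mat 1 - unit_entry p p 1" "transpose (- unit_entry p p 1) = - unit_entry p p 1"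
    by (auto simp: transpose_def unit_entry_def mat_def vec_eq_iff)
  show ?thesis
    unfolding symplectic_def t transpose_unit_entry
    by (simp add: matrix_diff_ldistrib matrix_diff_rdistrib matrix_minus_mult unit_entry_mult_unit_entry)
qed

section \<open>Reduction of symplectic matrices by row operations\<close>

locale even_unimodular =
  fixes S :: "int^24^24"
  assumes unimod: "unimodular S" and even_norm: "\<And>x. even (bilin S x x)"
begin

abbreviation reach where "reach \<equiv> reaches 12 (theta_series S :: complex^'n^'n \<Rightarrow> complex)"

lemma upper: "symplectic A B 0 D \<Longrightarrow> transforms 12 (theta_series S) A B 0 D"
  by (rule transforms_upper[OF unimodular_sym[OF unimod] even_norm]) auto

text \<open>In the row operations the blocks \<open>B'\<close> and \<open>D'\<close> stay
  unspecified: the reduction looks at \<open>A\<close> and \<open>C\<close> only, and what is needed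
  of the other blocks follows from the symplectic relations.\<close>

lemma reach_swap:
  "\<exists>B' D'. reach (A, B, C, D)
     ((\<chi> a. if a = i then C $ a else A $ a), B', (\<chi> a. if a = i then - A $ a else C $ a), D')"
proof -
  let ?E = "unit_entry i i 1"
  have "reach (A, B, C, D) ((mat 1 - ?E) ** A + ?E ** C, (mat 1 - ?E) ** B + ?E ** D,
      (- ?E) ** A + (mat 1 - ?E) ** C, (- ?E) ** B + (mat 1 - ?E) ** D)"
    by (rule reaches_left_mult[OF symplectic_inverse_inversion transforms_partial_inversion[OF unimod, of i]])
       (simp_all add: vec_eq_iff matrix_diff_rdistrib matrix_minus_mult unit_entry_mult, auto simp: unit_entry_def mat_def)
  moreover have "(mat 1 - ?E) ** A + ?E ** C = (\<chi> a. if a = i then C $ a else A $ a)"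
    by (auto simp: vec_eq_iff matrix_diff_rdistrib unit_entry_mult)
  moreover have "(- ?E) ** A + (mat 1 - ?E) ** C = (\<chi> a. if a = i then - A $ a else C $ a)"
    by (auto simp: vec_eq_iff matrix_diff_rdistrib matrix_minus_mult unit_entry_mult)
  ultimately show ?thesis by metis
qed

lemma reach_translate:
  "\<exists>B' D'. reach (A, B, C, D) ((\<chi> a. if a = i then A $ a + k *s C $ a else A $ a), B', C, D')"
proof -
  let ?E = "\<lambda>k. unit_entry i i k"
  have sp: "symplectic (mat 1) (?E k) 0 (mat 1)" for k
    unfolding symplectic_def transpose_unit_entry by (simp add: matrix_zero_mult transpose_zero)
  have "reach (A, B, C, D) (mat 1 ** A + ?E k ** C, mat 1 ** B + ?E k ** D, 0 ** A + mat 1 ** C, 0 ** B + mat 1 ** D)"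
    by (rule reaches_left_mult[OF sp upper[OF sp, of "- k"]])
       (simp_all add: unit_entry_minus matrix_zero_mult)
  moreover have "mat 1 ** A + ?E k ** C = (\<chi> a. if a = i then A $ a + k *s C $ a else A $ a)"
    by (auto simp: vec_eq_iff unit_entry_mult)
  moreover have "0 ** A + mat 1 ** C = C"
    by (simp add: matrix_zero_mult)
  ultimately show ?thesis by metis
qed

text \<open>A row operation on \<open>A\<close> is accompanied by the inverse transpose operation on
  \<open>C\<close>, hence the exchanged roles of \<open>i\<close> and \<open>j\<close> and the
  sign.\<close>

lemma reach_transvection:
  assumes "i \<noteq> j"
  shows "\<exists>B' D'. reach (A, B, C, D)
     ((\<chi> a. if a = i then A $ a + k *s A $ j else A $ a), B', (\<chi> a. if a = j then C $ a - k *s C $ i else C $ a), D')"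
proof -
  let ?U = "\<lambda>k. mat 1 + unit_entry i j k" and ?V = "\<lambda>k. mat 1 - unit_entry j i k"
  have sp: "symplectic (?U k) 0 0 (?V k)" for k
    unfolding symplectic_def using assms
    by (simp add: transpose_add transpose_unit_entry matrix_diff_ldistrib matrix_add_rdistrib unit_entry_mult_unit_entry
          matrix_zero_mult transpose_zero)
  have "reach (A, B, C, D) (?U k ** A + 0 ** C, ?U k ** B + 0 ** D, 0 ** A + ?V k ** C, 0 ** B + ?V k ** D)"
    by (rule reaches_left_mult[OF sp upper[OF sp, of "- k"]])
       (use assms in \<open>simp_all add: matrix_zero_mult unit_entry_minus matrix_diff_ldistrib matrix_add_rdistrib matrix_add_ldistrib
          matrix_diff_rdistrib matrix_minus_mult unit_entry_mult_unit_entry\<close>)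
  moreover have "?U k ** A + 0 ** C = (\<chi> a. if a = i then A $ a + k *s A $ j else A $ a)"
    by (auto simp: vec_eq_iff unit_entry_mult matrix_zero_mult matrix_add_rdistrib)
  moreover have "0 ** A + ?V k ** C = (\<chi> a. if a = j then C $ a - k *s C $ i else C $ a)"
    by (auto simp: vec_eq_iff unit_entry_mult matrix_zero_mult matrix_diff_rdistrib)
  ultimately show ?thesis by metis
qed

text \<open>Euclid's algorithm on the entries of \<open>A\<close> and \<open>C\<close> in row
  \<open>i\<close> and column \<open>l\<close>: a translation replaces the upper entry by a
  remainder, and a swap exchanges the roles. The last clause records that columns already cleared in
  this row stay cleared.\<close>

lemma reach_clear_lower:
  "\<exists>A' B' C' D'. reach (A, B, C, D) (A', B', C', D') \<and> C' $ i $ l = 0 \<and>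
     (\<forall>j. j \<noteq> i \<longrightarrow> A' $ j = A $ j \<and> C' $ j = C $ j) \<and>
     (\<forall>m. A $ i $ m = 0 \<and> C $ i $ m = 0 \<longrightarrow> A' $ i $ m = 0 \<and> C' $ i $ m = 0)"
proof (induction "nat \<bar>C $ i $ l\<bar>" arbitrary: A B C D rule: less_induct)
  case less
  show ?case
  proof (cases "C $ i $ l = 0")
    case True
    then show ?thesis using reaches_refl by blast
  next
    case False
    define q where "q = A $ i $ l div C $ i $ l"
    define A1 where "A1 = (\<chi> a. if a = i then A $ a + (- q) *s C $ a else A $ a)"
    define A2 where "A2 = (\<chi> a. if a = i then C $ a else A1 $ a)"
    define C2 where "C2 = (\<chi> a. if a = i then - A1 $ a else C $ a)"
    obtain B1 D1 where r1: "reach (A, B, C, D) (A1, B1, C, D1)"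
      using reach_translate[of A B C D i "- q"] unfolding A1_def by blast
    obtain B2 D2 where r2: "reach (A1, B1, C, D1) (A2, B2, C2, D2)"
      using reach_swap[of A1 B1 C D1 i] unfolding A2_def C2_def by blast
    have "C2 $ i $ l = - (A $ i $ l mod C $ i $ l)"
      by (simp add: C2_def A1_def q_def minus_div_mult_eq_mod[symmetric])
    then have "nat \<bar>C2 $ i $ l\<bar> < nat \<bar>C $ i $ l\<bar>"
      using False abs_mod_less[of "C $ i $ l" "A $ i $ l"] by simp
    from less[OF this, of A2 B2 D2] obtain A' B' C' D' where
      r3: "reach (A2, B2, C2, D2) (A', B', C', D')" "C' $ i $ l = 0"
        "\<forall>j. j \<noteq> i \<longrightarrow> A' $ j = A2 $ j \<and> C' $ j = C2 $ j"
        "\<forall>m. A2 $ i $ m = 0 \<and> C2 $ i $ m = 0 \<longrightarrow> A' $ i $ m = 0 \<and> C' $ i $ m = 0" by blast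
    have "reach (A, B, C, D) (A', B', C', D')"
      by (rule reaches_trans[OF r1 reaches_trans[OF r2 r3(1)]])
    moreover have "\<forall>j. j \<noteq> i \<longrightarrow> A' $ j = A $ j \<and> C' $ j = C $ j"
      using r3(3) by (simp add: A2_def C2_def A1_def)
    moreover have "\<forall>m. A $ i $ m = 0 \<and> C $ i $ m = 0 \<longrightarrow> A' $ i $ m = 0 \<and> C' $ i $ m = 0"
      using r3(4) by (simp add: A2_def C2_def A1_def)
    ultimately show ?thesis using r3(2) by blast
  qed
qed

text \<open>Euclid's algorithm between two rows of \<open>A\<close>. The accompanying changes of
  \<open>C\<close> mix the same two rows, so columns already cleared in both of them stay
  cleared.\<close>

lemma reach_clear_upper:
  assumes "i \<noteq> j"
  shows "\<exists>A' B' C' D'. reach (A, B, C, D) (A', B', C', D') \<and> A' $ j $ l = 0 \<and>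
     (\<forall>h. h \<noteq> i \<longrightarrow> h \<noteq> j \<longrightarrow> A' $ h = A $ h \<and> C' $ h = C $ h) \<and>
     (\<forall>m. A $ i $ m = 0 \<and> A $ j $ m = 0 \<longrightarrow> A' $ i $ m = 0 \<and> A' $ j $ m = 0) \<and>
     (\<forall>m. C $ i $ m = 0 \<and> C $ j $ m = 0 \<longrightarrow> C' $ i $ m = 0 \<and> C' $ j $ m = 0)"
proof (induction "nat \<bar>A $ j $ l\<bar>" arbitrary: A B C D rule: less_induct)
  case less
  show ?case
  proof (cases "A $ j $ l = 0")
    case True
    then show ?thesis using reaches_refl by blast
  next
    case False
    define q where "q = A $ i $ l div A $ j $ l"
    \<comment> \<open>Adding \<open>1 - q\<close> times row \<open>j\<close> leaves remainder plus
      divisor in row \<open>i\<close>; subtracting row \<open>i\<close> from row \<open>j\<close>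
      then leaves minus the remainder there. The rows need not be exchanged.\<close>
    define A1 where "A1 = (\<chi> a. if a = i then A $ a + (1 - q) *s A $ j else A $ a)"
    define C1 where "C1 = (\<chi> a. if a = j then C $ a - (1 - q) *s C $ i else C $ a)"
    define A2 where "A2 = (\<chi> a. if a = j then A1 $ a + (- 1) *s A1 $ i else A1 $ a)"
    define C2 where "C2 = (\<chi> a. if a = i then C1 $ a - (- 1) *s C1 $ j else C1 $ a)"
    obtain B1 D1 where r1: "reach (A, B, C, D) (A1, B1, C1, D1)"
      using reach_transvection[OF assms, of A B C D "1 - q"] unfolding A1_def C1_def by blast
    obtain B2 D2 where r2: "reach (A1, B1, C1, D1) (A2, B2, C2, D2)"
      using reach_transvection[of j i A1 B1 C1 D1 "- 1"] assms unfolding A2_def C2_def by blast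
    have "A2 $ j $ l = - (A $ i $ l mod A $ j $ l)"
      using assms by (simp add: A2_def A1_def q_def minus_div_mult_eq_mod[symmetric] algebra_simps)
    then have "nat \<bar>A2 $ j $ l\<bar> < nat \<bar>A $ j $ l\<bar>"
      using False abs_mod_less[of "A $ j $ l" "A $ i $ l"] by simp
    from less[OF this, of B2 C2 D2] obtain A' B' C' D' where
      r3: "reach (A2, B2, C2, D2) (A', B', C', D')" "A' $ j $ l = 0"
        "\<forall>h. h \<noteq> i \<longrightarrow> h \<noteq> j \<longrightarrow> A' $ h = A2 $ h \<and> C' $ h = C2 $ h"
        "\<forall>m. A2 $ i $ m = 0 \<and> A2 $ j $ m = 0 \<longrightarrow> A' $ i $ m = 0 \<and> A' $ j $ m = 0"
        "\<forall>m. C2 $ i $ m = 0 \<and> C2 $ j $ m = 0 \<longrightarrow> C' $ i $ m = 0 \<and> C' $ j $ m = 0" by blast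
    have "reach (A, B, C, D) (A', B', C', D')"
      by (rule reaches_trans[OF r1 reaches_trans[OF r2 r3(1)]])
    moreover have "\<forall>h. h \<noteq> i \<longrightarrow> h \<noteq> j \<longrightarrow> A' $ h = A $ h \<and> C' $ h = C $ h"
      using r3(3) by (simp add: A2_def C2_def A1_def C1_def)
    moreover have "\<forall>m. A $ i $ m = 0 \<and> A $ j $ m = 0 \<longrightarrow> A' $ i $ m = 0 \<and> A' $ j $ m = 0"
      using r3(4) assms by (simp add: A2_def A1_def)
    moreover have "\<forall>m. C $ i $ m = 0 \<and> C $ j $ m = 0 \<longrightarrow> C' $ i $ m = 0 \<and> C' $ j $ m = 0"
      using r3(5) assms by (simp add: C2_def C1_def)
    ultimately show ?thesis using r3(2) by blast
  qed
qed

lemma symplectic_entries: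
  assumes "symplectic A B C D"
  shows "(\<Sum>h\<in>UNIV. A $ h $ l * C $ h $ m) = (\<Sum>h\<in>UNIV. C $ h $ l * A $ h $ m)"
    and "(\<Sum>h\<in>UNIV. A $ h $ l * D $ h $ m) = (\<Sum>h\<in>UNIV. C $ h $ l * B $ h $ m) + of_bool (l = m)"
proof -
  have "(transpose A ** C) $ l $ m = (transpose C ** A) $ l $ m"
    "(transpose A ** D - transpose C ** B) $ l $ m = mat 1 $ l $ m"
    using assms by (simp_all add: symplectic_def)
  then show "(\<Sum>h\<in>UNIV. A $ h $ l * C $ h $ m) = (\<Sum>h\<in>UNIV. C $ h $ l * A $ h $ m)"
    "(\<Sum>h\<in>UNIV. A $ h $ l * D $ h $ m) = (\<Sum>h\<in>UNIV. C $ h $ l * B $ h $ m) + of_bool (l = m)"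
    by (simp_all add: matrix_matrix_mult_def transpose_def mat_def of_bool_def)
qed

text \<open>Row operations bring \<open>C\<close> to zero column by column, after which the case of
  a vanishing lower left block applies. The symplectic relations do part of the work: once a column
  of \<open>C\<close> and the entries of \<open>A\<close> below the diagonal are cleared, a whole
  row of \<open>C\<close> vanishes.\<close>

lemma transforms_symplectic:
  fixes A B C D :: "int^3^3"
  assumes sp: "symplectic A B C D"
  shows "transforms 12 (theta_series S) A B C D"
proof -
  obtain A1 B1 C1 D1 where 1: "reach (A, B, C, D) (A1, B1, C1, D1)" "C1 $ 1 $ 1 = 0"
    using reach_clear_lower[of A B C D 1 1] by blast
  obtain A2 B2 C2 D2 where 2: "reach (A1, B1, C1, D1) (A2, B2, C2, D2)" "C2 $ 2 $ 1 = 0"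
     "\<forall>j. j \<noteq> 2 \<longrightarrow> A2 $ j = A1 $ j \<and> C2 $ j = C1 $ j"
    using reach_clear_lower[of A1 B1 C1 D1 2 1] by blast
  obtain A3 B3 C3 D3 where 3: "reach (A2, B2, C2, D2) (A3, B3, C3, D3)" "C3 $ 3 $ 1 = 0"
     "\<forall>j. j \<noteq> 3 \<longrightarrow> A3 $ j = A2 $ j \<and> C3 $ j = C2 $ j"
    using reach_clear_lower[of A2 B2 C2 D2 3 1] by blast
  have c3: "C3 $ 1 $ 1 = 0" "C3 $ 2 $ 1 = 0" "C3 $ 3 $ 1 = 0"
    using 1 2 3 by simp_all
  obtain A4 B4 C4 D4 where 4: "reach (A3, B3, C3, D3) (A4, B4, C4, D4)" "A4 $ 2 $ 1 = 0"
     "\<forall>h. h \<noteq> 1 \<longrightarrow> h \<noteq> 2 \<longrightarrow> A4 $ h = A3 $ h \<and> C4 $ h = C3 $ h"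
     "\<forall>m. C3 $ 1 $ m = 0 \<and> C3 $ 2 $ m = 0 \<longrightarrow> C4 $ 1 $ m = 0 \<and> C4 $ 2 $ m = 0"
    using reach_clear_upper[of 1 2 A3 B3 C3 D3 1] by auto
  have c4: "C4 $ 1 $ 1 = 0" "C4 $ 2 $ 1 = 0" "C4 $ 3 $ 1 = 0"
    using 4(3,4) c3 by simp_all
  obtain A5 B5 C5 D5 where 5: "reach (A4, B4, C4, D4) (A5, B5, C5, D5)" "A5 $ 3 $ 1 = 0"
     "\<forall>h. h \<noteq> 1 \<longrightarrow> h \<noteq> 3 \<longrightarrow> A5 $ h = A4 $ h \<and> C5 $ h = C4 $ h"
     "\<forall>m. C4 $ 1 $ m = 0 \<and> C4 $ 3 $ m = 0 \<longrightarrow> C5 $ 1 $ m = 0 \<and> C5 $ 3 $ m = 0"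
    using reach_clear_upper[of 1 3 A4 B4 C4 D4 1] by auto
  have c5: "C5 $ 1 $ 1 = 0" "C5 $ 2 $ 1 = 0" "C5 $ 3 $ 1 = 0" and a5: "A5 $ 2 $ 1 = 0" "A5 $ 3 $ 1 = 0"
    using 5(2,3,4) 4(2) c4 by simp_all
  have r5: "reach (A, B, C, D) (A5, B5, C5, D5)"
    by (rule reaches_trans[OF 1(1) reaches_trans[OF 2(1) reaches_trans[OF 3(1) reaches_trans[OF 4(1) 5(1)]]]])
  then have sp5: "symplectic A5 B5 C5 D5" using sp by (simp add: reaches_def)
  \<comment> \<open>The relation between \<open>A\<close> and \<open>D\<close> at position (1, 1)
    reads \<open>A5 $ 1 $ 1 * D5 $ 1 $ 1 = 1\<close>.\<close>
  have ne5: "A5 $ 1 $ 1 \<noteq> 0"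
    using symplectic_entries(2)[OF sp5, of 1 1] a5 c5 by (auto simp: sum_3)
  \<comment> \<open>Symmetry of \<open>transpose A5 ** C5\<close> in row 1: on one side only the
    term with \<open>A5 $ 1 $ 1\<close> survives, and the other side is zero.\<close>
  have row1: "C5 $ 1 $ m = 0" for m
    using symplectic_entries(1)[OF sp5, of 1 m] a5 c5 ne5 by (auto simp: sum_3)
  obtain A6 B6 C6 D6 where 6: "reach (A5, B5, C5, D5) (A6, B6, C6, D6)" "C6 $ 2 $ 2 = 0"
     "\<forall>j. j \<noteq> 2 \<longrightarrow> A6 $ j = A5 $ j \<and> C6 $ j = C5 $ j"
     "\<forall>m. A5 $ 2 $ m = 0 \<and> C5 $ 2 $ m = 0 \<longrightarrow> A6 $ 2 $ m = 0 \<and> C6 $ 2 $ m = 0"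
    using reach_clear_lower[of A5 B5 C5 D5 2 2] by auto
  have c6: "C6 $ 1 $ m = 0" "C6 $ 2 $ 1 = 0" "C6 $ 3 $ 1 = 0" and a6: "A6 $ 2 $ 1 = 0" "A6 $ 3 $ 1 = 0" "A6 $ 1 $ 1 \<noteq> 0" for m
    using 6(3,4) c5 a5 row1 ne5 by simp_all
  obtain A7 B7 C7 D7 where 7: "reach (A6, B6, C6, D6) (A7, B7, C7, D7)" "C7 $ 3 $ 2 = 0"
     "\<forall>j. j \<noteq> 3 \<longrightarrow> A7 $ j = A6 $ j \<and> C7 $ j = C6 $ j"
     "\<forall>m. A6 $ 3 $ m = 0 \<and> C6 $ 3 $ m = 0 \<longrightarrow> A7 $ 3 $ m = 0 \<and> C7 $ 3 $ m = 0"
    using reach_clear_lower[of A6 B6 C6 D6 3 2] by auto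
  have c7: "C7 $ 1 $ m = 0" "C7 $ 2 $ 1 = 0" "C7 $ 3 $ 1 = 0" "C7 $ 2 $ 2 = 0"
    and a7: "A7 $ 2 $ 1 = 0" "A7 $ 3 $ 1 = 0" "A7 $ 1 $ 1 \<noteq> 0" for m
    using 7(3,4) 6(2) c6 a6 by simp_all
  obtain A8 B8 C8 D8 where 8: "reach (A7, B7, C7, D7) (A8, B8, C8, D8)" "A8 $ 3 $ 2 = 0"
     "\<forall>h. h \<noteq> 2 \<longrightarrow> h \<noteq> 3 \<longrightarrow> A8 $ h = A7 $ h \<and> C8 $ h = C7 $ h"
     "\<forall>m. A7 $ 2 $ m = 0 \<and> A7 $ 3 $ m = 0 \<longrightarrow> A8 $ 2 $ m = 0 \<and> A8 $ 3 $ m = 0"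
     "\<forall>m. C7 $ 2 $ m = 0 \<and> C7 $ 3 $ m = 0 \<longrightarrow> C8 $ 2 $ m = 0 \<and> C8 $ 3 $ m = 0"
    using reach_clear_upper[of 2 3 A7 B7 C7 D7 2] by auto
  have c8: "C8 $ 1 $ m = 0" "C8 $ 2 $ 1 = 0" "C8 $ 3 $ 1 = 0" "C8 $ 2 $ 2 = 0" "C8 $ 3 $ 2 = 0"
    and a8: "A8 $ 2 $ 1 = 0" "A8 $ 3 $ 1 = 0" "A8 $ 1 $ 1 \<noteq> 0" "A8 $ 3 $ 2 = 0" for m
    using 8(2,3,4,5) 7(2) c7 a7 by simp_all
  have r8: "reach (A, B, C, D) (A8, B8, C8, D8)"
    by (rule reaches_trans[OF r5 reaches_trans[OF 6(1) reaches_trans[OF 7(1) 8(1)]]])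
  then have sp8: "symplectic A8 B8 C8 D8" using sp by (simp add: reaches_def)
  \<comment> \<open>Position (1, 2) of the relation between \<open>A\<close> and \<open>D\<close>
    removes the contribution of \<open>A8 $ 1 $ 2\<close> at position (2, 2), which then reads
    \<open>A8 $ 2 $ 2 * D8 $ 2 $ 2 = 1\<close>.\<close>
  have "D8 $ 1 $ 2 = 0"
    using symplectic_entries(2)[OF sp8, of 1 2] a8 c8 by (auto simp: sum_3)
  then have ne8: "A8 $ 2 $ 2 \<noteq> 0"
    using symplectic_entries(2)[OF sp8, of 2 2] a8 c8 by (auto simp: sum_3)
  have row2: "C8 $ 2 $ m = 0" for m
    using symplectic_entries(1)[OF sp8, of 2 m] a8 c8 ne8 by (auto simp: sum_3)
  obtain A9 B9 C9 D9 where 9: "reach (A8, B8, C8, D8) (A9, B9, C9, D9)" "C9 $ 3 $ 3 = 0"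
     "\<forall>j. j \<noteq> 3 \<longrightarrow> A9 $ j = A8 $ j \<and> C9 $ j = C8 $ j"
     "\<forall>m. A8 $ 3 $ m = 0 \<and> C8 $ 3 $ m = 0 \<longrightarrow> A9 $ 3 $ m = 0 \<and> C9 $ 3 $ m = 0"
    using reach_clear_lower[of A8 B8 C8 D8 3 3] by auto
  have "C9 = 0"
    unfolding vec_eq_iff forall_3 using 9(2,3,4) c8 a8 row2 by simp
  then have r9: "reach (A, B, C, D) (A9, B9, 0, D9)" using reaches_trans[OF r8 9(1)] by simp
  then have "symplectic A9 B9 0 D9" using sp by (simp add: reaches_def)
  then show ?thesis using upper r9 by (auto simp: reaches_def)
qed

end

lemma transforms_matrix_inv:
  assumes "transforms k F A B C D" "Z \<in> siegel_space"
  shows "F ((map_matrix of_int A ** Z + map_matrix of_int B) ** matrix_inv (map_matrix of_int C ** Z + map_matrix of_int D))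
       = det (map_matrix of_int C ** Z + map_matrix of_int D) ^ k * F Z"
proof -
  let ?Q = "map_matrix of_int C ** Z + map_matrix of_int D"
  obtain W where W: "map_matrix of_int A ** Z + map_matrix of_int B = W ** ?Q" "det ?Q \<noteq> 0"
    "F W = det ?Q ^ k * F Z"
    using assms unfolding transforms_def by blast
  have "invertible ?Q" using W(2) by (simp add: invertible_det_nz)
  then have "?Q ** matrix_inv ?Q = mat 1" unfolding invertible_def matrix_inv_def by (rule someI2_ex) auto
  then show ?thesis unfolding W(1) by (simp add: matrix_mul_assoc[symmetric] W(3))
qed

section \<open>Holomorphy and Fourier expansions of theta series\<close>

lemma pos_definite_int_pos:
  assumes "pos_definite (map_matrix real_of_int S)" "x \<noteq> 0"
  shows "bilin S x x > 0"
proof -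
  have "(of_int_vec x :: real^'a) \<noteq> 0" using assms(2) by (simp add: of_int_vec_eq_0_iff)
  then have "bilin (map_matrix real_of_int S) (of_int_vec x) (of_int_vec x) > 0"
    using assms(1) unfolding pos_definite_def by blast
  then show ?thesis by (simp add: bilin_of_int_vec)
qed

lemma pos_definite_int_nonneg:
  assumes "pos_definite (map_matrix real_of_int S)"
  shows "bilin S x x \<ge> 0"
  using pos_definite_int_pos[OF assms, of x] by (cases "x = 0") auto

lemma pos_definite_int_sym:
  assumes "pos_definite (map_matrix real_of_int S)"
  shows "transpose S = S"
proof -
  have "transpose (map_matrix real_of_int S) = map_matrix real_of_int S"
    using assms unfolding pos_definite_def by blast
  then show ?thesis by (simp add: transpose_def map_matrix_def vec_eq_iff)
qed

lemma bilin_diff_left: "bilin S (x - y) z = bilin S x z - bilin S y z"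
  by (simp add: bilin_def algebra_simps sum_subtractf)

lemma bilin_diff_right: "bilin S z (x - y) = bilin S z x - bilin S z y"
  by (simp add: bilin_def algebra_simps sum_subtractf)

lemma abs_bilin_le:
  assumes S: "pos_definite (map_matrix real_of_int S)"
  shows "2 * \<bar>bilin S x y\<bar> \<le> bilin S x x + bilin S y y"
  using pos_definite_int_nonneg[OF S, of "x + y"] pos_definite_int_nonneg[OF S, of "x - y"]
    bilin_commute[OF pos_definite_int_sym[OF S], of y x]
  by (simp add: bilin_add_left bilin_add_right bilin_diff_left bilin_diff_right)

lemma gram_size_nonneg:
  assumes S: "pos_definite (map_matrix real_of_int S)"
  shows "gram_size S X \<ge> 0"
  unfolding gram_size_def using pos_definite_int_nonneg[OF S] by (intro sum_nonneg) simp

lemma norm_gram_trace_le: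
  fixes W :: "complex^'n^'n"
  assumes S: "pos_definite (map_matrix real_of_int S)"
  shows "norm (gram_trace S X W) \<le> (real CARD('n))\<^sup>2 * norm W * gram_size S X"
proof -
  have b: "\<bar>real_of_int (bilin S (column i X) (column j X))\<bar> \<le> gram_size S X" for i j
  proof -
    have one: "of_int (bilin S (column l X) (column l X)) \<le> gram_size S X" for l
      unfolding gram_size_def
      by (rule member_le_sum[of l UNIV "\<lambda>i. real_of_int (bilin S (column i X) (column i X))"])
         (use pos_definite_int_nonneg[OF S] in auto)
    have "2 * \<bar>real_of_int (bilin S (column i X) (column j X))\<bar> \<le> 
       of_int (bilin S (column i X) (column i X)) + of_int (bilin S (column j X) (column j X))"
      using abs_bilin_le[OF S, of "column i X" "column j X"] by linarith
    then show ?thesis using one[of i] one[of j] by linarith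
  qed
  have W: "norm (W $ j $ i) \<le> norm W" for j i
    using Finite_Cartesian_Product.norm_nth_le[of W j] Finite_Cartesian_Product.norm_nth_le[of "W $ j" i] by linarith
  have "norm (gram_trace S X W) \<le> (\<Sum>i\<in>(UNIV::'n set). \<Sum>j\<in>(UNIV::'n set). gram_size S X * norm W)"
    unfolding gram_trace_def
  proof (intro order.trans[OF norm_sum] sum_mono)
    fix i j
    show "norm (of_int (bilin S (column i X) (column j X)) * W $ j $ i) \<le> gram_size S X * norm W"
      unfolding norm_mult using b[of i j] W[of j i] gram_size_nonneg[OF S, of X] by (intro mult_mono) auto
  qed
  then show ?thesis by (simp add: power2_eq_square mult_ac)
qed

lemma square_le_exp:
  fixes t c :: real
  assumes "t \<ge> 0" "c > 0"
  shows "t\<^sup>2 \<le> (2 / c)\<^sup>2 * exp (c * t)"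
proof -
  have "c * t / 2 \<le> exp (c * t / 2)" using exp_ge_add_one_self[of "c * t / 2"] by linarith
  then have "(c * t / 2)\<^sup>2 \<le> (exp (c * t / 2))\<^sup>2" using assms by (intro power_mono) auto
  also have "(exp (c * t / 2))\<^sup>2 = exp (c * t)" by (simp add: power2_eq_square exp_add[symmetric])
  finally have "(2 / c)\<^sup>2 * (c * t / 2)\<^sup>2 \<le> (2 / c)\<^sup>2 * exp (c * t)" by (intro mult_left_mono) auto
  moreover have "(2 / c)\<^sup>2 * (c * t / 2)\<^sup>2 = t\<^sup>2" using assms by (simp add: power2_eq_square)
  ultimately show ?thesis by simp
qed

lemma has_sum_diff:
  fixes f g :: "'a \<Rightarrow> 'b::topological_ab_group_add"
  assumes "(f has_sum a) A" "(g has_sum b) A"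
  shows "((\<lambda>x. f x - g x) has_sum (a - b)) A"
  using has_sum_add[OF assms(1), of "\<lambda>x. - g x" "- b"] assms(2) by (simp add: has_sum_uminus)

lemma gram_trace_scale: "gram_trace S X (map_matrix (\<lambda>w. c * w) W) = c * gram_trace S X W"
  by (simp add: gram_trace_def map_matrix_def sum_distrib_left mult_ac)

lemma gram_trace_scaleR: "gram_trace S X (r *\<^sub>R W) = of_real r * gram_trace S X W"
  unfolding gram_trace_def by (simp add: sum_distrib_left scaleR_conv_of_real[where 'a = complex] mult_ac)

text \<open>Termwise differentiation. The decay rate \<open>pi * \<mu>\<close> of the terms is spent
  in portions: half of it on the exponential of a small perturbation, a quarter on the square of the
  size in Taylor's remainder, and the last quarter keeps the sum convergent.\<close>

lemma theta_holomorphic: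
  fixes S :: "int^'m^'m"
  assumes S: "pos_definite (map_matrix real_of_int S)"
  shows "holomorphic_siegel (theta_series S :: complex^'n^'n \<Rightarrow> complex)"
  unfolding holomorphic_siegel_def
proof
  fix Z :: "complex^'n^'n" assume Z: "Z \<in> siegel_space"
  obtain \<mu> where mu: "\<mu> > 0" "\<And>X. \<mu> * gram_size S X \<le> Im (gram_trace S X Z)"
    using Im_gram_trace_ge[OF S Z] by blast
  define e where "e X = exp (of_real pi * \<i> * gram_trace S X Z)" for X
  define u where "u X W = of_real pi * \<i> * gram_trace S X W" for X and W :: "complex^'n^'n"
  define \<kappa> where "\<kappa> = pi * (real CARD('n))\<^sup>2"
  have \<kappa>: "\<kappa> > 0" by (simp add: \<kappa>_def)
  have u: "norm (u X W) \<le> \<kappa> * norm W * gram_size S X" for X W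
  proof -
    have "norm (u X W) = pi * norm (gram_trace S X W)" by (simp add: u_def norm_mult)
    also have "\<dots> \<le> pi * ((real CARD('n))\<^sup>2 * norm W * gram_size S X)"
      by (intro mult_left_mono norm_gram_trace_le[OF S]) auto
    finally show ?thesis by (simp add: \<kappa>_def mult_ac)
  qed
  have u_add: "u X (V + W) = u X V + u X W" for X V W by (simp add: u_def gram_trace_add distrib_left)
  have e: "norm (e X) \<le> exp (- (pi * \<mu>) * gram_size S X)" for X
    unfolding e_def norm_exp_gram_trace using mu(2)[of X] by (simp add: mult.assoc)
  have sm: "(\<lambda>X :: int^'n^'m. C * exp (- (pi * \<mu> / 4) * gram_size S X)) summable_on UNIV" for C
    by (intro summable_on_cmult_right summable_exp_gram_size[OF S]) (use mu in simp)
  have q0: "gram_size S X \<ge> 0" for X by (rule gram_size_nonneg[OF S])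
  have q1: "gram_size S X \<le> 4 / (pi * \<mu>) * exp (pi * \<mu> / 4 * gram_size S X)" for X
  proof -
    have "pi * \<mu> / 4 * gram_size S X \<le> exp (pi * \<mu> / 4 * gram_size S X)"
      using exp_ge_add_one_self[of "pi * \<mu> / 4 * gram_size S X"] by linarith
    then show ?thesis using mu by (simp add: field_simps)
  qed
  define F' where "F' W = (\<Sum>\<^sub>\<infinity>X. e X * u X W)" for W
  have bnd1: "norm (e X * u X W) \<le> \<kappa> * norm W * (4 / (pi * \<mu>)) * exp (- (pi * \<mu> / 4) * gram_size S X)" for X W
  proof -
    have "norm (e X * u X W) \<le> exp (- (pi * \<mu>) * gram_size S X) * (\<kappa> * norm W * gram_size S X)"
      unfolding norm_mult by (intro mult_mono e u) auto
    also have "\<dots> \<le> exp (- (pi * \<mu>) * gram_size S X) * (\<kappa> * norm W * (4 / (pi * \<mu>) * exp (pi * \<mu> / 4 * gram_size S X)))"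
      by (intro mult_left_mono q1) (use \<kappa> in auto)
    also have "\<dots> = \<kappa> * norm W * (4 / (pi * \<mu>)) * exp (- (pi * \<mu>) * gram_size S X + pi * \<mu> / 4 * gram_size S X)"
      by (simp only: exp_add) (simp add: mult_ac)
    also have "\<dots> \<le> \<kappa> * norm W * (4 / (pi * \<mu>)) * exp (- (pi * \<mu> / 4) * gram_size S X)"
    proof -
      have "0 \<le> \<mu> * gram_size S X" using mu q0[of X] by simp
      then have "- (pi * \<mu>) * gram_size S X + pi * \<mu> / 4 * gram_size S X \<le> - (pi * \<mu> / 4) * gram_size S X" by simp
      then show ?thesis using \<kappa> mu by (intro mult_left_mono) auto
    qed
    finally show ?thesis .
  qed
  have abs1: "(\<lambda>X. norm (e X * u X W)) summable_on UNIV" for W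
    by (rule summable_on_comparison_test[OF sm bnd1]) auto
  have sum1: "(\<lambda>X. e X * u X W) summable_on UNIV" for W by (rule abs_summable_summable[OF abs1])
  define M where "M = (\<Sum>\<^sub>\<infinity>X :: int^'n^'m. exp (- (pi * \<mu> / 4) * gram_size S X))"
  have M0: "M \<ge> 0" unfolding M_def by (intro infsum_nonneg) auto
  have lin: "bounded_linear F'"
  proof (rule bounded_linear_intro[of _ "\<kappa> * (4 / (pi * \<mu>)) * M"])
    show "F' (V + W) = F' V + F' W" for V W
      unfolding F'_def u_add distrib_left by (rule infsum_add[OF sum1 sum1])
    show "F' (r *\<^sub>R W) = r *\<^sub>R F' W" for r W
    proof -
      have "e X * u X (r *\<^sub>R W) = of_real r * (e X * u X W)" for X
        by (simp add: u_def gram_trace_scaleR mult_ac)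
      then show ?thesis
        unfolding F'_def by (simp only: infsum_cmult_right' scaleR_conv_of_real[where 'a = complex])
    qed
    show "norm (F' W) \<le> norm W * (\<kappa> * (4 / (pi * \<mu>)) * M)" for W
    proof -
      have "norm (F' W) \<le> (\<Sum>\<^sub>\<infinity>X. norm (e X * u X W))"
        unfolding F'_def by (rule norm_infsum_bound[OF abs1])
      also have "\<dots> \<le> (\<Sum>\<^sub>\<infinity>X :: int^'n^'m. \<kappa> * norm W * (4 / (pi * \<mu>)) * exp (- (pi * \<mu> / 4) * gram_size S X))"
        by (intro infsum_mono abs1 sm bnd1)
      also have "\<dots> = norm W * (\<kappa> * (4 / (pi * \<mu>)) * M)"
        unfolding M_def infsum_cmult_right' by (simp add: mult_ac)
      finally show ?thesis .
    qed
  qed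
  define K where "K = \<kappa>\<^sup>2 * (2 / (pi * \<mu> / 4))\<^sup>2"
  have K0: "K \<ge> 0" by (simp add: K_def)
  have remainder: "norm (theta_series S (Z + W) - theta_series S Z - F' W) \<le> K * M * (norm W)\<^sup>2"
    if W: "\<kappa> * norm W \<le> pi * \<mu> / 2" "Z + W \<in> siegel_space" for W
  proof -
    have bnd2: "norm (e X * (exp (u X W) - 1 - u X W)) \<le> K * (norm W)\<^sup>2 * exp (- (pi * \<mu> / 4) * gram_size S X)" for X
    proof -
      let ?q = "gram_size S X"
      have "norm (exp (u X W) - 1 - u X W) \<le> exp \<bar>Re (u X W)\<bar> * norm (u X W) ^ 2"
        using Taylor_exp[of "u X W" 1] by (simp add: numeral_2_eq_2 diff_diff_eq)
      also have "\<dots> \<le> exp (pi * \<mu> / 2 * ?q) * (\<kappa> * norm W * ?q)\<^sup>2"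
      proof (intro mult_mono power_mono u)
        have "\<bar>Re (u X W)\<bar> \<le> \<kappa> * norm W * ?q" using abs_Re_le_cmod[of "u X W"] u[of X W] by linarith
        also have "\<dots> \<le> pi * \<mu> / 2 * ?q" by (intro mult_right_mono W q0)
        finally show "exp \<bar>Re (u X W)\<bar> \<le> exp (pi * \<mu> / 2 * ?q)" by simp
      qed auto
      also have "\<dots> = exp (pi * \<mu> / 2 * ?q) * (\<kappa>\<^sup>2 * (norm W)\<^sup>2 * ?q\<^sup>2)" by (simp add: power_mult_distrib)
      also have "\<dots> \<le> exp (pi * \<mu> / 2 * ?q) * (\<kappa>\<^sup>2 * (norm W)\<^sup>2 * ((2 / (pi * \<mu> / 4))\<^sup>2 * exp (pi * \<mu> / 4 * ?q)))"
        using square_le_exp[OF q0[of X], of "pi * \<mu> / 4"] mu by (intro mult_left_mono) auto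
      finally have r: "norm (exp (u X W) - 1 - u X W) \<le> K * (norm W)\<^sup>2 * (exp (pi * \<mu> / 2 * ?q) * exp (pi * \<mu> / 4 * ?q))"
        by (simp add: K_def mult_ac)
      have "norm (e X * (exp (u X W) - 1 - u X W)) \<le>
          exp (- (pi * \<mu>) * ?q) * (K * (norm W)\<^sup>2 * (exp (pi * \<mu> / 2 * ?q) * exp (pi * \<mu> / 4 * ?q)))"
        unfolding norm_mult by (intro mult_mono e r) auto
      also have "\<dots> = K * (norm W)\<^sup>2 * exp (- (pi * \<mu>) * ?q + (pi * \<mu> / 2 * ?q + pi * \<mu> / 4 * ?q))"
        by (simp only: exp_add) (simp add: mult_ac)
      also have "- (pi * \<mu>) * ?q + (pi * \<mu> / 2 * ?q + pi * \<mu> / 4 * ?q) = - (pi * \<mu> / 4) * ?q"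
        by (simp add: field_simps)
      finally show ?thesis .
    qed
    have abs2: "(\<lambda>X. norm (e X * (exp (u X W) - 1 - u X W))) summable_on UNIV"
      by (rule summable_on_comparison_test[OF sm bnd2]) auto
    have s1: "(e has_sum theta_series S Z) UNIV"
      unfolding theta_series_gram e_def by (rule has_sum_infsum[OF abs_summable_summable[OF theta_abs_summable[OF S Z]]])
    have "exp (of_real pi * \<i> * gram_trace S X (Z + W)) = e X * exp (u X W)" for X
      by (simp add: e_def u_def gram_trace_add distrib_left exp_add)
    then have s2: "((\<lambda>X. e X * exp (u X W)) has_sum theta_series S (Z + W)) UNIV"
      using has_sum_infsum[OF abs_summable_summable[OF theta_abs_summable[OF S W(2)]]] unfolding theta_series_gram by simp
    have "((\<lambda>X. e X * exp (u X W) - e X - e X * u X W) has_sum (theta_series S (Z + W) - theta_series S Z - F' W)) UNIV"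
      unfolding F'_def by (intro has_sum_diff s1 s2 has_sum_infsum sum1)
    moreover have "e X * exp (u X W) - e X - e X * u X W = e X * (exp (u X W) - 1 - u X W)" for X
      by (simp add: algebra_simps)
    ultimately have "theta_series S (Z + W) - theta_series S Z - F' W = (\<Sum>\<^sub>\<infinity>X. e X * (exp (u X W) - 1 - u X W))"
      by (simp add: infsumI)
    also have "norm \<dots> \<le> (\<Sum>\<^sub>\<infinity>X. norm (e X * (exp (u X W) - 1 - u X W)))"
      by (rule norm_infsum_bound[OF abs2])
    also have "\<dots> \<le> (\<Sum>\<^sub>\<infinity>X :: int^'n^'m. K * (norm W)\<^sup>2 * exp (- (pi * \<mu> / 4) * gram_size S X))"
      by (intro infsum_mono abs2 sm bnd2)
    also have "\<dots> = K * M * (norm W)\<^sup>2" unfolding M_def infsum_cmult_right' by (simp add: mult_ac)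
    finally show ?thesis .
  qed
  have "(theta_series S has_derivative F') (at Z within siegel_space)"
    unfolding has_derivative_within'
  proof (intro conjI lin allI impI)
    fix \<epsilon> :: real assume \<epsilon>: "\<epsilon> > 0"
    define \<delta> where "\<delta> = min (pi * \<mu> / 2 / \<kappa>) (\<epsilon> / (K * M + 1))"
    have KM: "K * M + 1 > 0" using K0 M0 by (simp add: add_nonneg_pos)
    have "\<delta> > 0" using \<epsilon> mu \<kappa> KM by (simp add: \<delta>_def)
    moreover have "norm (theta_series S Z' - theta_series S Z - F' (Z' - Z)) / norm (Z' - Z) < \<epsilon>"
      if Z': "Z' \<in> siegel_space" "0 < norm (Z' - Z)" "norm (Z' - Z) < \<delta>" for Z'
    proof -
      let ?W = "Z' - Z"
      have "norm ?W \<le> pi * \<mu> / 2 / \<kappa>" using Z'(3) by (simp add: \<delta>_def)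
      then have "\<kappa> * norm ?W \<le> pi * \<mu> / 2" using \<kappa> by (simp add: pos_le_divide_eq mult_ac)
      then have "norm (theta_series S Z' - theta_series S Z - F' ?W) \<le> K * M * (norm ?W)\<^sup>2"
        using remainder[of ?W] Z'(1) by simp
      then have "norm (theta_series S Z' - theta_series S Z - F' ?W) / norm ?W \<le> K * M * norm ?W"
        using Z'(2) by (simp add: pos_divide_le_eq power2_eq_square mult_ac)
      also have "\<dots> < (K * M + 1) * norm ?W" using Z'(2) by simp
      also have "\<dots> \<le> (K * M + 1) * (\<epsilon> / (K * M + 1))"
        using Z'(3) KM by (intro mult_left_mono) (auto simp: \<delta>_def)
      also have "\<dots> = \<epsilon>" using KM by simp
      finally show ?thesis .
    qed
    ultimately show "\<exists>d>0. \<forall>x'\<in>siegel_space. 0 < norm (x' - Z) \<and> norm (x' - Z) < d \<longrightarrow>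
        norm (theta_series S x' - theta_series S Z - F' (x' - Z)) / norm (x' - Z) < \<epsilon>" by blast
  qed
  moreover have "F' (map_matrix (\<lambda>w. c * w) W) = c * F' W" for c W
  proof -
    have "e X * u X (map_matrix (\<lambda>w. c * w) W) = c * (e X * u X W)" for X
      unfolding u_def gram_trace_scale by (simp only: mult_ac)
    then show ?thesis unfolding F'_def by (simp only: infsum_cmult_right')
  qed
  ultimately show "\<exists>F'. (theta_series S has_derivative F') (at Z within siegel_space) \<and>
      (\<forall>c W. F' (map_matrix (\<lambda>w. c * w) W) = c * F' W)" by blast
qed

section \<open>Uniqueness of Fourier expansions\<close>

lemma abs_summable_tail:
  fixes f :: "'a \<Rightarrow> complex"
  assumes "(\<lambda>x. norm (f x)) summable_on A" "\<epsilon> > 0"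
  obtains F where "finite F" "F \<subseteq> A" "\<And>B. B \<subseteq> A - F \<Longrightarrow> norm (infsum f B) < \<epsilon>"
proof -
  let ?s = "infsum (\<lambda>x. norm (f x)) A"
  have "(sum (\<lambda>x. norm (f x)) \<longlongrightarrow> ?s) (finite_subsets_at_top A)"
    using has_sum_infsum[OF assms(1)] by (simp add: has_sum_def)
  then have "\<forall>\<^sub>F F in finite_subsets_at_top A. sum (\<lambda>x. norm (f x)) F > ?s - \<epsilon>"
    by (rule order_tendstoD) (use assms(2) in simp)
  then obtain F where F: "finite F" "F \<subseteq> A" "sum (\<lambda>x. norm (f x)) F > ?s - \<epsilon>"
    unfolding eventually_finite_subsets_at_top by blast
  have "norm (infsum f B) < \<epsilon>" if B: "B \<subseteq> A - F" for B
  proof -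
    have sB: "(\<lambda>x. norm (f x)) summable_on B" by (rule summable_on_subset_banach[OF assms(1)]) (use B in auto)
    have sF: "(\<lambda>x. norm (f x)) summable_on F" using F by simp
    have "norm (infsum f B) \<le> infsum (\<lambda>x. norm (f x)) B" by (rule norm_infsum_bound[OF sB])
    moreover have "infsum (\<lambda>x. norm (f x)) F + infsum (\<lambda>x. norm (f x)) B = infsum (\<lambda>x. norm (f x)) (F \<union> B)"
      by (rule infsum_Un_disjoint[symmetric, OF sF sB]) (use B in auto)
    moreover have "infsum (\<lambda>x. norm (f x)) (F \<union> B) \<le> ?s"
      by (rule infsum_mono2[OF summable_on_union[OF sF sB] assms(1)]) (use F B in auto)
    ultimately show ?thesis using F by simp
  qed
  then show ?thesis using that F by blast
qed

text \<open>Averaging over the \<open>N\<close>-division points isolates the terms with \<open>\<phi> T \<equiv> m\<close> modulo \<open>N\<close>;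
  then \<open>N\<close> tends to infinity.\<close>

lemma fourier_series_zero:
  fixes h :: "'a \<Rightarrow> complex" and \<phi> :: "'a \<Rightarrow> int"
  assumes abs: "(\<lambda>T. norm (h T)) summable_on A"
    and zero: "\<And>x::real. (\<Sum>\<^sub>\<infinity>T\<in>A. h T * fourier_char (\<phi> T) (of_real x)) = 0"
  shows "(\<Sum>\<^sub>\<infinity>T\<in>{T\<in>A. \<phi> T = m}. h T) = 0"
proof -
  have sm: "(\<lambda>T. h T * fourier_char (\<phi> T) (of_real x)) summable_on A" for x :: real
    by (rule abs_summable_summable) (use abs in \<open>simp add: norm_mult norm_fourier_char\<close>)
  have sub: "h summable_on B" if "B \<subseteq> A" for B
    using abs_summable_summable[OF summable_on_subset_banach[OF abs that]] .
  have modN: "infsum h {T\<in>A. int N dvd \<phi> T - m} = 0" if N: "N > 0" for N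
  proof -
    have hs: "((\<lambda>T. h T * fourier_char (\<phi> T) (of_real x)) has_sum 0) A" for x :: real
      using has_sum_infsum[OF sm, of x] zero[of x] by simp
    have "((\<lambda>T. \<Sum>j<N. fourier_char (- m) (of_nat j / of_nat N) * (h T * fourier_char (\<phi> T) (of_real (real j / real N)))) has_sum (\<Sum>j<N. fourier_char (- m) (of_nat j / of_nat N) * 0)) A"
      by (intro has_sum_finite_sum has_sum_cmult_right hs)
    moreover have "(\<Sum>j<N. fourier_char (- m) (of_nat j / of_nat N) * (h T * fourier_char (\<phi> T) (of_real (real j / real N)))) =
        of_nat N * (if int N dvd \<phi> T - m then h T else 0)" for T
    proof -
      have "fourier_char (- m) (of_nat j / of_nat N) * (h T * fourier_char (\<phi> T) (of_real (real j / real N))) =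
          h T * fourier_char (\<phi> T - m) (of_nat j / of_nat N)" for j
        using fourier_char_add[of "\<phi> T" "- m" "of_nat j / of_nat N"] by simp
      then show ?thesis by (simp only: sum_distrib_left[symmetric] sum_fourier_char[OF N]) simp
    qed
    ultimately have "((\<lambda>T. of_nat N * (if int N dvd \<phi> T - m then h T else 0)) has_sum 0) A" by simp
    then have "(\<Sum>\<^sub>\<infinity>T\<in>A. of_nat N * (if int N dvd \<phi> T - m then h T else 0)) = 0" by (rule infsumI)
    then have "(\<Sum>\<^sub>\<infinity>T\<in>A. if int N dvd \<phi> T - m then h T else 0) = 0"
      using N by (simp add: infsum_cmult_right')
    moreover have "(\<Sum>\<^sub>\<infinity>T\<in>A. if int N dvd \<phi> T - m then h T else 0) = infsum h {T\<in>A. int N dvd \<phi> T - m}"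
      by (rule infsum_cong_neutral) auto
    ultimately show ?thesis by simp
  qed
  have "norm (infsum h {T\<in>A. \<phi> T = m}) < \<epsilon>" if e: "\<epsilon> > 0" for \<epsilon>
  proof -
    obtain F where F: "finite F" "F \<subseteq> A" "\<And>B. B \<subseteq> A - F \<Longrightarrow> norm (infsum h B) < \<epsilon>"
      using abs_summable_tail[OF abs e] by blast
    \<comment> \<open>\<open>N\<close> exceeds the distance of \<open>\<phi> T\<close> from
      \<open>m\<close> for all \<open>T\<close> in the finite set \<open>F\<close>; on
      \<open>F\<close>, congruence modulo \<open>N\<close> therefore means equality.\<close>
    define M where "M = (\<Sum>T\<in>F. nat \<bar>\<phi> T - m\<bar>)"
    define N where "N = Suc M"
    have small: "\<phi> T = m" if "T \<in> F" "int N dvd \<phi> T - m" for T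
    proof (rule ccontr)
      assume "\<phi> T \<noteq> m"
      then have "int N \<le> \<bar>\<phi> T - m\<bar>" using dvd_imp_le_int[OF _ that(2)] by simp
      moreover have "nat \<bar>\<phi> T - m\<bar> \<le> M"
        unfolding M_def by (rule member_le_sum) (use that F in auto)
      ultimately show False by (simp add: N_def)
    qed
    let ?B = "{T\<in>A. int N dvd \<phi> T - m \<and> \<phi> T \<noteq> m}"
    have "infsum h {T\<in>A. int N dvd \<phi> T - m} = infsum h ({T\<in>A. \<phi> T = m} \<union> ?B)"
      by (rule arg_cong[where f = "infsum h"]) auto
    also have "\<dots> = infsum h {T\<in>A. \<phi> T = m} + infsum h ?B"
      by (rule infsum_Un_disjoint) (auto intro: sub)
    finally have "infsum h {T\<in>A. \<phi> T = m} = - infsum h ?B"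
      using modN[of N] by (simp add: N_def eq_neg_iff_add_eq_0)
    moreover have "norm (infsum h ?B) < \<epsilon>" by (rule F(3)) (use small in auto)
    ultimately show ?thesis by simp
  qed
  then have "norm (infsum h {T\<in>A. \<phi> T = m}) = 0"
    by (metis less_irrefl norm_ge_zero order_le_less)
  then show ?thesis by simp
qed

text \<open>Variables are removed one at a time; the character of the removed variable is absorbed
  into \<open>h\<close>, whose norm it does not change.\<close>

lemma fourier_series_zero_multi:
  fixes h :: "'a \<Rightarrow> complex" and \<phi> :: "'p \<Rightarrow> 'a \<Rightarrow> int"
  assumes "finite P" and abs: "(\<lambda>T. norm (h T)) summable_on A"
    and zero: "\<And>x::'p \<Rightarrow> real. (\<Sum>\<^sub>\<infinity>T\<in>A. h T * (\<Prod>p\<in>P. fourier_char (\<phi> p T) (of_real (x p)))) = 0"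
  shows "(\<Sum>\<^sub>\<infinity>T\<in>{T\<in>A. \<forall>p\<in>P. \<phi> p T = m p}. h T) = 0"
  using assms
proof (induction P arbitrary: h rule: finite_induct)
  case empty
  then show ?case by simp
next
  case (insert q P)
  have "(\<Sum>\<^sub>\<infinity>T\<in>{T\<in>A. \<forall>p\<in>P. \<phi> p T = m p}. h T * fourier_char (\<phi> q T) (of_real y)) = 0" for y :: real
  proof (rule insert.IH)
    show "(\<lambda>T. norm (h T * fourier_char (\<phi> q T) (of_real y))) summable_on A"
      using insert.prems(1) by (simp add: norm_mult norm_fourier_char)
    fix x :: "'p \<Rightarrow> real"
    have "(\<Prod>p\<in>insert q P. fourier_char (\<phi> p T) (of_real ((x(q := y)) p))) =
       fourier_char (\<phi> q T) (of_real y) * (\<Prod>p\<in>P. fourier_char (\<phi> p T) (of_real (x p)))" for T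
      using insert.hyps by (simp, intro disjI2 prod.cong) auto
    then show "(\<Sum>\<^sub>\<infinity>T\<in>A. h T * fourier_char (\<phi> q T) (of_real y) * (\<Prod>p\<in>P. fourier_char (\<phi> p T) (of_real (x p)))) = 0"
      using insert.prems(2)[of "x(q := y)"] by (simp only: mult.assoc)
  qed
  moreover have "(\<lambda>T. norm (h T)) summable_on {T\<in>A. \<forall>p\<in>P. \<phi> p T = m p}"
    by (rule summable_on_subset_banach[OF insert.prems(1)]) auto
  ultimately have "(\<Sum>\<^sub>\<infinity>T\<in>{T\<in>{T\<in>A. \<forall>p\<in>P. \<phi> p T = m p}. \<phi> q T = m q}. h T) = 0"
    by (intro fourier_series_zero) auto
  moreover have "{T\<in>{T\<in>A. \<forall>p\<in>P. \<phi> p T = m p}. \<phi> q T = m q} = {T\<in>A. \<forall>p\<in>insert q P. \<phi> p T = m p}"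
    by auto
  ultimately show ?case by simp
qed

text \<open>At the points \<open>I1 + XX x\<close>, with fixed imaginary part, the difference of two
  expansions is an absolutely convergent multiple Fourier series that vanishes identically. Its
  frequencies are the integers \<open>2 * T $ i $ j\<close>, which determine \<open>T\<close>. This
  makes the definite description \<open>fourier_coeff\<close> usable.\<close>

lemma fourier_expansion_unique:
  fixes a b :: "'n::finite fourier_exp"
  assumes a: "has_fourier_expansion F a" and b: "has_fourier_expansion F b"
  shows "a = b"
proof
  fix T0 :: "real^'n^'n"
  let ?H = "half_integral_psd :: (real^'n^'n) set"
  show "a T0 = b T0"
  proof (cases "T0 \<in> ?H")
    case False
    then show ?thesis using a b by (simp add: has_fourier_expansion_def)
  next
    case T0: True
    define m where "m p T = \<lfloor>2 * T $ fst p $ snd p\<rfloor>" for p :: "'n \<times> 'n" and T :: "real^'n^'n"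
    have m: "of_int (m p T) = 2 * T $ fst p $ snd p" if "T \<in> ?H" for p T
    proof -
      have "2 * T $ fst p $ snd p \<in> \<int>" using that unfolding half_integral_psd_def by blast
      then show ?thesis by (auto simp: m_def elim!: Ints_cases)
    qed
    define ph where "ph = (\<lambda>(Z :: complex^'n^'n) (T :: real^'n^'n).
      exp (2 * complex_of_real pi * \<i> * trace (map_matrix complex_of_real T ** Z)))"
    define I1 where "I1 = (map_matrix (\<lambda>x. \<i> * of_int x) (mat 1) :: complex^'n^'n)"
    define h where "h T = (a T - b T) * ph I1 T" for T
    \<comment> \<open>The two summands make the matrix symmetric, and they double the pairing with
      \<open>T\<close>, which turns its entries into the integral frequencies
      \<open>m\<close>.\<close>
    define XX where "XX x = ((\<chi> i j. of_real (x (i, j) + x (j, i))) :: complex^'n^'n)" for x :: "'n \<times> 'n \<Rightarrow> real"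
    have trace_eq: "trace (map_matrix complex_of_real T ** Z) = (\<Sum>i\<in>UNIV. \<Sum>j\<in>UNIV. of_real (T $ i $ j) * Z $ j $ i)" for T :: "real^'n^'n" and Z
      unfolding trace_def by (subst matrix_matrix_mult_def) (simp add: map_matrix_def)
    have siegel: "I1 + XX x \<in> siegel_space" for x
    proof -
      have "transpose (I1 + XX x) = I1 + XX x"
        by (auto simp: I1_def XX_def transpose_def map_matrix_def mat_def vec_eq_iff add.commute)
      moreover have "map_matrix Im (I1 + XX x) = map_matrix real_of_int (mat 1)"
        by (auto simp: I1_def XX_def map_matrix_def mat_def vec_eq_iff)
      moreover have "pos_definite (map_matrix real_of_int (mat 1 :: int^'n^'n))"
        by (rule pos_definite_mat_1)
      ultimately show ?thesis by (simp add: siegel_space_def)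
    qed
    have ph_add: "ph (V + W) T = ph V T * ph W T" for V W T
      by (simp add: ph_def trace_eq ring_distribs sum.distrib exp_add)
    have phX: "ph (XX x) T = (\<Prod>p\<in>UNIV. fourier_char (m p T) (of_real (x p)))" if T: "T \<in> ?H" for x T
    proof -
      have sym: "T $ i $ j = T $ j $ i" for i j
        using T unfolding half_integral_psd_def pos_semidefinite_def by (auto intro: symmetric_entry)
      have "(\<Sum>i\<in>UNIV. \<Sum>j\<in>UNIV. T $ i $ j * (x (j, i) + x (i, j))) =
          (\<Sum>i\<in>UNIV. \<Sum>j\<in>UNIV. T $ i $ j * x (j, i)) + (\<Sum>i\<in>UNIV. \<Sum>j\<in>UNIV. T $ i $ j * x (i, j))"
        by (simp add: distrib_left sum.distrib)
      also have "(\<Sum>i\<in>UNIV. \<Sum>j\<in>UNIV. T $ i $ j * x (j, i)) = (\<Sum>i\<in>UNIV. \<Sum>j\<in>UNIV. T $ i $ j * x (i, j))"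
        by (subst sum.swap, subst sym) simp
      also have "\<dots> + \<dots> = (\<Sum>i\<in>UNIV. \<Sum>j\<in>UNIV. of_int (m (i, j) T) * x (i, j))"
        unfolding m[OF T] by (simp add: sum.distrib[symmetric] mult_ac)
      also have "\<dots> = (\<Sum>p\<in>UNIV. of_int (m p T) * x p)"
        by (simp add: sum.cartesian_product UNIV_Times_UNIV[symmetric] del: UNIV_Times_UNIV)
      finally have "trace (map_matrix complex_of_real T ** XX x) = of_real (\<Sum>p\<in>UNIV. of_int (m p T) * x p)"
        unfolding trace_eq XX_def by (simp flip: of_real_mult of_real_add of_real_sum)
      then show ?thesis
        unfolding ph_def fourier_char_def exp_sum[OF finite, symmetric] by (simp add: sum_distrib_left mult_ac)
    qed
    have zero: "((\<lambda>T. (a T - b T) * ph Z T) has_sum 0) ?H" if Z: "Z \<in> siegel_space" for Z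
    proof -
      have "((\<lambda>T. a T * ph Z T) has_sum F Z) ?H" "((\<lambda>T. b T * ph Z T) has_sum F Z) ?H"
        using a b Z unfolding has_fourier_expansion_def ph_def by auto
      from has_sum_diff[OF this] show ?thesis by (simp add: left_diff_distrib)
    qed
    have XX0: "XX (\<lambda>_. 0) = 0" by (simp add: XX_def vec_eq_iff)
    have "h summable_on ?H"
      using zero[OF siegel[of "\<lambda>_. 0"]] unfolding h_def XX0 by (auto simp: summable_on_def)
    then have abs: "(\<lambda>T. norm (h T)) summable_on ?H" by (simp add: summable_on_iff_abs_summable_on_complex)
    have "(\<Sum>\<^sub>\<infinity>T\<in>{T\<in>?H. \<forall>p\<in>UNIV. m p T = m p T0}. h T) = 0"
    proof (rule fourier_series_zero_multi[OF finite abs])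
      fix x :: "'n \<times> 'n \<Rightarrow> real"
      have "(\<Sum>\<^sub>\<infinity>T\<in>?H. h T * (\<Prod>p\<in>UNIV. fourier_char (m p T) (of_real (x p)))) = (\<Sum>\<^sub>\<infinity>T\<in>?H. (a T - b T) * ph (I1 + XX x) T)"
        by (rule infsum_cong) (simp add: h_def ph_add phX)
      also have "\<dots> = 0" using zero[OF siegel] by (rule infsumI)
      finally show "(\<Sum>\<^sub>\<infinity>T\<in>?H. h T * (\<Prod>p\<in>UNIV. fourier_char (m p T) (of_real (x p)))) = 0" .
    qed
    moreover have "{T\<in>?H. \<forall>p\<in>UNIV. m p T = m p T0} = {T0}"
    proof -
      have "T = T0" if T: "T \<in> ?H" "\<forall>p\<in>UNIV. m p T = m p T0" for T
      proof -
        have "T $ i $ j = T0 $ i $ j" for i j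
          using m[OF T(1), of "(i, j)"] m[OF T0, of "(i, j)"] T(2) by simp
        then show ?thesis by (simp add: vec_eq_iff)
      qed
      then show ?thesis using T0 by auto
    qed
    ultimately have "h T0 = 0" by simp
    then show ?thesis by (simp add: h_def ph_def)
  qed
qed

lemma fourier_coeff_eqI: "has_fourier_expansion F a \<Longrightarrow> fourier_coeff F = a"
  unfolding fourier_coeff_def using fourier_expansion_unique by (intro the_equality) auto

section \<open>Representation numbers as Fourier coefficients\<close>

definition representations :: "int^'m^'m \<Rightarrow> real^'n^'n \<Rightarrow> (int^'n^'m) set" where
  "representations S T = {X. \<forall>i j. of_int (bilin S (column i X) (column j X)) = 2 * T $ i $ j}"

text \<open>All representations of \<open>T\<close> have the same \<open>gram_size\<close>, so
  infinitely many would contribute equal positive terms to a convergent sum.\<close>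

lemma finite_representations:
  fixes S :: "int^'m^'m" and T :: "real^'n^'n"
  assumes S: "pos_definite (map_matrix real_of_int S)"
  shows "finite (representations S T)"
proof (rule ccontr)
  assume inf: "infinite (representations S T)"
  let ?c = "\<Sum>i\<in>UNIV. 2 * T $ i $ i"
  have size: "gram_size S X = ?c" if "X \<in> representations S T" for X
    using that unfolding gram_size_def representations_def by simp
  have "(\<lambda>X :: int^'n^'m. exp (- 1 * gram_size S X)) summable_on representations S T"
    by (rule summable_on_subset_banach[OF summable_exp_gram_size[OF S]]) auto
  then have sm: "(\<lambda>X :: int^'n^'m. exp (- ?c)) summable_on representations S T"
    by (rule summable_on_cong[THEN iffD1, rotated]) (simp add: size)
  obtain n :: nat where n: "real n * exp (- ?c) > infsum (\<lambda>X :: int^'n^'m. exp (- ?c)) (representations S T)"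
    using ex_less_of_nat_mult[of "exp (- ?c)"] by auto
  obtain F where F: "F \<subseteq> representations S T" "finite F" "card F = n"
    using infinite_arbitrarily_large[OF inf] by blast
  have "(\<Sum>X\<in>F. exp (- ?c)) \<le> infsum (\<lambda>X :: int^'n^'m. exp (- ?c)) (representations S T)"
    by (rule finite_sum_le_infsum) (use sm F in auto)
  then show False using n F by simp
qed

lemma bilin_gram:
  "bilin (\<chi> i j. real_of_int (bilin S (column i X) (column j X))) v v =
   bilin (map_matrix real_of_int S) (\<Sum>i\<in>UNIV. v $ i *s of_int_vec (column i X)) (\<Sum>i\<in>UNIV. v $ i *s of_int_vec (column i X))"
proof -
  let ?R = "map_matrix real_of_int S"
  have "bilin ?R (\<Sum>i\<in>UNIV. v $ i *s of_int_vec (column i X)) (\<Sum>i\<in>UNIV. v $ i *s of_int_vec (column i X)) =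
     (\<Sum>i\<in>UNIV. \<Sum>j\<in>UNIV. v $ i * (v $ j * real_of_int (bilin S (column i X) (column j X))))"
    unfolding bilin_sum_left bilin_sum_right bilin_scale_left bilin_scale_right bilin_of_int_vec
    by (subst sum.swap) (simp add: sum_distrib_left mult_ac)
  then show ?thesis by (simp add: bilin_def[of "\<chi> i j. _ i j"] mult_ac)
qed

lemma half_gram_psd:
  fixes S :: "int^'m^'m" and X :: "int^'n^'m"
  assumes S: "pos_definite (map_matrix real_of_int S)" and even: "\<And>x. even (bilin S x x)"
  shows "(\<chi> i j. real_of_int (bilin S (column i X) (column j X)) / 2) \<in> half_integral_psd" (is "?G \<in> _")
  unfolding half_integral_psd_def pos_semidefinite_def
proof (intro CollectI conjI allI)
  show "transpose ?G = ?G"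
    by (simp add: transpose_def vec_eq_iff bilin_commute[OF pos_definite_int_sym[OF S], of "column _ X" "column _ X"])
  show "0 \<le> bilin ?G v v" for v
  proof -
    have "bilin ?G v v = bilin (\<chi> i j. real_of_int (bilin S (column i X) (column j X))) v v / 2"
      by (simp add: bilin_def[of "?G"] bilin_def[of "\<chi> i j. _ i j"] sum_divide_distrib)
    moreover have "bilin (\<chi> i j. real_of_int (bilin S (column i X) (column j X))) v v \<ge> 0"
      unfolding bilin_gram using S unfolding pos_definite_def
      by (cases "(\<Sum>i\<in>UNIV. v $ i *s of_int_vec (column i X)) = (0 :: real^'m)") (auto intro: less_imp_le)
    ultimately show ?thesis by simp
  qed
  show "?G $ i $ i \<in> \<int>" for i
  proof -
    obtain k where "bilin S (column i X) (column i X) = 2 * k" using even[of "column i X"] by (elim evenE)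
    then show ?thesis by (simp)
  qed
  show "2 * ?G $ i $ j \<in> \<int>" for i j by (simp)
qed

text \<open>The terms of the theta series are grouped according to half the Gram matrix of the
  columns; each group is a finite set of representations with a common exponential.\<close>

lemma theta_has_fourier_expansion:
  fixes S :: "int^'m^'m"
  assumes S: "pos_definite (map_matrix real_of_int S)" and even: "\<And>x. even (bilin S x x)"
  shows "has_fourier_expansion (theta_series S :: complex^'n^'n \<Rightarrow> complex)
           (\<lambda>T. if T \<in> half_integral_psd then of_nat (card (representations S T)) else 0)"
  unfolding has_fourier_expansion_def
proof (intro conjI ballI allI impI)
  fix Z :: "complex^'n^'n" assume Z: "Z \<in> siegel_space"
  let ?H = "half_integral_psd :: (real^'n^'n) set"
  let ?e = "\<lambda>X :: int^'n^'m. exp (of_real pi * \<i> * gram_trace S X Z)"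
  define G where "G X = (\<chi> i j. real_of_int (bilin S (column i X) (column j X)) / 2)" for X :: "int^'n^'m"
  have G: "G X \<in> ?H" for X unfolding G_def by (rule half_gram_psd[OF S even])
  have rep: "X \<in> representations S T \<longleftrightarrow> T = G X" for X T
  proof -
    have "y = 2 * t \<longleftrightarrow> t = y / 2" for y t :: real by auto
    then show ?thesis
      by (simp only: representations_def mem_Collect_eq vec_eq_iff G_def vec_lambda_beta)
  qed
  have bij: "bij_betw snd (Sigma ?H (representations S)) UNIV"
    by (rule bij_betw_byWitness[of _ "\<lambda>X. (G X, X)"]) (auto simp: rep G)
  have "(?e has_sum theta_series S Z) UNIV"
    unfolding theta_series_gram by (rule has_sum_infsum[OF abs_summable_summable[OF theta_abs_summable[OF S Z]]])
  then have "((\<lambda>z. ?e (snd z)) has_sum theta_series S Z) (Sigma ?H (representations S))"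
    by (subst has_sum_reindex_bij_betw[OF bij])
  then show "((\<lambda>T. (if T \<in> ?H then of_nat (card (representations S T)) else 0) *
      exp (2 * complex_of_real pi * \<i> * trace (map_matrix complex_of_real T ** Z))) has_sum theta_series S Z) ?H"
  proof (rule has_sum_SigmaD)
    fix T assume T: "T \<in> ?H"
    have "?e X = exp (2 * complex_of_real pi * \<i> * trace (map_matrix complex_of_real T ** Z))" if "X \<in> representations S T" for X
    proof -
      have "of_int (bilin S (column i X) (column j X)) = (of_real (2 * T $ i $ j) :: complex)" for i j
        using that unfolding representations_def by (metis (mono_tags, lifting) mem_Collect_eq of_real_of_int_eq)
      then have "gram_trace S X Z = 2 * trace (map_matrix complex_of_real T ** Z)"
        unfolding gram_trace_def trace_def matrix_matrix_mult_def map_matrix_def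
        by (simp add: sum_distrib_left mult.assoc)
      then show ?thesis by (simp add: mult_ac)
    qed
    then have "(\<Sum>X\<in>representations S T. ?e (snd (T, X))) = 
       of_nat (card (representations S T)) * exp (2 * complex_of_real pi * \<i> * trace (map_matrix complex_of_real T ** Z))"
      by simp
    then show "((\<lambda>X. ?e (snd (T, X))) has_sum (if T \<in> ?H then of_nat (card (representations S T)) else 0) *
      exp (2 * complex_of_real pi * \<i> * trace (map_matrix complex_of_real T ** Z))) (representations S T)"
      using T has_sum_finite[OF finite_representations[OF S, of T], of "\<lambda>X. ?e (snd (T, X))"]
      by (simp only: if_True)
  qed
qed simp

lemmas fourier_coeff_theta = fourier_coeff_eqI[OF theta_has_fourier_expansion]

theorem (in even_unimodular) theta_modular:
  "siegel_modular_form 12 (theta_series S :: complex^3^3 \<Rightarrow> complex)"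
proof -
  have pd: "pos_definite (map_matrix real_of_int S)" using unimod by (simp add: unimodular_def)
  show ?thesis
    unfolding siegel_modular_form_def Let_def
    using theta_holomorphic[OF pd] theta_has_fourier_expansion[OF pd even_norm]
      transforms_matrix_inv[OF transforms_symplectic] by blast
qed

section \<open>Isometries of order 23\<close>

lemma funpow_fixed_coprime:
  assumes "(g ^^ a) x = x" "(g ^^ b) x = x" "coprime a b" "a \<noteq> 0"
  shows "g x = x"
proof -
  have mult: "(g ^^ (c * n)) x = x" if "(g ^^ c) x = x" for c n
    using that by (induction n) (auto simp: funpow_add)
  obtain u v where "a * u = b * v + 1"
    using bezout_nat[OF assms(4), of b] assms(3) by (auto simp: coprime_iff_gcd_eq_1)
  then have "x = (g ^^ (b * v + 1)) x" using mult[OF assms(1), of u] by simp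
  also have "\<dots> = g ((g ^^ (b * v)) x)" by simp
  also have "\<dots> = g x" using mult[OF assms(2), of v] by simp
  finally show ?thesis by simp
qed

text \<open>Whole orbits are removed: the orbit of a moved point has exactly \<open>p\<close>
  elements, since a shorter return time is coprime to \<open>p\<close> and would make the point
  fixed. The number \<open>k\<close> counts these orbits.\<close>

lemma card_fixed_points_mod_prime:
  fixes g :: "'a \<Rightarrow> 'a"
  assumes p: "prime p" and "finite A" "\<And>x. x \<in> A \<Longrightarrow> g x \<in> A" "\<And>x. x \<in> A \<Longrightarrow> (g ^^ p) x = x"
  shows "\<exists>k. card A = card {x\<in>A. g x = x} + p * k"
  using assms(2-)
proof (induction "card A" arbitrary: A rule: less_induct)
  case less
  show ?case
  proof (cases "\<forall>x\<in>A. g x = x")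
    case True
    then have "{x\<in>A. g x = x} = A" by auto
    then show ?thesis by (intro exI[of _ 0]) simp
  next
    case False
    then obtain x where x: "x \<in> A" "g x \<noteq> x" by blast
    have p0: "p > 0" using p prime_gt_0_nat by blast
    have it: "(g ^^ i) y \<in> A" if "y \<in> A" for i y using that less.prems(2) by (induction i) auto
    define B where "B = (\<lambda>i. (g ^^ i) x) ` {..<p}"
    have "B \<subseteq> A" using it x by (auto simp: B_def)
    have inj: "inj_on (\<lambda>i. (g ^^ i) x) {..<p}"
    proof -
      have False if "i < j" "j < p" "(g ^^ i) x = (g ^^ j) x" for i j
      proof -
        have "(g ^^ (p - i)) ((g ^^ i) x) = (g ^^ (p - i)) ((g ^^ j) x)" using that by simp
        then have "(g ^^ (p - i + i)) x = (g ^^ (p - i + j)) x" by (simp add: funpow_add)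
        moreover have "p - i + i = p" "p - i + j = (j - i) + p" using that by auto
        ultimately have "(g ^^ p) x = (g ^^ (j - i)) ((g ^^ p) x)" by (metis funpow_add o_apply)
        then have "(g ^^ (j - i)) x = x" using less.prems(3)[OF x(1)] by simp
        moreover have "coprime (j - i) p"
          using p that by (metis coprime_commute nat_dvd_not_less prime_imp_coprime_nat zero_less_diff less_imp_diff_less)
        ultimately show False
          using funpow_fixed_coprime[of "j - i" g x p] less.prems(3)[OF x(1)] x(2) that by simp
      qed
      then show ?thesis by (intro linorder_inj_onI) auto
    qed
    then have cB: "card B = p" by (simp add: B_def card_image)
    have gB: "y \<in> B \<longleftrightarrow> g y \<in> B" if y: "y \<in> A" for y
    proof
      assume "y \<in> B"
      then obtain i where i: "i < p" "y = (g ^^ i) x" by (auto simp: B_def)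
      show "g y \<in> B"
      proof (cases "Suc i = p")
        case True
        then have "g y = (g ^^ 0) x" using less.prems(3)[OF x(1)] i by (metis funpow.simps(2) funpow_0 o_apply)
        then show ?thesis using p0 unfolding B_def by blast
      next
        case False
        then have "g y = (g ^^ Suc i) x" "Suc i < p" using i by auto
        then show ?thesis unfolding B_def by blast
      qed
    next
      assume "g y \<in> B"
      then obtain i where i: "i < p" "g y = (g ^^ i) x" by (auto simp: B_def)
      have "y = (g ^^ (p - 1)) (g y)"
        using less.prems(3)[OF y] p0 by (metis Suc_diff_1 funpow_Suc_right o_apply)
      also have "\<dots> = (g ^^ (p - 1 + i)) x" by (simp add: i funpow_add)
      finally have y_eq: "y = (g ^^ (p - 1 + i)) x" .
      show "y \<in> B"
      proof (cases i)
        case 0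
        then have "y = (g ^^ (p - 1)) x" using y_eq by simp
        moreover have "p - 1 < p" using p0 by simp
        ultimately show ?thesis unfolding B_def by blast
      next
        case (Suc l)
        then have "p - 1 + i = l + p" using p0 by simp
        then have "y = (g ^^ l) x" using y_eq less.prems(3)[OF x(1)] by (simp add: funpow_add)
        moreover have "l < p" using Suc i by simp
        ultimately show ?thesis unfolding B_def by blast
      qed
    qed
    have "finite A" by fact
    have cA: "card A = card (A - B) + p"
      using cB \<open>B \<subseteq> A\<close> \<open>finite A\<close> card_mono[of A B] by (simp add: card_Diff_subset finite_subset)
    then have "card (A - B) < card A" using p0 by simp
    moreover have "finite (A - B)" using \<open>finite A\<close> by simp
    moreover have "g y \<in> A - B" if "y \<in> A - B" for y
      using that gB[of y] less.prems(2)[of y] by blast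
    moreover have "(g ^^ p) y = y" if "y \<in> A - B" for y
      using that less.prems(3)[of y] by blast
    ultimately obtain k where k: "card (A - B) = card {x\<in>A - B. g x = x} + p * k"
      using less.hyps[of "A - B"] by blast
    have "g y \<noteq> y" if yB: "y \<in> B" for y
    proof
      assume fixed: "g y = y"
      obtain i where i: "i < p" "y = (g ^^ i) x" using yB by (auto simp: B_def)
      have fy: "(g ^^ l) y = y" for l using fixed by (induction l) auto
      have "(g ^^ (p - i)) y = (g ^^ (p - i + i)) x" by (simp add: i(2) funpow_add)
      also have "p - i + i = p" using i(1) by simp
      also have "(g ^^ p) x = x" using less.prems(3)[OF x(1)] .
      finally have "y = x" using fy by simp
      then show False using fixed x by simp
    qed
    then have "{x\<in>A - B. g x = x} = {x\<in>A. g x = x}" by auto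
    then show ?thesis using k cA by (intro exI[of _ "Suc k"]) simp
  qed
qed

section \<open>Gram determinants of fixed vectors and the congruences modulo 23\<close>

definition gram2 :: "int^'m^'m \<Rightarrow> int^'m \<Rightarrow> int^'m \<Rightarrow> int" where
  "gram2 S x y = bilin S x x * bilin S y y - (bilin S x y)\<^sup>2"

text \<open>The 3 by 3 Gram determinant, written out for a symmetric form; it vanishes on linearly
  dependent vectors.\<close>

definition gram3 :: "int^'m^'m \<Rightarrow> int^'m \<Rightarrow> int^'m \<Rightarrow> int^'m \<Rightarrow> int" where
  "gram3 S x y z = bilin S x x * bilin S y y * bilin S z z + 2 * (bilin S x y * bilin S y z * bilin S x z)
     - bilin S x x * (bilin S y z)\<^sup>2 - bilin S y y * (bilin S x z)\<^sup>2 - bilin S z z * (bilin S x y)\<^sup>2"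

definition same_gram :: "int^'m^'m \<Rightarrow> (int^'m) \<times> (int^'m) \<Rightarrow> (int^'m) \<times> (int^'m) \<Rightarrow> bool" where
  "same_gram S = (\<lambda>(x, y) (x', y'). bilin S x x = bilin S x' x' \<and> bilin S x y = bilin S x' y' \<and> bilin S y y = bilin S y' y')"

text \<open>The rank of the fixed lattice is controlled through \<open>gram3\<close>, its
  discriminant modulo 23 through \<open>gram2\<close>. The pair \<open>x\<^sub>0\<close>,
  \<open>y\<^sub>0\<close> is to yield a coefficient prime to 23: it provides one fixed
  representation by itself, so an upper bound for their number suffices.\<close>

locale isometry23 = even_unimodular +
  fixes g :: "int^24 \<Rightarrow> int^24" and x\<^sub>0 y\<^sub>0 :: "int^24"
  assumes isometry: "\<And>x y. bilin S (g x) (g y) = bilin S x y"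
    and order23: "\<And>x. (g ^^ 23) x = x"
    and fixed_gram2: "\<And>x y. g x = x \<Longrightarrow> g y = y \<Longrightarrow> 23 dvd gram2 S x y"
    and fixed_gram3: "\<And>x y z. g x = x \<Longrightarrow> g y = y \<Longrightarrow> g z = z \<Longrightarrow> gram3 S x y z = 0"
    and fixed_pair: "g x\<^sub>0 = x\<^sub>0" "g y\<^sub>0 = y\<^sub>0" "gram2 S x\<^sub>0 y\<^sub>0 \<noteq> 0"
    and few_fixed_pairs: "card {(x, y). g x = x \<and> g y = y \<and> same_gram S (x, y) (x\<^sub>0, y\<^sub>0)} < 23"
begin

lemma pd: "pos_definite (map_matrix real_of_int S)"
  using unimod by (simp add: unimodular_def)

lemma bilin_sym: "bilin S x y = bilin S y x"
  by (rule bilin_commute[OF pos_definite_int_sym[OF pd]])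

definition act :: "int^'n^24 \<Rightarrow> int^'n^24" where
  "act X = (\<chi> k i. g (column i X) $ k)"

lemma column_act: "column i (act X) = g (column i X)"
  by (simp add: act_def column_def vec_eq_iff)

lemma matrix_eq_columns: "X = Y \<longleftrightarrow> (\<forall>i. column i X = column i Y)"
  by (auto simp: column_def vec_eq_iff)

lemma act_order: "(act ^^ 23) X = X"
proof -
  have "column i ((act ^^ n) X) = (g ^^ n) (column i X)" for n i
    by (induction n) (auto simp: column_act)
  then show ?thesis by (simp add: matrix_eq_columns order23 del: funpow.simps)
qed

lemma card_representations:
  "\<exists>k. card (representations S T) = card {X\<in>representations S T. \<forall>i. g (column i X) = column i X} + 23 * k"
proof -
  have "\<exists>k. card (representations S T) = card {X\<in>representations S T. act X = X} + 23 * k"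
  proof (rule card_fixed_points_mod_prime)
    show "act X \<in> representations S T" if "X \<in> representations S T" for X
      using that by (simp add: representations_def column_act isometry)
  qed (use finite_representations[OF pd] act_order in auto)
  then show ?thesis by (simp add: matrix_eq_columns column_act)
qed

lemma coeff: "T \<in> half_integral_psd \<Longrightarrow> fourier_coeff (theta_series S) T = of_nat (card (representations S T))"
  by (simp add: fourier_coeff_theta[OF pd even_norm])

lemma cong_zero_of_nat: "23 dvd n \<Longrightarrow> cong_zero 23 (of_nat n)"
proof -
  assume "23 dvd n"
  then obtain k where "n = 23 * k" by auto
  then show ?thesis
    unfolding cong_zero_def p_integral_def
    by (intro exI[of _ "of_nat k"] conjI exI[of _ "int k"] exI[of _ 1]) simp_all
qed

lemma cong_zero_of_nat_D:
  assumes "cong_zero 23 (of_nat n)"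
  shows "23 dvd n"
proof -
  obtain y where y: "p_integral 23 y" "of_nat n = of_nat 23 * y"
    using assms unfolding cong_zero_def by blast
  obtain u v :: int where "\<not> int 23 dvd v" "y = of_int u / of_int v"
    using y(1) unfolding p_integral_def by blast
  then have uv: "\<not> 23 dvd v" "of_nat n = (of_nat 23 * (of_int u / of_int v) :: complex)"
    using y(2) by simp_all
  then have "v \<noteq> 0" by auto
  then have "of_int (int n * v) = (of_int (23 * u) :: complex)" using uv(2) by (simp add: field_simps)
  then have "int n * v = 23 * u" by (simp only: of_int_eq_iff)
  then have "23 dvd int n * v" by simp
  moreover have "prime (23::int)" by simp
  ultimately have "23 dvd int n" using uv(1) prime_dvd_mult_iff by blast
  then show ?thesis by presburger
qed

text \<open>\<open>4 * det T\<close> is the Gram determinant of every representation. Either some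
  representation is fixed and 23 divides this determinant, or none is and 23 divides the number of
  representations; the denominator 4 is prime to 23.\<close>

lemma theta_op_cong:
  "expansion_cong_zero 23 (theta_op (fourier_coeff (theta_series S :: complex^2^2 \<Rightarrow> complex)))"
  unfolding expansion_cong_zero_def
proof
  fix T :: "real^2^2" assume T: "T \<in> half_integral_psd"
  let ?n = "card (representations S T)"
  show "cong_zero 23 (theta_op (fourier_coeff (theta_series S)) T)"
  proof (cases "representations S T = {}")
    case True
    then have "theta_op (fourier_coeff (theta_series S)) T = of_nat 0"
      by (simp add: theta_op_def coeff[OF T])
    then show ?thesis using cong_zero_of_nat[of 0] by simp
  next
    case False
    have det: "4 * det T = of_int (gram2 S (column 1 X) (column 2 X))" if "X \<in> representations S T" for X
    proof -
      have e: "2 * T $ i $ j = of_int (bilin S (column i X) (column j X))" for i j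
        using that by (simp add: representations_def)
      have "4 * det T = (2 * T $ 1 $ 1) * (2 * T $ 2 $ 2) - (2 * T $ 1 $ 2) * (2 * T $ 2 $ 1)"
        by (simp add: det_2 algebra_simps)
      then show ?thesis unfolding e gram2_def by (simp add: bilin_sym[of "column 2 X" "column 1 X"] power2_eq_square)
    qed
    obtain X where X: "X \<in> representations S T" using False by blast
    define D where "D = gram2 S (column 1 X) (column 2 X)"
    have D: "det T = of_int D / 4" using det[OF X] by (simp add: D_def)
    have "23 dvd int ?n * D"
    proof (cases "{X\<in>representations S T. \<forall>i. g (column i X) = column i X} = {}")
      case True
      then obtain k where "?n = 23 * k" using card_representations[of T] by (metis (no_types, lifting) add_0 card.empty)
      then show ?thesis by simp
    next
      case False
      then obtain Y where Y: "Y \<in> representations S T" "\<And>i. g (column i Y) = column i Y" by blast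
      have "gram2 S (column 1 Y) (column 2 Y) = D"
        using det[OF Y(1)] D by simp
      then show ?thesis using fixed_gram2[OF Y(2) Y(2), of 1 2] by simp
    qed
    then obtain k where k: "int ?n * D = 23 * k" by blast
    have "theta_op (fourier_coeff (theta_series S)) T = of_int (int ?n * D) / 4"
      by (simp add: theta_op_def coeff[OF T] D)
    also have "\<dots> = of_nat 23 * (of_int k / of_int 4)" unfolding k by simp
    finally have eq: "theta_op (fourier_coeff (theta_series S)) T = of_nat 23 * (of_int k / of_int 4)" .
    show ?thesis
      unfolding cong_zero_def eq p_integral_def
      by (intro exI[of _ "of_int k / of_int 4"] conjI refl exI[of _ k] exI[of _ 4]) auto
  qed
qed

text \<open>A fixed representation would make \<open>8 * det T\<close> a Gram determinant of three
  fixed vectors, hence zero. Without fixed representations all orbits have 23 elements.\<close>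

lemma rank3_cong:
  fixes T :: "real^3^3"
  assumes T: "T \<in> half_integral_psd" and rank: "rank T \<ge> 3"
  shows "cong_zero 23 (fourier_coeff (theta_series S) T)"
proof -
  have "det T \<noteq> 0" using rank det_eq_0_rank[of T] by auto
  have "{X\<in>representations S T. \<forall>i. g (column i X) = column i X} = {}"
  proof (rule ccontr)
    assume "{X\<in>representations S T. \<forall>i. g (column i X) = column i X} \<noteq> {}"
    then obtain X where X: "X \<in> representations S T" "\<And>i. g (column i X) = column i X" by blast
    have e: "2 * T $ i $ j = of_int (bilin S (column i X) (column j X))" for i j
      using X(1) by (simp add: representations_def)
    have "8 * det T = (2 * T $ 1 $ 1) * (2 * T $ 2 $ 2) * (2 * T $ 3 $ 3) + (2 * T $ 1 $ 2) * (2 * T $ 2 $ 3) * (2 * T $ 3 $ 1)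
       + (2 * T $ 1 $ 3) * (2 * T $ 2 $ 1) * (2 * T $ 3 $ 2) - (2 * T $ 1 $ 1) * (2 * T $ 2 $ 3) * (2 * T $ 3 $ 2)
       - (2 * T $ 1 $ 2) * (2 * T $ 2 $ 1) * (2 * T $ 3 $ 3) - (2 * T $ 1 $ 3) * (2 * T $ 2 $ 2) * (2 * T $ 3 $ 1)"
      by (simp add: det_3 algebra_simps)
    also have "\<dots> = of_int (gram3 S (column 1 X) (column 2 X) (column 3 X))"
      unfolding e gram3_def
      by (simp add: bilin_sym[of "column 2 X" "column 1 X"] bilin_sym[of "column 3 X" "column 1 X"]
          bilin_sym[of "column 3 X" "column 2 X"] power2_eq_square mult_ac)
    also have "\<dots> = 0" using fixed_gram3[OF X(2) X(2) X(2)] by simp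
    finally show False using \<open>det T \<noteq> 0\<close> by simp
  qed
  then have "23 dvd card (representations S T)"
    using card_representations[of T] by (metis (no_types, lifting) add_0 card.empty dvd_triv_left)
  then show ?thesis unfolding coeff[OF T] by (rule cong_zero_of_nat)
qed

definition pair_matrix :: "(int^24) \<times> (int^24) \<Rightarrow> int^3^24" where
  "pair_matrix = (\<lambda>(x, y). \<chi> k i. if i = 1 then x $ k else if i = 2 then y $ k else 0)"

lemma column_pair_matrix:
  "column 1 (pair_matrix (x, y)) = x" "column 2 (pair_matrix (x, y)) = y" "column 3 (pair_matrix (x, y)) = 0"
  by (simp_all add: pair_matrix_def column_def vec_eq_iff)

text \<open>The Gram matrix of the given pair is padded by a zero column. Definiteness forces the
  third column of every representation to be zero, so the fixed representations are the fixed pairs,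
  whose number lies strictly between 0 and 23.\<close>

lemma rank2_not_cong:
  "\<exists>T\<in>half_integral_psd. rank T = 2 \<and> \<not> cong_zero 23 (fourier_coeff (theta_series S :: complex^3^3 \<Rightarrow> complex) T)"
proof -
  let ?X = "pair_matrix (x\<^sub>0, y\<^sub>0)"
  define T :: "real^3^3" where "T = (\<chi> i j. real_of_int (bilin S (column i ?X) (column j ?X)) / 2)"
  have T: "T \<in> half_integral_psd" unfolding T_def by (rule half_gram_psd[OF pd even_norm])
  have rep: "X \<in> representations S T \<longleftrightarrow> (\<forall>i j. bilin S (column i X) (column j X) = bilin S (column i ?X) (column j ?X))" for X
    by (simp add: representations_def T_def)
  have g0: "g 0 = 0"
    using isometry[of 0 0] pos_definite_int_pos[OF pd, of "g 0"] by fastforce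
  let ?P = "{(x, y). g x = x \<and> g y = y \<and> same_gram S (x, y) (x\<^sub>0, y\<^sub>0)}"
  have fixed: "{X\<in>representations S T. \<forall>i. g (column i X) = column i X} = pair_matrix ` ?P"
  proof (intro equalityI subsetI)
    fix X assume X: "X \<in> {X\<in>representations S T. \<forall>i. g (column i X) = column i X}"
    have "bilin S (column 3 X) (column 3 X) = 0" using X by (simp add: rep column_pair_matrix)
    then have "column 3 X = 0" using pos_definite_int_pos[OF pd, of "column 3 X"] by fastforce
    then have "X = pair_matrix (column 1 X, column 2 X)"
      by (simp add: matrix_eq_columns forall_3 column_pair_matrix)
    moreover have "(column 1 X, column 2 X) \<in> ?P"
      using X by (simp add: rep column_pair_matrix same_gram_def)
    ultimately show "X \<in> pair_matrix ` ?P" by blast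
  next
    fix X assume "X \<in> pair_matrix ` ?P"
    then obtain x y where xy: "X = pair_matrix (x, y)" "g x = x" "g y = y" "same_gram S (x, y) (x\<^sub>0, y\<^sub>0)" by blast
    then show "X \<in> {X\<in>representations S T. \<forall>i. g (column i X) = column i X}"
      by (simp add: rep forall_3 column_pair_matrix g0 same_gram_def bilin_sym[of y x] bilin_sym[of y\<^sub>0 x\<^sub>0])
  qed
  have "inj pair_matrix"
    by (rule injI) (metis column_pair_matrix(1,2) surj_pair)
  then have card_eq: "card {X\<in>representations S T. \<forall>i. g (column i X) = column i X} = card ?P"
    unfolding fixed by (meson card_image inj_on_subset subset_UNIV)
  have "finite (pair_matrix ` ?P)"
    unfolding fixed[symmetric] using finite_representations[OF pd, of T] by simp
  then have "finite ?P" using \<open>inj pair_matrix\<close> by (meson finite_imageD inj_on_subset subset_UNIV)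
  moreover have "(x\<^sub>0, y\<^sub>0) \<in> ?P" using fixed_pair by (simp add: same_gram_def)
  ultimately have "card ?P > 0" by (auto simp: card_gt_0_iff)
  moreover obtain k where "card (representations S T) = card ?P + 23 * k"
    using card_representations[of T] card_eq by auto
  ultimately have "\<not> 23 dvd card (representations S T)"
    using few_fixed_pairs by (simp add: dvd_add_left_iff nat_dvd_not_less)
  then have "\<not> cong_zero 23 (fourier_coeff (theta_series S :: complex^3^3 \<Rightarrow> complex) T)"
    unfolding coeff[OF T] using cong_zero_of_nat_D by blast
  moreover have "rank T = 2"
  proof -
    let ?p = "T $ 1 $ 1" and ?q = "T $ 1 $ 2" and ?r = "T $ 2 $ 2"
    have Te: "T $ 2 $ 1 = ?q" "T $ 1 $ 3 = 0" "T $ 2 $ 3 = 0" "T $ 3 $ i = 0" for i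
      by (simp_all add: T_def column_pair_matrix bilin_sym[of y\<^sub>0 x\<^sub>0])
    define \<Delta> where "\<Delta> = ?p * ?r - ?q * ?q"
    have "4 * \<Delta> = of_int (gram2 S x\<^sub>0 y\<^sub>0)"
      by (simp add: \<Delta>_def T_def column_pair_matrix gram2_def power2_eq_square algebra_simps)
    then have "\<Delta> \<noteq> 0" using fixed_pair(3) by auto
    have "det T = 0" by (simp add: det_3 Te)
    then have "rank T < 3" using det_eq_0_rank[of T] by simp
    moreover have "rank T \<ge> 2"
    proof -
      let ?B = "{axis 1 1, axis 2 1} :: (real^3) set"
      have \<Delta>1: "?p * ?r / \<Delta> - ?q * ?q / \<Delta> = 1" "?r * ?p / \<Delta> - ?q * ?q / \<Delta> = 1"
        using \<open>\<Delta> \<noteq> 0\<close> by (simp_all add: diff_divide_distrib[symmetric] \<Delta>_def mult.commute)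
      \<comment> \<open>The preimages of the first two unit vectors are the columns of the inverse
        of the upper left 2 by 2 block, padded by zero.\<close>
      have m1: "T *v (\<chi> i. if i = 1 then ?r / \<Delta> else if i = 2 then - ?q / \<Delta> else 0) = axis 1 1"
        using \<Delta>1 by (simp add: vec_eq_iff forall_3 matrix_vector_mult_def sum_3 Te axis_def mult.commute)
      have m2: "T *v (\<chi> i. if i = 1 then - ?q / \<Delta> else if i = 2 then ?p / \<Delta> else 0) = axis 2 1"
        using \<Delta>1 by (simp add: vec_eq_iff forall_3 matrix_vector_mult_def sum_3 Te axis_def mult.commute)
      have "?B \<subseteq> range ((*v) T)"
        using rangeI[of "(*v) T"] unfolding m1[symmetric] m2[symmetric] by blast
      moreover have "independent ?B"
        by (rule independent_mono[OF independent_Basis]) (auto simp: Basis_vec_def)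
      ultimately have "card ?B \<le> dim (range ((*v) T))" by (rule independent_card_le_dim)
      then show ?thesis unfolding rank_dim_range by (simp add: axis_eq_axis)
    qed
    ultimately show ?thesis by simp
  qed
  ultimately show ?thesis using T by blast
qed

theorem theta_singular: "mod_p_singular 23 12 2 (theta_series S :: complex^3^3 \<Rightarrow> complex)"
  unfolding mod_p_singular_def
proof (intro conjI ballI impI)
  show "p_integral 23 (fourier_coeff (theta_series S :: complex^3^3 \<Rightarrow> complex) T)" if "T \<in> half_integral_psd" for T
    unfolding coeff[OF that] p_integral_def by (intro exI[of _ "int _"] exI[of _ 1]) auto
qed (use theta_modular rank3_cong rank2_not_cong in auto)

end

section \<open>Lattices with cyclically permutable coordinates\<close>

definition cycle23 :: "nat \<Rightarrow> nat" where
  "cycle23 i = (if i < 23 then Suc i mod 23 else i)"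

lemma cycle23_less: "i < 24 \<Longrightarrow> cycle23 i < 24"
  by (auto simp: cycle23_def)

lemma cycle23_funpow: "i < 23 \<Longrightarrow> (cycle23 ^^ m) i = (i + m) mod 23"
  by (induction m) (auto simp: cycle23_def mod_Suc_eq)

lemma cycle23_order: "i < 24 \<Longrightarrow> (cycle23 ^^ 23) i = i"
proof (cases "i < 23")
  case True
  then show ?thesis using cycle23_funpow[of i 23] by simp
next
  case False
  assume "i < 24"
  have "(cycle23 ^^ m) 23 = 23" for m by (induction m) (auto simp: cycle23_def)
  then show ?thesis using False \<open>i < 24\<close> by (metis less_antisym Suc_numeral semiring_norm(5) semiring_norm(8) semiring_norm(4) semiring_norm(2))
qed

lemma bij_betw_cycle23: "bij_betw cycle23 {..<24} {..<24}"
proof (rule bij_betw_byWitness[of _ "cycle23 ^^ 22"])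
  show "\<forall>i\<in>{..<24}. (cycle23 ^^ 22) (cycle23 i) = i"
    using cycle23_order funpow_swap1 by (metis funpow_Suc_right lessThan_iff numeral_eq_Suc o_apply pred_numeral_simps(3) BitM.simps semiring_norm)
  show "\<forall>i\<in>{..<24}. cycle23 ((cycle23 ^^ 22) i) = i"
    using cycle23_order by (metis funpow.simps(2) lessThan_iff numeral_eq_Suc o_apply pred_numeral_simps(3) BitM.simps semiring_norm)
  show "cycle23 ` {..<24} \<subseteq> {..<24}" using cycle23_less by auto
  have "(cycle23 ^^ m) i < 24" if "i < 24" for m i using that cycle23_less by (induction m) auto
  then show "(cycle23 ^^ 22) ` {..<24} \<subseteq> {..<24}" by auto
qed

lemma sum_const_but_last:
  fixes v :: "nat \<Rightarrow> int"
  assumes "\<And>i. i < 23 \<Longrightarrow> v i = a"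
  shows "(\<Sum>i<24. v i) = 23 * a + v 23"
proof -
  have "(\<Sum>i<24. v i) = (\<Sum>i<23. v i) + v 23"
    using sum.lessThan_Suc[of v 23] by simp
  then show ?thesis using assms by simp
qed

text \<open>The form \<open>e \<Sum>u\<^sub>i v\<^sub>i - h (\<Sum>u\<^sub>i) (\<Sum>v\<^sub>i)\<close> on vectors \<open>(a, \<dots>, a, b)\<close> and \<open>(a', \<dots>, a', b')\<close>.\<close>

definition fixed_form :: "int \<Rightarrow> int \<Rightarrow> int \<times> int \<Rightarrow> int \<times> int \<Rightarrow> int" where
  "fixed_form e h = (\<lambda>(a, b) (a', b'). e * (23 * a * a' + b * b') - h * ((23 * a + b) * (23 * a' + b')))"

text \<open>\<open>fixed_form\<close> is a binary form of determinant
  \<open>23 * e * (e - 24 * h)\<close>; a Gram determinant is this times the square of the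
  determinant of the coordinates.\<close>

lemma fixed_form_gram2:
  "fixed_form e h u u * fixed_form e h v v - (fixed_form e h u v)\<^sup>2 =
   23 * (e * (e - 24 * h) * (fst u * snd v - fst v * snd u)\<^sup>2)"
  by (simp add: fixed_form_def split_beta power2_eq_square algebra_simps)

text \<open>Three vectors in a space of dimension two; once the coefficients of the binary form are
  collected, this is a polynomial identity.\<close>

lemma fixed_form_gram3:
  "fixed_form e h u u * fixed_form e h v v * fixed_form e h w w + 2 * (fixed_form e h u v * fixed_form e h v w * fixed_form e h u w)
     - fixed_form e h u u * (fixed_form e h v w)\<^sup>2 - fixed_form e h v v * (fixed_form e h u w)\<^sup>2
     - fixed_form e h w w * (fixed_form e h u v)\<^sup>2 = 0"
proof -
  define p q r where "p = 23 * e - 529 * h" and "q = - 23 * h" and "r = e - h"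
  have f: "fixed_form e h u v = p * fst u * fst v + q * (fst u * snd v + snd u * fst v) + r * snd u * snd v" for u v
    by (simp add: fixed_form_def split_beta p_def q_def r_def algebra_simps)
  show ?thesis unfolding f by algebra
qed

text \<open>In the coordinates \<open>n\<close> the form is, up to the factor \<open>c\<close>,
  invariant under permutations, so permuting coordinates is an isometry as soon as the image of the
  lattice is closed under it. That \<open>c\<close> is prime to 23 lets divisibility be read off the
  coordinates; \<open>Q\<close> lists the candidates for fixed pairs.\<close>

theorem isometry23_of_coordinates:
  fixes S :: "int^24^24" and n :: "int^24 \<Rightarrow> nat \<Rightarrow> int"
  assumes S: "even_unimodular S"
    and form: "\<And>x y. c * bilin S x y = e * (\<Sum>i<24. n x i * n y i) - h * ((\<Sum>i<24. n x i) * (\<Sum>i<24. n y i))"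
    and c: "\<not> 23 dvd c"
    and closed: "\<And>x. \<exists>y. \<forall>i<24. n y i = n x (cycle23 i)"
    and x0: "\<exists>x. \<forall>i<24. n x i = (if i < 23 then fst u\<^sub>0 else snd u\<^sub>0)"
    and y0: "\<exists>x. \<forall>i<24. n x i = (if i < 23 then fst v\<^sub>0 else snd v\<^sub>0)"
    and ne: "fst u\<^sub>0 * snd v\<^sub>0 \<noteq> fst v\<^sub>0 * snd u\<^sub>0" "e \<noteq> 0" "e \<noteq> 24 * h"
    and sol: "\<And>u v. fixed_form e h u u = fixed_form e h u\<^sub>0 u\<^sub>0 \<Longrightarrow> fixed_form e h u v = fixed_form e h u\<^sub>0 v\<^sub>0 \<Longrightarrow>
       fixed_form e h v v = fixed_form e h v\<^sub>0 v\<^sub>0 \<Longrightarrow> (u, v) \<in> Q"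
    and Q: "finite Q" "card Q < 23"
  shows "\<exists>g x y. isometry23 S g x y"
proof -
  interpret even_unimodular S by fact
  have pd: "pos_definite (map_matrix real_of_int S)" using unimod by (simp add: unimodular_def)
  have c0: "c \<noteq> 0" using c by auto
  \<comment> \<open>The coordinates determine all inner products and hence, by definiteness, the
    vector.\<close>
  have inj: "x = y" if "\<forall>i<24. n x i = n y i" for x y
  proof -
    have eq: "bilin S x z = bilin S y z" for z
    proof -
      have "(\<Sum>i<24. n x i * n z i) = (\<Sum>i<24. n y i * n z i)" "(\<Sum>i<24. n x i) = (\<Sum>i<24. n y i)"
        using that by (auto intro!: sum.cong)
      then have "c * bilin S x z = c * bilin S y z" unfolding form by simp
      then show ?thesis using c0 by simp
    qed
    have "bilin S (x - y) (x - y) = 0" by (simp add: bilin_diff_left eq)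
    then show ?thesis using pos_definite_int_pos[OF pd, of "x - y"] by fastforce
  qed
  define g where "g x = (SOME y. \<forall>i<24. n y i = n x (cycle23 i))" for x
  have g: "n (g x) i = n x (cycle23 i)" if "i < 24" for x i
    using someI_ex[OF closed[of x]] that unfolding g_def by blast
  have isom: "bilin S (g x) (g y) = bilin S x y" for x y
  proof -
    have "(\<Sum>i<24. n (g x) i * n (g y) i) = (\<Sum>i<24. n x (cycle23 i) * n y (cycle23 i))"
      by (intro sum.cong) (auto simp: g)
    also have "\<dots> = (\<Sum>i<24. n x i * n y i)"
      by (rule sum.reindex_bij_betw[OF bij_betw_cycle23])
    finally have 1: "(\<Sum>i<24. n (g x) i * n (g y) i) = (\<Sum>i<24. n x i * n y i)" .
    have 2: "(\<Sum>i<24. n (g z) i) = (\<Sum>i<24. n z i)" for z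
    proof -
      have "(\<Sum>i<24. n (g z) i) = (\<Sum>i<24. n z (cycle23 i))" by (intro sum.cong) (auto simp: g)
      also have "\<dots> = (\<Sum>i<24. n z i)" by (rule sum.reindex_bij_betw[OF bij_betw_cycle23])
      finally show ?thesis .
    qed
    have "c * bilin S (g x) (g y) = c * bilin S x y" unfolding form 1 2 ..
    then show ?thesis using c0 by simp
  qed
  have order: "(g ^^ 23) x = x" for x
  proof (rule inj, intro allI impI)
    fix i :: nat assume i: "i < 24"
    have "n ((g ^^ m) x) i = n x ((cycle23 ^^ m) i)" if "i < 24" for m i
      using that
    proof (induction m arbitrary: i)
      case (Suc m)
      have "n ((g ^^ Suc m) x) i = n ((g ^^ m) x) (cycle23 i)" using g[OF Suc.prems] by simp
      also have "\<dots> = n x ((cycle23 ^^ m) (cycle23 i))" by (rule Suc.IH[OF cycle23_less[OF Suc.prems]])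
      finally show ?case by (simp only: funpow_Suc_right o_apply)
    qed simp
    then show "n ((g ^^ 23) x) i = n x i" using i cycle23_order by metis
  qed
  define ab where "ab x = (n x 0, n x 23)" for x
  have fixed_n: "n x i = n x 0" if "g x = x" "i < 23" for x i
    using that(2)
  proof (induction i)
    case (Suc i)
    then have "n x i = n x (Suc i)" using g[of i x] that(1) by (simp add: cycle23_def)
    then show ?case using Suc by simp
  qed simp
  have fixed_form: "c * bilin S x y = fixed_form e h (ab x) (ab y)" if "g x = x" "g y = y" for x y
  proof -
    have "(\<Sum>i<24. n x i * n y i) = 23 * (n x 0 * n y 0) + n x 23 * n y 23"
      by (rule sum_const_but_last) (use fixed_n that in metis)
    moreover have "(\<Sum>i<24. n z i) = 23 * n z 0 + n z 23" if "g z = z" for z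
      by (rule sum_const_but_last) (use fixed_n that in metis)
    ultimately show ?thesis using that by (simp add: form fixed_form_def ab_def mult_ac)
  qed
  have fixed_inj: "x = y" if "g x = x" "g y = y" "ab x = ab y" for x y
  proof (rule inj, intro allI impI)
    fix i :: nat assume "i < 24"
    then have "i < 23 \<or> i = 23" by auto
    then show "n x i = n y i" using fixed_n[of x i] fixed_n[of y i] that by (auto simp: ab_def)
  qed
  have exfix: "\<exists>x. g x = x \<and> ab x = u" if ex: "\<exists>x. \<forall>i<24. n x i = (if i < 23 then fst u else snd u)" for u
  proof -
    obtain x where x: "\<And>i. i < 24 \<Longrightarrow> n x i = (if i < 23 then fst u else snd u)" using ex by blast
    have "g x = x"
    proof (rule inj, intro allI impI)
      fix i :: nat assume i: "i < 24"
      then show "n (g x) i = n x i" using cycle23_less[OF i] by (auto simp: g x cycle23_def)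
    qed
    moreover have "ab x = u" using x[of 0] x[of 23] by (simp add: ab_def)
    ultimately show ?thesis by blast
  qed
  obtain x where x: "g x = x" "ab x = u\<^sub>0" using exfix[OF x0] by blast
  obtain y where y: "g y = y" "ab y = v\<^sub>0" using exfix[OF y0] by blast
  have gram2: "c\<^sup>2 * gram2 S x y = 23 * (e * (e - 24 * h) * (fst (ab x) * snd (ab y) - fst (ab y) * snd (ab x))\<^sup>2)"
    if "g x = x" "g y = y" for x y
  proof -
    have "c\<^sup>2 * gram2 S x y = (c * bilin S x x) * (c * bilin S y y) - (c * bilin S x y)\<^sup>2"
      by (simp add: gram2_def power2_eq_square algebra_simps)
    then show ?thesis using that by (simp only: fixed_form fixed_form_gram2)
  qed
  have "isometry23 S g x y"
  proof
    show "bilin S (g x) (g y) = bilin S x y" for x y by (rule isom)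
    show "(g ^^ 23) x = x" for x by (rule order)
    show "23 dvd gram2 S x y" if "g x = x" "g y = y" for x y
    proof -
      have "23 dvd c\<^sup>2 * gram2 S x y" unfolding gram2[OF that] by simp
      moreover have "prime (23::int)" by simp
      moreover have "\<not> 23 dvd c\<^sup>2" using c \<open>prime (23::int)\<close> prime_dvd_power by blast
      ultimately show ?thesis using prime_dvd_mult_iff by blast
    qed
    show "gram3 S x y z = 0" if "g x = x" "g y = y" "g z = z" for x y z
    proof -
      have "c ^ 3 * gram3 S x y z = (c * bilin S x x) * (c * bilin S y y) * (c * bilin S z z)
        + 2 * ((c * bilin S x y) * (c * bilin S y z) * (c * bilin S x z))
        - (c * bilin S x x) * (c * bilin S y z)\<^sup>2 - (c * bilin S y y) * (c * bilin S x z)\<^sup>2 - (c * bilin S z z) * (c * bilin S x y)\<^sup>2"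
        unfolding gram3_def by algebra
      also have "\<dots> = 0" using that by (simp only: fixed_form fixed_form_gram3)
      finally show ?thesis using c0 by simp
    qed
    show "g x = x" "g y = y" by fact+
    show "gram2 S x y \<noteq> 0"
    proof
      assume "gram2 S x y = 0"
      then have "e * (e - 24 * h) * (fst u\<^sub>0 * snd v\<^sub>0 - fst v\<^sub>0 * snd u\<^sub>0)\<^sup>2 = 0"
        using gram2[OF x(1) y(1)] x y by simp
      then show False using ne by simp
    qed
    let ?P = "{(x', y'). g x' = x' \<and> g y' = y' \<and> same_gram S (x', y') (x, y)}"
    have "map_prod ab ab ` ?P \<subseteq> Q"
    proof
      fix z assume "z \<in> map_prod ab ab ` ?P"
      then obtain x' y' where z: "z = (ab x', ab y')" "g x' = x'" "g y' = y'" "same_gram S (x', y') (x, y)" by auto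
      show "z \<in> Q" unfolding z(1)
        by (rule sol) (use z x y in \<open>simp_all add: fixed_form[symmetric] x(2)[symmetric] y(2)[symmetric] same_gram_def\<close>)
    qed
    moreover have "inj_on (map_prod ab ab) ?P"
      by (rule inj_onI) (auto intro: fixed_inj)
    ultimately have "card ?P \<le> card Q" using Q(1) by (intro card_inj_on_le)
    then show "card ?P < 23" using Q(2) by simp
  qed
  then show ?thesis by blast
qed

section \<open>Root systems of type \<open>D\<close> and \<open>A\<close>\<close>

lemma mat_mult_left: "(mat c ** A) $ i $ j = c * A $ i $ j" for c :: "'a::comm_ring_1"
  by (simp add: matrix_matrix_mult_def mat_def if_distrib[of "\<lambda>x. x * _"] cong: if_cong)

lemma mat_mult_right: "(A ** mat c) $ i $ j = c * A $ i $ j" for c :: "'a::comm_ring_1"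
  by (simp add: matrix_matrix_mult_def mat_def if_distrib[of "\<lambda>x. _ * x"] cong: if_cong)

text \<open>The determinant of \<open>A\<close> is non-zero, so \<open>A\<close> can be cancelled
  over the reals in \<open>A ** (B ** A) = A ** mat c\<close>.\<close>

lemma int_matrix_scaled_inverse:
  fixes A B :: "int^'n^'n"
  assumes AB: "A ** B = mat c" and c: "c \<noteq> 0"
  shows "B ** A = mat c"
proof -
  let ?c = "map_matrix of_int :: int^'n^'n \<Rightarrow> real^'n^'n"
  have "det (mat c :: int^'n^'n) = c ^ CARD('n)"
    by (subst det_diagonal) (auto simp: mat_def)
  then have "det A * det B = c ^ CARD('n)" using arg_cong[OF AB, of det] by (simp add: det_mul)
  then have "det A \<noteq> 0" using c by auto
  then have "invertible (?c A)" by (simp add: invertible_det_nz det_map_matrix_of_int)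
  then obtain A' where A': "A' ** ?c A = mat 1" unfolding invertible_def by blast
  have "A ** (B ** A) = A ** mat c"
    unfolding matrix_mul_assoc AB by (simp add: vec_eq_iff mat_mult_left mat_mult_right)
  then have "?c A ** ?c (B ** A) = ?c A ** ?c (mat c)" by (simp only: map_matrix_of_int_mult[symmetric])
  then have "A' ** (?c A ** ?c (B ** A)) = A' ** (?c A ** ?c (mat c))" by simp
  then have "?c (B ** A) = ?c (mat c)" by (simp add: matrix_mul_assoc A')
  then show ?thesis by (simp add: vec_eq_iff map_matrix_nth)
qed

text \<open>\<open>H\<close> is \<open>c\<close> times the inverse of the Gram matrix of the vectors
  \<open>r\<close>. The form is expressed through inner products with these vectors alone, so these
  can serve as coordinates even where the \<open>r i\<close> span only a sublattice.\<close>

lemma bilin_gram_expansion: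
  fixes S H :: "int^'n^'n" and r :: "'n \<Rightarrow> int^'n"
  assumes S: "transpose S = S" and c: "c \<noteq> 0"
    and inv: "\<And>i k. (\<Sum>j\<in>UNIV. bilin S (r i) (r j) * H $ j $ k) = (if i = k then c else 0)"
  shows "c * bilin S x y = (\<Sum>i\<in>UNIV. \<Sum>j\<in>UNIV. bilin S x (r i) * H $ i $ j * bilin S y (r j))"
proof -
  define M :: "int^'n^'n" where "M = (\<chi> k i. r i $ k)"
  define R :: "int^'n^'n" where "R = (\<chi> i k. (S *v r i) $ k)"
  have b: "bilin S x (r i) = (\<Sum>k\<in>UNIV. x $ k * R $ i $ k)" for x i
    by (simp add: bilin_matrix_vector R_def)
  have RM: "(R ** M) $ i $ j = bilin S (r i) (r j)" for i j
  proof -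
    have "(R ** M) $ i $ j = bilin S (r j) (r i)"
      unfolding b by (simp add: matrix_matrix_mult_def M_def mult.commute)
    then show ?thesis using bilin_commute[OF S] by simp
  qed
  have "(R ** (M ** H)) $ i $ k = (mat c :: int^'n^'n) $ i $ k" for i k
    unfolding matrix_mul_assoc using inv[of i k]
    by (subst matrix_matrix_mult_def) (simp add: RM mat_def)
  then have "R ** (M ** H) = mat c" by (simp add: vec_eq_iff)
  then have MHR: "(M ** H) ** R = mat c" by (rule int_matrix_scaled_inverse[OF _ c])
  have "(\<Sum>i\<in>UNIV. \<Sum>j\<in>UNIV. bilin S x (r i) * H $ i $ j * bilin S y (r j)) =
    (\<Sum>i\<in>UNIV. bilin S x (r i) * (\<Sum>l\<in>UNIV. (H ** R) $ i $ l * y $ l))"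
    unfolding b[of y] matrix_matrix_mult_def
    by (simp add: sum_distrib_left sum_distrib_right mult_ac) (rule sum.cong[OF refl], rule sum.swap)
  also have "\<dots> = (\<Sum>i\<in>UNIV. bilin S x (r i) * ((H ** R) *v y) $ i)"
    by (simp add: matrix_vector_mult_def)
  also have "\<dots> = bilin S x (\<Sum>i\<in>UNIV. ((H ** R) *v y) $ i *s r i)"
    by (simp add: bilin_sum_right bilin_scale_right mult.commute)
  also have "(\<Sum>i\<in>UNIV. ((H ** R) *v y) $ i *s r i) = M *v ((H ** R) *v y)"
    by (simp add: vec_eq_iff M_def matrix_vector_mult_def mult.commute)
  also have "\<dots> = mat c *v y"
    unfolding matrix_vector_mul_assoc matrix_mul_assoc[symmetric] using MHR by (simp add: matrix_mul_assoc)
  also have "mat c *v y = c *s y"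
    by (simp add: vec_eq_iff matrix_vector_mult_def mat_def if_distrib[of "\<lambda>x. x * _"] cong: if_cong)
  finally show ?thesis by (simp add: bilin_scale_right)
qed

text \<open>A cycle is a product of transpositions of neighbours, and the transpositions are
  available from reflections in roots.\<close>

lemma closed_cycle23:
  assumes swap: "\<And>x i k. i < 24 \<Longrightarrow> k < 24 \<Longrightarrow> i \<noteq> k \<Longrightarrow>
     \<exists>y. \<forall>l<24. n y l = n x (if l = i then k else if l = k then i else l)"
  shows "\<exists>y. \<forall>i<24. n y i = (n x (cycle23 i) :: int)"
proof -
  have "\<exists>y. \<forall>i<24. n y i = n x (if i < m then Suc i else if i = m then 0 else i)" if "m \<le> 22" for m
    using that
  proof (induction m)
    case 0
    show ?case by (intro exI[of _ x]) auto
  next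
    case (Suc m)
    then obtain y where y: "\<And>i. i < 24 \<Longrightarrow> n y i = n x (if i < m then Suc i else if i = m then 0 else i)" by auto
    obtain z where "\<And>l. l < 24 \<Longrightarrow> n z l = n y (if l = m then Suc m else if l = Suc m then m else l)"
      using swap[of m "Suc m" y] Suc.prems by auto
    then have "n z i = n x (if i < Suc m then Suc i else if i = Suc m then 0 else i)" if "i < 24" for i
      using y that Suc.prems by auto
    then show ?case by blast
  qed
  from this[of 22] obtain y where y: "\<And>i. i < 24 \<Longrightarrow> n y i = n x (if i < 22 then Suc i else if i = 22 then 0 else i)" by auto
  have "(if i < 22 then Suc i else if i = 22 then 0 else i) = cycle23 i" if "i < 24" for i
  proof -
    consider "i < 22" | "i = 22" | "i = 23" using \<open>i < 24\<close> by linarith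
    then show ?thesis by cases (auto simp: cycle23_def)
  qed
  then show ?thesis using y by auto
qed

text \<open>The right-hand side is at most 64, less than 23 times 4, so \<open>a\<close> is at most
  1 in absolute value; and \<open>t\<^sup>2 - 23\<close> is negative or 41, which is not a
  square.\<close>

lemma pell64:
  fixes a b :: int
  assumes "23 * a\<^sup>2 + b\<^sup>2 = t\<^sup>2" "t \<in> {2, 4, 8}"
  shows "a = 0" "b = t \<or> b = - t"
proof -
  have t: "t\<^sup>2 \<le> 64" using assms(2) by auto
  have "23 * a\<^sup>2 \<le> 64" using assms(1) t zero_le_power2[of b] by linarith
  then have "\<bar>a\<bar>\<^sup>2 < 2\<^sup>2" by simp
  then have "\<bar>a\<bar> < 2" by (rule power_less_imp_less_base) simp
  then have "a = 0 \<or> a = 1 \<or> a = -1" by auto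
  moreover have "a\<^sup>2 \<noteq> 1"
  proof
    assume "a\<^sup>2 = 1"
    then have b: "b\<^sup>2 = t\<^sup>2 - 23" using assms(1) by simp
    then have "b\<^sup>2 = 41" using assms(2) zero_le_power2[of b] by auto
    then have "\<bar>b\<bar>\<^sup>2 = 41" by simp
    moreover have "\<bar>b\<bar> \<le> 6 \<or> \<bar>b\<bar> \<ge> 7" by linarith
    ultimately show False using power_mono[of "\<bar>b\<bar>" 6 2] power_mono[of 7 "\<bar>b\<bar>" 2] by auto
  qed
  ultimately show "a = 0" by auto
  then show "b = t \<or> b = - t" using assms(1) by (simp add: power2_eq_iff)
qed

text \<open>The distinguished pair is \<open>t\<close> times the last unit vector and
  \<open>t\<close> times the sum of the others. The norm equations leave only changes of sign, so at
  most four fixed pairs share its Gram matrix. The value of \<open>t\<close> depends on the scaling: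
  2, 4 and 8 occur for the root systems \<open>A_1^24\<close> and \<open>D_24\<close> and for the
  Leech lattice.\<close>

lemma isometry23_of_orthogonal_coordinates:
  fixes S :: "int^24^24" and n :: "int^24 \<Rightarrow> nat \<Rightarrow> int"
  assumes S: "even_unimodular S" and t: "t \<in> {2, 4, 8}"
    and form: "\<And>x y. c * bilin S x y = (\<Sum>i<24. n x i * n y i)"
    and c: "\<not> 23 dvd c"
    and closed: "\<And>x. \<exists>y. \<forall>i<24. n y i = n x (cycle23 i)"
    and x0: "\<exists>x. \<forall>i<24. n x i = (if i < 23 then 0 else t)"
    and y0: "\<exists>x. \<forall>i<24. n x i = (if i < 23 then t else 0)"
  shows "\<exists>g x y. isometry23 S g x y"
proof -
  let ?Q = "{((0, t), (t, 0)), ((0, t), (- t, 0)), ((0, - t), (t, 0)), ((0, - t), (- t, 0))} :: ((int \<times> int) \<times> int \<times> int) set"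
  show ?thesis
  proof (rule isometry23_of_coordinates[where e = 1 and h = 0 and u\<^sub>0 = "(0, t)" and v\<^sub>0 = "(t, 0)" and Q = ?Q, OF S _ c closed])
    fix u v assume uv: "fixed_form 1 0 u u = fixed_form 1 0 (0, t) (0, t)"
      "fixed_form 1 0 u v = fixed_form 1 0 (0, t) (t, 0)" "fixed_form 1 0 v v = fixed_form 1 0 (t, 0) (t, 0)"
    obtain a b a' b' where [simp]: "u = (a, b)" "v = (a', b')" by (cases u, cases v)
    have "23 * a\<^sup>2 + b\<^sup>2 = t\<^sup>2" using uv(1) by (simp add: fixed_form_def power2_eq_square)
    from pell64[OF this t] have ab: "a = 0" "b = t \<or> b = - t" by auto
    have "t \<noteq> 0" using t by auto
    then have b': "b' = 0" using uv(2) ab by (auto simp: fixed_form_def)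
    then have "a' * a' = t * t" using uv(3) by (simp add: fixed_form_def)
    then have "a' = t \<or> a' = - t" by (simp add: square_eq_iff)
    then show "(u, v) \<in> ?Q" using ab b' by auto
  next
    have "card ?Q \<le> 4" by (intro card_insert_le_m1) auto
    then show "card ?Q < 23" by linarith
    show "c * bilin S x y = 1 * (\<Sum>i<24. n x i * n y i) - 0 * ((\<Sum>i<24. n x i) * (\<Sum>i<24. n y i))" for x y
      by (simp add: form)
    show "\<exists>x. \<forall>i<24. n x i = (if i < 23 then fst (0, t) else snd (0, t))" using x0 unfolding fst_conv snd_conv .
    show "\<exists>x. \<forall>i<24. n x i = (if i < 23 then fst (t, 0) else snd (t, 0))" using y0 unfolding fst_conv snd_conv .
  qed (use t in auto)
qed

lemma root_preimages:
  assumes "has_root_system S R"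
  obtains \<rho> where "\<And>v w. v \<in> R \<Longrightarrow> w \<in> R \<Longrightarrow> of_int (bilin S (\<rho> v) (\<rho> w)) = v \<bullet> w"
    "\<And>x. bilin S x x = 2 \<Longrightarrow> \<exists>v\<in>R. x = \<rho> v" "\<And>v. v \<in> R \<Longrightarrow> bilin S (\<rho> v) (\<rho> v) = 2"
proof -
  obtain f where f: "bij_betw f (lattice_roots S) R"
    "\<forall>x\<in>lattice_roots S. \<forall>y\<in>lattice_roots S. f x \<bullet> f y = of_int (bilin S x y)"
    using assms unfolding has_root_system_def by blast
  let ?\<rho> = "inv_into (lattice_roots S) f"
  have mem: "?\<rho> v \<in> lattice_roots S" "f (?\<rho> v) = v" if "v \<in> R" for v
    using f(1) that unfolding bij_betw_def by (auto simp: inv_into_into f_inv_into_f)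
  show ?thesis
  proof (rule that[of ?\<rho>])
    show "of_int (bilin S (?\<rho> v) (?\<rho> w)) = v \<bullet> w" if "v \<in> R" "w \<in> R" for v w
      using f(2) mem[OF that(1)] mem[OF that(2)] by metis
    show "bilin S (?\<rho> v) (?\<rho> v) = 2" if "v \<in> R" for v
      using mem(1)[OF that] by (simp add: lattice_roots_def)
    show "\<exists>v\<in>R. x = ?\<rho> v" if "bilin S x x = 2" for x
    proof -
      have "x \<in> lattice_roots S" using that by (simp add: lattice_roots_def)
      then have "?\<rho> (f x) = x" "f x \<in> R"
        using f(1) by (auto simp: bij_betw_def)
      then show ?thesis by metis
    qed
  qed
qed

lemma enumerate24: obtains \<epsilon> :: "nat \<Rightarrow> 24" where "bij_betw \<epsilon> {..<24} UNIV"
  using ex_bij_betw_nat_finite[of "UNIV :: 24 set"] by (auto simp: atLeast0LessThan)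

text \<open>If \<open>b(x, \<rho>) t = n\<^sub>i(x) - n\<^sub>k(x)\<close> and the coordinates of \<open>\<rho>\<close> are \<open>t (e\<^sub>i - e\<^sub>k)\<close>, then the map
  \<open>x \<mapsto> x - b(x, \<rho>) \<rho>\<close> swaps the coordinates \<open>i\<close> and \<open>k\<close>.\<close>

lemma swap_coordinates:
  assumes "i \<noteq> k" "bilin S x \<rho> * t = bilin S x (r i) - bilin S x (r k)"
    and "\<And>l. bilin S \<rho> (r l) = t * (of_bool (l = i) - of_bool (l = k))"
  shows "bilin S (x - bilin S x \<rho> *s \<rho>) (r l) = bilin S x (r (if l = i then k else if l = k then i else l))"
proof -
  have "bilin S (x - bilin S x \<rho> *s \<rho>) (r l) =
    bilin S x (r l) - (bilin S x \<rho> * t) * (of_bool (l = i) - of_bool (l = k))"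
    by (simp add: bilin_diff_left bilin_scale_left assms(3))
  then show ?thesis unfolding assms(2) using assms(1) by auto
qed

text \<open>The vectors \<open>r i\<close> stand for twice the unit vectors, which are sums of two
  roots, whereas the unit vectors have odd norm and do not lie in the lattice. Coordinates are inner
  products with the \<open>r i\<close>; reflections in the roots \<open>e_i - e_k\<close> transpose
  them.\<close>

theorem D24_isometry23:
  fixes S :: "int^24^24"
  assumes S: "even_unimodular S" and R: "has_root_system S (root_system_D :: (real^24) set)"
  shows "\<exists>g x y. isometry23 S g x y"
proof -
  interpret even_unimodular S by fact
  let ?R = "root_system_D :: (real^24) set"
  obtain \<rho> where \<rho>: "\<And>v w. v \<in> ?R \<Longrightarrow> w \<in> ?R \<Longrightarrow> of_int (bilin S (\<rho> v) (\<rho> w)) = v \<bullet> w"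
    using root_preimages[OF R] by metis
  have sym: "transpose S = S" by (rule unimodular_sym[OF unimod])
  have mem: "axis i s + axis j t \<in> ?R" if "i \<noteq> j" "s \<in> {1, -1}" "t \<in> {1, -1}" for i j s t
    using that unfolding root_system_D_def by blast
  \<comment> \<open>Some second index, used to write \<open>2 e_i\<close> as the sum of the roots
    \<open>e_i + e_j\<close> and \<open>e_i - e_j\<close>.\<close>
  define o' :: "24 \<Rightarrow> 24" where "o' i = (if i = 0 then 1 else 0)" for i
  have o': "i \<noteq> o' i" for i by (auto simp: o'_def)
  define r where "r i = \<rho> (axis i 1 + axis (o' i) 1) + \<rho> (axis i 1 + axis (o' i) (- 1))" for i
  have axis_inner: "axis i s \<bullet> axis j t = (if i = j then s * t else 0)" for i j :: 24 and s t :: real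
    by (simp add: inner_axis_axis)
  have \<rho>r: "real_of_int (bilin S (\<rho> v) (r l)) = 2 * v $ l" if "v \<in> ?R" for v l
  proof -
    have "real_of_int (bilin S (\<rho> v) (r l)) = v \<bullet> (axis l 1 + axis (o' l) 1) + v \<bullet> (axis l 1 + axis (o' l) (- 1))"
      unfolding r_def bilin_add_right of_int_add using \<rho>[OF that mem] o' by simp
    also have "\<dots> = 2 * v $ l"
      by (simp add: inner_add_right inner_axis)
    finally show ?thesis .
  qed
  have rr: "bilin S (r i) (r l) = (if i = l then 4 else 0)" for i l
  proof -
    have "real_of_int (bilin S (r i) (r l)) = 2 * (axis i 1 + axis (o' i) 1) $ l + 2 * (axis i 1 + axis (o' i) (- 1)) $ l"
      unfolding r_def[of i] bilin_add_left of_int_add using \<rho>r mem o' by simp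
    also have "\<dots> = real_of_int (if i = l then 4 else 0)" by (simp add: axis_def)
    finally show ?thesis by (simp only: of_int_eq_iff)
  qed
  have form: "4 * bilin S x y = (\<Sum>i\<in>UNIV. bilin S x (r i) * bilin S y (r i))" for x y
  proof -
    have "4 * bilin S x y = (\<Sum>i\<in>UNIV. \<Sum>j\<in>UNIV. bilin S x (r i) * mat 1 $ i $ j * bilin S y (r j))"
      by (rule bilin_gram_expansion[OF sym]) (auto simp: rr mat_def if_distrib[of "\<lambda>x. x * _"] cong: if_cong)
    also have "\<dots> = (\<Sum>i\<in>UNIV. bilin S x (r i) * bilin S y (r i))"
      by (simp add: mat_def if_distrib[of "\<lambda>x. _ * x * _"] if_distrib[of "\<lambda>x. x * _"] cong: if_cong)
    finally show ?thesis .
  qed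
  obtain \<epsilon> :: "nat \<Rightarrow> 24" where \<epsilon>: "bij_betw \<epsilon> {..<24} UNIV" using enumerate24 .
  have \<epsilon>_eq: "\<epsilon> i = \<epsilon> j \<longleftrightarrow> i = j" if "i < 24" "j < 24" for i j
    using \<epsilon> that by (auto simp: bij_betw_def inj_on_eq_iff)
  define n where "n x i = bilin S x (r (\<epsilon> i))" for x i
  show ?thesis
  proof (rule isometry23_of_orthogonal_coordinates[where t = 4 and c = 4 and n = n, OF S])
    show "4 * bilin S x y = (\<Sum>i<24. n x i * n y i)" for x y
      unfolding form n_def by (rule sum.reindex_bij_betw[OF \<epsilon>, symmetric])
    show "\<exists>y. \<forall>i<24. n y i = n x (cycle23 i)" for x
    proof (rule closed_cycle23)
      fix x i k assume ik: "i < 24" "k < (24::nat)" "i \<noteq> k"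
      have ne: "\<epsilon> i \<noteq> \<epsilon> k" using ik \<epsilon>_eq by simp
      define v :: "real^24" where "v = axis (\<epsilon> i) 1 + axis (\<epsilon> k) (- 1)"
      have v: "v \<in> ?R" unfolding v_def using mem[OF ne] by simp
      have \<rho>rl: "bilin S (\<rho> v) (r l) = 2 * (of_bool (l = \<epsilon> i) - of_bool (l = \<epsilon> k))" for l
      proof -
        have "v $ l = of_int (of_bool (l = \<epsilon> i) - of_bool (l = \<epsilon> k))" using ne by (auto simp: v_def axis_def)
        then have "real_of_int (bilin S (\<rho> v) (r l)) = of_int (2 * (of_bool (l = \<epsilon> i) - of_bool (l = \<epsilon> k)))"
          using \<rho>r[OF v] by simp
        then show ?thesis by (simp only: of_int_eq_iff)
      qed
      have "4 * bilin S x (\<rho> v) = (\<Sum>l\<in>UNIV. bilin S x (r l) * (2 * (of_bool (l = \<epsilon> i) - of_bool (l = \<epsilon> k))))"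
        unfolding form \<rho>rl ..
      also have "\<dots> = 2 * (bilin S x (r (\<epsilon> i)) - bilin S x (r (\<epsilon> k)))"
        by (simp add: right_diff_distrib sum_subtractf of_bool_def if_distrib[of "\<lambda>x. _ * x"] cong: if_cong)
      finally have "bilin S x (\<rho> v) * 2 = bilin S x (r (\<epsilon> i)) - bilin S x (r (\<epsilon> k))" by simp
      from swap_coordinates[OF ne this \<rho>rl] show "\<exists>y. \<forall>l<24. n y l = n x (if l = i then k else if l = k then i else l)"
        using \<epsilon>_eq ik by (intro exI[of _ "x - bilin S x (\<rho> v) *s \<rho> v"]) (auto simp: n_def)
    qed
    show "\<exists>x. \<forall>i<24. n x i = (if i < 23 then 0 else 4)"
      by (intro exI[of _ "r (\<epsilon> 23)"]) (auto simp: n_def rr \<epsilon>_eq)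
    show "\<exists>x. \<forall>i<24. n x i = (if i < 23 then 4 else 0)"
    proof (intro exI[of _ "\<Sum>j<23. r (\<epsilon> j)"] allI impI)
      fix i :: nat assume "i < 24"
      then have "n (\<Sum>j<23. r (\<epsilon> j)) i = (\<Sum>j<23. if j = i then 4 else 0)"
        unfolding n_def bilin_sum_left rr by (intro sum.cong) (auto simp: \<epsilon>_eq)
      then show "n (\<Sum>j<23. r (\<epsilon> j)) i = (if i < 23 then 4 else 0)" by simp
    qed
  qed auto
qed

text \<open>Twice the norm of \<open>(a, b)\<close> is
  \<open>23 * (2 * a - b)\<^sup>2 + 25 * b\<^sup>2\<close>; its size and divisibility by 23 leave
  \<open>b = 2\<close> or \<open>b = -2\<close>. The mixed product then fixes \<open>b'\<close>, and
  the second norm leaves two values of \<open>a'\<close>.\<close>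

lemma A24_fixed_pairs:
  assumes "fixed_form 25 1 u u = fixed_form 25 1 (1, 2) (1, 2)" "fixed_form 25 1 u v = fixed_form 25 1 (1, 2) (24, 23)"
    and "fixed_form 25 1 v v = fixed_form 25 1 (24, 23) (24, 23)"
  shows "(u, v) \<in> {((1, 2), (24, 23)), ((1, 2), (-1, 23)), ((-1, -2), (1, -23)), ((-1, -2), (-24, -23))}"
proof -
  obtain a b a' b' where [simp]: "u = (a, b)" "v = (a', b')" by (cases u, cases v)
  have 1: "23 * (2 * a - b)\<^sup>2 + 25 * b\<^sup>2 = 100"
    using assms(1) by (simp add: fixed_form_def power2_eq_square algebra_simps)
  have "25 * b\<^sup>2 \<le> 100" using 1 zero_le_power2[of "2 * a - b"] by linarith
  then have "\<bar>b\<bar>\<^sup>2 < 3\<^sup>2" by simp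
  then have "\<bar>b\<bar> < 3" by (rule power_less_imp_less_base) simp
  then have "b \<in> {-2, -1, 0, 1, 2}" by auto
  moreover have "23 dvd 100 - 25 * b\<^sup>2" using 1 by (metis add_diff_cancel_right' dvd_triv_left)
  ultimately have b: "b = 2 \<or> b = -2" by auto
  then have a: "2 * a = b" using 1 by auto
  have 2: "25 * b * b' = 1150"
    using assms(2) a[symmetric] by (simp add: fixed_form_def algebra_simps)
  have b': "b' = 23 * a" using b a 2 by auto
  have "23 * (2 * a' - b')\<^sup>2 + 25 * b'\<^sup>2 = 27600"
    using assms(3) by (simp add: fixed_form_def power2_eq_square algebra_simps)
  moreover have "b'\<^sup>2 = 529" using b' a b by auto
  ultimately have "(2 * a' - b')\<^sup>2 = 25\<^sup>2" by simp
  then have "2 * a' - b' = 25 \<or> 2 * a' - b' = -25" by (simp only: power2_eq_iff)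
  moreover have "a = 1 \<and> b = 2 \<and> b' = 23 \<or> a = -1 \<and> b = -2 \<and> b' = -23" using a b b' by presburger
  ultimately have "a = 1 \<and> b = 2 \<and> b' = 23 \<and> (a' = 24 \<or> a' = -1) \<or>
      a = -1 \<and> b = -2 \<and> b' = -23 \<and> (a' = 1 \<or> a' = -24)" by presburger
  then show ?thesis by (elim disjE conjE) simp_all
qed

text \<open>The roots joining one of the 25 points to the others form a basis of the root lattice
  with Gram matrix \<open>I + J\<close>, where \<open>J\<close> has all entries 1. Twenty-five times
  its inverse is \<open>25 I - J\<close>, whence \<open>c = 25\<close>, \<open>e = 25\<close> and
  \<open>h = 1\<close>.\<close>

theorem A24_isometry23:
  fixes S :: "int^24^24"
  assumes S: "even_unimodular S" and R: "has_root_system S (root_system_A :: (real^25) set)"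
  shows "\<exists>g x y. isometry23 S g x y"
proof -
  interpret even_unimodular S by fact
  let ?R = "root_system_A :: (real^25) set"
  obtain \<rho> where \<rho>: "\<And>v w. v \<in> ?R \<Longrightarrow> w \<in> ?R \<Longrightarrow> of_int (bilin S (\<rho> v) (\<rho> w)) = v \<bullet> w"
    using root_preimages[OF R] by metis
  have sym: "transpose S = S" by (rule unimodular_sym[OF unimod])
  have mem: "axis i 1 - axis j 1 \<in> ?R" if "i \<noteq> j" for i j
    using that unfolding root_system_A_def by blast
  have "card (UNIV :: 24 set) = card (- {0} :: 25 set)" by (simp add: Compl_eq_Diff_UNIV)
  then obtain \<iota> :: "24 \<Rightarrow> 25" where \<iota>: "bij_betw \<iota> UNIV (- {0})"
    using finite_same_card_bij[of "UNIV :: 24 set" "- {0} :: 25 set"] by auto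
  have \<iota>0: "\<iota> i \<noteq> 0" for i using \<iota> by (auto simp: bij_betw_def)
  have \<iota>_eq: "\<iota> i = \<iota> j \<longleftrightarrow> i = j" for i j using \<iota> by (auto simp: bij_betw_def inj_on_eq_iff)
  define r where "r i = \<rho> (axis (\<iota> i) 1 - axis 0 1)" for i
  have \<rho>r: "real_of_int (bilin S (\<rho> v) (r l)) = v $ \<iota> l - v $ 0" if "v \<in> ?R" for v l
    unfolding r_def \<rho>[OF that mem[OF \<iota>0]] by (simp add: inner_diff_right inner_axis)
  have rr: "bilin S (r i) (r l) = (if i = l then 2 else 1)" for i l
  proof -
    have "real_of_int (bilin S (r i) (r l)) = real_of_int (if i = l then 2 else 1)"
      unfolding r_def[of i] \<rho>r[OF mem[OF \<iota>0]] using \<iota>0 by (simp add: axis_def \<iota>_eq)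
    then show ?thesis by (simp only: of_int_eq_iff)
  qed
  define H :: "int^24^24" where "H = (\<chi> i j. if i = j then 24 else -1)"
  have form: "25 * bilin S x y = 25 * (\<Sum>i\<in>UNIV. bilin S x (r i) * bilin S y (r i)) -
      1 * ((\<Sum>i\<in>UNIV. bilin S x (r i)) * (\<Sum>i\<in>UNIV. bilin S y (r i)))" for x y
  proof -
    have "(\<Sum>j\<in>UNIV. bilin S (r i) (r j) * H $ j $ k) = (if i = k then 25 else 0)" for i k
    proof -
      have "bilin S (r i) (r j) * H $ j $ k =
         -1 + 25 * (if j = k then 1 else 0) + (if j = i then (if i = k then 25 else 0) - 1 else 0)" for j
        by (auto simp: rr H_def)
      then show ?thesis by (simp add: sum.distrib sum_subtractf sum_distrib_left[symmetric])
    qed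
    then have "25 * bilin S x y = (\<Sum>i\<in>UNIV. \<Sum>j\<in>UNIV. bilin S x (r i) * H $ i $ j * bilin S y (r j))"
      by (intro bilin_gram_expansion[OF sym]) auto
    also have "\<dots> = (\<Sum>i\<in>UNIV. \<Sum>j\<in>UNIV. (if i = j then 25 * (bilin S x (r i) * bilin S y (r i)) else 0)
        - bilin S x (r i) * bilin S y (r j))"
      by (intro sum.cong refl) (auto simp: H_def algebra_simps)
    finally show ?thesis by (simp add: sum_subtractf sum_product sum_distrib_left[of 25])
  qed
  obtain \<epsilon> :: "nat \<Rightarrow> 24" where \<epsilon>: "bij_betw \<epsilon> {..<24} UNIV" using enumerate24 .
  have \<epsilon>_eq: "\<epsilon> i = \<epsilon> j \<longleftrightarrow> i = j" if "i < 24" "j < 24" for i j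
    using \<epsilon> that by (auto simp: bij_betw_def inj_on_eq_iff)
  define n where "n x i = bilin S x (r (\<epsilon> i))" for x i
  let ?Q = "{((1, 2), (24, 23)), ((1, 2), (-1, 23)), ((-1, -2), (1, -23)), ((-1, -2), (-24, -23))} :: ((int \<times> int) \<times> int \<times> int) set"
  show ?thesis
  \<comment> \<open>The distinguished pair: the last of the roots \<open>r\<close> has coordinates
    \<open>(1, ..., 1, 2)\<close>, and the sum of the other 23 has
    \<open>(24, ..., 24, 23)\<close>.\<close>
  proof (rule isometry23_of_coordinates[where c = 25 and e = 25 and h = 1 and n = n and Q = ?Q and u\<^sub>0 = "(1, 2)" and v\<^sub>0 = "(24, 23)", OF S])
    show "25 * bilin S x y = 25 * (\<Sum>i<24. n x i * n y i) - 1 * ((\<Sum>i<24. n x i) * (\<Sum>i<24. n y i))" for x y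
      unfolding form n_def
      by (simp only: sum.reindex_bij_betw[OF \<epsilon>, of "\<lambda>i. bilin S x (r i) * bilin S y (r i)"]
          sum.reindex_bij_betw[OF \<epsilon>, of "\<lambda>i. bilin S x (r i)"] sum.reindex_bij_betw[OF \<epsilon>, of "\<lambda>i. bilin S y (r i)"])
    show "\<exists>y. \<forall>i<24. n y i = n x (cycle23 i)" for x
    proof (rule closed_cycle23)
      fix x i k assume ik: "i < 24" "k < (24::nat)" "i \<noteq> k"
      have ne: "\<epsilon> i \<noteq> \<epsilon> k" using ik \<epsilon>_eq by simp
      define v :: "real^25" where "v = axis (\<iota> (\<epsilon> i)) 1 - axis (\<iota> (\<epsilon> k)) 1"
      have v: "v \<in> ?R" unfolding v_def using mem ne \<iota>_eq by simp
      have \<rho>rl: "bilin S (\<rho> v) (r l) = 1 * (of_bool (l = \<epsilon> i) - of_bool (l = \<epsilon> k))" for l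
      proof -
        have "v $ \<iota> l - v $ 0 = of_int (of_bool (l = \<epsilon> i) - of_bool (l = \<epsilon> k))"
          using \<iota>0[THEN not_sym] by (auto simp: v_def axis_def \<iota>_eq)
        then have "real_of_int (bilin S (\<rho> v) (r l)) = of_int (of_bool (l = \<epsilon> i) - of_bool (l = \<epsilon> k))"
          using \<rho>r[OF v] by simp
        then show ?thesis by (simp only: of_int_eq_iff mult_1)
      qed
      have "25 * bilin S x (\<rho> v) = 25 * (\<Sum>l\<in>UNIV. bilin S x (r l) * (of_bool (l = \<epsilon> i) - of_bool (l = \<epsilon> k)))"
        unfolding form \<rho>rl by (simp add: sum_subtractf of_bool_def)
      also have "(\<Sum>l\<in>UNIV. bilin S x (r l) * (of_bool (l = \<epsilon> i) - of_bool (l = \<epsilon> k))) = bilin S x (r (\<epsilon> i)) - bilin S x (r (\<epsilon> k))"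
        by (simp add: right_diff_distrib sum_subtractf of_bool_def if_distrib[of "\<lambda>x. _ * x"] cong: if_cong)
      finally have "bilin S x (\<rho> v) * 1 = bilin S x (r (\<epsilon> i)) - bilin S x (r (\<epsilon> k))" by simp
      from swap_coordinates[OF ne this \<rho>rl] show "\<exists>y. \<forall>l<24. n y l = n x (if l = i then k else if l = k then i else l)"
        using \<epsilon>_eq ik by (intro exI[of _ "x - bilin S x (\<rho> v) *s \<rho> v"]) (auto simp: n_def)
    qed
    show "\<exists>x. \<forall>i<24. n x i = (if i < 23 then fst (1, 2) else snd (1, 2))"
      by (intro exI[of _ "r (\<epsilon> 23)"]) (auto simp: n_def rr \<epsilon>_eq)
    show "\<exists>x. \<forall>i<24. n x i = (if i < 23 then fst (24, 23) else snd (24, 23))"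
    proof (intro exI[of _ "\<Sum>j<23. r (\<epsilon> j)"] allI impI)
      fix i :: nat assume i: "i < 24"
      then have "n (\<Sum>j<23. r (\<epsilon> j)) i = (\<Sum>j<23. 1 + (if j = i then 1 else 0))"
        unfolding n_def bilin_sum_left rr by (intro sum.cong) (auto simp: \<epsilon>_eq)
      then show "n (\<Sum>j<23. r (\<epsilon> j)) i = (if i < 23 then fst (24, 23) else snd (24, 23))"
        by (simp add: sum.distrib)
    qed
    show "card ?Q < 23" by simp
  qed (use A24_fixed_pairs in auto)
qed

section \<open>The Leech lattice\<close>

lemma card_sym_diff:
  assumes "finite A" "finite B"
  shows "card (sym_diff A B) + 2 * card (A \<inter> B) = card A + card B"
proof -
  have "card (sym_diff A B) = card (A - B) + card (B - A)"
    using assms by (intro card_Un_disjoint) auto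
  moreover have "card (A - B) = card A - card (A \<inter> B)" "card (B - A) = card B - card (A \<inter> B)"
    using card_Diff_subset_Int[of A B] card_Diff_subset_Int[of B A] assms by (simp_all add: Int_commute)
  moreover have "card (A \<inter> B) \<le> card A" "card (A \<inter> B) \<le> card B"
    using assms by (auto intro: card_mono)
  ultimately show ?thesis by simp
qed

lemma even_card_sym_diff_Int:
  assumes "finite A" "finite B"
  shows "even (card (sym_diff A B \<inter> C)) \<longleftrightarrow> (even (card (A \<inter> C)) \<longleftrightarrow> even (card (B \<inter> C)))"
proof -
  have "sym_diff A B \<inter> C = sym_diff (A \<inter> C) (B \<inter> C)" by auto
  moreover have "card (sym_diff (A \<inter> C) (B \<inter> C)) + 2 * card (A \<inter> C \<inter> (B \<inter> C)) = card (A \<inter> C) + card (B \<inter> C)"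
    by (rule card_sym_diff) (use assms in auto)
  ultimately show ?thesis by presburger
qed

text \<open>The field is listed explicitly so that statements about residues become finite
  evaluations.\<close>

definition F23 :: "23 list" where
  "F23 = [0,1,2,3,4,5,6,7,8,9,10,11,12,13,14,15,16,17,18,19,20,21,22]"

lemma set_F23: "set F23 = UNIV"
proof -
  have "distinct F23" by (simp add: F23_def)
  then have "card (set F23) = CARD(23)" by (simp add: distinct_card F23_def)
  then show ?thesis using card_subset_eq[of UNIV "set F23"] by auto
qed

definition nonres23 :: "23 list" where
  "nonres23 = [0, 5, 7, 10, 11, 14, 15, 17, 19, 20, 21, 22]"

lemma nonres23: "x \<in> set nonres23 \<longleftrightarrow> x = 0 \<or> (\<nexists>m. x = m ^ 2)" for x :: 23
proof -
  have "\<forall>x\<in>set F23. x \<in> set nonres23 \<longleftrightarrow> x = 0 \<or> \<not> (\<exists>m\<in>set F23. x = m ^ 2)"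
    by (simp add: F23_def nonres23_def)
  then show ?thesis by (simp add: set_F23)
qed

lemma nonres23_uminus: "x \<noteq> 0 \<Longrightarrow> - x \<in> set nonres23 \<longleftrightarrow> x \<notin> set nonres23" for x :: 23
proof -
  have "\<forall>x\<in>set F23. x \<noteq> 0 \<longrightarrow> (- x \<in> set nonres23 \<longleftrightarrow> x \<notin> set nonres23)"
    by (simp add: F23_def nonres23_def)
  then show "x \<noteq> 0 \<Longrightarrow> - x \<in> set nonres23 \<longleftrightarrow> x \<notin> set nonres23" by (simp add: set_F23)
qed

text \<open>Each of the 23 shifts is evaluated. The result means that any two generators of the code
  meet in an even number of points.\<close>

lemma nonres23_overlap: "even (card {n \<in> set nonres23. n + k \<in> set nonres23})"
proof -
  have "distinct nonres23" by (simp add: nonres23_def)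
  then have "card {n \<in> set nonres23. n + k \<in> set nonres23} = length (filter (\<lambda>n. n + k \<in> set nonres23) nonres23)"
    by (subst distinct_length_filter) (auto intro: arg_cong[where f = card])
  moreover have "\<forall>k\<in>set F23. even (length (filter (\<lambda>n. n + k \<in> set nonres23) nonres23))"
    by (simp add: F23_def nonres23_def)
  ultimately show ?thesis by (simp add: set_F23)
qed

lemma golay_generator_iff: "Some x \<in> golay_generator i \<longleftrightarrow> x + i \<in> set nonres23" "None \<notin> golay_generator i"
proof -
  have "Some x \<in> golay_generator i \<longleftrightarrow> (\<exists>n. x = n - i \<and> n \<in> set nonres23)"
    unfolding golay_generator_def nonres23 by auto
  also have "\<dots> \<longleftrightarrow> x + i \<in> set nonres23" by (metis add_diff_cancel diff_add_cancel)
  finally show "Some x \<in> golay_generator i \<longleftrightarrow> x + i \<in> set nonres23" .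
qed (simp add: golay_generator_def image_iff)

lemma golay_generator_image: "golay_generator i = (\<lambda>n. Some (n - i)) ` set nonres23"
  by (simp only: golay_generator_def nonres23[symmetric] setcompr_eq_image image_image Collect_mem_eq)

lemma card_golay_generator: "card (golay_generator i) = 12"
proof -
  have "card (golay_generator i) = card (set nonres23)"
    unfolding golay_generator_image by (rule card_image) (auto simp: inj_on_def)
  also have "\<dots> = 12" by (simp add: nonres23_def)
  finally show ?thesis .
qed

lemma even_golay_generator_Int: "even (card (golay_generator i \<inter> golay_generator j))"
proof -
  have "golay_generator i \<inter> golay_generator j = (\<lambda>n. Some (n - i)) ` {n \<in> set nonres23. n + (j - i) \<in> set nonres23}"
    unfolding golay_generator_image[of i] by (auto simp: golay_generator_iff algebra_simps)
  also have "card \<dots> = card {n \<in> set nonres23. n + (j - i) \<in> set nonres23}"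
    by (rule card_image) (auto simp: inj_on_def)
  finally show ?thesis using nonres23_overlap by simp
qed

text \<open>Both properties are carried together: adding a generator keeps weights divisible by 4
  because the generator has weight 12 and meets the word in an even number of points.\<close>

lemma golay_code_weights:
  assumes "A \<in> golay_code"
  shows "4 dvd card A \<and> (\<forall>i. even (card (A \<inter> golay_generator i)))"
  using assms
proof induction
  case (whole C)
  have "card (sym_diff C UNIV) + 2 * card C = card C + 24"
    using card_sym_diff[of C UNIV] by (simp del: card_option)  simp
  then have "4 dvd card (sym_diff C UNIV)" using whole.IH by (auto elim!: dvdE) presburger
  moreover have "even (card (sym_diff C UNIV \<inter> golay_generator i))" for i
    using even_card_sym_diff_Int[of C UNIV "golay_generator i"] whole.IH card_golay_generator[of i] by simp
  ultimately show ?case by blast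
next
  case (generator C i)
  have "card (sym_diff C (golay_generator i)) + 2 * card (C \<inter> golay_generator i) = card C + 12"
    using card_sym_diff[of C "golay_generator i"] card_golay_generator[of i] by simp
  moreover have "even (card (C \<inter> golay_generator i))" "4 dvd card C" using generator.IH by auto
  ultimately have "4 dvd card (sym_diff C (golay_generator i))" by presburger
  moreover have "even (card (sym_diff C (golay_generator i) \<inter> golay_generator j))" for j
    using even_card_sym_diff_Int[of C "golay_generator i" "golay_generator j"] generator.IH even_golay_generator_Int[of i j] by simp
  ultimately show ?case by blast
qed simp

lemma golay_code_sym_diff:
  assumes "B \<in> golay_code" "A \<in> golay_code"
  shows "sym_diff A B \<in> golay_code"
  using assms(1)
proof induction
  case empty
  then show ?case using assms(2) by simp
next
  case (whole C)
  have "sym_diff A (sym_diff C UNIV) = sym_diff (sym_diff A C) UNIV" by auto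
  then show ?case using golay_code.whole[OF whole.IH] by simp
next
  case (generator C i)
  have "sym_diff A (sym_diff C (golay_generator i)) = sym_diff (sym_diff A C) (golay_generator i)" by auto
  then show ?case using golay_code.generator[OF generator.IH] by simp
qed

text \<open>The sum of the words \<open>F z\<close> for \<open>z\<close> in \<open>Z\<close>, over
  the field with two elements.\<close>

definition sym_diff_family :: "('i \<Rightarrow> 'a set) \<Rightarrow> 'i set \<Rightarrow> 'a set" where
  "sym_diff_family F Z = {x. odd (card {z\<in>Z. x \<in> F z})}"

lemma sym_diff_family_golay:
  assumes "finite Z" "\<And>z. F z \<in> golay_code"
  shows "sym_diff_family F Z \<in> golay_code"
  using assms(1)
proof (induction Z rule: finite_induct)
  case empty
  then show ?case by (simp add: sym_diff_family_def golay_code.empty)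
next
  case (insert w Z)
  have "card {z\<in>insert w Z. x \<in> F z} = card {z\<in>Z. x \<in> F z} + of_bool (x \<in> F w)" for x
  proof -
    have "{z\<in>insert w Z. x \<in> F z} = (if x \<in> F w then insert w {z\<in>Z. x \<in> F z} else {z\<in>Z. x \<in> F z})" by auto
    then show ?thesis using insert by simp
  qed
  then have "sym_diff_family F (insert w Z) = sym_diff (sym_diff_family F Z) (F w)"
    by (auto simp: sym_diff_family_def)
  then show ?case using golay_code_sym_diff[OF assms(2)[of w] insert.IH] by simp
qed

text \<open>As \<open>-1\<close> is a nonresidue, the complements of the generators are the translates of the set of
  residues (with infinity), and they act as a generating idempotent on the dual code.\<close>

lemma golay_code_self_dual:
  assumes y: "\<And>C. C \<in> golay_code \<Longrightarrow> even (card (y \<inter> C))"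
  shows "y \<in> golay_code"
proof -
  define F where "F z = sym_diff (sym_diff {} UNIV) (golay_generator (- z))" for z
  have F: "F z \<in> golay_code" for z
    unfolding F_def by (intro golay_code.intros)
  have F_iff: "Some x \<in> F z \<longleftrightarrow> x - z \<notin> set nonres23" "None \<in> F z" for x z
    by (auto simp: F_def golay_generator_iff)
  let ?Z = "{z. Some z \<in> y}"
  \<comment> \<open>A point \<open>Some x\<close> is decided by orthogonality of \<open>y\<close> to
    the generator for \<open>- x\<close>, the point at infinity by orthogonality to the whole
    line.\<close>
  have "sym_diff_family F ?Z = y"
  proof (rule set_eqI)
    fix w
    show "w \<in> sym_diff_family F ?Z \<longleftrightarrow> w \<in> y"
    proof (cases w)
      case None
      have "sym_diff {} UNIV \<in> golay_code" by (intro golay_code.intros)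
      then have "even (card y)" using y[of UNIV] by simp
      moreover have "card y = card ?Z + (if None \<in> y then 1 else 0)"
      proof -
        have y_eq: "y = Some ` ?Z \<union> (if None \<in> y then {None} else {})"
        proof (rule set_eqI)
          fix v show "v \<in> y \<longleftrightarrow> v \<in> Some ` ?Z \<union> (if None \<in> y then {None} else {})"
            by (cases v) auto
        qed
        have "card y = card (Some ` ?Z \<union> (if None \<in> y then {None} else {}))"
          by (rule arg_cong[where f = card, OF y_eq])
        also have "\<dots> = card ?Z + (if None \<in> y then 1 else 0)"
          by (subst card_Un_disjoint) (auto simp: card_image)
        finally show ?thesis .
      qed
      ultimately show ?thesis using None by (simp add: sym_diff_family_def F_iff split: if_splits)
    next
      case (Some x)
      have "golay_generator (- x) \<in> golay_code"
        using golay_code.generator[OF golay_code.empty, of "- x"] by simp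
      from y[OF this] have "even (card (y \<inter> golay_generator (- x)))" .
      also have "y \<inter> golay_generator (- x) = Some ` {z \<in> ?Z. z - x \<in> set nonres23}"
      proof (rule set_eqI)
        fix v show "v \<in> y \<inter> golay_generator (- x) \<longleftrightarrow> v \<in> Some ` {z \<in> ?Z. z - x \<in> set nonres23}"
          by (cases v) (auto simp: golay_generator_iff)
      qed
      finally have ev: "even (card {z \<in> ?Z. z - x \<in> set nonres23})" by (simp add: card_image)
      have "{z \<in> ?Z. z - x \<in> set nonres23} = {z \<in> ?Z. x - z \<notin> set nonres23} \<union> (if Some x \<in> y then {x} else {})"
      proof (rule set_eqI)
        fix z
        have "z - x \<in> set nonres23 \<longleftrightarrow> x - z \<notin> set nonres23" if "z \<noteq> x"
          using nonres23_uminus[of "x - z"] that by simp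
        moreover have "(0::23) \<in> set nonres23" by (simp add: nonres23_def)
        ultimately show "z \<in> {z \<in> ?Z. z - x \<in> set nonres23} \<longleftrightarrow>
           z \<in> {z \<in> ?Z. x - z \<notin> set nonres23} \<union> (if Some x \<in> y then {x} else {})"
          by (cases "z = x") auto
      qed
      moreover have "(0::23) \<in> set nonres23" by (simp add: nonres23_def)
      ultimately have "card {z \<in> ?Z. z - x \<in> set nonres23} = card {z \<in> ?Z. x - z \<notin> set nonres23} + (if Some x \<in> y then 1 else 0)"
        by (simp add: card_Un_disjoint)
      then show ?thesis using ev Some by (simp add: sym_diff_family_def F_iff split: if_splits)
    qed
  qed
  then show ?thesis using sym_diff_family_golay[of ?Z F] F by simp
qed

lemma golay_code_translate:
  assumes "C \<in> golay_code"
  shows "map_option (\<lambda>z. z + 1) -` C \<in> golay_code"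
  using assms
proof induction
  case empty
  then show ?case by (simp add: golay_code.empty)
next
  case (whole C)
  have "map_option (\<lambda>z. z + 1) -` sym_diff C UNIV = sym_diff (map_option (\<lambda>z. z + 1) -` C) UNIV" by auto
  then show ?case using golay_code.whole[OF whole.IH] by simp
next
  case (generator C i)
  have "map_option (\<lambda>z. z + 1) -` golay_generator i = golay_generator (i + 1)"
  proof (rule set_eqI)
    fix w show "w \<in> map_option (\<lambda>z. z + 1) -` golay_generator i \<longleftrightarrow> w \<in> golay_generator (i + 1)"
      by (cases w) (auto simp: golay_generator_iff add_ac)
  qed
  then have "map_option (\<lambda>z. z + 1) -` sym_diff C (golay_generator i) =
      sym_diff (map_option (\<lambda>z. z + 1) -` C) (golay_generator (i + 1))" by auto
  then show ?case using golay_code.generator[OF generator.IH, of "i + 1"] by simp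
qed

text \<open>Modulo 16 the square of a coordinate is determined by its residue modulo 4, in the odd
  case after subtracting \<open>2 * x $ i - 1\<close>. In the sum only the weight of the code word,
  divisible by 4, and the coordinate sum remain.\<close>

lemma scaled_leech_norm:
  assumes "x \<in> scaled_leech"
  shows "16 dvd (\<Sum>i\<in>UNIV. x $ i * x $ i)"
proof -
  obtain m where m: "m \<in> {0, 1}" "\<And>i. x $ i mod 2 = m" "{i. x $ i mod 4 = m + 2} \<in> golay_code"
    "(\<Sum>i\<in>UNIV. x $ i) mod 8 = 4 * m"
    using assms unfolding scaled_leech_def by blast
  let ?A = "{i. x $ i mod 4 = m + 2}"
  have A: "4 dvd card ?A" using golay_code_weights[OF m(3)] by blast
  have indicator: "(\<Sum>i\<in>UNIV. if i \<in> ?A then 4 else 0) = 4 * int (card ?A)"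
    by (simp add: sum.If_cases)
  have "m = 0 \<or> m = 1" using m(1) by auto
  then show ?thesis
  proof
    assume m0: "m = 0"
    have "16 dvd (\<Sum>i\<in>UNIV. x $ i * x $ i - (if i \<in> ?A then 4 else 0))"
    proof (rule dvd_sum)
      fix i
      define t where "t = x $ i div 4"
      have "x $ i mod 4 = 2 \<or> x $ i mod 4 = 0" using m(2)[of i] m0 by presburger
      then have "x $ i = 4 * t + 2 \<and> i \<in> ?A \<or> x $ i = 4 * t \<and> i \<notin> ?A"
        unfolding t_def mem_Collect_eq m0 by presburger
      then have "x $ i * x $ i - (if i \<in> ?A then 4 else 0) = 16 * (t * t + t) \<or>
         x $ i * x $ i - (if i \<in> ?A then 4 else 0) = 16 * (t * t)"
        by (auto simp: algebra_simps)
      then show "16 dvd x $ i * x $ i - (if i \<in> ?A then 4 else 0)" by (metis dvd_triv_left)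
    qed
    then have "16 dvd (\<Sum>i\<in>UNIV. x $ i * x $ i) - 4 * int (card ?A)"
      unfolding sum_subtractf indicator .
    then show ?thesis using A by presburger
  next
    assume m1: "m = 1"
    have "16 dvd (\<Sum>i\<in>UNIV. x $ i * x $ i - (2 * x $ i - 1 + (if i \<in> ?A then 4 else 0)))"
    proof (rule dvd_sum)
      fix i
      define t where "t = x $ i div 4"
      have "x $ i mod 4 = 3 \<or> x $ i mod 4 = 1" using m(2)[of i] m1 by presburger
      then have "x $ i = 4 * t + 3 \<and> i \<in> ?A \<or> x $ i = 4 * t + 1 \<and> i \<notin> ?A"
        unfolding t_def mem_Collect_eq m1 by presburger
      then have "x $ i * x $ i - (2 * x $ i - 1 + (if i \<in> ?A then 4 else 0)) = 16 * (t * t + t) \<or>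
         x $ i * x $ i - (2 * x $ i - 1 + (if i \<in> ?A then 4 else 0)) = 16 * (t * t)"
        by (auto simp: algebra_simps)
      then show "16 dvd x $ i * x $ i - (2 * x $ i - 1 + (if i \<in> ?A then 4 else 0))" by (metis dvd_triv_left)
    qed
    then have "16 dvd (\<Sum>i\<in>UNIV. x $ i * x $ i) - (2 * (\<Sum>i\<in>UNIV. x $ i) - 24 + 4 * int (card ?A))"
      unfolding sum_subtractf sum.distrib indicator sum_distrib_left by simp
    then show ?thesis using A m(4) m1 by presburger
  qed
qed

lemma scaled_leech_even_vector:
  assumes "C \<in> golay_code" "\<And>i. u $ i mod 4 = (if i \<in> C then 2 else 0)" "8 dvd (\<Sum>i\<in>UNIV. u $ i)"
  shows "u \<in> scaled_leech"
proof -
  have "u $ i mod 2 = 0" for i using assms(2)[of i] by (simp split: if_splits) presburger+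
  moreover have "{i. u $ i mod 4 = 0 + 2} = C" using assms(2) by (auto split: if_splits)
  moreover have "(\<Sum>i\<in>UNIV. u $ i) mod 8 = 4 * 0" using assms(3) by simp
  ultimately show ?thesis unfolding scaled_leech_def using assms(1) by (intro CollectI bexI[of _ 0]) auto
qed

lemma sum_axis: "(\<Sum>i\<in>UNIV. axis k c $ i) = (c :: int)"
  by (simp add: axis_def)

lemma sum_mult_axis: "(\<Sum>i\<in>UNIV. v $ i * axis k c $ i) = (v $ k * c :: int)"
  by (simp add: axis_def if_distrib[of "\<lambda>x. _ * x"] cong: if_cong)

lemma scaled_leech_axis: "axis k 8 \<in> scaled_leech"
  by (rule scaled_leech_even_vector[OF golay_code.empty]) (auto simp: sum_axis axis_def)

text \<open>Three kinds of test vectors suffice: \<open>4 e_i + 4 e_None\<close> compares parities,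
  twice a code word gives orthogonality to the code and hence membership by self-duality of the
  code, and one odd vector fixes the coordinate sum.\<close>

lemma scaled_leech_self_dual:
  fixes v :: "int^(23 option)"
  assumes v: "\<And>u. u \<in> scaled_leech \<Longrightarrow> 8 dvd (\<Sum>i\<in>UNIV. v $ i * u $ i)"
  shows "v \<in> scaled_leech"
proof -
  define m where "m = v $ None mod 2"
  have m01: "m = 0 \<or> m = 1" unfolding m_def by presburger
  have par: "v $ i mod 2 = m" for i
  proof (cases "i = None")
    case False
    have "axis i 4 + axis None 4 \<in> scaled_leech"
      by (rule scaled_leech_even_vector[OF golay_code.empty])
         (use False in \<open>auto simp: sum.distrib sum_axis\<close>, auto simp: axis_def)
    from v[OF this] have "8 dvd v $ i * 4 + v $ None * 4"
      by (simp add: distrib_left sum.distrib sum_mult_axis)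
    then show ?thesis unfolding m_def by presburger
  qed (simp add: m_def)
  let ?A = "{i. v $ i mod 4 = m + 2}"
  have "?A \<in> golay_code"
  proof (rule golay_code_self_dual)
    fix C assume C: "C \<in> golay_code"
    have C4: "4 dvd card C" using golay_code_weights[OF C] by blast
    define u :: "int^(23 option)" where "u = (\<chi> i. if i \<in> C then 2 else 0)"
    have "(\<Sum>i\<in>UNIV. u $ i) = 2 * int (card C)" by (simp add: u_def sum.If_cases)
    then have "8 dvd (\<Sum>i\<in>UNIV. u $ i)" using C4 by presburger
    then have "u \<in> scaled_leech"
      by (intro scaled_leech_even_vector[OF C]) (simp_all add: u_def)
    from v[OF this] have "8 dvd (\<Sum>i\<in>UNIV. v $ i * u $ i)" .
    also have "(\<Sum>i\<in>UNIV. v $ i * u $ i) = 2 * (\<Sum>i\<in>C. v $ i)"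
    proof -
      have "(\<Sum>i\<in>UNIV. v $ i * u $ i) = (\<Sum>i\<in>UNIV. if i \<in> C then 2 * v $ i else 0)"
        by (intro sum.cong) (auto simp: u_def)
      then show ?thesis by (simp add: sum.If_cases sum_distrib_left)
    qed
    finally have 1: "4 dvd (\<Sum>i\<in>C. v $ i)" by presburger
    have "4 dvd (\<Sum>i\<in>C. v $ i - (m + (if i \<in> ?A then 2 else 0)))"
    proof (rule dvd_sum)
      fix i assume "i \<in> C"
      show "4 dvd v $ i - (m + (if i \<in> ?A then 2 else 0))"
        using par[of i] m01 by (auto; presburger)
    qed
    also have "(\<Sum>i\<in>C. v $ i - (m + (if i \<in> ?A then 2 else 0))) = (\<Sum>i\<in>C. v $ i) - (m * int (card C) + 2 * int (card (?A \<inter> C)))"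
      by (simp add: sum_subtractf sum.distrib sum.If_cases Int_commute Collect_conj_eq mult.commute)
    finally have 2: "4 dvd (\<Sum>i\<in>C. v $ i) - (m * int (card C) + 2 * int (card (?A \<inter> C)))" .
    have 3: "4 dvd m * int (card C)" using C4 by (intro dvd_mult) presburger
    have "4 dvd 2 * int (card (?A \<inter> C))" using 1 2 3 by presburger
    then show "even (card (?A \<inter> C))" by presburger
  qed
  moreover have "(\<Sum>i\<in>UNIV. v $ i) mod 8 = 4 * m"
  proof -
    \<comment> \<open>All ones except -3 at infinity: every coordinate is congruent to 1 modulo 4,
      so the associated word is empty, and the coordinate sum is 20.\<close>
    define u :: "int^(23 option)" where "u = (\<chi> i. 1) - axis None 4"
    have "u $ i mod 2 = 1" "u $ i mod 4 \<noteq> 1 + 2" for i by (auto simp: u_def axis_def)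
    moreover have "(\<Sum>i\<in>UNIV. u $ i) mod 8 = 4 * 1" by (simp add: u_def sum_subtractf sum_axis)
    ultimately have "u \<in> scaled_leech"
      unfolding scaled_leech_def using golay_code.empty by (intro CollectI bexI[of _ 1]) auto
    from v[OF this] have "8 dvd (\<Sum>i\<in>UNIV. v $ i) - v $ None * 4"
      by (simp add: u_def right_diff_distrib sum_subtractf sum_mult_axis)
    then show ?thesis unfolding m_def by presburger
  qed
  ultimately show ?thesis
    unfolding scaled_leech_def using m01 par by (intro CollectI bexI[of _ m]) auto
qed

lemma scaled_leech_translate:
  assumes "u \<in> scaled_leech"
  shows "(\<chi> i. u $ map_option (\<lambda>z. z + 1) i) \<in> scaled_leech" (is "?u \<in> _")
proof -
  let ?s = "map_option (\<lambda>z. z + 1) :: 23 option \<Rightarrow> 23 option"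
  obtain m where m: "m \<in> {0, 1}" "\<And>i. u $ i mod 2 = m" "{i. u $ i mod 4 = m + 2} \<in> golay_code"
    "(\<Sum>i\<in>UNIV. u $ i) mod 8 = 4 * m"
    using assms unfolding scaled_leech_def by blast
  have bij: "bij ?s"
    by (rule o_bij[of "map_option (\<lambda>z. z - 1)"]) (auto simp: fun_eq_iff option.map_comp o_def option.map_ident)
  have "{i. ?u $ i mod 4 = m + 2} = ?s -` {i. u $ i mod 4 = m + 2}" by auto
  then have "{i. ?u $ i mod 4 = m + 2} \<in> golay_code" using golay_code_translate[OF m(3)] by simp
  moreover have "(\<Sum>i\<in>UNIV. ?u $ i) = (\<Sum>i\<in>UNIV. u $ i)"
    using sum.reindex_bij_betw[OF bij, of "\<lambda>i. u $ i"] by simp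
  ultimately show ?thesis
    unfolding scaled_leech_def using m by (intro CollectI bexI[of _ m]) auto
qed

lemma gram_of_basis:
  fixes B :: "int^'n^'m" and S :: "int^'n^'n"
  assumes "transpose B ** B = map_matrix (\<lambda>s. c * s) S"
  shows "(\<Sum>w\<in>UNIV. (B *v x) $ w * (B *v y) $ w) = c * bilin S x y"
proof -
  have e: "(\<Sum>w\<in>UNIV. B $ w $ i * B $ w $ j) = c * S $ i $ j" for i j
    using arg_cong[OF assms, of "\<lambda>M. M $ i $ j"]
    by (simp add: matrix_matrix_mult_def transpose_def map_matrix_def)
  have "(\<Sum>w\<in>UNIV. (B *v x) $ w * (B *v y) $ w) = (\<Sum>w\<in>UNIV. \<Sum>i\<in>UNIV. \<Sum>j\<in>UNIV. x $ i * (B $ w $ i * B $ w $ j) * y $ j)"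
    by (simp add: matrix_vector_mult_def sum_product mult_ac)
  also have "\<dots> = (\<Sum>i\<in>UNIV. \<Sum>j\<in>UNIV. x $ i * (\<Sum>w\<in>UNIV. B $ w $ i * B $ w $ j) * y $ j)"
    by (subst sum_rotate) (simp add: sum_distrib_left sum_distrib_right)
  finally show ?thesis unfolding e by (simp add: bilin_def sum_distrib_left mult_ac)
qed

text \<open>The two index types have equally many elements; relabelling one by the other reduces to
  square matrices.\<close>

lemma rectangular_scaled_inverse:
  fixes B :: "int^'n^'m" and C :: "int^'m^'n"
  assumes BC: "B ** C = mat c" and card: "CARD('m) = CARD('n)" and c: "c \<noteq> 0"
  shows "C ** B = mat c"
proof -
  obtain \<tau> :: "'n \<Rightarrow> 'm" where \<tau>: "bij \<tau>"
    using finite_same_card_bij[of "UNIV :: 'n set" "UNIV :: 'm set"] card by auto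
  define B' :: "int^'n^'n" where "B' = (\<chi> i j. B $ \<tau> i $ j)"
  define C' :: "int^'n^'n" where "C' = (\<chi> i j. C $ i $ \<tau> j)"
  have eq: "\<tau> i = \<tau> j \<longleftrightarrow> i = j" for i j using \<tau> by (auto simp: bij_def inj_eq)
  have "(B' ** C') $ i $ j = (B ** C) $ \<tau> i $ \<tau> j" for i j
    by (simp add: matrix_matrix_mult_def B'_def C'_def)
  then have "B' ** C' = mat c" unfolding BC by (simp add: vec_eq_iff mat_def eq)
  then have "C' ** B' = mat c" by (rule int_matrix_scaled_inverse[OF _ c])
  moreover have "(C' ** B') $ i $ j = (C ** B) $ i $ j" for i j
    using sum.reindex_bij_betw[OF \<tau>, of "\<lambda>w. C $ i $ w * B $ w $ j"]
    by (simp add: matrix_matrix_mult_def B'_def C'_def)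
  ultimately show ?thesis by (simp add: vec_eq_iff)
qed

text \<open>Evenness and unimodularity are derived from the set of vectors. The lattice contains
  eight times each unit vector, which makes \<open>B\<close> invertible up to the factor 8. For a
  target \<open>b\<close>, the vector \<open>transpose C *v b\<close> pairs with the lattice in
  multiples of 8 and hence lies in it by self-duality.\<close>

theorem leech_even_unimodular:
  assumes "leech_gram S"
  shows "even_unimodular S"
proof -
  obtain B :: "int^24^(23 option)" where B: "range (\<lambda>x. B *v x) = scaled_leech"
    "transpose B ** B = map_matrix (\<lambda>s. 8 * s) S"
    using assms unfolding leech_gram_def by blast
  note gram = gram_of_basis[OF B(2)]
  have "\<forall>w. \<exists>x. B *v x = axis w 8" using B(1) scaled_leech_axis by (metis imageE)
  then obtain k where k: "\<And>w. B *v k w = axis w 8" by metis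
  define C :: "int^(23 option)^24" where "C = (\<chi> i w. k w $ i)"
  have "(B ** C) $ i $ w = (B *v k w) $ i" for i w
    by (simp add: matrix_matrix_mult_def matrix_vector_mult_def C_def)
  then have "B ** C = mat 8" unfolding k by (auto simp: vec_eq_iff mat_def axis_def)
  then have CB: "C ** B = mat 8" by (rule rectangular_scaled_inverse) auto
  let ?R = "map_matrix real_of_int S"
  have sym: "S $ i $ j = S $ j $ i" for i j
  proof -
    have "transpose (map_matrix (\<lambda>s. 8 * s) S) = map_matrix (\<lambda>s. 8 * s) S"
      unfolding B(2)[symmetric] by (simp add: matrix_transpose_mul)
    from symmetric_entry[OF this, of i j] show ?thesis by (simp add: map_matrix_nth)
  qed
  have "pos_definite ?R"
    unfolding pos_definite_def
  proof (intro conjI allI impI)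
    show "transpose ?R = ?R" using sym by (simp add: vec_eq_iff transpose_def map_matrix_def)
    fix x :: "real^24" assume x: "x \<noteq> 0"
    let ?B = "map_matrix real_of_int B" and ?C = "map_matrix real_of_int C"
    have "8 * bilin ?R x x = (\<Sum>w\<in>UNIV. ((?B *v x) $ w)\<^sup>2)"
    proof -
      have e: "(\<Sum>w\<in>UNIV. real_of_int (B $ w $ i * B $ w $ j)) = 8 * real_of_int (S $ i $ j)" for i j
      proof -
        have "(\<Sum>w\<in>UNIV. B $ w $ i * B $ w $ j) = 8 * S $ i $ j"
          using arg_cong[OF B(2), of "\<lambda>M. M $ i $ j"]
          by (simp add: matrix_matrix_mult_def transpose_def map_matrix_def)
        from arg_cong[OF this, of real_of_int] show ?thesis by simp
      qed
      have "(\<Sum>w\<in>UNIV. ((?B *v x) $ w)\<^sup>2) =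
        (\<Sum>w\<in>UNIV. \<Sum>i\<in>UNIV. \<Sum>j\<in>UNIV. x $ i * real_of_int (B $ w $ i * B $ w $ j) * x $ j)"
        by (simp add: matrix_vector_mult_def map_matrix_def power2_eq_square sum_product mult_ac)
      also have "\<dots> = (\<Sum>i\<in>UNIV. \<Sum>j\<in>UNIV. x $ i * (\<Sum>w\<in>UNIV. real_of_int (B $ w $ i * B $ w $ j)) * x $ j)"
        by (subst sum_rotate) (simp add: sum_distrib_left sum_distrib_right)
      finally show ?thesis unfolding e by (simp add: bilin_def map_matrix_def sum_distrib_left mult_ac)
    qed
    moreover have "?B *v x \<noteq> 0"
    proof
      assume "?B *v x = 0"
      then have "(?C ** ?B) *v x = 0" by (simp add: matrix_vector_mul_assoc[symmetric])
      then have "map_matrix real_of_int (mat 8) *v x = 0" unfolding map_matrix_of_int_mult[symmetric] CB .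
      moreover have "map_matrix real_of_int (mat 8) = (mat 8 :: real^24^24)"
        by (simp add: map_matrix_def mat_def vec_eq_iff)
      moreover have "mat 8 *v x = 8 *s x"
        by (simp add: vec_eq_iff matrix_vector_mult_def mat_def if_distrib[of "\<lambda>x. x * _"] cong: if_cong)
      ultimately show False using x by simp
    qed
    then obtain w where "(?B *v x) $ w \<noteq> 0" by (auto simp: vec_eq_iff)
    then have "(\<Sum>w\<in>UNIV. ((?B *v x) $ w)\<^sup>2) > 0" by (intro sum_pos2[of _ w]) auto
    ultimately show "bilin ?R x x > 0" by simp
  qed
  moreover have "\<exists>x. S *v x = b" for b
  proof -
    define v where "v = transpose C *v b"
    have TB: "transpose B *v v = 8 *s b"
    proof -
      have "transpose B *v v = transpose (C ** B) *v b"
        unfolding v_def matrix_vector_mul_assoc matrix_transpose_mul ..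
      also have "\<dots> = 8 *s b"
        unfolding CB transpose_mat
        by (simp add: vec_eq_iff matrix_vector_mult_def mat_def if_distrib[of "\<lambda>x. x * _"] cong: if_cong)
      finally show ?thesis .
    qed
    have "v \<in> scaled_leech"
    proof (rule scaled_leech_self_dual)
      fix u assume "u \<in> scaled_leech"
      then obtain y where u: "u = B *v y" using B(1) by blast
      have "(\<Sum>i\<in>UNIV. v $ i * u $ i) = (\<Sum>j\<in>UNIV. (transpose B *v v) $ j * y $ j)"
        unfolding u matrix_vector_mult_def transpose_def
        by (simp add: sum_distrib_left sum_distrib_right mult_ac) (rule sum.swap)
      also have "\<dots> = 8 * (\<Sum>j\<in>UNIV. b $ j * y $ j)" unfolding TB by (simp add: sum_distrib_left mult.assoc)
      finally show "8 dvd (\<Sum>i\<in>UNIV. v $ i * u $ i)" by simp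
    qed
    then obtain x where "v = B *v x" using B(1) by blast
    then have "map_matrix (\<lambda>s. 8 * s) S *v x = 8 *s b"
      using TB unfolding B(2)[symmetric] by (simp only: matrix_vector_mul_assoc)
    moreover have "map_matrix (\<lambda>s. 8 * s) S *v x = 8 *s (S *v x)"
      by (simp add: vec_eq_iff matrix_vector_mult_def map_matrix_def sum_distrib_left mult.assoc)
    ultimately have "8 *s (S *v x) = 8 *s b" by simp
    then have "S *v x = b" by (simp add: vec_eq_iff)
    then show ?thesis by blast
  qed
  moreover have "even (bilin S x x)" for x
  proof -
    have "B *v x \<in> scaled_leech" using B(1) by blast
    from scaled_leech_norm[OF this] have "16 dvd 8 * bilin S x x" unfolding gram .
    then show ?thesis by presburger
  qed
  ultimately show ?thesis by unfold_locales (auto simp: unimodular_def)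
qed

text \<open>Orders the projective line so that \<open>cycle23\<close> becomes translation by 1, with
  infinity in the last place.\<close>

definition line_point :: "nat \<Rightarrow> 23 option" where
  "line_point i = (if i < 23 then Some (F23 ! i) else None)"

lemma bij_betw_line_point: "bij_betw line_point {..<24} UNIV"
proof -
  have d: "distinct F23" "length F23 = 23" by (simp_all add: F23_def)
  have "inj_on line_point {..<24}"
    by (rule inj_onI) (use d in \<open>auto simp: line_point_def nth_eq_iff_index_eq split: if_splits\<close>)
  moreover have "w \<in> line_point ` {..<24}" for w
  proof (cases w)
    case None
    then show ?thesis by (intro image_eqI[of _ _ 23]) (auto simp: line_point_def)
  next
    case (Some z)
    then obtain i where "i < 23" "F23 ! i = z" using d set_F23 by (metis UNIV_I in_set_conv_nth)
    then show ?thesis using Some by (intro image_eqI[of _ _ i]) (auto simp: line_point_def)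
  qed
  ultimately show ?thesis by (auto simp: bij_betw_def)
qed

lemma line_point_cycle23:
  assumes "i < 24"
  shows "line_point (cycle23 i) = map_option (\<lambda>z. z + 1) (line_point i)"
proof (cases "i < 23")
  case True
  have "\<forall>i\<in>set [0..<23]. F23 ! (Suc i mod 23) = F23 ! i + 1"
    by (simp add: F23_def upt_conv_Cons)
  then show ?thesis using True by (simp add: line_point_def cycle23_def)
qed (simp add: line_point_def cycle23_def)

text \<open>Translation of the line preserves the lattice. The distinguished pair is the vector with
  8 at infinity and the vector with 8 at all finite points, both with empty code word.\<close>

theorem leech_isometry23:
  fixes S :: "int^24^24"
  assumes L: "leech_gram S"
  shows "\<exists>g x y. isometry23 S g x y"
proof -
  obtain B :: "int^24^(23 option)" where B: "range (\<lambda>x. B *v x) = scaled_leech"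
    "transpose B ** B = map_matrix (\<lambda>s. 8 * s) S"
    using L unfolding leech_gram_def by blast
  define n where "n x i = (B *v x) $ line_point i" for x i
  show ?thesis
  proof (rule isometry23_of_orthogonal_coordinates[where t = 8 and c = 8 and n = n, OF leech_even_unimodular[OF L]])
    show "8 * bilin S x y = (\<Sum>i<24. n x i * n y i)" for x y
      unfolding n_def gram_of_basis[OF B(2), symmetric]
      by (rule sum.reindex_bij_betw[OF bij_betw_line_point, symmetric])
    show "\<exists>y. \<forall>i<24. n y i = n x (cycle23 i)" for x
    proof -
      have "(\<chi> i. (B *v x) $ map_option (\<lambda>z. z + 1) i) \<in> scaled_leech"
        by (rule scaled_leech_translate) (use B(1) in blast)
      then obtain y where "B *v y = (\<chi> i. (B *v x) $ map_option (\<lambda>z. z + 1) i)" using B(1) by (metis imageE)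
      then show ?thesis by (intro exI[of _ y]) (simp add: n_def line_point_cycle23)
    qed
    obtain x where "B *v x = axis None 8" using B(1) scaled_leech_axis by (metis imageE)
    then show "\<exists>x. \<forall>i<24. n x i = (if i < 23 then 0 else 8)"
      by (intro exI[of _ x]) (auto simp: n_def line_point_def axis_def)
    define u :: "int^(23 option)" where "u = (\<chi> w. if w = None then 0 else 8)"
    have "u \<in> scaled_leech"
      by (rule scaled_leech_even_vector[OF golay_code.empty]) (auto simp: u_def intro!: dvd_sum)
    then obtain y where "B *v y = u" using B(1) by (metis imageE)
    then show "\<exists>x. \<forall>i<24. n x i = (if i < 23 then 8 else 0)"
      by (intro exI[of _ y]) (auto simp: n_def line_point_def u_def)
  qed auto
qed

section \<open>Uniqueness of the Golay code\<close>

text \<open>Linear algebra over the field with two elements, by induction on the coordinates. If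
  \<open>{k}\<close> lies in \<open>V\<close>, the coordinate \<open>k\<close> can be ignored.
  Otherwise \<open>k\<close> is projected away; if this moves \<open>t\<close> into the image of
  \<open>V\<close>, then \<open>t\<close> differs from a member of \<open>V\<close> in
  \<open>k\<close> alone and a parity check involving \<open>k\<close> is constructed.\<close>

lemma set_system_separation:
  fixes V :: "'a set set"
  assumes "finite K" "V \<subseteq> Pow K" "{} \<in> V" "\<And>a b. a \<in> V \<Longrightarrow> b \<in> V \<Longrightarrow> sym_diff a b \<in> V"
    and "t \<subseteq> K" "t \<notin> V"
  shows "\<exists>y\<subseteq>K. (\<forall>v\<in>V. even (card (y \<inter> v))) \<and> odd (card (y \<inter> t))"
  using assms
proof (induction K arbitrary: V t rule: finite_induct)
  case empty
  then show ?case by auto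
next
  case (insert k K)
  note sd = insert.prems(3)
  have fin: "finite v" if "v \<subseteq> insert k K" for v using that insert.hyps(1) by (meson finite.insertI finite_subset)
  define V0 where "V0 = {v \<in> V. k \<notin> v}"
  have V0: "V0 \<subseteq> Pow K" "{} \<in> V0" "\<And>a b. a \<in> V0 \<Longrightarrow> b \<in> V0 \<Longrightarrow> sym_diff a b \<in> V0"
    using insert.prems(1,2) sd by (auto simp: V0_def)
  have tK: "t - {k} \<subseteq> K" using insert.prems(4) by auto
  have drop: "y \<inter> (v - {k}) = y \<inter> v" if "y \<subseteq> K" for y v using that insert.hyps(2) by auto
  show ?case
  proof (cases "{k} \<in> V")
    case True
    have V: "v - {k} \<in> V0" if "v \<in> V" for v
    proof (cases "k \<in> v")
      case kv: True
      then have "sym_diff v {k} = v - {k}" by auto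
      then show ?thesis using sd[OF that True] by (auto simp: V0_def)
    qed (use that in \<open>auto simp: V0_def\<close>)
    have "t - {k} \<notin> V0"
    proof
      assume "t - {k} \<in> V0"
      then have "t - {k} \<in> V" by (simp add: V0_def)
      moreover have "sym_diff (t - {k}) {k} = t" if "k \<in> t" using that by auto
      ultimately show False using sd[OF _ True, of "t - {k}"] insert.prems(5) by (cases "k \<in> t") auto
    qed
    from insert.IH[OF V0 tK this] obtain y where y: "y \<subseteq> K" "\<forall>v\<in>V0. even (card (y \<inter> v))" "odd (card (y \<inter> (t - {k})))"
      by blast
    show ?thesis using y V drop[OF y(1)] by (intro exI[of _ y]) (metis subset_insertI2)
  next
    case False
    define W where "W = (\<lambda>v. v - {k}) ` V"
    show ?thesis
    proof (cases "t - {k} \<in> W")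
      case tW: False
      have "W \<subseteq> Pow K" "{} \<in> W" using insert.prems(1,2) by (auto simp: W_def image_iff intro!: bexI[of _ "{}"])
      moreover have "sym_diff a b \<in> W" if ab: "a \<in> W" "b \<in> W" for a b
      proof -
        obtain a' b' where "a' \<in> V" "b' \<in> V" "a = a' - {k}" "b = b' - {k}" using ab unfolding W_def by blast
        moreover have "sym_diff (a' - {k}) (b' - {k}) = sym_diff a' b' - {k}" by auto
        ultimately show ?thesis using sd[of a' b'] by (auto simp: W_def)
      qed
      ultimately obtain y where y: "y \<subseteq> K" "\<forall>v\<in>W. even (card (y \<inter> v))" "odd (card (y \<inter> (t - {k})))"
        using insert.IH[of W "t - {k}"] tK tW by blast
      show ?thesis using y drop[OF y(1)] by (intro exI[of _ y]) (auto simp: W_def)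
    next
      case True
      then obtain v0 where v0: "v0 \<in> V" "v0 - {k} = t - {k}" by (auto simp: W_def)
      have t: "sym_diff v0 {k} = t"
      proof -
        have "v0 \<noteq> t" using v0 insert.prems(5) by auto
        then have "(k \<in> v0) \<noteq> (k \<in> t)" using v0(2) by (metis insert_Diff Diff_insert_absorb Diff_empty Diff_insert0)
        then show ?thesis using v0(2) by auto
      qed
      \<comment> \<open>A parity check through \<open>k\<close> that annihilates \<open>V\<close>:
        it is obtained by separating \<open>v1 - {k}\<close> from the members that avoid
        \<open>k\<close>, and inserting \<open>k\<close> corrects the parity on the members that
        contain it.\<close>
      have "\<exists>y. y \<subseteq> insert k K \<and> k \<in> y \<and> (\<forall>v\<in>V. even (card (y \<inter> v)))"
      proof (cases "\<forall>v\<in>V. k \<notin> v")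
        case True
        then show ?thesis by (intro exI[of _ "{k}"]) auto
      next
        case not_all: False
        then obtain v1 where v1: "v1 \<in> V" "k \<in> v1" by blast
        have "v1 - {k} \<notin> V0"
        proof
          assume "v1 - {k} \<in> V0"
          then have "sym_diff v1 (v1 - {k}) \<in> V" using sd[OF v1(1)] by (simp add: V0_def)
          moreover have "sym_diff v1 (v1 - {k}) = {k}" using v1 by auto
          ultimately show False using False by simp
        qed
        moreover have "v1 - {k} \<subseteq> K" using v1 insert.prems(1) by auto
        ultimately obtain y where y: "y \<subseteq> K" "\<forall>v\<in>V0. even (card (y \<inter> v))" "odd (card (y \<inter> (v1 - {k})))"
          using insert.IH[OF V0] by blast
        have even0: "even (card (insert k y \<inter> v))" if "v \<in> V0" for v
        proof -
          have "insert k y \<inter> v = y \<inter> v" using that by (auto simp: V0_def)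
          then show ?thesis using y(2) that by simp
        qed
        have even1: "even (card (insert k y \<inter> v1))"
        proof -
          have "insert k y \<inter> v1 = insert k (y \<inter> (v1 - {k}))" using v1 by auto
          moreover have "k \<notin> y \<inter> (v1 - {k})" by simp
          moreover have "finite (y \<inter> (v1 - {k}))" using y(1) insert.hyps(1) by (meson finite_Int finite_subset)
          ultimately show ?thesis using y(3) by simp
        qed
        have "even (card (insert k y \<inter> v))" if "v \<in> V" for v
        proof (cases "k \<in> v")
          case True
          then have "sym_diff v v1 \<in> V0" using sd[OF that v1(1)] v1 by (auto simp: V0_def)
          then have "even (card (sym_diff v v1 \<inter> insert k y))" using even0[of "sym_diff v v1"] by (simp only: Int_commute)
          moreover have "finite v" "finite v1" using that v1(1) insert.prems(1) fin by blast+
          ultimately show ?thesis using even1 by (simp only: even_card_sym_diff_Int) (simp add: Int_commute)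
        qed (use that even0 in \<open>auto simp: V0_def\<close>)
        then show ?thesis using y(1) by (intro exI[of _ "insert k y"]) auto
      qed
      then obtain y where y: "y \<subseteq> insert k K" "k \<in> y" "\<forall>v\<in>V. even (card (y \<inter> v))" by blast
      have "finite v0" using v0(1) insert.prems(1) fin by blast
      then have "odd (card (sym_diff v0 {k} \<inter> y))"
        using y(2,3) v0(1) by (simp only: even_card_sym_diff_Int finite.intros) (simp add: Int_commute)
      then show ?thesis using y t by (intro exI[of _ y]) (auto simp: Int_commute)
    qed
  qed
qed

section \<open>Self-dual doubly even codes of length 24 without words of weight 4\<close>

locale extremal_code =
  fixes C :: "'a::finite set set"
  assumes card_points: "CARD('a) = 24"
    and self_dual: "A \<in> C \<longleftrightarrow> (\<forall>B\<in>C. even (card (A \<inter> B)))"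
    and doubly_even: "A \<in> C \<Longrightarrow> 4 dvd card A"
    and no_tetrad: "A \<in> C \<Longrightarrow> card A \<noteq> 4"
begin

lemma even_Int: "A \<in> C \<Longrightarrow> B \<in> C \<Longrightarrow> even (card (A \<inter> B))"
  using self_dual by blast

lemma sym_diff_closed:
  assumes "A \<in> C" "B \<in> C"
  shows "sym_diff A B \<in> C"
proof (subst self_dual, intro ballI)
  fix B' assume "B' \<in> C"
  then show "even (card (sym_diff A B \<inter> B'))"
    using even_Int[OF assms(1)] even_Int[OF assms(2)] by (simp only: even_card_sym_diff_Int finite)
qed

lemma UNIV_mem: "UNIV \<in> C"
proof (subst self_dual, intro ballI)
  fix B assume "B \<in> C"
  then have "4 dvd card B" by (rule doubly_even)
  then show "even (card (UNIV \<inter> B))" using dvd_trans[of 2 4] by auto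
qed

lemma empty_mem: "{} \<in> C" using sym_diff_closed[OF UNIV_mem UNIV_mem] by simp

lemma Compl_mem: "A \<in> C \<Longrightarrow> - A \<in> C"
  using sym_diff_closed[OF UNIV_mem] by (simp add: Compl_eq_Diff_UNIV)

lemma card_Compl: "card (- A) = 24 - card A" for A :: "'a set"
  using card_Diff_subset[of A UNIV] by (simp add: Compl_eq_Diff_UNIV card_points)

lemma card_le: "card A \<le> 24" for A :: "'a set"
  using card_mono[of UNIV A] by (simp add: card_points)

lemma card_cases: 
  assumes "A \<in> C" shows "card A \<in> {0, 8, 12, 16, 24}"
proof -
  have "card (- A) \<noteq> 4" by (rule no_tetrad[OF Compl_mem[OF assms]])
  then have "card A \<noteq> 20" by (simp add: card_Compl)
  moreover obtain k where "card A = 4 * k" using doubly_even[OF assms] by blast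
  ultimately show ?thesis using no_tetrad[OF assms] card_le[of A] by (auto; presburger)
qed

text \<open>A set that is not the trace of a word on \<open>K\<close> would be separated from the
  traces by a parity check \<open>y\<close> inside \<open>K\<close>. This \<open>y\<close> is
  orthogonal to the code, hence a word by self-duality, and contradicts the parity assumption on
  \<open>s\<close>.\<close>

lemma prescribe:
  assumes "s \<subseteq> K" "\<And>a. a \<in> C \<Longrightarrow> a \<subseteq> K \<Longrightarrow> even (card (s \<inter> a))"
  obtains w where "w \<in> C" "w \<inter> K = s"
proof -
  define V where "V = (\<lambda>w. w \<inter> K) ` C"
  have "s \<in> V"
  proof (rule ccontr)
    assume "s \<notin> V"
    have "sym_diff a b \<in> V" if ab: "a \<in> V" "b \<in> V" for a b
    proof -
      obtain a' b' where "a' \<in> C" "b' \<in> C" "a = a' \<inter> K" "b = b' \<inter> K" using ab unfolding V_def by blast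
      moreover have "sym_diff (a' \<inter> K) (b' \<inter> K) = sym_diff a' b' \<inter> K" by auto
      ultimately show ?thesis using sym_diff_closed[of a' b'] by (auto simp: V_def)
    qed
    moreover have "V \<subseteq> Pow K" "{} \<in> V" using empty_mem by (auto simp: V_def image_iff intro!: bexI[of _ "{}"])
    ultimately obtain y where y: "y \<subseteq> K" "\<forall>v\<in>V. even (card (y \<inter> v))" "odd (card (y \<inter> s))"
      using set_system_separation[of K V s] assms(1) \<open>s \<notin> V\<close> by auto
    have "even (card (y \<inter> w))" if "w \<in> C" for w
    proof -
      have "y \<inter> w = y \<inter> (w \<inter> K)" using y(1) by auto
      then show ?thesis using y(2) that by (auto simp: V_def)
    qed
    then have "y \<in> C" by (subst self_dual) blast
    then show False using assms(2)[of y] y by (simp add: Int_commute)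
  qed
  then show ?thesis using that by (auto simp: V_def)
qed

text \<open>No non-empty word fits into fewer than eight points, so the parity condition on
  \<open>s\<close> is void.\<close>

lemma prescribe_septad:
  assumes "card K < 8" "s \<subseteq> K"
  obtains w where "w \<in> C" "w \<inter> K = s"
proof (rule prescribe[OF assms(2)])
  fix a assume a: "a \<in> C" "a \<subseteq> K"
  then have "card a < 8" using card_mono[of K a] assms(1) by simp
  then have "a = {}" using card_cases[OF a(1)] by auto
  then show "even (card (s \<inter> a))" by simp
qed (use that in blast)

lemma octad_exists: 
  assumes "\<forall>A\<in>C. card A \<noteq> 12"
  obtains A where "A \<in> C" "card A = 8"
proof -
  obtain K :: "'a set" where K: "card K = 2" using obtain_subset_with_card_n[of 2 "UNIV :: 'a set"] card_points by auto
  then obtain a b where ab: "K = {a, b}" "a \<noteq> b" by (auto simp: card_2_iff)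
  obtain w where w: "w \<in> C" "w \<inter> K = {a}" using prescribe_septad[of K "{a}"] K ab by auto
  have "card w \<noteq> 0" "card w \<noteq> 24"
    using w(2) ab card_subset_eq[of UNIV w] card_points by auto
  then have "card w = 8 \<or> card (- w) = 8" using card_cases[OF w(1)] assms w(1) by (auto simp: card_Compl)
  then show ?thesis using that w(1) Compl_mem[OF w(1)] by blast
qed

text \<open>Suppose there is an octad. A word with two prescribed points among seven of its points
  meets it in two or three points, hence in two by parity. Adding the octad raises the weight by 4,
  and two possible weights at distance 4 include 12.\<close>

lemma dodecad_exists: obtains D where "D \<in> C" "card D = 12"
proof (cases "\<exists>A\<in>C. card A = 12")
  case False
  then obtain A where A: "A \<in> C" "card A = 8" using octad_exists by blast
  obtain K where K: "K \<subseteq> A" "card K = 7" using obtain_subset_with_card_n[of 7 A] A by auto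
  obtain s where s: "s \<subseteq> K" "card s = 2" using obtain_subset_with_card_n[of 2 K] K by auto
  obtain w where w: "w \<in> C" "w \<inter> K = s" using prescribe_septad[of K s] K s by auto
  have "card (w \<inter> A) \<le> card (s \<union> (A - K))" using w(2) by (intro card_mono) auto
  also have "\<dots> \<le> card s + card (A - K)" by (rule card_Un_le)
  also have "card (A - K) = 1" using K A by (simp add: card_Diff_subset)
  finally have "card (w \<inter> A) \<le> 3" using s by simp
  moreover have "card s \<le> card (w \<inter> A)" using w(2) K s by (intro card_mono) auto
  moreover have "even (card (w \<inter> A))" using even_Int w A by blast
  ultimately have 2: "card (w \<inter> A) = 2" using s by presburger
  have "card (sym_diff w A) + 2 * 2 = card w + 8" using card_sym_diff[of w A] 2 A by simp
  then have "card w = 12 \<or> card (sym_diff w A) = 12" 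
    using card_cases[OF w(1)] card_cases[OF sym_diff_closed[OF w(1) A(1)]] by auto
  then show ?thesis using that w(1) sym_diff_closed[OF w(1) A(1)] by blast
qed (use that in blast)

end

text \<open>\<open>p\<close> is the common point of the pairs \<open>{p, d}\<close> in
  \<open>D\<close>; \<open>p'\<close> singles out one of the two words with such a trace on
  \<open>D\<close>, which differ by the complement of \<open>D\<close>.\<close>

locale pointed_dodecad = extremal_code C for C :: "'a::finite set set" +
  fixes D :: "'a set" and p p' :: 'a
  assumes D: "D \<in> C" "card D = 12" and p: "p \<in> D" and p': "p' \<notin> D"
begin

text \<open>An octad inside a dodecad would leave a word of weight 4 as the difference.\<close>

lemma subset_dodecad:
  assumes "a \<in> C" "card a = 12" "b \<in> C" "b \<subseteq> a"
  shows "b = {} \<or> b = a"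
proof -
  have "card b \<le> 12" using card_mono[of a b] assms by simp
  moreover have "card b \<noteq> 8"
  proof
    assume "card b = 8"
    then have "card (sym_diff b a) = 4" using card_sym_diff[of b a] assms by (simp add: Int_absorb2)
    then show False using no_tetrad[OF sym_diff_closed[OF assms(3,1)]] by simp
  qed
  moreover have "b = a" if "card b = 12" using card_subset_eq[of a b] assms that by simp
  ultimately show ?thesis using card_cases[OF assms(3)] by auto
qed

lemma card_Compl_D: "card (- D) = 12" using D by (simp add: card_Compl)

lemma card_split_D: "card w = card (w \<inter> D) + card (w - D)"
  using card_Int_Diff[of w D] by simp

lemma card_outside:
  assumes "w \<in> C" "card (w \<inter> D) = 2"
  shows "card (w - D) = 6 \<or> card (w - D) = 10"
proof -
  have "card (w - D) \<le> 12" using card_mono[of "- D" "w - D"] card_Compl_D by auto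
  then show ?thesis using card_cases[OF assms(1)] assms(2) card_split_D[of w] by auto
qed

lemma card_sym_diff_Compl_D: "card (sym_diff w (- D)) + card (w - D) = 12 + card (w \<inter> D)"
proof -
  have "w \<inter> - D = w - D" by auto
  then show ?thesis using card_sym_diff[of w "- D"] card_Compl_D card_split_D[of w] by simp
qed

text \<open>Ten points outside would become two after adding the complement of \<open>D\<close>, and
  the sum would have weight 4.\<close>

lemma card_outside_6:
  assumes "w \<in> C" "card (w \<inter> D) = 2"
  shows "card (w - D) = 6"
proof -
  have "card (sym_diff w (- D)) \<noteq> 4" by (rule no_tetrad[OF sym_diff_closed[OF assms(1) Compl_mem[OF D(1)]]])
  then show ?thesis using card_outside[OF assms] card_sym_diff_Compl_D[of w] assms(2) by auto
qed

lemma pair_word_exists: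
  assumes "d \<in> D - {p}"
  shows "\<exists>w. w \<in> C \<and> w \<inter> D = {p, d} \<and> p' \<notin> w"
proof -
  have "even (card ({p, d} \<inter> a))" if "a \<in> C" "a \<subseteq> D" for a
    using subset_dodecad[OF D that] p assms by auto
  then obtain w where w: "w \<in> C" "w \<inter> D = {p, d}" using prescribe[of "{p, d}" D] p assms by auto
  show ?thesis
  proof (cases "p' \<in> w")
    case True
    have "sym_diff w (- D) \<inter> D = {p, d}" "p' \<notin> sym_diff w (- D)" using w True p' by auto
    then show ?thesis using sym_diff_closed[OF w(1) Compl_mem[OF D(1)]] by blast
  qed (use w in blast)
qed

definition pair_word :: "'a \<Rightarrow> 'a set" where
  "pair_word d = (SOME w. w \<in> C \<and> w \<inter> D = {p, d} \<and> p' \<notin> w)"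

lemma pair_word:
  assumes "d \<in> D - {p}"
  shows "pair_word d \<in> C" "pair_word d \<inter> D = {p, d}" "p' \<notin> pair_word d" "card (pair_word d - D) = 6"
proof -
  show *: "pair_word d \<in> C" "pair_word d \<inter> D = {p, d}" "p' \<notin> pair_word d"
    using someI_ex[OF pair_word_exists[OF assms]] unfolding pair_word_def by blast+
  show "card (pair_word d - D) = 6" using card_outside_6[OF *(1)] *(2) assms by auto
qed

text \<open>The dodecad, its complement and the pair words span the code: adding pair words to a
  word removes its points in \<open>D\<close> other than \<open>p\<close>, and what remains is empty
  or the complement of \<open>D\<close>. The code is thus determined by thirteen words.\<close>

lemma mem_iff_orthogonal:
  "A \<in> C \<longleftrightarrow> even (card (A \<inter> D)) \<and> even (card (A \<inter> - D)) \<and> (\<forall>d\<in>D - {p}. even (card (A \<inter> pair_word d)))"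
  (is "_ \<longleftrightarrow> ?R")
proof
  assume "A \<in> C"
  then show ?R using even_Int D(1) Compl_mem[OF D(1)] pair_word(1) by blast
next
  assume R: ?R
  have "even (card (B \<inter> A))" if "B \<in> C" for B
    using that
  proof (induction "card (B \<inter> (D - {p}))" arbitrary: B rule: less_induct)
    case less
    show ?case
    proof (cases "B \<inter> (D - {p}) = {}")
      case True
      then have "B \<inter> D \<subseteq> {p}" by auto
      moreover have "even (card (B \<inter> D))" by (rule even_Int[OF less.prems D(1)])
      ultimately have "B \<inter> D = {}" by (auto simp: subset_singleton_iff)
      then have "B = {} \<or> B = - D"
        using subset_dodecad[OF Compl_mem[OF D(1)] card_Compl_D less.prems] by auto
      then show ?thesis using R by (auto simp: Int_commute)
    next
      case False
      then obtain d where d: "d \<in> B" "d \<in> D - {p}" by auto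
      let ?B = "sym_diff B (pair_word d)"
      have "?B \<inter> (D - {p}) = B \<inter> (D - {p}) - {d}" using pair_word(2)[OF d(2)] d by auto
      moreover have "card (B \<inter> (D - {p}) - {d}) < card (B \<inter> (D - {p}))" using d by (intro card_Diff1_less) auto
      ultimately have "even (card (?B \<inter> A))"
        using less.hyps[of ?B] sym_diff_closed[OF less.prems pair_word(1)[OF d(2)]] by simp
      moreover have "even (card (pair_word d \<inter> A))" using R d by (simp add: Int_commute)
      ultimately show ?thesis by (simp only: even_card_sym_diff_Int finite)
    qed
  qed
  then show "A \<in> C" by (subst self_dual) (simp add: Int_commute)
qed

text \<open>On the eleven points outside \<open>D\<close> other than \<open>p'\<close> the eleven
  blocks form a biplane: five points each, and two points in common for any two of them.\<close>

definition block :: "'a \<Rightarrow> 'a set" where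
  "block d = - D - {p'} - pair_word d"

lemma card_points_outside: "card (- D - {p'}) = 11"
  using card_Compl_D p' by simp

lemma card_block:
  assumes "d \<in> D - {p}"
  shows "card (block d) = 5"
proof -
  have "block d = (- D - {p'}) - (pair_word d - D)" by (auto simp: block_def)
  moreover have "card \<dots> = card (- D - {p'}) - card (pair_word d - D)"
    by (rule card_Diff_subset) (use pair_word(3)[OF assms] in auto)
  ultimately show ?thesis by (simp add: card_points_outside pair_word(4)[OF assms])
qed

lemma card_block_Int:
  assumes d: "d \<in> D - {p}" "e \<in> D - {p}" "d \<noteq> e"
  shows "card (block d \<inter> block e) = 2"
proof -
  let ?w = "sym_diff (pair_word d) (pair_word e)"
  have w: "?w \<in> C" by (intro sym_diff_closed pair_word(1) d)
  have "?w \<inter> D = {d, e}" using pair_word(2)[OF d(1)] pair_word(2)[OF d(2)] d by auto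
  then have "card (?w - D) = 6" using card_outside_6[OF w] d(3) by simp
  moreover have "?w - D = sym_diff (block d) (block e)"
    using pair_word(3)[OF d(1)] pair_word(3)[OF d(2)] by (auto simp: block_def)
  ultimately show ?thesis
    using card_sym_diff[of "block d" "block e"] card_block[OF d(1)] card_block[OF d(2)] by simp
qed

text \<open>If two blocks met \<open>block d\<close> in the same pair, the three blocks would share
  just this pair and cover all eleven points. The three pair words would then add up to
  \<open>{p, d, e, f}\<close>, of weight 4.\<close>

lemma block_Int_inj:
  assumes d: "d \<in> D - {p}" "e \<in> D - {p}" "f \<in> D - {p}" and ne: "d \<noteq> e" "d \<noteq> f" "e \<noteq> f"
  shows "block d \<inter> block e \<noteq> block d \<inter> block f"
proof
  assume eq: "block d \<inter> block e = block d \<inter> block f"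
  note cards = card_block[OF d(1)] card_block[OF d(2)] card_block[OF d(3)]
    card_block_Int[OF d(1,2) ne(1)] card_block_Int[OF d(2,3) ne(3)]
  have sub: "block d \<inter> block e \<subseteq> block e \<inter> block f" using eq by auto
  have P: "block e \<inter> block f = block d \<inter> block e"
    by (rule card_subset_eq[OF _ sub, symmetric]) (simp_all add: cards)
  have "card (block d \<union> block e) = 8"
    using card_Un_Int[of "block d" "block e"] by (simp add: cards)
  moreover have "(block d \<union> block e) \<inter> block f = block d \<inter> block e" using P eq by auto
  ultimately have "card (block d \<union> block e \<union> block f) = 11"
    using card_Un_Int[of "block d \<union> block e" "block f"] by (simp add: cards)
  then have all: "block d \<union> block e \<union> block f = - D - {p'}"
    by (intro card_subset_eq) (auto simp: card_points_outside block_def)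
  let ?w = "sym_diff (sym_diff (pair_word d) (pair_word e)) (pair_word f)"
  have w: "?w \<in> C" by (intro sym_diff_closed pair_word(1) d)
  have "x \<in> ?w \<longleftrightarrow> x \<in> {p, d, e, f}" for x
  proof (cases "x \<in> D")
    case True
    then have "x \<in> pair_word d \<longleftrightarrow> x \<in> {p, d}" "x \<in> pair_word e \<longleftrightarrow> x \<in> {p, e}" "x \<in> pair_word f \<longleftrightarrow> x \<in> {p, f}"
      using pair_word(2)[OF d(1)] pair_word(2)[OF d(2)] pair_word(2)[OF d(3)] by blast+
    then show ?thesis using d ne by auto
  next
    case xD: False
    have "x \<notin> ?w"
    proof (cases "x = p'")
      case True
      then show ?thesis using pair_word(3) d by simp
    next
      case False
      have b: "x \<in> block c \<longleftrightarrow> x \<notin> pair_word c" for c using xD False by (auto simp: block_def)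
      show ?thesis using all xD False P eq b[of d] b[of e] b[of f] by blast
    qed
    then show ?thesis using xD d p by auto
  qed
  then have "?w = {p, d, e, f}" by blast
  moreover have "card {p, d, e, f} = 4" using d ne by auto
  ultimately show False using no_tetrad[OF w] by simp
qed

text \<open>The ten other blocks cut out ten distinct pairs, and a set of five points has no
  more.\<close>

lemma block_Int_surj:
  assumes d: "d \<in> D - {p}" and X: "X \<subseteq> block d" "card X = 2"
  shows "\<exists>e\<in>D - {p, d}. block d \<inter> block e = X"
proof -
  let ?f = "\<lambda>e. block d \<inter> block e"
  have "inj_on ?f (D - {p, d})"
    using block_Int_inj[OF d] unfolding inj_on_def by blast
  then have "card (?f ` (D - {p, d})) = card (D - {p, d})" by (rule card_image)
  also have "\<dots> = 10" using d p D by (subst card_Diff_subset) auto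
  also have "10 = card {X. X \<subseteq> block d \<and> card X = 2}"
    using n_subsets[of "block d" 2] card_block[OF d] by (simp add: choose_two)
  finally have "?f ` (D - {p, d}) = {X. X \<subseteq> block d \<and> card X = 2}"
  proof (intro card_subset_eq subsetI)
    fix Y assume "Y \<in> ?f ` (D - {p, d})"
    then obtain e where "e \<in> D - {p}" "d \<noteq> e" "Y = ?f e" by auto
    then show "Y \<in> {X. X \<subseteq> block d \<and> card X = 2}" using card_block_Int[OF d] by simp
  qed auto
  moreover have "X \<in> {X. X \<subseteq> block d \<and> card X = 2}" using X by simp
  ultimately have "X \<in> ?f ` (D - {p, d})" by (simp only:)
  then obtain e where "e \<in> D - {p, d}" "?f e = X" by (auto simp only: image_iff)
  then show ?thesis by (rule bexI[rotated])
qed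

end

section \<open>Triples in a set of six points\<close>

lemma triple_count:
  "card (X \<inter> {a, b, c}) = n \<Longrightarrow> distinct [a, b, c] \<Longrightarrow> of_bool (a \<in> X) + of_bool (b \<in> X) + of_bool (c \<in> X) = n"
  by (auto simp: Int_insert_right)

text \<open>If \<open>A\<close> lost the same point to \<open>P\<close> and to \<open>Q\<close>, the
  two points of \<open>A\<close> in \<open>P\<close> would lie in \<open>Q\<close> as well. If the
  new points agreed, this point and a point common to all three sets would lie in \<open>P\<close>
  and \<open>Q\<close>. Both exceed the single common point of \<open>P\<close> and
  \<open>Q\<close>.\<close>

lemma overlapping_triples:
  assumes fin: "finite A" "finite P" "finite Q" and c: "card A = 3" "card P = 3" "card Q = 3"
    and AP: "card (A \<inter> P) = 2" and AQ: "card (A \<inter> Q) = 2" and PQ: "card (P \<inter> Q) = 1"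
    and a: "A - P = {a}" and b: "A - Q = {b}" and e: "P - A = {e}" and f: "Q - A = {f}"
  shows "a \<noteq> b" "e \<noteq> f"
proof -
  have ab: "a \<noteq> b"
  proof
    assume "a = b"
    then have "A \<inter> P \<subseteq> P \<inter> Q" using a b by auto
    then show False using card_mono[of "P \<inter> Q" "A \<inter> P"] fin AP PQ by simp
  qed
  then show "a \<noteq> b" .
  show "e \<noteq> f"
  proof
    assume ef: "e = f"
    have "A - {a, b} \<noteq> {}"
    proof
      assume "A - {a, b} = {}"
      then have "card A \<le> card {a, b}" by (intro card_mono) auto
      then show False using c ab by simp
    qed
    then obtain g where "g \<in> A - {a, b}" by blast
    then have "g \<in> P \<inter> Q" "e \<in> P \<inter> Q" "e \<noteq> g" using a b e f ef by auto
    moreover obtain h where "P \<inter> Q = {h}" using PQ card_1_singletonE by blast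
    ultimately show False by auto
  qed
qed

text \<open>Each of \<open>B\<close>, \<open>E\<close> and \<open>F\<close> replaces one point of
  \<open>A\<close> by a point outside \<open>A\<close>. The replaced points are distinct, and so are
  the new ones; together they exhaust the six points.\<close>

lemma base_triples:
  assumes R: "finite R" "card R = 6" and sub: "A \<subseteq> R" "B \<subseteq> R" "E \<subseteq> R" "F \<subseteq> R"
    and c: "card A = 3" "card B = 3" "card E = 3" "card F = 3"
    and two: "card (A \<inter> B) = 2" "card (A \<inter> E) = 2" "card (A \<inter> F) = 2"
    and one: "card (B \<inter> E) = 1" "card (B \<inter> F) = 1" "card (E \<inter> F) = 1"
  obtains x y z u v w where "distinct [x, y, z, u, v, w]" "R = {x, y, z, u, v, w}"
    "A = {x, y, z}" "B = {y, z, u}" "E = {x, z, v}" "F = {x, y, w}"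
proof -
  have fin: "finite A" "finite B" "finite E" "finite F" using sub R(1) finite_subset by blast+
  have "card (A - B) = 1" "card (A - E) = 1" "card (A - F) = 1" "card (B - A) = 1" "card (E - A) = 1" "card (F - A) = 1"
    using card_Int_Diff[of A B] card_Int_Diff[of A E] card_Int_Diff[of A F]
      card_Int_Diff[of B A] card_Int_Diff[of E A] card_Int_Diff[of F A] fin c two by (simp_all add: Int_commute)
  then obtain x y z u v w where d: "A - B = {x}" "A - E = {y}" "A - F = {z}" "B - A = {u}" "E - A = {v}" "F - A = {w}"
    by (elim card_1_singletonE) blast
  have ne: "x \<noteq> y" "x \<noteq> z" "y \<noteq> z" "u \<noteq> v" "u \<noteq> w" "v \<noteq> w"
    using overlapping_triples[OF fin(1,2,3) c(1,2,3) two(1,2) one(1) d(1,2,4,5)]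
      overlapping_triples[OF fin(1,2,4) c(1,2,4) two(1,3) one(2) d(1,3,4,6)]
      overlapping_triples[OF fin(1,3,4) c(1,3,4) two(2,3) one(3) d(2,3,5,6)] by blast+
  have A: "A = {x, y, z}"
    by (rule card_subset_eq[OF fin(1), symmetric]) (use d ne c in auto)
  have "u \<notin> A" "v \<notin> A" "w \<notin> A" using d by auto
  then have dist: "distinct [x, y, z, u, v, w]" using ne A by auto
  have "u \<in> R" "v \<in> R" "w \<in> R" using d sub by auto
  then have "{x, y, z, u, v, w} \<subseteq> R" using sub(1) A by simp
  moreover have "card {x, y, z, u, v, w} = card R" using distinct_card[OF dist] R(2) by simp
  ultimately have R': "{x, y, z, u, v, w} = R" by (rule card_subset_eq[OF R(1)])
  have union: "P = (A - (A - P)) \<union> (P - A)" for P :: "'a set" by auto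
  have "B = {y, z, u}" by (subst union[of B], unfold d(1,4)) (use A dist in auto)
  moreover have "E = {x, z, v}" by (subst union[of E], unfold d(2,5)) (use A dist in auto)
  moreover have "F = {x, y, w}" by (subst union[of F], unfold d(3,6)) (use A dist in auto)
  ultimately show ?thesis using that[OF dist R'[symmetric] A] by simp
qed

context
  fixes x y z u v w :: 'a and X :: "'a set"
  assumes six: "distinct [x, y, z, u, v, w]" "X \<subseteq> {x, y, z, u, v, w}"
begin

lemma six_distinct: "distinct [x, y, z]" "distinct [y, z, u]" "distinct [x, z, v]" "distinct [x, y, w]"
  "distinct [x, w, u]" "distinct [y, w, v]"
  using six(1) by auto

lemma six_Int: "{x, y, z, u, v, w} \<inter> X = X" using six(2) by blast

text \<open>Intersection numbers are linear conditions on the six membership values, settled by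
  trying all of them. The two solutions are exchanged by the symmetry that swaps \<open>x\<close>
  with \<open>y\<close> and \<open>u\<close> with \<open>v\<close>.\<close>

lemma triple_xwu_or_ywv:
  assumes "card (X \<inter> {x, y, z}) = 1" "card (X \<inter> {y, z, u}) = 1" "card (X \<inter> {x, z, v}) = 1" "card (X \<inter> {x, y, w}) = 2"
  shows "X = {x, w, u} \<or> X = {y, w, v}"
proof -
  have "x \<in> X \<and> w \<in> X \<and> u \<in> X \<and> y \<notin> X \<and> z \<notin> X \<and> v \<notin> X \<or>
      y \<in> X \<and> w \<in> X \<and> v \<in> X \<and> x \<notin> X \<and> z \<notin> X \<and> u \<notin> X"
    using triple_count[OF assms(1) six_distinct(1)] triple_count[OF assms(2) six_distinct(2)] triple_count[OF assms(3) six_distinct(3)] triple_count[OF assms(4) six_distinct(4)] 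
    by (cases "x \<in> X"; cases "y \<in> X"; cases "z \<in> X"; cases "u \<in> X"; cases "v \<in> X"; cases "w \<in> X"; simp)
  then have "{x, y, z, u, v, w} \<inter> X = {x, w, u} \<or> {x, y, z, u, v, w} \<inter> X = {y, w, v}"
    by (elim disjE conjE) (simp_all add: Int_insert_left insert_commute)
  then show ?thesis unfolding six_Int .
qed

lemma triple_zvw:
  assumes "card (X \<inter> {x, y, z}) = 1" "card (X \<inter> {y, z, u}) = 1" "card (X \<inter> {x, z, v}) = 2" "card (X \<inter> {x, y, w}) = 1"
    "card (X \<inter> {x, w, u}) = 1" "card (X \<inter> {y, w, v}) = 2"
  shows "X = {z, v, w}"
proof -
  have "z \<in> X \<and> v \<in> X \<and> w \<in> X \<and> x \<notin> X \<and> y \<notin> X \<and> u \<notin> X"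
    using triple_count[OF assms(1) six_distinct(1)] triple_count[OF assms(2) six_distinct(2)] triple_count[OF assms(3) six_distinct(3)] triple_count[OF assms(4) six_distinct(4)] triple_count[OF assms(5) six_distinct(5)] triple_count[OF assms(6) six_distinct(6)] 
    by (cases "x \<in> X"; cases "y \<in> X"; cases "z \<in> X"; cases "u \<in> X"; cases "v \<in> X"; cases "w \<in> X"; simp)
  then have "{x, y, z, u, v, w} \<inter> X = {z, v, w}" by (simp add: Int_insert_left insert_commute)
  then show ?thesis unfolding six_Int .
qed

lemma triple_xuv:
  assumes "card (X \<inter> {x, y, z}) = 1" "card (X \<inter> {y, z, u}) = 1" "card (X \<inter> {x, z, v}) = 2" "card (X \<inter> {x, y, w}) = 1"
    "card (X \<inter> {x, w, u}) = 2" "card (X \<inter> {y, w, v}) = 1"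
  shows "X = {x, u, v}"
proof -
  have "x \<in> X \<and> u \<in> X \<and> v \<in> X \<and> y \<notin> X \<and> z \<notin> X \<and> w \<notin> X"
    using triple_count[OF assms(1) six_distinct(1)] triple_count[OF assms(2) six_distinct(2)] triple_count[OF assms(3) six_distinct(3)] triple_count[OF assms(4) six_distinct(4)] triple_count[OF assms(5) six_distinct(5)] triple_count[OF assms(6) six_distinct(6)] 
    by (cases "x \<in> X"; cases "y \<in> X"; cases "z \<in> X"; cases "u \<in> X"; cases "v \<in> X"; cases "w \<in> X"; simp)
  then have "{x, y, z, u, v, w} \<inter> X = {x, u, v}" by (simp add: Int_insert_left insert_commute)
  then show ?thesis unfolding six_Int .
qed

lemma triple_yuv:
  assumes "card (X \<inter> {x, y, z}) = 1" "card (X \<inter> {y, z, u}) = 2" "card (X \<inter> {x, z, v}) = 1" "card (X \<inter> {x, y, w}) = 1"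
    "card (X \<inter> {x, w, u}) = 1" "card (X \<inter> {y, w, v}) = 2"
  shows "X = {y, u, v}"
proof -
  have "y \<in> X \<and> u \<in> X \<and> v \<in> X \<and> x \<notin> X \<and> z \<notin> X \<and> w \<notin> X"
    using triple_count[OF assms(1) six_distinct(1)] triple_count[OF assms(2) six_distinct(2)] triple_count[OF assms(3) six_distinct(3)] triple_count[OF assms(4) six_distinct(4)] triple_count[OF assms(5) six_distinct(5)] triple_count[OF assms(6) six_distinct(6)] 
    by (cases "x \<in> X"; cases "y \<in> X"; cases "z \<in> X"; cases "u \<in> X"; cases "v \<in> X"; cases "w \<in> X"; simp)
  then have "{x, y, z, u, v, w} \<inter> X = {y, u, v}" by (simp add: Int_insert_left insert_commute)
  then show ?thesis unfolding six_Int .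
qed

lemma triple_zuw:
  assumes "card (X \<inter> {x, y, z}) = 1" "card (X \<inter> {y, z, u}) = 2" "card (X \<inter> {x, z, v}) = 1" "card (X \<inter> {x, y, w}) = 1"
    "card (X \<inter> {x, w, u}) = 2" "card (X \<inter> {y, w, v}) = 1"
  shows "X = {z, u, w}"
proof -
  have "z \<in> X \<and> u \<in> X \<and> w \<in> X \<and> x \<notin> X \<and> y \<notin> X \<and> v \<notin> X"
    using triple_count[OF assms(1) six_distinct(1)] triple_count[OF assms(2) six_distinct(2)] triple_count[OF assms(3) six_distinct(3)] triple_count[OF assms(4) six_distinct(4)] triple_count[OF assms(5) six_distinct(5)] triple_count[OF assms(6) six_distinct(6)] 
    by (cases "x \<in> X"; cases "y \<in> X"; cases "z \<in> X"; cases "u \<in> X"; cases "v \<in> X"; cases "w \<in> X"; simp)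
  then have "{x, y, z, u, v, w} \<inter> X = {z, u, w}" by (simp add: Int_insert_left insert_commute)
  then show ?thesis unfolding six_Int .
qed

end

text \<open>\<open>T X\<close> will be the part outside a fixed block of the block that meets it in
  the pair \<open>X\<close>. Four of the triples give names to the six points. The only choice left
  is which of two triples belongs to which of two points of \<open>Q\<close>; naming these points
  accordingly removes it, and the other triples are forced.\<close>

lemma biplane_triples:
  fixes T :: "'b set \<Rightarrow> 'a set"
  assumes R: "finite R" "card R = 6" and Q: "card Q = 5"
    and T: "\<And>X. X \<subseteq> Q \<Longrightarrow> card X = 2 \<Longrightarrow> T X \<subseteq> R" "\<And>X. X \<subseteq> Q \<Longrightarrow> card X = 2 \<Longrightarrow> card (T X) = 3"
    and TT: "\<And>X Y. X \<subseteq> Q \<Longrightarrow> card X = 2 \<Longrightarrow> Y \<subseteq> Q \<Longrightarrow> card Y = 2 \<Longrightarrow> X \<noteq> Y \<Longrightarrow>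
      card (T X \<inter> T Y) + card (X \<inter> Y) = 2"
  obtains q\<^sub>0 q\<^sub>1 q\<^sub>2 q\<^sub>3 q\<^sub>4 x y z u v w where "distinct [q\<^sub>0, q\<^sub>1, q\<^sub>2, q\<^sub>3, q\<^sub>4]" "Q = {q\<^sub>0, q\<^sub>1, q\<^sub>2, q\<^sub>3, q\<^sub>4}"
    "distinct [x, y, z, u, v, w]" "R = {x, y, z, u, v, w}"
    "T {q\<^sub>0, q\<^sub>1} = {x, y, z}" "T {q\<^sub>0, q\<^sub>2} = {x, w, u}" "T {q\<^sub>0, q\<^sub>3} = {z, v, w}" "T {q\<^sub>0, q\<^sub>4} = {y, u, v}"
    "T {q\<^sub>1, q\<^sub>2} = {y, w, v}" "T {q\<^sub>1, q\<^sub>3} = {x, u, v}" "T {q\<^sub>1, q\<^sub>4} = {z, u, w}"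
    "T {q\<^sub>2, q\<^sub>3} = {y, z, u}" "T {q\<^sub>2, q\<^sub>4} = {x, z, v}" "T {q\<^sub>3, q\<^sub>4} = {x, y, w}"
proof -
  note result = that
  have "finite Q" using Q card.infinite by fastforce
  then obtain qs where qs: "set qs = Q" "distinct qs" "length qs = 5"
    using finite_distinct_list[of Q] Q distinct_card by metis
  then obtain a b q\<^sub>2 q\<^sub>3 q\<^sub>4 where "qs = [a, b, q\<^sub>2, q\<^sub>3, q\<^sub>4]"
    by (auto simp: length_Suc_conv numeral_eq_Suc)
  with qs have q: "Q = {a, b, q\<^sub>2, q\<^sub>3, q\<^sub>4}" "distinct [a, b, q\<^sub>2, q\<^sub>3, q\<^sub>4]" by auto
  have sub: "T {i, j} \<subseteq> R" "card (T {i, j}) = 3" if "i \<in> Q" "j \<in> Q" "i \<noteq> j" for i j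
    using T[of "{i, j}"] that by auto
  have disj: "card (T {i, j} \<inter> T {k, l}) = 2" if "{i, j, k, l} \<subseteq> Q" "distinct [i, j, k, l]" for i j k l
    using TT[of "{i, j}" "{k, l}"] that by (auto simp: doubleton_eq_iff)
  have share: "card (T {i, j} \<inter> T {i, k}) = 1" if "{i, j, k} \<subseteq> Q" "distinct [i, j, k]" for i j k
    using TT[of "{i, j}" "{i, k}"] that by (auto simp: doubleton_eq_iff)
  have share': "card (T {i, j} \<inter> T {k, j}) = 1" "card (T {i, j} \<inter> T {j, k}) = 1" "card (T {i, j} \<inter> T {k, i}) = 1"
    if "{i, j, k} \<subseteq> Q" "distinct [i, j, k]" for i j k
    using share[of j i k] share[of i j k] that by (auto simp: insert_commute)
  have pairs: "card (T {a, b} \<inter> T {q\<^sub>2, q\<^sub>3}) = 2" "card (T {a, b} \<inter> T {q\<^sub>2, q\<^sub>4}) = 2" "card (T {a, b} \<inter> T {q\<^sub>3, q\<^sub>4}) = 2"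
    "card (T {q\<^sub>2, q\<^sub>3} \<inter> T {q\<^sub>2, q\<^sub>4}) = 1" "card (T {q\<^sub>2, q\<^sub>3} \<inter> T {q\<^sub>3, q\<^sub>4}) = 1" "card (T {q\<^sub>2, q\<^sub>4} \<inter> T {q\<^sub>3, q\<^sub>4}) = 1"
    using q by (intro disj share share'; auto)+
  obtain x y z u v w where six: "distinct [x, y, z, u, v, w]" "R = {x, y, z, u, v, w}"
    and base: "T {a, b} = {x, y, z}" "T {q\<^sub>2, q\<^sub>3} = {y, z, u}" "T {q\<^sub>2, q\<^sub>4} = {x, z, v}" "T {q\<^sub>3, q\<^sub>4} = {x, y, w}"
    by (rule base_triples[of R "T {a, b}" "T {q\<^sub>2, q\<^sub>3}" "T {q\<^sub>2, q\<^sub>4}" "T {q\<^sub>3, q\<^sub>4}"])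
      (use R q pairs in \<open>simp_all add: sub\<close>)
  have card3: "card {x, w, u} = 3" "card {y, w, v} = 3"
    using distinct_card[of "[x, w, u]"] distinct_card[of "[y, w, v]"] six(1) by auto
  have swap: "T {i, j} = {x, y, z}" "Q = {i, j, q\<^sub>2, q\<^sub>3, q\<^sub>4}" "distinct [i, j, q\<^sub>2, q\<^sub>3, q\<^sub>4]"
    if "i = a \<and> j = b \<or> i = b \<and> j = a" for i j
  proof -
    have "{b, a, q\<^sub>2, q\<^sub>3, q\<^sub>4} = Q" "{b, a} = {a, b}"
      using q(1) by (simp_all add: insert_commute)
    moreover have "distinct [b, a, q\<^sub>2, q\<^sub>3, q\<^sub>4]" using q(2) by auto
    ultimately show "T {i, j} = {x, y, z}" "Q = {i, j, q\<^sub>2, q\<^sub>3, q\<^sub>4}" "distinct [i, j, q\<^sub>2, q\<^sub>3, q\<^sub>4]"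
      using that base(1) q by (elim disjE conjE; simp)+
  qed
  have either: "T {i, q\<^sub>2} = {x, w, u} \<or> T {i, q\<^sub>2} = {y, w, v}" if i: "i = a \<and> j = b \<or> i = b \<and> j = a" for i j
  proof (rule triple_xwu_or_ywv[OF six(1)])
    note ij = swap(1)[OF i] and iq = swap(2,3)[OF i]
    note s = sub disj share share'
    show "T {i, q\<^sub>2} \<subseteq> {x, y, z, u, v, w}" unfolding six(2)[symmetric] by (rule sub) (use iq in auto)
    show "card (T {i, q\<^sub>2} \<inter> {x, y, z}) = 1" unfolding ij[symmetric] using iq by (intro s) auto
    show "card (T {i, q\<^sub>2} \<inter> {y, z, u}) = 1" unfolding base[symmetric] using iq by (intro s) auto
    show "card (T {i, q\<^sub>2} \<inter> {x, z, v}) = 1" unfolding base[symmetric] using iq by (intro s) auto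
    show "card (T {i, q\<^sub>2} \<inter> {x, y, w}) = 2" unfolding base[symmetric] using iq by (intro s) auto
  qed
  \<comment> \<open>The argument for the order of \<open>a\<close> and \<open>b\<close> in which the
    first of the two possible triples belongs to \<open>i\<close>.\<close>
  have core: thesis if i: "i = a \<and> j = b \<or> i = b \<and> j = a" and xwu: "T {i, q\<^sub>2} = {x, w, u}" for i j
  proof -
    note ij = swap(1)[OF i] and iq = swap(2,3)[OF i]
    have ywv: "T {j, q\<^sub>2} = {y, w, v}"
    proof (rule ccontr)
      assume "T {j, q\<^sub>2} \<noteq> {y, w, v}"
      then have "T {j, q\<^sub>2} = {x, w, u}" using either[of j i] i by auto
      moreover have "card (T {i, q\<^sub>2} \<inter> T {j, q\<^sub>2}) = 1" using iq by (intro share') auto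
      ultimately show False using xwu card3(1) by simp
    qed
    note facts = ij base xwu ywv
    have sub': "T {k, l} \<subseteq> {x, y, z, u, v, w}" if "k \<in> Q" "l \<in> Q" "k \<noteq> l" for k l
      using sub[OF that] six(2) by simp
    note s = sub' disj share share'
    have 3: "T {i, q\<^sub>3} = {z, v, w}"
      by (rule triple_zvw[OF six(1)]) (unfold facts[symmetric], (intro s; use iq in auto)+)
    have 4: "T {j, q\<^sub>3} = {x, u, v}"
      by (rule triple_xuv[OF six(1)]) (unfold facts[symmetric], (intro s; use iq in auto)+)
    have 5: "T {i, q\<^sub>4} = {y, u, v}"
      by (rule triple_yuv[OF six(1)]) (unfold facts[symmetric], (intro s; use iq in auto)+)
    have 6: "T {j, q\<^sub>4} = {z, u, w}"
      by (rule triple_zuw[OF six(1)]) (unfold facts[symmetric], (intro s; use iq in auto)+)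
    show thesis by (rule result[OF iq(2,1) six ij xwu 3 5 ywv 4 6 base(2,3,4)])
  qed
  show thesis
  proof (cases "T {a, q\<^sub>2} = {x, w, u}")
    case True
    then show ?thesis using core[of a b] by simp
  next
    case False
    then have ywv: "T {a, q\<^sub>2} = {y, w, v}" using either[of a b] by simp
    have "T {b, q\<^sub>2} \<noteq> {y, w, v}"
    proof
      assume "T {b, q\<^sub>2} = {y, w, v}"
      moreover have "card (T {a, q\<^sub>2} \<inter> T {b, q\<^sub>2}) = 1" using q by (intro share') auto
      ultimately show False using ywv card3(2) by simp
    qed
    then show ?thesis using core[of b a] either[of b a] by simp
  qed
qed

text \<open>The words \<open>D\<close>, its complement, and the words meeting \<open>D\<close> in two points, for an enumeration of the points
  that was found by computing an isomorphism to the quadratic residue code of length 23.\<close>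

definition golay_words :: "nat list list" where
  "golay_words = [
    [0, 1, 2, 3, 4, 5, 6, 9, 11, 12, 17, 18],
    [7, 8, 10, 13, 14, 15, 16, 19, 20, 21, 22, 23],
    [0, 1, 7, 10, 19, 21, 22, 23],
    [0, 2, 7, 8, 10, 13, 16, 22],
    [0, 3, 8, 13, 14, 21, 22, 23],
    [0, 4, 10, 13, 14, 16, 19, 23],
    [0, 7, 8, 14, 16, 17, 19, 21],
    [0, 5, 8, 10, 13, 15, 19, 21],
    [0, 7, 9, 13, 15, 16, 21, 23],
    [0, 8, 15, 16, 18, 19, 22, 23],
    [0, 7, 12, 13, 14, 15, 19, 22],
    [0, 7, 8, 10, 11, 14, 15, 23],
    [0, 6, 10, 14, 15, 16, 21, 22]]"

text \<open>A finite evaluation. By self-duality it will show that the shifted words belong to the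
  code.\<close>

lemma golay_words_cycle23:
  assumes "g \<in> set golay_words" "h \<in> set golay_words"
  shows "even (card (set h \<inter> cycle23 ` set g))"
proof -
  have "\<forall>g\<in>set golay_words. \<forall>h\<in>set golay_words. even (length (filter (\<lambda>i. i \<in> set h) (map cycle23 g)))"
    "\<forall>g\<in>set golay_words. distinct (map cycle23 g)"
    by code_simp+
  then have *: "even (length (filter (\<lambda>i. i \<in> set h) (map cycle23 g)))" "distinct (map cycle23 g)"
    using assms by blast+
  have "card (set h \<inter> cycle23 ` set g) = card (set (filter (\<lambda>i. i \<in> set h) (map cycle23 g)))"
    by (intro arg_cong[where f = card]) auto
  then show ?thesis using *(1) distinct_card[OF distinct_filter[OF *(2)]] by simp
qed

lemma golay_words_less: "g \<in> set golay_words \<Longrightarrow> set g \<subseteq> {..<24}"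
  by (auto simp: golay_words_def)

lemma two_subset_of_five:
  assumes "X \<subseteq> {a, b, c, d, e}" "card X = 2"
  shows "X \<in> {{a, b}, {a, c}, {a, d}, {a, e}, {b, c}, {b, d}, {b, e}, {c, d}, {c, e}, {d, e}}"
proof -
  obtain i j where X: "X = {i, j}" "i \<noteq> j" using assms(2) by (auto simp: card_2_iff)
  then have "i \<in> {a, b, c, d, e}" "j \<in> {a, b, c, d, e}" using assms(1) by auto
  then show ?thesis unfolding X(1) using X(2) by (elim insertE emptyE) (simp_all add: doubleton_eq_iff)
qed

context pointed_dodecad
begin

text \<open>The points of \<open>D\<close> are \<open>p\<close>, \<open>d\<close> and the indices
  \<open>e X\<close> of the blocks that meet \<open>block d\<close> in one of its ten pairs
  \<open>X\<close>; the other points are \<open>p'\<close>, the five points of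
  \<open>block d\<close> and six more. The normal form of the triples makes all pair words explicit
  in these names.\<close>

lemma golay_labelling:
  obtains \<epsilon> :: "nat \<Rightarrow> 'a" where "bij_betw \<epsilon> {..<24} UNIV"
    "\<And>A. A \<in> C \<longleftrightarrow> (\<forall>g\<in>set golay_words. even (card (A \<inter> \<epsilon> ` set g)))"
proof -
  note result = that
  have "card (D - {p}) = 11" using D(2) p by simp
  then obtain d where d: "d \<in> D - {p}" by (metis card.empty ex_in_conv zero_neq_numeral)
  define e where "e X = (SOME e. e \<in> D - {p, d} \<and> block d \<inter> block e = X)" for X
  have e: "e X \<in> D - {p}" "e X \<noteq> d" "block d \<inter> block (e X) = X" if "X \<subseteq> block d" "card X = 2" for X
  proof -
    have "\<exists>e. e \<in> D - {p, d} \<and> block d \<inter> block e = X" using block_Int_surj[OF d that] by blast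
    then have "e X \<in> D - {p, d} \<and> block d \<inter> block (e X) = X" unfolding e_def by (rule someI_ex)
    then show "e X \<in> D - {p}" "e X \<noteq> d" "block d \<inter> block (e X) = X" by auto
  qed
  define T where "T X = block (e X) - block d" for X
  define R where "R = - D - {p'} - block d"
  have bsub: "block c \<subseteq> - D - {p'}" for c by (auto simp: block_def)
  have R: "card R = 6"
    unfolding R_def using card_Diff_subset[OF _ bsub[of d]] card_block[OF d] card_points_outside by simp
  obtain q\<^sub>0 q\<^sub>1 q\<^sub>2 q\<^sub>3 q\<^sub>4 x y z u v w where q: "distinct [q\<^sub>0, q\<^sub>1, q\<^sub>2, q\<^sub>3, q\<^sub>4]" "block d = {q\<^sub>0, q\<^sub>1, q\<^sub>2, q\<^sub>3, q\<^sub>4}"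
    and six: "distinct [x, y, z, u, v, w]" "R = {x, y, z, u, v, w}"
    and TT: "T {q\<^sub>0, q\<^sub>1} = {x, y, z}" "T {q\<^sub>0, q\<^sub>2} = {x, w, u}" "T {q\<^sub>0, q\<^sub>3} = {z, v, w}" "T {q\<^sub>0, q\<^sub>4} = {y, u, v}"
      "T {q\<^sub>1, q\<^sub>2} = {y, w, v}" "T {q\<^sub>1, q\<^sub>3} = {x, u, v}" "T {q\<^sub>1, q\<^sub>4} = {z, u, w}"
      "T {q\<^sub>2, q\<^sub>3} = {y, z, u}" "T {q\<^sub>2, q\<^sub>4} = {x, z, v}" "T {q\<^sub>3, q\<^sub>4} = {x, y, w}"
  proof (rule biplane_triples[of R "block d" T])
    fix X assume X: "X \<subseteq> block d" "card X = 2"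
    show "T X \<subseteq> R" unfolding T_def R_def using bsub by blast
    have "card (block (e X) \<inter> block d) = 2" using e(3)[OF X] X(2) by (simp add: Int_commute)
    then show "card (T X) = 3"
      using card_Int_Diff[of "block (e X)" "block d"] card_block[OF e(1)[OF X]] by (simp add: T_def)
  next
    fix X Y assume X: "X \<subseteq> block d" "card X = 2" and Y: "Y \<subseteq> block d" "card Y = 2" and "X \<noteq> Y"
    then have "e X \<noteq> e Y" using e(3)[OF X] e(3)[OF Y] by metis
    then have "card (block (e X) \<inter> block (e Y)) = 2" by (rule card_block_Int[OF e(1)[OF X] e(1)[OF Y]])
    moreover have "block (e X) \<inter> block (e Y) = (T X \<inter> T Y) \<union> (X \<inter> Y)"
      using e(3)[OF X] e(3)[OF Y] by (auto simp: T_def)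
    moreover have "(T X \<inter> T Y) \<inter> (X \<inter> Y) = {}" using X by (auto simp: T_def)
    ultimately show "card (T X \<inter> T Y) + card (X \<inter> Y) = 2" by (simp add: card_Un_disjoint)
  qed (use R card_block[OF d] in auto)
  have pair_sub: "{q\<^sub>0, q\<^sub>1} \<subseteq> block d" "card {q\<^sub>0, q\<^sub>1} = 2"
      "{q\<^sub>0, q\<^sub>2} \<subseteq> block d" "card {q\<^sub>0, q\<^sub>2} = 2"
      "{q\<^sub>0, q\<^sub>3} \<subseteq> block d" "card {q\<^sub>0, q\<^sub>3} = 2"
      "{q\<^sub>0, q\<^sub>4} \<subseteq> block d" "card {q\<^sub>0, q\<^sub>4} = 2"
      "{q\<^sub>1, q\<^sub>2} \<subseteq> block d" "card {q\<^sub>1, q\<^sub>2} = 2"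
      "{q\<^sub>1, q\<^sub>3} \<subseteq> block d" "card {q\<^sub>1, q\<^sub>3} = 2"
      "{q\<^sub>1, q\<^sub>4} \<subseteq> block d" "card {q\<^sub>1, q\<^sub>4} = 2"
      "{q\<^sub>2, q\<^sub>3} \<subseteq> block d" "card {q\<^sub>2, q\<^sub>3} = 2"
      "{q\<^sub>2, q\<^sub>4} \<subseteq> block d" "card {q\<^sub>2, q\<^sub>4} = 2"
      "{q\<^sub>3, q\<^sub>4} \<subseteq> block d" "card {q\<^sub>3, q\<^sub>4} = 2"
    using q by auto
  define E where "E = {q\<^sub>0, q\<^sub>1, q\<^sub>2, q\<^sub>3, q\<^sub>4, x, y, z, u, v, w}"
  have E: "- D - {p'} = E"
    using bsub[of d] six(2) q(2) unfolding R_def E_def by auto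
  have outside: "- D = insert p' E" using E p' by blast
  have in_D: "c = p \<or> c = d \<or> (\<exists>X. X \<subseteq> block d \<and> card X = 2 \<and> c = e X)" if c: "c \<in> D" for c
  proof (cases "c = p \<or> c = d")
    case False
    then have c': "c \<in> D - {p}" "c \<noteq> d" using c by auto
    define X where "X = block d \<inter> block c"
    have X: "X \<subseteq> block d" "card X = 2" using card_block_Int[OF d c'(1)] c'(2) by (auto simp: X_def)
    have "e X = c" using block_Int_inj[OF d e(1)[OF X] c'(1)] e(2,3)[OF X] c'(2) X_def by blast
    then show ?thesis using X by blast
  qed blast
  have D_eq: "D = {p, d, e {q\<^sub>0, q\<^sub>1}, e {q\<^sub>0, q\<^sub>2}, e {q\<^sub>0, q\<^sub>3}, e {q\<^sub>0, q\<^sub>4}, e {q\<^sub>1, q\<^sub>2}, e {q\<^sub>1, q\<^sub>3}, e {q\<^sub>1, q\<^sub>4}, e {q\<^sub>2, q\<^sub>3}, e {q\<^sub>2, q\<^sub>4}, e {q\<^sub>3, q\<^sub>4}}" (is "_ = ?D")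
  proof
    show "D \<subseteq> ?D"
    proof
      fix c assume "c \<in> D"
      from in_D[OF this] show "c \<in> ?D"
      proof (elim disjE exE conjE)
        fix X assume X: "X \<subseteq> block d" "card X = 2" and c: "c = e X"
        from two_subset_of_five[OF X(1)[unfolded q(2)] X(2)] show "c \<in> ?D" unfolding c by (elim insertE emptyE) simp_all
      qed simp_all
    qed
    show "?D \<subseteq> D" using d p e(1)[OF pair_sub(1,2)] e(1)[OF pair_sub(3,4)] e(1)[OF pair_sub(5,6)] e(1)[OF pair_sub(7,8)] e(1)[OF pair_sub(9,10)] e(1)[OF pair_sub(11,12)] e(1)[OF pair_sub(13,14)] e(1)[OF pair_sub(15,16)] e(1)[OF pair_sub(17,18)] e(1)[OF pair_sub(19,20)] by simp
  qed
  have word: "pair_word c = insert p (insert c (E - block c))" if "c \<in> D - {p}" for c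
  proof -
    have "pair_word c = (pair_word c \<inter> D) \<union> (- D - {p'} - (- D - {p'} - pair_word c))"
      using pair_word(3)[OF that] by blast
    then show ?thesis unfolding pair_word(2)[OF that] block_def E by simp
  qed
  have block_e: "block (e X) = X \<union> T X" if "X \<subseteq> block d" "card X = 2" for X
    using e(3)[OF that] by (auto simp: T_def)
  \<comment> \<open>The order of the points in which the thirteen spanning words become
    \<open>golay_words\<close>, and in which cyclic rotation of the first 23 places preserves the
    code.\<close>
  define \<epsilon> where "\<epsilon> = nth [p, d, e {q\<^sub>0, q\<^sub>1}, e {q\<^sub>0, q\<^sub>2}, e {q\<^sub>0, q\<^sub>3}, e {q\<^sub>1, q\<^sub>2}, e {q\<^sub>3, q\<^sub>4}, w, q\<^sub>3, e {q\<^sub>1, q\<^sub>3}, u, e {q\<^sub>2, q\<^sub>4}, e {q\<^sub>2, q\<^sub>3}, q\<^sub>4, q\<^sub>1, q\<^sub>0, q\<^sub>2, e {q\<^sub>0, q\<^sub>4}, e {q\<^sub>1, q\<^sub>4}, x, p', z, v, y]"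
  have "\<epsilon> ` {..<24} = UNIV"
  proof -
    have "\<epsilon> ` {..<24} = set [p, d, e {q\<^sub>0, q\<^sub>1}, e {q\<^sub>0, q\<^sub>2}, e {q\<^sub>0, q\<^sub>3}, e {q\<^sub>1, q\<^sub>2}, e {q\<^sub>3, q\<^sub>4}, w, q\<^sub>3, e {q\<^sub>1, q\<^sub>3}, u, e {q\<^sub>2, q\<^sub>4}, e {q\<^sub>2, q\<^sub>3}, q\<^sub>4, q\<^sub>1, q\<^sub>0, q\<^sub>2, e {q\<^sub>0, q\<^sub>4}, e {q\<^sub>1, q\<^sub>4}, x, p', z, v, y]"
      unfolding \<epsilon>_def using nth_image[of 24 "[p, d, e {q\<^sub>0, q\<^sub>1}, e {q\<^sub>0, q\<^sub>2}, e {q\<^sub>0, q\<^sub>3}, e {q\<^sub>1, q\<^sub>2}, e {q\<^sub>3, q\<^sub>4}, w, q\<^sub>3, e {q\<^sub>1, q\<^sub>3}, u, e {q\<^sub>2, q\<^sub>4}, e {q\<^sub>2, q\<^sub>3}, q\<^sub>4, q\<^sub>1, q\<^sub>0, q\<^sub>2, e {q\<^sub>0, q\<^sub>4}, e {q\<^sub>1, q\<^sub>4}, x, p', z, v, y]"] by (simp add: lessThan_atLeast0)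
    also have "\<dots> = D \<union> - D" unfolding outside unfolding D_eq E_def by (simp add: insert_commute)
    finally show ?thesis by simp
  qed
  then have bij: "bij_betw \<epsilon> {..<24} UNIV"
    unfolding bij_betw_def using eq_card_imp_inj_on[of "{..<24}" \<epsilon>] card_points by simp
  have points: "distinct [q\<^sub>0, q\<^sub>1, q\<^sub>2, q\<^sub>3, q\<^sub>4, x, y, z, u, v, w]"
  proof -
    have "R \<inter> block d = {}" by (auto simp: R_def)
    then show ?thesis using q six(1) unfolding six(2) q(2) by auto
  qed
  then have points': "distinct [w, v, u, z, y, x, q\<^sub>4, q\<^sub>3, q\<^sub>2, q\<^sub>1, q\<^sub>0]" using distinct_rev by fastforce
  have image_D: "\<epsilon> ` set [0, 1, 2, 3, 4, 5, 6, 9, 11, 12, 17, 18] = D" unfolding \<epsilon>_def D_eq by (simp add: insert_commute)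
  have image_D': "\<epsilon> ` set [7, 8, 10, 13, 14, 15, 16, 19, 20, 21, 22, 23] = - D" unfolding \<epsilon>_def outside E_def by (simp add: insert_commute)
  have w0: "pair_word d = \<epsilon> ` set [0, 1, 7, 10, 19, 21, 22, 23]"
  proof -
    have "E - block d = {x, y, z, u, v, w}" using points points' unfolding E_def q(2) by simp
    then show ?thesis unfolding word[OF d] \<epsilon>_def by (simp add: insert_commute)
  qed
  have w1: "pair_word (e {q\<^sub>0, q\<^sub>1}) = \<epsilon> ` set [0, 2, 7, 8, 10, 13, 16, 22]"
  proof -
    have "E - block (e {q\<^sub>0, q\<^sub>1}) = {q\<^sub>2, q\<^sub>3, q\<^sub>4, u, v, w}"
      using points points' unfolding E_def block_e[OF pair_sub(1,2)] TT(1) by (simp add: insert_Diff_if)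
    then show ?thesis unfolding word[OF e(1)[OF pair_sub(1,2)]] \<epsilon>_def by (simp add: insert_commute)
  qed
  have w2: "pair_word (e {q\<^sub>0, q\<^sub>2}) = \<epsilon> ` set [0, 3, 8, 13, 14, 21, 22, 23]"
  proof -
    have "E - block (e {q\<^sub>0, q\<^sub>2}) = {q\<^sub>1, q\<^sub>3, q\<^sub>4, y, z, v}"
      using points points' unfolding E_def block_e[OF pair_sub(3,4)] TT(2) by (simp add: insert_Diff_if)
    then show ?thesis unfolding word[OF e(1)[OF pair_sub(3,4)]] \<epsilon>_def by (simp add: insert_commute)
  qed
  have w3: "pair_word (e {q\<^sub>0, q\<^sub>3}) = \<epsilon> ` set [0, 4, 10, 13, 14, 16, 19, 23]"
  proof -
    have "E - block (e {q\<^sub>0, q\<^sub>3}) = {q\<^sub>1, q\<^sub>2, q\<^sub>4, x, y, u}"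
      using points points' unfolding E_def block_e[OF pair_sub(5,6)] TT(3) by (simp add: insert_Diff_if)
    then show ?thesis unfolding word[OF e(1)[OF pair_sub(5,6)]] \<epsilon>_def by (simp add: insert_commute)
  qed
  have w4: "pair_word (e {q\<^sub>0, q\<^sub>4}) = \<epsilon> ` set [0, 7, 8, 14, 16, 17, 19, 21]"
  proof -
    have "E - block (e {q\<^sub>0, q\<^sub>4}) = {q\<^sub>1, q\<^sub>2, q\<^sub>3, x, z, w}"
      using points points' unfolding E_def block_e[OF pair_sub(7,8)] TT(4) by (simp add: insert_Diff_if)
    then show ?thesis unfolding word[OF e(1)[OF pair_sub(7,8)]] \<epsilon>_def by (simp add: insert_commute)
  qed
  have w5: "pair_word (e {q\<^sub>1, q\<^sub>2}) = \<epsilon> ` set [0, 5, 8, 10, 13, 15, 19, 21]"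
  proof -
    have "E - block (e {q\<^sub>1, q\<^sub>2}) = {q\<^sub>0, q\<^sub>3, q\<^sub>4, x, z, u}"
      using points points' unfolding E_def block_e[OF pair_sub(9,10)] TT(5) by (simp add: insert_Diff_if)
    then show ?thesis unfolding word[OF e(1)[OF pair_sub(9,10)]] \<epsilon>_def by (simp add: insert_commute)
  qed
  have w6: "pair_word (e {q\<^sub>1, q\<^sub>3}) = \<epsilon> ` set [0, 7, 9, 13, 15, 16, 21, 23]"
  proof -
    have "E - block (e {q\<^sub>1, q\<^sub>3}) = {q\<^sub>0, q\<^sub>2, q\<^sub>4, y, z, w}"
      using points points' unfolding E_def block_e[OF pair_sub(11,12)] TT(6) by (simp add: insert_Diff_if)
    then show ?thesis unfolding word[OF e(1)[OF pair_sub(11,12)]] \<epsilon>_def by (simp add: insert_commute)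
  qed
  have w7: "pair_word (e {q\<^sub>1, q\<^sub>4}) = \<epsilon> ` set [0, 8, 15, 16, 18, 19, 22, 23]"
  proof -
    have "E - block (e {q\<^sub>1, q\<^sub>4}) = {q\<^sub>0, q\<^sub>2, q\<^sub>3, x, y, v}"
      using points points' unfolding E_def block_e[OF pair_sub(13,14)] TT(7) by (simp add: insert_Diff_if)
    then show ?thesis unfolding word[OF e(1)[OF pair_sub(13,14)]] \<epsilon>_def by (simp add: insert_commute)
  qed
  have w8: "pair_word (e {q\<^sub>2, q\<^sub>3}) = \<epsilon> ` set [0, 7, 12, 13, 14, 15, 19, 22]"
  proof -
    have "E - block (e {q\<^sub>2, q\<^sub>3}) = {q\<^sub>0, q\<^sub>1, q\<^sub>4, x, v, w}"
      using points points' unfolding E_def block_e[OF pair_sub(15,16)] TT(8) by (simp add: insert_Diff_if)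
    then show ?thesis unfolding word[OF e(1)[OF pair_sub(15,16)]] \<epsilon>_def by (simp add: insert_commute)
  qed
  have w9: "pair_word (e {q\<^sub>2, q\<^sub>4}) = \<epsilon> ` set [0, 7, 8, 10, 11, 14, 15, 23]"
  proof -
    have "E - block (e {q\<^sub>2, q\<^sub>4}) = {q\<^sub>0, q\<^sub>1, q\<^sub>3, y, u, w}"
      using points points' unfolding E_def block_e[OF pair_sub(17,18)] TT(9) by (simp add: insert_Diff_if)
    then show ?thesis unfolding word[OF e(1)[OF pair_sub(17,18)]] \<epsilon>_def by (simp add: insert_commute)
  qed
  have w10: "pair_word (e {q\<^sub>3, q\<^sub>4}) = \<epsilon> ` set [0, 6, 10, 14, 15, 16, 21, 22]"
  proof -
    have "E - block (e {q\<^sub>3, q\<^sub>4}) = {q\<^sub>0, q\<^sub>1, q\<^sub>2, z, u, v}"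
      using points points' unfolding E_def block_e[OF pair_sub(19,20)] TT(10) by (simp add: insert_Diff_if)
    then show ?thesis unfolding word[OF e(1)[OF pair_sub(19,20)]] \<epsilon>_def by (simp add: insert_commute)
  qed
  have DP: "D - {p} = {d, e {q\<^sub>0, q\<^sub>1}, e {q\<^sub>0, q\<^sub>2}, e {q\<^sub>0, q\<^sub>3}, e {q\<^sub>0, q\<^sub>4}, e {q\<^sub>1, q\<^sub>2}, e {q\<^sub>1, q\<^sub>3}, e {q\<^sub>1, q\<^sub>4}, e {q\<^sub>2, q\<^sub>3}, e {q\<^sub>2, q\<^sub>4}, e {q\<^sub>3, q\<^sub>4}}"
    using d e(1)[OF pair_sub(1,2)] e(1)[OF pair_sub(3,4)] e(1)[OF pair_sub(5,6)] e(1)[OF pair_sub(7,8)] e(1)[OF pair_sub(9,10)] e(1)[OF pair_sub(11,12)] e(1)[OF pair_sub(13,14)] e(1)[OF pair_sub(15,16)] e(1)[OF pair_sub(17,18)] e(1)[OF pair_sub(19,20)] unfolding D_eq by auto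
  have ball_Cons: "(\<forall>g\<in>set (a # as). Q g) \<longleftrightarrow> Q a \<and> (\<forall>g\<in>set as. Q g)" for a and as :: "nat list list" and Q by simp
  have "A \<in> C \<longleftrightarrow> (\<forall>g\<in>set golay_words. even (card (A \<inter> \<epsilon> ` set g)))" for A
    unfolding mem_iff_orthogonal[of A] golay_words_def DP
    by (simp only: ball_Cons list.set(1) ball_empty ball_simps image_D image_D' w0 w1 w2 w3 w4 w5 w6 w7 w8 w9 w10 simp_thms)
  then show thesis by (rule result[OF bij])
qed

end

text \<open>The shifted spanning words are orthogonal to the spanning words and so belong to the
  code. Orthogonality of the preimage of \<open>A\<close> to a spanning word amounts to
  orthogonality of \<open>A\<close> to its shift.\<close>

lemma (in extremal_code) cyclic_enumeration:
  obtains \<epsilon> :: "nat \<Rightarrow> 'a" where "bij_betw \<epsilon> {..<24} UNIV"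
    "\<And>A. A \<in> C \<Longrightarrow> \<epsilon> ` {i \<in> {..<24}. \<epsilon> (cycle23 i) \<in> A} \<in> C"
proof -
  obtain D where D: "D \<in> C" "card D = 12" by (rule dodecad_exists)
  then have "D \<noteq> {}" "D \<noteq> UNIV" using card_points by auto
  then obtain p p' where "p \<in> D" "p' \<notin> D" by blast
  with D interpret pointed_dodecad C D p p' by unfold_locales
  obtain \<epsilon> :: "nat \<Rightarrow> 'a" where \<epsilon>: "bij_betw \<epsilon> {..<24} UNIV"
    and mem: "\<And>A. A \<in> C \<longleftrightarrow> (\<forall>g\<in>set golay_words. even (card (A \<inter> \<epsilon> ` set g)))"
    using golay_labelling by blast
  have inj: "inj_on \<epsilon> I" if "I \<subseteq> {..<24}" for I using \<epsilon> that by (meson bij_betw_def inj_on_subset)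
  have cyc: "cycle23 ` set g \<subseteq> {..<24}" if "g \<in> set golay_words" for g
    using golay_words_less[OF that] cycle23_less by auto
  have shift: "\<epsilon> ` cycle23 ` set g \<in> C" if g: "g \<in> set golay_words" for g
    unfolding mem
  proof
    fix h assume h: "h \<in> set golay_words"
    have "\<epsilon> ` cycle23 ` set g \<inter> \<epsilon> ` set h = \<epsilon> ` (set h \<inter> cycle23 ` set g)"
      using inj_on_image_Int[OF inj[OF subset_refl] cyc[OF g] golay_words_less[OF h]] by (simp add: Int_commute)
    moreover have "card (\<epsilon> ` (set h \<inter> cycle23 ` set g)) = card (set h \<inter> cycle23 ` set g)"
      by (rule card_image[OF inj]) (use golay_words_less[OF h] in auto)
    ultimately show "even (card (\<epsilon> ` cycle23 ` set g \<inter> \<epsilon> ` set h))" using golay_words_cycle23[OF g h] by simp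
  qed
  have "\<epsilon> ` {i \<in> {..<24}. \<epsilon> (cycle23 i) \<in> A} \<in> C" if A: "A \<in> C" for A
    unfolding mem
  proof
    fix g assume g: "g \<in> set golay_words"
    let ?I = "{i \<in> set g. \<epsilon> (cycle23 i) \<in> A}"
    have gl: "set g \<subseteq> {..<24}" by (rule golay_words_less[OF g])
    have "\<epsilon> ` {i \<in> {..<24}. \<epsilon> (cycle23 i) \<in> A} \<inter> \<epsilon> ` set g = \<epsilon> ` ({i \<in> {..<24}. \<epsilon> (cycle23 i) \<in> A} \<inter> set g)"
      by (rule inj_on_image_Int[OF inj[OF subset_refl], symmetric]) (use gl in auto)
    also have "{i \<in> {..<24}. \<epsilon> (cycle23 i) \<in> A} \<inter> set g = ?I" using gl by auto
    finally have "card (\<epsilon> ` {i \<in> {..<24}. \<epsilon> (cycle23 i) \<in> A} \<inter> \<epsilon> ` set g) = card (\<epsilon> ` ?I)" by simp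
    also have "\<dots> = card ?I" by (rule card_image[OF inj]) (use gl in auto)
    also have "\<dots> = card ((\<lambda>i. \<epsilon> (cycle23 i)) ` ?I)"
    proof (rule card_image[symmetric])
      have "inj_on (\<epsilon> \<circ> cycle23) {..<24}"
        using bij_betw_trans[OF bij_betw_cycle23 \<epsilon>] by (simp add: bij_betw_def)
      then show "inj_on (\<lambda>i. \<epsilon> (cycle23 i)) ?I"
        unfolding comp_def by (rule inj_on_subset) (use gl in auto)
    qed
    also have "(\<lambda>i. \<epsilon> (cycle23 i)) ` ?I = A \<inter> \<epsilon> ` cycle23 ` set g" by auto
    finally show "even (card (\<epsilon> ` {i \<in> {..<24}. \<epsilon> (cycle23 i) \<in> A} \<inter> \<epsilon> ` set g))"
      using even_Int[OF A shift[OF g]] by simp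
  qed
  then show thesis by (rule that[OF \<epsilon>])
qed

section \<open>The root system \<open>A\<^sub>1\<^sup>24\<close>\<close>

text \<open>Cramer's rule with determinant 1 solves the linear system in integers.\<close>

lemma niemeier_even_unimodular:
  assumes "niemeier S"
  shows "even_unimodular S"
proof
  have det: "det S = 1" and pos: "pos_definite (map_matrix real_of_int S)" using assms by (auto simp: niemeier_def)
  have "\<exists>x. S *v x = b" for b
  proof -
    let ?S = "map_matrix real_of_int S" and ?b = "\<chi> i. real_of_int (b $ i)"
    let ?M = "\<lambda>k. (\<chi> i j. if j = k then b $ i else S $ i $ j) :: int^24^24"
    have "(\<chi> i j. if j = k then ?b $ i else ?S $ i $ j) = map_matrix real_of_int (?M k)" for k
      by (simp add: vec_eq_iff map_matrix_nth)
    then have "?S *v (\<chi> k. real_of_int (det (?M k))) = ?b"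
      by (subst cramer) (simp_all add: det det_map_matrix_of_int)
    then have "(?S *v (\<chi> k. real_of_int (det (?M k)))) $ i = ?b $ i" for i by simp
    then have "real_of_int ((S *v (\<chi> k. det (?M k))) $ i) = real_of_int (b $ i)" for i
      by (simp add: matrix_vector_mult_def map_matrix_nth)
    then show ?thesis by (intro exI[of _ "\<chi> k. det (?M k)"]) (simp add: vec_eq_iff)
  qed
  then show "unimodular S" unfolding unimodular_def using pos by blast
  show "even (bilin S x x)" for x using assms by (simp add: niemeier_def)
qed

text \<open>The lattice lies between \<open>A\<^sub>1\<^sup>24\<close> and its dual; its glue code is self-dual and has no words of weight 4
  because these would yield further roots. Hence it is the Golay code.\<close>

theorem A1_24_isometry23:
  fixes S :: "int^24^24"
  assumes S: "even_unimodular S" and R: "has_root_system S (root_system_A1_power :: (real^24) set)"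
  shows "\<exists>g x y. isometry23 S g x y"
proof -
  interpret even_unimodular S by fact
  let ?R = "root_system_A1_power :: (real^24) set"
  obtain \<rho> where \<rho>: "\<And>v w. v \<in> ?R \<Longrightarrow> w \<in> ?R \<Longrightarrow> of_int (bilin S (\<rho> v) (\<rho> w)) = v \<bullet> w"
    "\<And>x. bilin S x x = 2 \<Longrightarrow> \<exists>v\<in>?R. x = \<rho> v"
    using root_preimages[OF R] by metis
  have sym: "transpose S = S" by (rule unimodular_sym[OF unimod])
  have mem: "axis i (sqrt 2) \<in> ?R" for i unfolding root_system_A1_power_def by blast
  define r where "r i = \<rho> (axis i (sqrt 2))" for i
  have rr: "bilin S (r i) (r j) = (if i = j then 2 else 0)" for i j
  proof -
    have "real_of_int (bilin S (r i) (r j)) = real_of_int (if i = j then 2 else 0)"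
      unfolding r_def \<rho>(1)[OF mem mem] by (simp add: inner_axis_axis)
    then show ?thesis by (simp only: of_int_eq_iff)
  qed
  \<comment> \<open>A vector of norm 2 is one of the given roots, so all its inner products with the
    \<open>r j\<close> are 0, 2 or -2. The parity will exclude words of weight 4.\<close>
  have root: "even (bilin S x (r j))" if x: "bilin S x x = 2" for x j
  proof -
    obtain v where v: "v \<in> ?R" "x = \<rho> v" using \<rho>(2)[OF x] by blast
    then obtain i s where v_eq: "v = axis i s" "s = sqrt 2 \<or> s = - sqrt 2" unfolding root_system_A1_power_def by auto
    have "real_of_int (bilin S x (r j)) = (if i = j then s * sqrt 2 else 0)"
      unfolding v(2) r_def \<rho>(1)[OF v(1) mem] by (simp add: v_eq(1) inner_axis_axis)
    also have "\<dots> \<in> {real_of_int 2, real_of_int (- 2), real_of_int 0}" using v_eq(2) by auto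
    finally have "bilin S x (r j) \<in> {2, - 2, 0}" by (simp only: insert_iff empty_iff of_int_eq_iff)
    then show ?thesis by auto
  qed
  have form: "2 * bilin S x y = (\<Sum>i\<in>UNIV. bilin S x (r i) * bilin S y (r i))" for x y
  proof -
    have "2 * bilin S x y = (\<Sum>i\<in>UNIV. \<Sum>j\<in>UNIV. bilin S x (r i) * (mat 1 :: int^24^24) $ i $ j * bilin S y (r j))"
      by (rule bilin_gram_expansion[OF sym]) (simp_all add: rr mat_def if_distrib[of "\<lambda>a. _ * a"] if_distrib[of "\<lambda>a. a * _"] cong: if_cong)
    then show ?thesis by (simp add: mat_def if_distrib[of "\<lambda>a. _ * a"] if_distrib[of "\<lambda>a. a * _"] cong: if_cong)
  qed
  have combine: "bilin S (\<Sum>i\<in>UNIV. k i *s r i) (r j) = 2 * k j" for k j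
    by (simp add: bilin_sum_left bilin_scale_left rr if_distrib[of "\<lambda>a. _ * a"] cong: if_cong)
  \<comment> \<open>The glue code: parities of the inner products with the 24 orthogonal
    roots.\<close>
  define C where "C = {A. \<exists>x. \<forall>i. i \<in> A \<longleftrightarrow> odd (bilin S x (r i))}"
  \<comment> \<open>Subtracting multiples of the roots, each of which changes a single coordinate by
    2, brings all coordinates to 0 or 1.\<close>
  have rep: "\<exists>x. \<forall>i. bilin S x (r i) = of_bool (i \<in> A)" if A: "A \<in> C" for A
  proof -
    obtain x where x: "\<And>i. i \<in> A \<longleftrightarrow> odd (bilin S x (r i))" using A unfolding C_def by blast
    have "bilin S (x - (\<Sum>i\<in>UNIV. (bilin S x (r i) div 2) *s r i)) (r j) = of_bool (j \<in> A)" for j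
      unfolding bilin_diff_left combine x by (simp add: minus_mult_div_eq_mod mod_2_eq_odd)
    then show ?thesis by blast
  qed
  have even_Int: "even (card (A \<inter> B))" if A: "A \<in> C" and B: "B \<in> C" for A B
  proof -
    obtain x where x: "\<And>i. bilin S x (r i) = of_bool (i \<in> A)" using rep[OF A] by blast
    obtain y where y: "\<And>i. bilin S y (r i) = of_bool (i \<in> B)" using rep[OF B] by blast
    have "2 * bilin S x y = (\<Sum>i\<in>UNIV. of_bool (i \<in> A \<inter> B))"
      unfolding form x y by (intro sum.cong) auto
    also have "\<dots> = int (card (A \<inter> B))" by (simp add: Int_def)
    finally show ?thesis by presburger
  qed
  have code: "extremal_code C"
  proof
    show "CARD(24) = 24" by simp
    show "A \<in> C \<longleftrightarrow> (\<forall>B\<in>C. even (card (A \<inter> B)))" for A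
    proof
      assume A: "\<forall>B\<in>C. even (card (A \<inter> B))"
      have ev: "even (\<Sum>i\<in>A. bilin S z (r i))" for z
      proof -
        have "{i. odd (bilin S z (r i))} \<in> C" unfolding C_def by blast
        then have "even (card (A \<inter> {i. odd (bilin S z (r i))}))" using A by blast
        then show ?thesis by (simp add: even_sum_iff Int_def)
      qed
      \<comment> \<open>The image under \<open>S\<close> of half the sum of the roots indexed by
        \<open>A\<close>. It is integral because \<open>A\<close> meets every parity word evenly,
        and unimodularity then makes the half sum a lattice vector.\<close>
      define b where "b = (\<chi> k. (\<Sum>i\<in>A. (S *v r i) $ k) div 2)"
      have "(\<Sum>i\<in>A. (S *v r i) $ k) = (\<Sum>i\<in>A. bilin S (axis k 1) (r i))" for k
        by (simp add: bilin_matrix_vector axis_def if_distrib[of "\<lambda>a. a * _"] cong: if_cong)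
      then have b: "2 * b $ k = (\<Sum>i\<in>A. (S *v r i) $ k)" for k using ev[of "axis k 1"] by (simp add: b_def)
      obtain x where x: "S *v x = b" using unimod unfolding unimodular_def by blast
      have "2 * bilin S x (r j) = 2 * of_bool (j \<in> A)" for j
      proof -
        have "bilin S x (r j) = (\<Sum>k\<in>UNIV. r j $ k * b $ k)"
          by (subst bilin_commute[OF sym]) (simp only: bilin_matrix_vector x)
        then have "2 * bilin S x (r j) = (\<Sum>k\<in>UNIV. r j $ k * (2 * b $ k))"
          by (simp add: sum_distrib_left mult.left_commute)
        also have "\<dots> = (\<Sum>i\<in>A. \<Sum>k\<in>UNIV. r j $ k * (S *v r i) $ k)"
          unfolding b sum_distrib_left by (rule sum.swap)
        also have "\<dots> = (\<Sum>i\<in>A. bilin S (r j) (r i))" by (simp only: bilin_matrix_vector)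
        also have "\<dots> = 2 * of_bool (j \<in> A)" by (simp add: rr)
        finally show ?thesis .
      qed
      then show "A \<in> C" unfolding C_def by (intro CollectI exI[of _ x]) auto
    qed (use even_Int in blast)
    fix A assume A: "A \<in> C"
    obtain x where x: "\<And>i. bilin S x (r i) = of_bool (i \<in> A)" using rep[OF A] by blast
    have "2 * bilin S x x = (\<Sum>i\<in>UNIV. of_bool (i \<in> A))"
      unfolding form x by (intro sum.cong) auto
    also have "\<dots> = int (card A)" by simp
    finally have n: "2 * bilin S x x = int (card A)" .
    then show "4 dvd card A" using even_norm[of x] by presburger
    show "card A \<noteq> 4"
    proof
      assume c: "card A = 4"
      then have "even (bilin S x (r i))" for i using root n by simp
      then have "i \<notin> A" for i using x[of i] by (metis odd_one of_bool_eq(2))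
      then have "A = {}" by blast
      then show False using c by simp
    qed
  qed
  obtain \<epsilon> :: "nat \<Rightarrow> 24" where \<epsilon>: "bij_betw \<epsilon> {..<24} UNIV"
    and cyc: "\<And>A. A \<in> C \<Longrightarrow> \<epsilon> ` {i \<in> {..<24}. \<epsilon> (cycle23 i) \<in> A} \<in> C"
    using extremal_code.cyclic_enumeration[OF code] by blast
  have \<epsilon>_eq: "\<epsilon> i = \<epsilon> j \<longleftrightarrow> i = j" if "i < 24" "j < 24" for i j
    using \<epsilon> that by (auto simp: bij_betw_def inj_on_eq_iff)
  define n where "n x i = bilin S x (r (\<epsilon> i))" for x i
  show ?thesis
  proof (rule isometry23_of_orthogonal_coordinates[where t = 2 and c = 2 and n = n, OF S])
    show "2 * bilin S x y = (\<Sum>i<24. n x i * n y i)" for x y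
      unfolding form n_def by (rule sum.reindex_bij_betw[OF \<epsilon>, symmetric])
    show "\<exists>y. \<forall>i<24. n y i = n x (cycle23 i)" for x
    proof -
      define A where "A = {i. odd (bilin S x (r i))}"
      have "A \<in> C" unfolding A_def C_def by blast
      then obtain z where z: "\<And>i. bilin S z (r i) = of_bool (i \<in> \<epsilon> ` {i \<in> {..<24}. \<epsilon> (cycle23 i) \<in> A})"
        using rep[OF cyc] by blast
      \<comment> \<open>\<open>z\<close> already has the parities of the shifted coordinates; roots
        with multiplicities \<open>k\<close> supply the even difference.\<close>
      define k where "k l = n x (cycle23 (inv_into {..<24} \<epsilon> l)) div 2" for l
      have "n (z + (\<Sum>i\<in>UNIV. k i *s r i)) i = n x (cycle23 i)" if i: "i < 24" for i
      proof -
        have "inv_into {..<24} \<epsilon> (\<epsilon> i) = i" using \<epsilon> i by (auto simp: bij_betw_def)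
        moreover have "\<epsilon> i \<in> \<epsilon> ` {i \<in> {..<24}. \<epsilon> (cycle23 i) \<in> A} \<longleftrightarrow> odd (n x (cycle23 i))"
          using i \<epsilon>_eq by (auto simp: A_def n_def)
        ultimately have "n (z + (\<Sum>i\<in>UNIV. k i *s r i)) i = of_bool (odd (n x (cycle23 i))) + 2 * (n x (cycle23 i) div 2)"
          unfolding n_def[of "z + _"] bilin_add_left combine z by (simp add: k_def)
        then show ?thesis by (simp add: mod_2_eq_odd[symmetric])
      qed
      then show ?thesis by blast
    qed
    have "n (\<Sum>j\<in>UNIV. of_bool (P j) *s r j) i = 2 * of_bool (P (\<epsilon> i))" for P i
      unfolding n_def combine ..
    note sub = this
    show "\<exists>x. \<forall>i<24. n x i = (if i < 23 then 0 else 2)"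
      by (intro exI[of _ "\<Sum>j\<in>UNIV. of_bool (j = \<epsilon> 23) *s r j"] allI impI, subst sub) (auto simp: \<epsilon>_eq)
    show "\<exists>x. \<forall>i<24. n x i = (if i < 23 then 2 else 0)"
      by (intro exI[of _ "\<Sum>j\<in>UNIV. of_bool (j \<noteq> \<epsilon> 23) *s r j"] allI impI, subst sub) (auto simp: \<epsilon>_eq)
  qed auto
qed

theorem theorem8:
  fixes \<alpha> \<delta> \<psi> \<omega> :: "int^24^24"
  assumes "niemeier \<alpha>" and "has_root_system \<alpha> (root_system_D :: (real^24) set)"
    and "niemeier \<delta>" and "has_root_system \<delta> (root_system_A :: (real^25) set)"
    and "niemeier \<psi>" and "has_root_system \<psi> (root_system_A1_power :: (real^24) set)"
    and "leech_gram \<omega>"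
  shows "(\<forall>S\<in>{\<alpha>, \<delta>, \<psi>, \<omega>}.
            expansion_cong_zero 23
              (theta_op (fourier_coeff (theta_series S :: complex^2^2 \<Rightarrow> complex)))) \<and>
         (\<forall>S\<in>{\<alpha>, \<delta>, \<psi>, \<omega>}.
            mod_p_singular 23 12 2 (theta_series S :: complex^3^3 \<Rightarrow> complex))"
proof -
  have isometry: "\<exists>g x y. isometry23 S g x y" if "S \<in> {\<alpha>, \<delta>, \<psi>, \<omega>}" for S
    using that D24_isometry23[OF niemeier_even_unimodular] A24_isometry23[OF niemeier_even_unimodular]
      A1_24_isometry23[OF niemeier_even_unimodular] leech_isometry23 assms by blast
  show ?thesis
  proof (intro conjI ballI)
    fix S assume "S \<in> {\<alpha>, \<delta>, \<psi>, \<omega>}"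
    then obtain g x y where *: "isometry23 S g x y" using isometry by blast
    show "expansion_cong_zero 23 (theta_op (fourier_coeff (theta_series S :: complex^2^2 \<Rightarrow> complex)))"
      by (rule isometry23.theta_op_cong[OF *])
    show "mod_p_singular 23 12 2 (theta_series S :: complex^3^3 \<Rightarrow> complex)"
      by (rule isometry23.theta_singular[OF *])
  qed
qed

end
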